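(* Let $Q$ be a finite quiver with a distinguished two-cycle consisting of arrows $c\colon 0\to 1$ and $d\colon 1\to 0$ between distinct vertices $0,1\in Q_0$, and let $Q^{U}$ be the unlinking of $Q$ at $(c,d)$. Then for each $\epsilon\in\mathbb{N}Q_0^{U}$, with associated dimension vector $\delta=u(\epsilon)\in\mathbb{N}Q_0$, there is a homotopy equivalence $$\mathcal{M}_\epsilon(Q^{U})\to\mathcal{S}_{(u(\epsilon),\epsilon_\star)},$$ and for each $\delta\in\mathbb{N}Q_0$ this yields a decomposition in cohomology (an isomorphism of graded vector spaces) $$H^\bullet(\mathcal{M}_\delta(Q),\mathbb{Q})[-\chi_Q(\delta,\delta)]\;\cong\;\bigoplus_{\epsilon\in\mathbb{N}Q_0^U,\ u(\epsilon)=\delta}H^\bullet(\mathcal{M}_\epsilon(Q^{U}),\mathbb{Q})[-\chi_{Q^{U}}(\epsilon,\epsilon)].$$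
   Context: Quivers: arrows are written $a\colon i\to j$ with source $i$ and target $j$. $\mathbb{N}Q_0$ is the monoid of dimension vectors. The Euler pairing is $\chi_Q(\delta,\delta')=\sum_{i\in Q_0}\delta_i\delta'_i-\sum_{a\colon i\to j\in Q_1}\delta_j\delta'_i$. $R_\delta(Q)=\prod_{a\colon i\to j}\mathrm{Mat}_{\mathbb{C}}(\delta_j,\delta_i)$ (matrices with $\delta_j$ rows and $\delta_i$ columns), with base-change action of $GL_\delta=\prod_{i\in Q_0}GL_{\delta_i}(\mathbb{C})$, and $\mathcal{M}_\delta(Q)=[R_\delta(Q)/GL_\delta]$ is the quotient stack. Cohomology of a quotient stack $[X/G]$ is $G$-equivariant cohomology; a homotopy equivalence between quotient stacks is a map inducing a homotopy equivalence of the homotopy quotients (Borel constructions). For graded $V$, $V[m]^n=V^{n+m}$. Unlinking: $Q^{U}$ has vertices $Q_0^U=Q_0\sqcup\{\star\}$ and the following arrows, for each arrow $a\colon i\to j$ of $Q$: - if $i,j\notin\{0,1\}$: one arrow $a\colon i\to j$; - if $i\notin\{0,1\}$, $j\in\{0,1\}$: two arrows $a\colon i\to j$, $a_\star\colon i\to\star$; - if $i\in\{0,1\}$, $j\notin\{0,1\}$: two arrows $a\colon i\to j$, $a^\star\colon\star\to j$; - if $i,j\in\{0,1\}$ and $a\notin\{c,d\}$: four arrows $a\colon i\to j$, $a^\star\colon\star\to j$, $a_\star\colon i\to\star$, $a^\star_\star\colon\star\to\star$; - $a=c$ contributes a single loop $c^\star_\star\colon\star\to\star$, and $a=d$ contributes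 no arrow. The linear map $u\colon\mathbb{N}Q_0^U\to\mathbb{N}Q_0$ is $u(\epsilon)_i=\epsilon_i+\epsilon_\star$ for $i\in\{0,1\}$ and $u(\epsilon)_i=\epsilon_i$ otherwise. Strata: for $\delta\in\mathbb{N}Q_0$ and $\ell\in\mathbb{N}$, $S_{\delta,\ell}=\{\rho\in R_\delta(Q)\mid\mathrm{rk}\,\rho_d=\ell\}$ and $\mathcal{S}_{\delta,\ell}=[S_{\delta,\ell}/GL_\delta]$, a locally closed substack of $\mathcal{M}_\delta(Q)$. *)

theory Defs
  imports
    "HOL-Homology.Homology"
    "Jordan_Normal_Form.DL_Rank"
    "Graph_Theory.Digraph"
begin

section \<open>Quivers and unlinking\<close>

text \<open>A quiver is a \<^typ>\<open>('v, 'e) pre_digraph\<close> (loops and parallel arcs are allowed); an arrow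
  \<open>a : i \<rightarrow> j\<close> has \<open>tail Q a = i\<close> and \<open>head Q a = j\<close>. Dimension vectors are functions vanishing
  off the vertex set, so that each element of the monoid has exactly one representative.\<close>

definition dim_vectors :: "('v, 'e) pre_digraph \<Rightarrow> ('v \<Rightarrow> nat) set" where
  "dim_vectors Q = {\<delta>. \<forall>i. i \<notin> verts Q \<longrightarrow> \<delta> i = 0}"

definition euler_pairing :: "('v, 'e) pre_digraph \<Rightarrow> ('v \<Rightarrow> nat) \<Rightarrow> ('v \<Rightarrow> nat) \<Rightarrow> int" where
  "euler_pairing Q \<delta> \<delta>' =
     (\<Sum>i\<in>verts Q. int (\<delta> i) * int (\<delta>' i))
     - (\<Sum>a\<in>arcs Q. int (\<delta> (head Q a)) * int (\<delta>' (tail Q a)))"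

text \<open>The new vertex is \<^const>\<open>None\<close>. The arrows \<open>a\<close>, \<open>a\<close> with upper star, \<open>a\<close> with lower star and
  \<open>a\<close> with both stars are \<open>Plain a\<close>, \<open>From_star a\<close>, \<open>To_star a\<close> and \<open>Loop_star a\<close>. The two
  distinguished vertices are the endpoints of \<open>c\<close>.\<close>

datatype 'e unlink_arrow = Plain 'e | From_star 'e | To_star 'e | Loop_star 'e

fun unlink_tail :: "('v, 'e) pre_digraph \<Rightarrow> 'e unlink_arrow \<Rightarrow> 'v option" where
  "unlink_tail Q (Plain a) = Some (tail Q a)"
| "unlink_tail Q (From_star a) = None"
| "unlink_tail Q (To_star a) = Some (tail Q a)"
| "unlink_tail Q (Loop_star a) = None"

fun unlink_head :: "('v, 'e) pre_digraph \<Rightarrow> 'e unlink_arrow \<Rightarrow> 'v option" where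
  "unlink_head Q (Plain a) = Some (head Q a)"
| "unlink_head Q (From_star a) = Some (head Q a)"
| "unlink_head Q (To_star a) = None"
| "unlink_head Q (Loop_star a) = None"

definition arrows_from :: "('v, 'e) pre_digraph \<Rightarrow> 'e \<Rightarrow> 'e \<Rightarrow> 'e \<Rightarrow> 'e unlink_arrow set" where
  "arrows_from Q c d a =
     (let Z = {tail Q c, head Q c} in
      if a = c then {Loop_star a}
      else if a = d then {}
      else if tail Q a \<notin> Z \<and> head Q a \<notin> Z then {Plain a}
      else if tail Q a \<notin> Z then {Plain a, To_star a}
      else if head Q a \<notin> Z then {Plain a, From_star a}
      else {Plain a, From_star a, To_star a, Loop_star a})"

definition unlink ::
  "('v, 'e) pre_digraph \<Rightarrow> 'e \<Rightarrow> 'e \<Rightarrow> ('v option, 'e unlink_arrow) pre_digraph" where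
  "unlink Q c d =
     \<lparr>verts = insert None (Some ` verts Q),
      arcs = (\<Union>a\<in>arcs Q. arrows_from Q c d a),
      tail = unlink_tail Q,
      head = unlink_head Q\<rparr>"

definition unlink_dim :: "('v, 'e) pre_digraph \<Rightarrow> 'e \<Rightarrow> ('v option \<Rightarrow> nat) \<Rightarrow> 'v \<Rightarrow> nat" where
  "unlink_dim Q c \<epsilon> i = (if i \<in> {tail Q c, head Q c} then \<epsilon> (Some i) + \<epsilon> None else \<epsilon> (Some i))"


section \<open>Homotopy quotients\<close>

definition quotient_topology :: "'a topology \<Rightarrow> ('a \<Rightarrow> 'b) \<Rightarrow> 'b topology" where
  "quotient_topology X q =
     topology (\<lambda>U. U \<subseteq> q ` topspace X \<and> openin X {x \<in> topspace X. q x \<in> U})"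

lemma openin_quotient_topology:
  "openin (quotient_topology X q) U \<longleftrightarrow>
     U \<subseteq> q ` topspace X \<and> openin X {x \<in> topspace X. q x \<in> U}"
proof -
  have "istopology (\<lambda>U. U \<subseteq> q ` topspace X \<and> openin X {x \<in> topspace X. q x \<in> U})"
    unfolding istopology_def
  proof (intro conjI allI impI)
    fix S T
    assume S: "S \<subseteq> q ` topspace X \<and> openin X {x \<in> topspace X. q x \<in> S}"
      and T: "T \<subseteq> q ` topspace X \<and> openin X {x \<in> topspace X. q x \<in> T}"
    show "S \<inter> T \<subseteq> q ` topspace X" using S by blast
    have "{x \<in> topspace X. q x \<in> S \<inter> T}
        = {x \<in> topspace X. q x \<in> S} \<inter> {x \<in> topspace X. q x \<in> T}" by blast
    then show "openin X {x \<in> topspace X. q x \<in> S \<inter> T}"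
      using openin_Int[OF conjunct2[OF S] conjunct2[OF T]] by (simp only:)
  next
    fix K assume K: "\<forall>S\<in>K. S \<subseteq> q ` topspace X \<and> openin X {x \<in> topspace X. q x \<in> S}"
    show "\<Union>K \<subseteq> q ` topspace X" using K by blast
    have "{x \<in> topspace X. q x \<in> \<Union>K} = \<Union>((\<lambda>S. {x \<in> topspace X. q x \<in> S}) ` K)" by blast
    moreover have "openin X (\<Union>((\<lambda>S. {x \<in> topspace X. q x \<in> S}) ` K))"
      using K by (intro openin_Union) blast
    ultimately show "openin X {x \<in> topspace X. q x \<in> \<Union>K}" by (simp only:)
  qed
  then show ?thesis unfolding quotient_topology_def by (simp only: topology_inverse')
qed

lemma topspace_quotient_topology: "topspace (quotient_topology X q) = q ` topspace X"
proof (rule antisym)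
  show "topspace (quotient_topology X q) \<subseteq> q ` topspace X"
    using openin_topspace[of "quotient_topology X q"] unfolding openin_quotient_topology by (rule conjunct1)
  have "{x \<in> topspace X. q x \<in> q ` topspace X} = topspace X" by blast
  then have "openin (quotient_topology X q) (q ` topspace X)"
    unfolding openin_quotient_topology by simp
  then show "q ` topspace X \<subseteq> topspace (quotient_topology X q)" by (rule openin_subset)
qed

lemma quotient_map_quotient_topology: "quotient_map X (quotient_topology X q) q"
  unfolding quotient_map_def topspace_quotient_topology openin_quotient_topology by simp

text \<open>Milnor's model of the universal principal bundle of a topological group: the infinite join
  of copies of the group, with the coarsest topology making the barycentric coordinates
  \<open>fst (e k)\<close> and the partially defined group coordinates \<open>snd (e k)\<close> continuous. Group
  coordinates with vanishing barycentric coordinate carry no information and are normalised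
  to the unit.\<close>

definition milnor_points :: "'g monoid \<Rightarrow> (nat \<Rightarrow> real \<times> 'g) set" where
  "milnor_points G =
     {e. (\<forall>k. 0 \<le> fst (e k) \<and> snd (e k) \<in> carrier G \<and> (fst (e k) = 0 \<longrightarrow> snd (e k) = \<one>\<^bsub>G\<^esub>)) \<and>
         finite {k. fst (e k) \<noteq> 0} \<and> (\<Sum>k | fst (e k) \<noteq> 0. fst (e k)) = 1}"

definition milnor_space :: "'g monoid \<Rightarrow> 'g topology \<Rightarrow> (nat \<Rightarrow> real \<times> 'g) topology" where
  "milnor_space G T =
     topology_generated_by
       ({{e \<in> milnor_points G. fst (e k) \<in> U} | k U. open U} \<union>
        {{e \<in> milnor_points G. fst (e k) \<noteq> 0 \<and> snd (e k) \<in> V} | k V. openin T V})"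

definition milnor_act :: "'g monoid \<Rightarrow> (nat \<Rightarrow> real \<times> 'g) \<Rightarrow> 'g \<Rightarrow> (nat \<Rightarrow> real \<times> 'g)" where
  "milnor_act G e g =
     (\<lambda>k. (fst (e k), if fst (e k) = 0 then \<one>\<^bsub>G\<^esub> else snd (e k) \<otimes>\<^bsub>G\<^esub> g))"

definition milnor_map :: "('g \<Rightarrow> 'h) \<Rightarrow> (nat \<Rightarrow> real \<times> 'g) \<Rightarrow> (nat \<Rightarrow> real \<times> 'h)" where
  "milnor_map \<phi> e = (\<lambda>k. (fst (e k), \<phi> (snd (e k))))"

text \<open>A quotient stack is given by its presentation: a topological group acting (from the left)
  on a space. The sets of coordinate functions record the algebraic structure. For an affine
  variety they generate its coordinate ring; for a locally closed subvariety of an affine variety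
  they are the restricted ambient coordinates.\<close>

record ('g, 'x) quotient_stack =
  grp :: "'g monoid"
  grp_top :: "'g topology"
  grp_coords :: "('g \<Rightarrow> complex) set"
  space :: "'x topology"
  space_coords :: "('x \<Rightarrow> complex) set"
  act :: "'g \<Rightarrow> 'x \<Rightarrow> 'x"

definition borel_orbit ::
  "('g, 'x) quotient_stack \<Rightarrow> (nat \<Rightarrow> real \<times> 'g) \<times> 'x \<Rightarrow> ((nat \<Rightarrow> real \<times> 'g) \<times> 'x) set" where
  "borel_orbit M p =
     {(milnor_act (grp M) (fst p) g, act M (inv\<^bsub>grp M\<^esub> g) (snd p)) | g. g \<in> carrier (grp M)}"

definition homotopy_quotient ::
  "('g, 'x) quotient_stack \<Rightarrow> ((nat \<Rightarrow> real \<times> 'g) \<times> 'x) set topology" where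
  "homotopy_quotient M =
     quotient_topology (prod_topology (milnor_space (grp M) (grp_top M)) (space M)) (borel_orbit M)"

inductive_set generated_algebra :: "('x \<Rightarrow> complex) set \<Rightarrow> ('x \<Rightarrow> complex) set"
  for A :: "('x \<Rightarrow> complex) set" where
  const: "(\<lambda>_. z) \<in> generated_algebra A"
| gen: "h \<in> A \<Longrightarrow> h \<in> generated_algebra A"
| add: "h \<in> generated_algebra A \<Longrightarrow> k \<in> generated_algebra A \<Longrightarrow> (\<lambda>x. h x + k x) \<in> generated_algebra A"
| mult: "h \<in> generated_algebra A \<Longrightarrow> k \<in> generated_algebra A \<Longrightarrow> (\<lambda>x. h x * k x) \<in> generated_algebra A"

definition regular_map ::
  "'x set \<Rightarrow> ('x \<Rightarrow> complex) set \<Rightarrow> ('y \<Rightarrow> complex) set \<Rightarrow> ('x \<Rightarrow> 'y) \<Rightarrow> bool" where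
  "regular_map S A B f \<longleftrightarrow> (\<forall>h\<in>B. \<exists>r\<in>generated_algebra A. \<forall>x\<in>S. h (f x) = r x)"

text \<open>A map of quotient stacks out of an affine quotient is presented by a homomorphism of
  algebraic groups and an equivariant morphism of varieties.\<close>

definition stack_map ::
  "('g, 'x) quotient_stack \<Rightarrow> ('h, 'y) quotient_stack \<Rightarrow> ('g \<Rightarrow> 'h) \<Rightarrow> ('x \<Rightarrow> 'y) \<Rightarrow> bool" where
  "stack_map M N \<phi> f \<longleftrightarrow>
     \<phi> \<in> hom (grp M) (grp N) \<and>
     continuous_map (grp_top M) (grp_top N) \<phi> \<and>
     regular_map (carrier (grp M)) (grp_coords M) (grp_coords N) \<phi> \<and>
     continuous_map (space M) (space N) f \<and>
     regular_map (topspace (space M)) (space_coords M) (space_coords N) f \<and>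
     (\<forall>g\<in>carrier (grp M). \<forall>x\<in>topspace (space M). f (act M g x) = act N (\<phi> g) (f x))"

text \<open>The induced map of homotopy quotients; all members of the union coincide when \<open>(\<phi>, f)\<close> is a
  stack map.\<close>

definition homotopy_quotient_map ::
  "('h, 'y) quotient_stack \<Rightarrow> ('g \<Rightarrow> 'h) \<Rightarrow> ('x \<Rightarrow> 'y) \<Rightarrow>
   ((nat \<Rightarrow> real \<times> 'g) \<times> 'x) set \<Rightarrow> ((nat \<Rightarrow> real \<times> 'h) \<times> 'y) set" where
  "homotopy_quotient_map N \<phi> f P =
     (\<Union>p\<in>P. borel_orbit N (milnor_map \<phi> (fst p), f (snd p)))"

definition homotopy_equivalence :: "'a topology \<Rightarrow> 'b topology \<Rightarrow> ('a \<Rightarrow> 'b) \<Rightarrow> bool" where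
  "homotopy_equivalence X Y f \<longleftrightarrow>
     (\<exists>g. continuous_map X Y f \<and> continuous_map Y X g \<and>
          homotopic_with (\<lambda>x. True) X X (g \<circ> f) id \<and>
          homotopic_with (\<lambda>x. True) Y Y (f \<circ> g) id)"

definition stack_homotopy_equivalence ::
  "('g, 'x) quotient_stack \<Rightarrow> ('h, 'y) quotient_stack \<Rightarrow> ('g \<Rightarrow> 'h) \<Rightarrow> ('x \<Rightarrow> 'y) \<Rightarrow> bool" where
  "stack_homotopy_equivalence M N \<phi> f \<longleftrightarrow>
     stack_map M N \<phi> f \<and>
     homotopy_equivalence (homotopy_quotient M) (homotopy_quotient N) (homotopy_quotient_map N \<phi> f)"


section \<open>Moduli stacks of representations\<close>

definition general_linear :: "nat \<Rightarrow> complex mat monoid" where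
  "general_linear n = units_of (ring_mat TYPE(complex) n ())"

definition mat_topology :: "nat \<Rightarrow> nat \<Rightarrow> complex mat topology" where
  "mat_topology r k =
     pullback_topology (carrier_mat r k) (\<lambda>A. \<lambda>ij\<in>{..<r} \<times> {..<k}. A $$ ij)
       (product_topology (\<lambda>_. euclidean) ({..<r} \<times> {..<k}))"

definition rep_space :: "('v, 'e) pre_digraph \<Rightarrow> ('v \<Rightarrow> nat) \<Rightarrow> ('e \<Rightarrow> complex mat) topology" where
  "rep_space Q \<delta> = product_topology (\<lambda>a. mat_topology (\<delta> (head Q a)) (\<delta> (tail Q a))) (arcs Q)"

definition base_change_group ::
  "('v, 'e) pre_digraph \<Rightarrow> ('v \<Rightarrow> nat) \<Rightarrow> ('v \<Rightarrow> complex mat) monoid" where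
  "base_change_group Q \<delta> = product_group (verts Q) (\<lambda>i. general_linear (\<delta> i))"

definition base_change ::
  "('v, 'e) pre_digraph \<Rightarrow> ('v \<Rightarrow> nat) \<Rightarrow> ('v \<Rightarrow> complex mat) \<Rightarrow> ('e \<Rightarrow> complex mat) \<Rightarrow>
   ('e \<Rightarrow> complex mat)" where
  "base_change Q \<delta> g \<rho> =
     (\<lambda>a\<in>arcs Q. g (head Q a) * \<rho> a * inv\<^bsub>general_linear (\<delta> (tail Q a))\<^esub> (g (tail Q a)))"

definition moduli_stack ::
  "('v, 'e) pre_digraph \<Rightarrow> ('v \<Rightarrow> nat) \<Rightarrow> ('v \<Rightarrow> complex mat, 'e \<Rightarrow> complex mat) quotient_stack" where
  "moduli_stack Q \<delta> =
     \<lparr>grp = base_change_group Q \<delta>,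
      grp_top = product_topology
        (\<lambda>i. subtopology (mat_topology (\<delta> i) (\<delta> i)) (carrier (general_linear (\<delta> i)))) (verts Q),
      grp_coords = {\<lambda>g. g i $$ (p, q) | i p q. i \<in> verts Q \<and> p < \<delta> i \<and> q < \<delta> i}
        \<union> {\<lambda>g. inverse (det (g i)) | i. i \<in> verts Q},
      space = rep_space Q \<delta>,
      space_coords = {\<lambda>\<rho>. \<rho> a $$ (p, q) | a p q.
        a \<in> arcs Q \<and> p < \<delta> (head Q a) \<and> q < \<delta> (tail Q a)},
      act = base_change Q \<delta>\<rparr>"

definition stratum ::
  "('v, 'e) pre_digraph \<Rightarrow> 'e \<Rightarrow> ('v \<Rightarrow> nat) \<Rightarrow> nat \<Rightarrow> ('e \<Rightarrow> complex mat) set" where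
  "stratum Q d \<delta> l =
     {\<rho> \<in> topspace (rep_space Q \<delta>). vec_space.rank (\<delta> (head Q d)) (\<rho> d) = l}"

definition stratum_stack ::
  "('v, 'e) pre_digraph \<Rightarrow> 'e \<Rightarrow> ('v \<Rightarrow> nat) \<Rightarrow> nat \<Rightarrow>
   ('v \<Rightarrow> complex mat, 'e \<Rightarrow> complex mat) quotient_stack" where
  "stratum_stack Q d \<delta> l =
     (moduli_stack Q \<delta>)\<lparr>space := subtopology (rep_space Q \<delta>) (stratum Q d \<delta> l)\<rparr>"


section \<open>Graded vector spaces and rational cohomology\<close>

text \<open>The fields \<^const>\<open>monoid.mult\<close> and \<^const>\<open>monoid.one\<close> of a module record are unused.\<close>

definition quotient_module :: "('k, 'a) module \<Rightarrow> 'a set \<Rightarrow> ('k, 'a set) module" where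
  "quotient_module V W =
     \<lparr>carrier = a_rcosets\<^bsub>V\<^esub> W, mult = undefined, one = undefined,
      zero = W, add = set_add V,
      smult = (\<lambda>k A. \<Union>v\<in>A. W +>\<^bsub>V\<^esub> (k \<odot>\<^bsub>V\<^esub> v))\<rparr>"

definition zero_module :: "('k, 'a) module" where
  "zero_module =
     \<lparr>carrier = {undefined}, mult = undefined, one = undefined,
      zero = undefined, add = (\<lambda>_ _. undefined), smult = (\<lambda>_ _. undefined)\<rparr>"

definition direct_sum_family :: "'i set \<Rightarrow> ('i \<Rightarrow> ('k, 'a) module) \<Rightarrow> ('k, 'i \<Rightarrow> 'a) module" where
  "direct_sum_family I V =
     \<lparr>carrier = {x \<in> (\<Pi>\<^sub>E i\<in>I. carrier (V i)). finite {i \<in> I. x i \<noteq> \<zero>\<^bsub>V i\<^esub>}},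
      mult = undefined, one = undefined,
      zero = (\<lambda>i\<in>I. \<zero>\<^bsub>V i\<^esub>),
      add = (\<lambda>x y. \<lambda>i\<in>I. x i \<oplus>\<^bsub>V i\<^esub> y i),
      smult = (\<lambda>k x. \<lambda>i\<in>I. k \<odot>\<^bsub>V i\<^esub> x i)\<rparr>"

type_synonym 'a graded = "int \<Rightarrow> (rat, 'a) module"

definition shift :: "'a graded \<Rightarrow> int \<Rightarrow> 'a graded" where
  "shift V m = (\<lambda>n. V (n + m))"

definition graded_direct_sum :: "'i set \<Rightarrow> ('i \<Rightarrow> 'a graded) \<Rightarrow> ('i \<Rightarrow> 'a) graded" where
  "graded_direct_sum I V = (\<lambda>n. direct_sum_family I (\<lambda>i. V i n))"

definition graded_isomorphic :: "'a graded \<Rightarrow> 'b graded \<Rightarrow> bool" where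
  "graded_isomorphic V W \<longleftrightarrow>
     (\<forall>n. \<exists>T. linear_map class_ring (V n) (W n) T \<and> bij_betw T (carrier (V n)) (carrier (W n)))"

definition cochains :: "nat \<Rightarrow> 'a topology \<Rightarrow> ('a chain \<Rightarrow> rat) set" where
  "cochains p X =
     hom (chain_group p X) (add_monoid class_ring) \<inter> extensional (singular_chain_set p X)"

definition cocycles :: "nat \<Rightarrow> 'a topology \<Rightarrow> (rat, 'a chain \<Rightarrow> rat) module" where
  "cocycles p X =
     \<lparr>carrier = {\<phi> \<in> cochains p X.
        \<forall>s\<in>singular_chain_set (Suc p) X. \<phi> (chain_boundary (Suc p) s) = 0},
      mult = undefined, one = undefined,
      zero = (\<lambda>s\<in>singular_chain_set p X. 0),
      add = (\<lambda>\<phi> \<psi>. \<lambda>s\<in>singular_chain_set p X. \<phi> s + \<psi> s),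
      smult = (\<lambda>k \<phi>. \<lambda>s\<in>singular_chain_set p X. k * \<phi> s)\<rparr>"

text \<open>For \<open>p = 0\<close> this is \<open>{0}\<close>, because \<^term>\<open>chain_boundary 0\<close> vanishes.\<close>

definition coboundaries :: "nat \<Rightarrow> 'a topology \<Rightarrow> ('a chain \<Rightarrow> rat) set" where
  "coboundaries p X =
     (\<lambda>\<psi>. \<lambda>s\<in>singular_chain_set p X. \<psi> (chain_boundary p s)) ` cochains (p - 1) X"

definition cohomology :: "'a topology \<Rightarrow> ('a chain \<Rightarrow> rat) set graded" where
  "cohomology X n =
     (if n < 0 then zero_module else quotient_module (cocycles (nat n) X) (coboundaries (nat n) X))"

definition stack_cohomology ::
  "('g, 'x) quotient_stack \<Rightarrow> (((nat \<Rightarrow> real \<times> 'g) \<times> 'x) set chain \<Rightarrow> rat) set graded" where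
  "stack_cohomology M = cohomology (homotopy_quotient M)"

end

theory Submission
  imports Defs "HOL-Computational_Algebra.Formal_Power_Series"
begin

text \<open>
The stratum is the sweep of the locus where \<open>d\<close> is the block identity of rank \<open>l\<close>. The stabiliser of
that block retracts, by scaling off-diagonal blocks, onto the group of the unlinking, and pivots give
local sections with a partition of unity. The Milnor join glues these into a homotopy inverse.

As representation spaces are contractible, both sides of the decomposition are cohomologies of classifying
spaces. Frames modulo base change are products of infinite Grassmannians, filtered by even-dimensional
Schubert cells, which determine the Betti numbers; these agree by the Durfee rectangle identity, whose
exponents are the codimensions of the strata.
\<close>

text \<open>Milnor's model comes with no bundle theory, so every comparison is an explicit homotopy
  on total spaces, equivariant at each time, which descends because orbit maps are open. Its main
  source is that any two equivariant maps into the join are equivariantly homotopic. The retraction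
  of the stabiliser is a family of endomorphisms, so it can be applied directly to the group
  coordinates of join points.

  The decomposition is obtained by dimension count: in each degree both sides are
  finite-dimensional. Over the rationals cohomology is dual to homology by divisibility, and
  evenness of the cells makes all connecting maps vanish. The Schubert pieces are used through open
  pivot sets: adding one of them attaches a stratum of finite complex codimension \<open>w\<close>,
  whose normal slice has relative homology in degree \<open>2 * w\<close> only. The two Euler forms
  differ by twice the product of the dimensions left at the two vertices once \<open>l\<close> is
  split off, which is the real codimension of the stratum of rank \<open>l\<close>; this is the
  shift that the counting identity predicts.\<close>

abbreviation "I01 == top_of_set {0..1::real}"
abbreviation "GL == general_linear"
abbreviation "BG == base_change_group"
abbreviation "Hr == relative_homology_group"

section \<open>Topological groups and the Milnor construction\<close>

lemma continuous_map_locallyI: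
 assumes "!!x. x : topspace X ==> \<exists>U. openin X U & x : U & continuous_map (subtopology X U) Y f" shows "continuous_map X Y f"
proof -
 obtain U where U: "!!x. x : topspace X ==> openin X (U x) & x : U x & continuous_map (subtopology X (U x)) Y f" using assms by metis
 show ?thesis by (rule pasting_lemma[where I = "topspace X" and T = U and f = "%_. f"]) (use U in auto)
qed

lemma continuous_map_restrict_eq:
 assumes "continuous_map (subtopology X U) Y g" "!!x. x : topspace X ==> x : U ==> f x = g x" shows "continuous_map (subtopology X U) Y f"
 using assms by (metis IntE continuous_map_eq topspace_subtopology)

lemma openin_nonzero:
 assumes "continuous_map Z euclidean (f :: _ => 'b::t1_space)" shows "openin Z {z : topspace Z. f z ~= c}"
proof -
 have "openin Z {z : topspace Z. f z : - {c}}" by (rule openin_continuous_map_preimage[OF assms]) auto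
 then show ?thesis by simp
qed

lemma homotopic_withI:
 assumes "continuous_map (prod_topology I01 X) Y (%z. h (fst z) (snd z))" and "!!t. t : {0..1} ==> P (h t)"
 shows "homotopic_with P X Y (h 0) (h 1)" unfolding homotopic_with_def by (rule exI[of _ "%z. h (fst z) (snd z)"]) (use assms in simp)

locale topological_group = group G for G :: "'g monoid" (structure) +
 fixes T
 assumes topspace_T: "topspace T = carrier G" and continuous_mult: "continuous_map (prod_topology T T) T (%(x, y). x \<otimes> y)"
  and continuous_inv: "continuous_map T T (%x. inv x)"
begin

lemma continuous_map_mult:
 assumes "continuous_map Z T f" "continuous_map Z T g" shows "continuous_map Z T (%z. f z \<otimes> g z)"
 using continuous_map_compose[OF continuous_map_pairedI[OF assms] continuous_mult] by (simp add: o_def)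

lemma continuous_map_inv:
 assumes "continuous_map Z T f" shows "continuous_map Z T (%z. inv (f z))" using continuous_map_compose[OF assms continuous_inv]
   by (simp add: o_def)

end

text \<open>Where the weight vanishes the given group coordinate may be anything, even outside the
  carrier. Normalising once here reduces equality of join points to a check on the support
  (\<open>mpt_cong\<close>).\<close>

definition mpt :: "'g monoid => (nat => real) => (nat => 'g) => nat => real \<times> 'g" where
 "mpt G t g = (%k. (t k, if t k = 0 then \<one>\<^bsub>G\<^esub> else g k))"

lemma fst_mpt [simp]: "fst (mpt G t g k) = t k" and snd_mpt: "t k ~= 0 ==> snd (mpt G t g k) = g k" by (simp_all add: mpt_def)

lemma mpt_cong: "(!!k. t k = t' k) ==> (!!k. t k ~= 0 ==> g k = g' k) ==> mpt G t g = mpt G t' g'" by (auto simp: mpt_def)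

text \<open>Writing the total mass as a convergent series lets the rearrangements of positions below
  use series arithmetic instead of tracking supports.\<close>

lemma milnor_points_iff:
 "e : milnor_points G \<longleftrightarrow>
   (\<forall>k. 0 <= fst (e k) & snd (e k) : carrier G & (fst (e k) = 0 --> snd (e k) = \<one>\<^bsub>G\<^esub>)) &
   finite {k. fst (e k) ~= 0} & (%k. fst (e k)) sums 1"
proof -
 have "finite {k. fst (e k) ~= 0} ==> (%k. fst (e k)) sums (\<Sum>k | fst (e k) ~= 0. fst (e k))" by (rule sums_finite) auto
 then have "finite {k. fst (e k) ~= 0} ==>
   (\<Sum>k | fst (e k) ~= 0. fst (e k)) = 1 \<longleftrightarrow> (%k. fst (e k)) sums 1" using sums_unique2 by metis
 then show ?thesis unfolding milnor_points_def mem_Collect_eq by (simp cong: conj_cong)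
qed

lemma mpt_in_milnor_points:
 assumes "monoid G" "!!k. 0 <= t k" "finite {k. t k ~= 0}" "t sums 1" "!!k. t k ~= 0 ==> g k : carrier G"
 shows "mpt G t g : milnor_points G" unfolding milnor_points_iff using assms(2-) monoid.one_closed[OF assms(1)] by (simp add: mpt_def)

lemma mpt_eta: "e : milnor_points G ==> mpt G (%k. fst (e k)) (%k. snd (e k)) = e"
 by (rule ext) (auto simp: mpt_def milnor_points_def prod_eq_iff)

lemma milnor_pointsD:
 assumes "e : milnor_points G" shows "0 <= fst (e k)" "snd (e k) : carrier G" "finite {k. fst (e k) ~= 0}" "(%k. fst (e k)) sums 1"
 using assms unfolding milnor_points_iff by auto

lemma milnor_act_mpt: "milnor_act G (mpt G t g) h = mpt G t (%k. g k \<otimes>\<^bsub>G\<^esub> h)" by (auto simp: milnor_act_def mpt_def)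

lemma milnor_act_eq: "milnor_act G e h = mpt G (%k. fst (e k)) (%k. snd (e k) \<otimes>\<^bsub>G\<^esub> h)"
 by (auto simp: milnor_act_def mpt_def)

lemma milnor_map_mpt: "ph \<one>\<^bsub>G\<^esub> = \<one>\<^bsub>H\<^esub> ==> milnor_map ph (mpt G t g) = mpt H t (%k. ph (g k))"
 by (auto simp: milnor_map_def mpt_def)

lemma topspace_milnor_space [simp]: "topspace (milnor_space G T) = milnor_points G"
proof -
 have "{e : milnor_points G. fst (e 0) : UNIV} \<in>
   ({{e : milnor_points G. fst (e k) : U} | k U. open U} \<union>
    {{e : milnor_points G. fst (e k) ~= 0 & snd (e k) : V} | k V. openin T V})" using open_UNIV by blast
 then show ?thesis unfolding milnor_space_def topology_generated_by_topspace by auto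
qed

lemma openin_milnor_fst: "open U ==> openin (milnor_space G T) {e : milnor_points G. fst (e k) : U}"
 unfolding milnor_space_def by (rule topology_generated_by_Basis) blast

lemma openin_milnor_snd:
 "openin T V ==> openin (milnor_space G T) {e : milnor_points G. fst (e k) ~= 0 & snd (e k) : V}"
 unfolding milnor_space_def by (rule topology_generated_by_Basis) blast

lemma continuous_milnor_fst:
 assumes "continuous_map Z (milnor_space G T) f" shows "continuous_map Z euclideanreal (%z. fst (f z k))"
proof -
 have "continuous_map (milnor_space G T) euclideanreal (%e. fst (e k))"
  unfolding continuous_map using openin_milnor_fst[of _ G T k] by auto
 from continuous_map_compose[OF assms this] show ?thesis by (simp add: o_def)
qed

lemma continuous_milnor_snd:
 assumes "continuous_map Z (milnor_space G T) f" "topspace T = carrier G"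
 shows "continuous_map (subtopology Z {z. fst (f z k) ~= 0}) T (%z. snd (f z k))"
proof -
 have "continuous_map (subtopology (milnor_space G T) {e. fst (e k) ~= 0}) T (%e. snd (e k))" unfolding continuous_map
 proof (intro conjI allI impI)
  show "(%e. snd (e k)) ` topspace (subtopology (milnor_space G T) {e. fst (e k) ~= 0}) <= topspace T"
   using assms(2) by (auto simp: milnor_points_def)
  fix V assume "openin T V"
  then have "openin (milnor_space G T) {e : milnor_points G. fst (e k) ~= 0 & snd (e k) : V}" by (rule openin_milnor_snd)
  moreover have "{x : topspace (subtopology (milnor_space G T) {e. fst (e k) ~= 0}). snd (x k) : V}
   = {e : milnor_points G. fst (e k) ~= 0 & snd (e k) : V} \<inter> {e. fst (e k) ~= 0}" by auto
  ultimately show "openin (subtopology (milnor_space G T) {e. fst (e k) ~= 0})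
     {x : topspace (subtopology (milnor_space G T) {e. fst (e k) ~= 0}). snd (x k) : V}" unfolding openin_subtopology by blast
 qed
 from continuous_map_compose[OF _ this] have "continuous_map (subtopology Z {z. fst (f z k) ~= 0}) T (%z. snd (f z k))"
  if "continuous_map (subtopology Z {z. fst (f z k) ~= 0}) (subtopology (milnor_space G T) {e. fst (e k) ~= 0}) f"
  using that by (fastforce simp: o_def)
 moreover have "continuous_map (subtopology Z {z. fst (f z k) ~= 0})
   (subtopology (milnor_space G T) {e. fst (e k) ~= 0}) f"
  using assms(1) by (auto simp: continuous_map_in_subtopology continuous_map_from_subtopology)
 ultimately show ?thesis by blast
qed

lemma continuous_map_into_milnor:
 assumes pts: "!!z. z : topspace Z ==> f z : milnor_points G" and t: "!!k. continuous_map Z euclideanreal (%z. fst (f z k))"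
  and g: "!!k. continuous_map (subtopology Z {z. fst (f z k) ~= 0}) T (%z. snd (f z k))" shows "continuous_map Z (milnor_space G T) f"
 unfolding milnor_space_def
proof (rule continuous_on_generated_topo)
 show "f ` topspace Z <= \<Union>({{e : milnor_points G. fst (e k) : U} | k U. open U} \<union>
    {{e : milnor_points G. fst (e k) ~= 0 & snd (e k) : V} | k V. openin T V})" using topspace_milnor_space[of G T] pts
  unfolding milnor_space_def topology_generated_by_topspace by blast
 fix W assume "W : {{e : milnor_points G. fst (e k) : U} | k U. open U} \<union>
    {{e : milnor_points G. fst (e k) ~= 0 & snd (e k) : V} | k V. openin T V}"
 then consider k U where "W = {e : milnor_points G. fst (e k) : U}" "open U"
  | k V where "W = {e : milnor_points G. fst (e k) ~= 0 & snd (e k) : V}" "openin T V" by blast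
 then show "openin Z (f -` W \<inter> topspace Z)"
 proof cases
  case 1
  have "f -` W \<inter> topspace Z = {z : topspace Z. fst (f z k) : U}" using pts 1 by auto
  then show ?thesis using openin_continuous_map_preimage[OF t[of k], of U] 1 by simp
 next
  case 2
  let ?U = "{z : topspace Z. fst (f z k) ~= 0}"
  have U: "openin Z ?U" by (rule openin_nonzero[OF t])
  have "continuous_map (subtopology Z ?U) T (%z. snd (f z k))" by (rule continuous_map_from_subtopology_mono[OF g]) auto
  from openin_continuous_map_preimage[OF this 2(2)]
  have "openin Z {z : topspace (subtopology Z ?U). snd (f z k) : V}" using openin_trans_full[OF _ U] by blast
  moreover have "f -` W \<inter> topspace Z = {z : topspace (subtopology Z ?U). snd (f z k) : V}" using pts 2 by auto
  ultimately show ?thesis by simp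
 qed
qed

lemma continuous_map_mpt:
 assumes "monoid G" and "!!z k. z : topspace Z ==> 0 <= t z k" "!!z. z : topspace Z ==> finite {k. t z k ~= 0}"
  and "!!z. z : topspace Z ==> t z sums 1" "topspace T = carrier G" and t: "!!k. continuous_map Z euclideanreal (%z. t z k)"
  and g: "!!k. continuous_map (subtopology Z {z. t z k ~= 0}) T (%z. g z k)"
 shows "continuous_map Z (milnor_space G T) (%z. mpt G (t z) (g z))"
proof (rule continuous_map_into_milnor)
 fix z assume z: "z : topspace Z"
 show "mpt G (t z) (g z) : milnor_points G"
 proof (rule mpt_in_milnor_points)
  fix k assume "t z k ~= 0"
  then show "g z k : carrier G" using g[of k] z assms(5) by (auto simp: continuous_map_def)
 qed (use assms z in auto)
next
 fix k
 show "continuous_map Z euclideanreal (%z. fst (mpt G (t z) (g z) k))" using t by simp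
 show "continuous_map (subtopology Z {z. fst (mpt G (t z) (g z) k) ~= 0}) T (%z. snd (mpt G (t z) (g z) k))"
  unfolding fst_mpt by (rule continuous_map_restrict_eq[OF g]) (simp add: snd_mpt)
qed

context topological_group begin

abbreviation EG where "EG == milnor_space G T"

lemma milnor_act_closed: "e : milnor_points G ==> g : carrier G ==> milnor_act G e g : milnor_points G" unfolding milnor_act_eq
 by (rule mpt_in_milnor_points) (auto simp: milnor_pointsD[of e G] monoid_axioms)

lemma milnor_act_one: "e : milnor_points G ==> milnor_act G e \<one> = e"
 by (rule ext) (auto simp: milnor_act_def milnor_points_def prod_eq_iff)

lemma milnor_act_mult:
 "e : milnor_points G ==> g : carrier G ==> h : carrier G ==>
   milnor_act G (milnor_act G e g) h = milnor_act G e (g \<otimes> h)" by (rule ext) (auto simp: milnor_act_def milnor_points_def m_assoc)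

lemma continuous_map_milnor_act:
 assumes "continuous_map Z EG f" "continuous_map Z T g" shows "continuous_map Z EG (%z. milnor_act G (f z) (g z))" unfolding milnor_act_eq
proof (rule continuous_map_mpt)
 have "f z : milnor_points G" if "z : topspace Z" for z using assms(1) that by (auto simp: continuous_map_def)
 note D = milnor_pointsD[OF this]
 show "0 <= fst (f z k)" "finite {k. fst (f z k) ~= 0}" "(%k. fst (f z k)) sums 1"
  if "z : topspace Z" for z k using D that by auto
 show "continuous_map (subtopology Z {z. fst (f z k) ~= 0}) T (%z. snd (f z k) \<otimes> g z)" for k
  using continuous_milnor_snd[OF assms(1) topspace_T] assms(2) by (intro continuous_map_mult) (auto simp: continuous_map_from_subtopology)
qed (use assms(1) topspace_T monoid_axioms continuous_milnor_fst in auto)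

end

subsection \<open>Equivariant contractibility of the universal bundle\<close>

text \<open>\<open>shuffle_weight k s\<close> runs from \<open>0\<close> (for \<open>k > 0\<close>) at \<open>s = 0\<close> to \<open>1\<close> at \<open>s = 1\<close>,
 one index after the other: no weight moves before all smaller ones have arrived. So coordinate
 \<open>m\<close> can travel from position \<open>2 * m\<close> to position \<open>m\<close>, which is vacated by then.\<close>

definition shuffle_weight :: "nat => real => real" where
 "shuffle_weight k s = max 0 (min 1 ((real k + 1) * (1 - real k * (1 - s))))"

lemma shuffle_weight_bounds: "0 <= shuffle_weight k s" "shuffle_weight k s <= 1" by (auto simp: shuffle_weight_def)

lemma shuffle_weight_0 [simp]: "shuffle_weight 0 s = 1" by (simp add: shuffle_weight_def)

lemma shuffle_weight_start: "k ~= 0 ==> shuffle_weight k 0 = 0"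
 using mult_nonneg_nonpos[of "real k + 1" "1 - real k"] by (simp add: shuffle_weight_def)

lemma shuffle_weight_end [simp]: "shuffle_weight k 1 = 1" by (simp add: shuffle_weight_def)

text \<open>The slope factor \<open>k + 1\<close> is chosen for this. A nonzero weight at
  \<open>k\<close> means \<open>k * (1 - s) < 1\<close>, hence \<open>(m + 1) * (1 - s) < 1\<close>
  for \<open>m < k\<close>, and then the unclipped value at \<open>m\<close> is at least
  \<open>(m + 1) - m = 1\<close>.\<close>

lemma shuffle_weight_order:
 assumes "shuffle_weight k s ~= 0" "m < k" "s <= 1" shows "shuffle_weight m s = 1"
proof -
 have "(real k + 1) * (1 - real k * (1 - s)) > 0"
  using assms(1) unfolding shuffle_weight_def by (metis max.absorb1 min.absorb2 not_less zero_le_one order_trans)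
 then have "real k * (1 - s) < 1" by (simp add: zero_less_mult_iff)
 moreover have "(real m + 1) * (1 - s) <= real k * (1 - s)" using assms(2,3) by (intro mult_right_mono) auto
 ultimately have "real m * ((real m + 1) * (1 - s)) <= real m * 1" by (intro mult_left_mono) auto
 then have "(real m + 1) * (1 - real m * (1 - s)) \<ge> 1" by (simp add: algebra_simps)
 then show ?thesis unfolding shuffle_weight_def by simp
qed

text \<open>Position \<open>n\<close> is claimed by its own coordinate and by the one still waiting
  to leave for \<open>n div 2\<close>. Group coordinates cannot be averaged, so the two must never
  be present together.\<close>

lemma shuffle_disjoint:
 assumes "shuffle_weight n s ~= 0" "1 - shuffle_weight (n div 2) s ~= 0" "s <= 1" shows False
proof (cases "n = 0")
 case False
 then show ?thesis using shuffle_weight_order[of n s "n div 2"] assms by simp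
qed (use assms in simp)

lemma continuous_map_shuffle_weight:
 assumes "continuous_map Z euclideanreal s" shows "continuous_map Z euclideanreal (%z. shuffle_weight k (s z))"
 unfolding shuffle_weight_def by (intro continuous_map_real_max continuous_map_real_min continuous_map_real_mult
   continuous_map_diff assms continuous_map_canonical_const)

definition shuffle :: "'g monoid => real => (nat => real \<times> 'g) => nat => real \<times> 'g" where
 "shuffle G s e = mpt G
   (%n. shuffle_weight n s * fst (e n) +
    (if even n then (1 - shuffle_weight (n div 2) s) * fst (e (n div 2)) else 0))
   (%n. snd (e (if shuffle_weight n s = 0 then n div 2 else n)))"

text \<open>The straight segment of the join: the two points occupy positions of different parity,
  so their group coordinates never compete.\<close>

definition interleave ::
 "'g monoid => real => (nat => real \<times> 'g) => (nat => real \<times> 'g) => nat => real \<times> 'g" where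
 "interleave G s e e' = mpt G
   (%n. if even n then (1 - s) * fst (e (n div 2)) else s * fst (e' (n div 2)))
   (%n. snd ((if even n then e else e') (n div 2)))"

lemma sums_even_part:
 assumes "(f :: nat => real) sums x" shows "(%n. if even n then f (n div 2) else 0) sums x" using sums_if[OF sums_zero assms] by simp

lemma finite_div2:
 assumes "finite {k :: nat. P k}" shows "finite {n. P (n div 2)}"
proof -
 have "n = 2 * (n div 2) \<or> n = 2 * (n div 2) + 1" for n :: nat by presburger
 then have "{n. P (n div 2)} <= (\<Union>k\<in>{k. P k}. {2 * k, 2 * k + 1})" by blast
 then show ?thesis by (rule finite_subset) (use assms in blast)
qed

context topological_group begin

lemma continuous_map_shuffle:
 assumes f: "continuous_map Z EG f" and s: "continuous_map Z I01 s" shows "continuous_map Z EG (%z. shuffle G (s z) (f z))"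
 unfolding shuffle_def
proof (rule continuous_map_mpt)
 have pt: "f z : milnor_points G" if "z : topspace Z" for z using f that by (auto simp: continuous_map_def)
 note D = milnor_pointsD[OF pt]
 have s01: "0 <= s z" "s z <= 1" if "z : topspace Z" for z using s that by (auto simp: continuous_map_def)
 have sc: "continuous_map Z euclideanreal s" using s by (simp add: continuous_map_in_subtopology)
 note wc = continuous_map_shuffle_weight[OF sc] and fc = continuous_milnor_fst[OF f]
 let ?t = "%z n. shuffle_weight n (s z) * fst (f z n) +
    (if even n then (1 - shuffle_weight (n div 2) (s z)) * fst (f z (n div 2)) else 0)"
 fix z k assume z: "z : topspace Z"
 show "0 <= ?t z k" using D[OF z] shuffle_weight_bounds[of _ "s z"] by auto
 have "{k. ?t z k ~= 0} <= {k. fst (f z k) ~= 0} \<union> {k. fst (f z (k div 2)) ~= 0}" by auto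
 then show "finite {k. ?t z k ~= 0}" using D(3)[OF z] finite_div2[OF D(3)[OF z]] finite_subset by blast
 have fin: "finite {k. shuffle_weight k (s z) * fst (f z k) ~= 0}" using D(3)[OF z] by (rule rev_finite_subset) auto
 \<comment> \<open>The masses that stay have some finite sum; the complementary masses, spread over
   the even positions, add up to one minus that sum.\<close>
 have 1: "(%n. shuffle_weight n (s z) * fst (f z n)) sums (suminf (%n. shuffle_weight n (s z) * fst (f z n)))"
  by (rule summable_sums[OF summable_finite[OF fin]]) blast
 have "(%n. fst (f z n) - shuffle_weight n (s z) * fst (f z n)) sums
    (1 - (suminf (%n. shuffle_weight n (s z) * fst (f z n))))" by (rule sums_diff[OF D(4)[OF z] 1])
 then have "(%n. (1 - shuffle_weight n (s z)) * fst (f z n)) sums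
    (1 - (suminf (%n. shuffle_weight n (s z) * fst (f z n))))" by (simp add: algebra_simps)
 from sums_add[OF 1 sums_even_part[OF this]] show "?t z sums 1" by simp
next
 have sc: "continuous_map Z euclideanreal s" using s by (simp add: continuous_map_in_subtopology)
 note wc = continuous_map_shuffle_weight[OF sc] and fc = continuous_milnor_fst[OF f]
 fix n
 let ?a = "%z. shuffle_weight n (s z) * fst (f z n)"
 let ?b = "%z. (1 - shuffle_weight (n div 2) (s z)) * fst (f z (n div 2))"
 have a: "continuous_map Z euclideanreal ?a" by (intro continuous_map_real_mult wc fc)
 have b: "continuous_map Z euclideanreal ?b" by (intro continuous_map_real_mult wc fc continuous_map_diff continuous_map_canonical_const)
 show "continuous_map Z euclideanreal (%z. ?a z + (if even n then ?b z else 0))"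
  using continuous_map_add[OF a b] a by (cases "even n") auto
 let ?Z = "subtopology Z {z. ?a z + (if even n then ?b z else 0) ~= 0}"
 show "continuous_map ?Z T (%z. snd (f z (if shuffle_weight n (s z) = 0 then n div 2 else n)))"
 proof (rule continuous_map_locallyI)
  fix z assume z: "z : topspace ?Z"
  then have zZ: "z : topspace Z" by simp
  have s1: "s z <= 1" if "z : topspace Z" for z using s that by (auto simp: continuous_map_def)
  have co: "continuous_map (subtopology ?Z U) T (%z. snd (f z m))"
   if "U <= {z. fst (f z m) ~= 0}" for U m unfolding subtopology_subtopology
   by (rule continuous_map_from_subtopology_mono[OF continuous_milnor_snd[OF f topspace_T]])
    (use that in blast)
  \<comment> \<open>At each point exactly one of the two summands is nonzero, and it stays nonzero
    nearby. So locally the group coordinate is one fixed coordinate of \<open>f\<close>.\<close>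
  show "\<exists>U. openin ?Z U & z : U & continuous_map (subtopology ?Z U) T
    (%z. snd (f z (if shuffle_weight n (s z) = 0 then n div 2 else n)))"
  proof (cases "?a z = 0")
   case False
   show ?thesis
   proof (intro exI conjI)
    show "openin ?Z {z : topspace ?Z. ?a z ~= 0}" by (rule openin_nonzero) (rule continuous_map_from_subtopology[OF a])
    show "z : {z : topspace ?Z. ?a z ~= 0}" using False z by simp
    have "continuous_map (subtopology ?Z {z : topspace ?Z. ?a z ~= 0}) T (%z. snd (f z n))" by (rule co) auto
    then show "continuous_map (subtopology ?Z {z : topspace ?Z. ?a z ~= 0}) T
      (%z. snd (f z (if shuffle_weight n (s z) = 0 then n div 2 else n)))" by (rule continuous_map_restrict_eq) auto
   qed
  next
   case True
   then have ev: "even n" and bz: "?b z ~= 0" using z by (auto split: if_splits)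
   show ?thesis
   proof (intro exI conjI)
    show "openin ?Z {z : topspace ?Z. ?b z ~= 0}" by (rule openin_nonzero) (rule continuous_map_from_subtopology[OF b])
    show "z : {z : topspace ?Z. ?b z ~= 0}" using bz z by simp
    have "continuous_map (subtopology ?Z {z : topspace ?Z. ?b z ~= 0}) T (%z. snd (f z (n div 2)))" by (rule co) auto
    then show "continuous_map (subtopology ?Z {z : topspace ?Z. ?b z ~= 0}) T
      (%z. snd (f z (if shuffle_weight n (s z) = 0 then n div 2 else n)))"
    proof (rule continuous_map_restrict_eq)
     fix y assume y: "y : topspace ?Z" "y : {z : topspace ?Z. ?b z ~= 0}"
     then have "shuffle_weight n (s y) = 0" using shuffle_disjoint[of n "s y"] s1[of y] by auto
     then show "snd (f y (if shuffle_weight n (s y) = 0 then n div 2 else n)) = snd (f y (n div 2))" by simp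
    qed
   qed
  qed
 qed
qed (use topspace_T monoid_axioms in auto)

lemma shuffle_end: "e : milnor_points G ==> shuffle G 1 e = e" by (simp add: shuffle_def mpt_eta cong: if_cong)

text \<open>At time \<open>0\<close> only even positions are occupied, which is why
  \<open>e'\<close> is arbitrary.\<close>

lemma shuffle_start: "e : milnor_points G ==> shuffle G 0 e = interleave G 0 e e'" unfolding shuffle_def interleave_def
proof (rule mpt_cong)
 fix k
 show "shuffle_weight k 0 * fst (e k) +
     (if even k then (1 - shuffle_weight (k div 2) 0) * fst (e (k div 2)) else 0) =
     (if even k then (1 - 0) * fst (e (k div 2)) else 0 * fst (e' (k div 2)))"
  by (cases "k = 0"; cases "k div 2 = 0") (auto simp: shuffle_weight_start)
next
 fix k
 assume *: "shuffle_weight k 0 * fst (e k) +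
     (if even k then (1 - shuffle_weight (k div 2) 0) * fst (e (k div 2)) else 0) ~= 0"
 show "snd (e (if shuffle_weight k 0 = 0 then k div 2 else k)) = snd ((if even k then e else e') (k div 2))"
  by (cases "k = 0") (use * shuffle_weight_start[of k] in "auto split: if_splits")
qed

lemma milnor_act_shuffle:
 assumes "e : milnor_points G" "g : carrier G" "s <= 1" shows "shuffle G s (milnor_act G e g) = milnor_act G (shuffle G s e) g"
proof -
 have "shuffle_weight n s ~= 0 ==> shuffle_weight (n div 2) s = 1" for n using shuffle_disjoint[of n s] assms(3) by auto
 then show ?thesis unfolding shuffle_def milnor_act_mpt by (intro mpt_cong) (auto simp: milnor_act_def split: if_splits)
qed

lemma continuous_map_interleave:
 assumes f: "continuous_map Z EG f" and f': "continuous_map Z EG f'" and s: "continuous_map Z I01 s"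
 shows "continuous_map Z EG (%z. interleave G (s z) (f z) (f' z))" unfolding interleave_def
proof (rule continuous_map_mpt)
 let ?t = "%z n. if even n then (1 - s z) * fst (f z (n div 2)) else s z * fst (f' z (n div 2))"
 fix z k assume z: "z : topspace Z"
 have D: "f z : milnor_points G" "f' z : milnor_points G" using f f' z by (auto simp: continuous_map_def)
 have s01: "0 <= s z" "s z <= 1" using s z by (auto simp: continuous_map_def)
 show "0 <= ?t z k" using D s01 by (auto simp: milnor_pointsD)
 have "{k. ?t z k ~= 0} <= {k. fst (f z (k div 2)) ~= 0} \<union> {k. fst (f' z (k div 2)) ~= 0}" by auto
 then show "finite {k. ?t z k ~= 0}" using finite_div2[OF milnor_pointsD(3)[OF D(1)]] finite_div2[OF milnor_pointsD(3)[OF D(2)]]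
   finite_subset by blast
 have "(%n. if even n then (1 - s z) * fst (f z (n div 2)) else s z * fst (f' z ((n - 1) div 2))) sums
   (s z * 1 + (1 - s z) * 1)" by (intro sums_if sums_mult milnor_pointsD(4)[OF D(1)] milnor_pointsD(4)[OF D(2)])
 moreover have "(if even n then (1 - s z) * fst (f z (n div 2)) else s z * fst (f' z ((n - 1) div 2))) = ?t z n" for n
  by (auto elim!: oddE)
 ultimately show "?t z sums 1" by simp
next
 have sc: "continuous_map Z euclideanreal s" using s by (simp add: continuous_map_in_subtopology)
 fix n
 let ?t = "%z n. if even n then (1 - s z) * fst (f z (n div 2)) else s z * fst (f' z (n div 2))"
 have 1: "continuous_map Z euclideanreal (%z. (1 - s z) * fst (f z (n div 2)))"
  by (intro continuous_map_real_mult continuous_map_diff continuous_map_canonical_const sc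
    continuous_milnor_fst[OF f])
 have 2: "continuous_map Z euclideanreal (%z. s z * fst (f' z (n div 2)))"
  by (intro continuous_map_real_mult sc continuous_milnor_fst[OF f'])
 show "continuous_map Z euclideanreal (%z. ?t z n)" using 1 2 by (cases "even n") auto
 show "continuous_map (subtopology Z {z. ?t z n ~= 0}) T (%z. snd ((if even n then f z else f' z) (n div 2)))"
  using continuous_map_from_subtopology_mono[OF continuous_milnor_snd[OF f topspace_T, of "n div 2"], of "{z. ?t z n ~= 0}"]
   continuous_map_from_subtopology_mono[OF continuous_milnor_snd[OF f' topspace_T, of "n div 2"], of "{z. ?t z n ~= 0}"]
  by (cases "even n") (auto simp: subset_iff)
qed (use topspace_T monoid_axioms in auto)

lemma milnor_act_interleave:
 "interleave G s (milnor_act G e g) (milnor_act G e' g) = milnor_act G (interleave G s e e') g" unfolding interleave_def milnor_act_mpt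
 by (intro mpt_cong) (auto simp: milnor_act_def split: if_splits)

definition equivariant2 where
 "equivariant2 f \<longleftrightarrow> (\<forall>e\<in>milnor_points G. \<forall>e'\<in>milnor_points G. \<forall>g\<in>carrier G.
   f (milnor_act G e g, milnor_act G e' g) = milnor_act G (f (e, e')) g)"

text \<open>Spread \<open>fst\<close> over the even positions, let \<open>snd\<close> take over in
  the odd ones, forget \<open>fst\<close>, and run the first two moves backwards for
  \<open>snd\<close>. All moves commute with the diagonal action; this is the equivariant form of
  contractibility.\<close>

theorem milnor_contraction:
 "homotopic_with equivariant2 (prod_topology EG EG) EG fst snd"
proof -
 let ?X = "prod_topology EG EG"
 let ?I = "I01"
 have s: "continuous_map (prod_topology ?I ?X) ?I fst" by (rule continuous_map_fst)
 have e: "continuous_map (prod_topology ?I ?X) EG (%z. fst (snd z))" and e': "continuous_map (prod_topology ?I ?X) EG (%z. snd (snd z))"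
  using continuous_map_compose[OF continuous_map_snd continuous_map_fst, of ?I EG EG]
   continuous_map_compose[OF continuous_map_snd continuous_map_snd, of ?I EG EG] by (simp_all add: o_def)
 have cong: "equivariant2 h \<longleftrightarrow> equivariant2 k"
  if "!!x. x : topspace ?X ==> h x = k x" for h k using that by (auto simp: equivariant2_def milnor_act_closed)
 have sh: "homotopic_with equivariant2 ?X EG (%x. shuffle G 0 (p x)) (%x. shuffle G 1 (p x))"
  if p: "continuous_map (prod_topology ?I ?X) EG (%z. p (snd z))"
    "!!x. x : topspace ?X ==> p x : milnor_points G" "equivariant2 p" for p
  by (rule homotopic_withI[where h = "%s x. shuffle G s (p x)"], rule continuous_map_shuffle[OF p(1) s])
   (use p(2,3) in "simp add: equivariant2_def milnor_act_shuffle")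
 have eq: "equivariant2 fst" "equivariant2 snd" by (auto simp: equivariant2_def)
 have fst: "homotopic_with equivariant2 ?X EG (%x. interleave G 0 (fst x) (snd x)) fst"
  by (rule homotopic_with_eq[OF sh[OF e _ eq(1)] _ _ cong])
   (auto simp: shuffle_start[symmetric] shuffle_end)
 have snd: "homotopic_with equivariant2 ?X EG (%x. interleave G 0 (snd x) (snd x)) snd"
  by (rule homotopic_with_eq[OF sh[OF e' _ eq(2)] _ _ cong])
   (auto simp: shuffle_start[symmetric] shuffle_end)
 have "homotopic_with equivariant2 ?X EG
    (%x. interleave G 0 (p x) (snd x)) (%x. interleave G 1 (p x) (snd x))"
  if p: "continuous_map (prod_topology ?I ?X) EG (%z. p (snd z))" "p = fst \<or> p = snd" for p
  by (rule homotopic_withI[where h = "%s x. interleave G s (p x) (snd x)"],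
    rule continuous_map_interleave[OF p(1) e' s])
   (use p(2) in "auto simp: equivariant2_def milnor_act_interleave")
 note il = this[of fst, OF e] this[of snd, OF e']
 have "interleave G 1 (fst x) (snd x) = interleave G 1 (snd x) (snd x)" for x
  unfolding interleave_def by (rule mpt_cong) (auto split: if_splits)
 then have "homotopic_with equivariant2 ?X EG
   (%x. interleave G 0 (fst x) (snd x)) (%x. interleave G 0 (snd x) (snd x))"
  using homotopic_with_trans[OF il(1)] homotopic_with_symD[OF il(2)] by simp
 then show ?thesis using homotopic_with_trans[OF homotopic_with_symD[OF fst]] homotopic_with_trans snd by blast
qed

end

section \<open>Borel constructions\<close>

lemma open_quotient_continuous_map:
 assumes "continuous_map X B q" "open_map X B q" "q ` topspace X = topspace B"
  and "continuous_map X Z \<Phi>" "!!x. x : topspace X ==> f (q x) = \<Phi> x" shows "continuous_map B Z f"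
proof (rule continuous_compose_quotient_map)
 show "quotient_map X B q" using assms continuous_open_imp_quotient_map by blast
 show "continuous_map X Z (f \<circ> q)" using assms(4,5) by (auto intro: continuous_map_eq)
qed

text \<open>Openness of \<open>q\<close> is what makes \<open>id \<times> q\<close> a quotient map, so that homotopies descend.\<close>

lemma open_quotient_homotopic_with:
 assumes q: "continuous_map X B q" "open_map X B q" "q ` topspace X = topspace B"
  and cont: "continuous_map (prod_topology I01 X) Z (%z. \<Phi> (fst z) (snd z))"
  and inv: "!!s x y. s : {0..1} ==> x : topspace X ==> y : topspace X ==> q x = q y ==> \<Phi> s x = \<Phi> s y"
  and f0: "!!x. x : topspace X ==> f0 (q x) = \<Phi> 0 x" and f1: "!!x. x : topspace X ==> f1 (q x) = \<Phi> 1 x"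
  and S: "S <= topspace X" "!!s x. s : {0..1} ==> x : S ==> \<Phi> s x : T" shows "homotopic_with (%h. h ` q ` S <= T) B Z f0 f1"
proof -
 let ?I = "I01"
 \<comment> \<open>A set-theoretic section, in general discontinuous. Invariance of
   \<open>\<Phi>\<close> makes the composite independent of it.\<close>
 define r where "r = inv_into (topspace X) q"
 have r: "r b : topspace X" "q (r b) = b" if "b : topspace B" for b
  using that q(3) unfolding r_def by (metis inv_into_into, metis f_inv_into_f)
 have qq: "q x : topspace B" if "x : topspace X" for x using that q(3) by blast
 let ?q = "%z. (fst z, q (snd z))"
 have "continuous_map (prod_topology ?I B) Z (%z. \<Phi> (fst z) (r (snd z)))"
 proof (rule open_quotient_continuous_map[OF _ _ _ cont])
  show "continuous_map (prod_topology ?I X) (prod_topology ?I B) ?q" using continuous_map_compose[OF continuous_map_snd q(1)]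
   by (auto intro!: continuous_map_pairedI continuous_map_fst simp: o_def)
  show "open_map (prod_topology ?I X) (prod_topology ?I B) ?q" unfolding open_map_def
  proof (intro allI impI)
   fix W assume W: "openin (prod_topology ?I X) W"
   show "openin (prod_topology ?I B) (?q ` W)" unfolding openin_prod_topology_alt
   proof (intro allI impI)
    fix s b assume "(s, b) : ?q ` W"
    then obtain x where x: "(s, x) : W" "b = q x" by auto
    then obtain U V where UV: "openin ?I U" "openin X V" "s : U" "x : V" "U \<times> V <= W"
     using W unfolding openin_prod_topology_alt by meson
    moreover have "U \<times> (q ` V) <= ?q ` W" using UV(5) by force
    moreover have "openin B (q ` V)" using q(2) UV(2) unfolding open_map_def by blast
    ultimately show "\<exists>U V. openin ?I U & openin B V & s : U & b : V & U \<times> V <= ?q ` W" using x by blast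
   qed
  qed
  show "?q ` topspace (prod_topology ?I X) = topspace (prod_topology ?I B)"
   unfolding topspace_prod_topology q(3)[symmetric] by (auto simp: image_iff)
  fix z assume "z : topspace (prod_topology ?I X)"
  then show "\<Phi> (fst (?q z)) (r (snd (?q z))) = \<Phi> (fst z) (snd z)" using qq r by (auto intro!: inv)
 qed
 moreover have "(%b. \<Phi> t (r b)) ` q ` S <= T" if t: "t : {0..1}" for t
 proof -
  have "\<Phi> t (r (q x)) : T" if x: "x : S" for x
  proof -
   have X: "x : topspace X" using x S(1) by blast
   have "\<Phi> t (r (q x)) = \<Phi> t x" by (rule inv[OF t r(1)[OF qq[OF X]] X r(2)[OF qq[OF X]]])
   then show ?thesis using S(2)[OF t x] by simp
  qed
  then show ?thesis by blast
 qed
 ultimately have "homotopic_with (%h. h ` q ` S <= T) B Z (%b. \<Phi> 0 (r b)) (%b. \<Phi> 1 (r b))"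
  by (rule homotopic_withI[where h = "%s b. \<Phi> s (r b)"])
 moreover have "q ` S <= topspace B" using S(1) q(3) by blast
 ultimately show ?thesis by (elim homotopic_with_eq) (use r f0 f1 in "metis, metis, metis (no_types, lifting) image_cong subsetD")
qed

lemma open_quotient_homotopic:
 assumes "continuous_map X B q" "open_map X B q" "q ` topspace X = topspace B"
  and "continuous_map (prod_topology I01 X) Z (%z. \<Phi> (fst z) (snd z))"
  and "!!s x y. s : {0..1} ==> x : topspace X ==> y : topspace X ==> q x = q y ==> \<Phi> s x = \<Phi> s y"
  and "!!x. x : topspace X ==> f0 (q x) = \<Phi> 0 x" and "!!x. x : topspace X ==> f1 (q x) = \<Phi> 1 x"
 shows "homotopic_with (%_. True) B Z f0 f1" by (rule homotopic_with_mono[OF open_quotient_homotopic_with[OF assms, of "{}" "{}"]]) auto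

locale stack_presentation = topological_group "grp M" "grp_top M" for M :: "('g, 'x) quotient_stack" +
 assumes continuous_act:
   "continuous_map (prod_topology (grp_top M) (space M)) (space M) (%(g, x). act M g x)"
  and act_one: "!!x. x : topspace (space M) ==> act M \<one>\<^bsub>grp M\<^esub> x = x"
  and act_mult: "!!g h x. g : carrier (grp M) ==> h : carrier (grp M) ==> x : topspace (space M) ==>
    act M (g \<otimes>\<^bsub>grp M\<^esub> h) x = act M g (act M h x)"
begin

abbreviation (input) "G == grp M"
abbreviation (input) "X == space M"
abbreviation "btot == prod_topology (milnor_space (grp M) (grp_top M)) (space M)"
abbreviation "hq == homotopy_quotient M"
abbreviation "bo == borel_orbit M"

definition twist where
 "twist p g = (milnor_act (grp M) (fst p) g, act M (inv\<^bsub>grp M\<^esub> g) (snd p))"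

lemma act_closed: "g : carrier G ==> x : topspace X ==> act M g x : topspace X"
 using continuous_map_funspace[OF continuous_act] topspace_T by (auto simp: Pi_iff)

lemma continuous_map_act:
 assumes "continuous_map Z (grp_top M) f" "continuous_map Z X g" shows "continuous_map Z X (%z. act M (f z) (g z))"
 using continuous_map_compose[OF continuous_map_pairedI[OF assms] continuous_act] by (simp add: o_def)

lemma twist_twist:
 "p : topspace btot ==> g : carrier G ==> h : carrier G ==>
   twist (twist p g) h = twist p (g \<otimes>\<^bsub>G\<^esub> h)" by (auto simp: twist_def milnor_act_mult inv_mult_group act_mult)

lemma twist_one: "p : topspace btot ==> twist p \<one>\<^bsub>G\<^esub> = p" by (auto simp: twist_def milnor_act_one act_one)

lemma borel_orbit_twist: "bo p = (%g. twist p g) ` carrier G" by (auto simp: borel_orbit_def twist_def)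

lemma borel_orbit_self: "p : topspace btot ==> p : bo p" unfolding borel_orbit_twist using twist_one by (metis image_eqI one_closed)

lemma bo_twist:
 assumes "p : topspace btot" "g : carrier G" shows "bo (twist p g) = bo p"
proof (intro equalityI subsetI)
 fix y assume "y : bo (twist p g)"
 then show "y : bo p" unfolding borel_orbit_twist using twist_twist assms by auto
next
 fix y assume "y : bo p"
 then obtain h where "h : carrier G" "y = twist p h" unfolding borel_orbit_twist by blast
 then have "y = twist (twist p g) (inv\<^bsub>G\<^esub> g \<otimes>\<^bsub>G\<^esub> h)"
  using assms by (simp add: twist_twist m_assoc[symmetric])
 then show "y : bo (twist p g)" unfolding borel_orbit_twist using \<open>h : carrier G\<close> assms by auto
qed

lemma bo_eq_iff:
 assumes "p : topspace btot" "p' : topspace btot" shows "bo p = bo p' \<longleftrightarrow> (\<exists>g\<in>carrier G. p' = twist p g)"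
proof
 assume "bo p = bo p'"
 then have "p' : bo p" using borel_orbit_self[OF assms(2)] by simp
 then show "\<exists>g\<in>carrier G. p' = twist p g" unfolding borel_orbit_twist by blast
qed (use bo_twist assms in auto)

lemma bo_eqE:
 assumes "bo p = bo p'" "p : topspace btot" "p' : topspace btot"
 obtains g where "g : carrier G" "p' = twist p g" using bo_eq_iff assms by blast

lemma topspace_hq: "topspace hq = bo ` topspace btot" by (simp add: homotopy_quotient_def topspace_quotient_topology)

lemma quotient_map_bo: "quotient_map btot hq bo" unfolding homotopy_quotient_def by (rule quotient_map_quotient_topology)

lemma continuous_map_bo: "continuous_map btot hq bo" using quotient_map_bo by (rule quotient_imp_continuous_map)

lemma continuous_map_twist: "g : carrier G ==> continuous_map btot btot (%p. twist p g)" unfolding twist_def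
 by (intro continuous_map_pairedI continuous_map_milnor_act continuous_map_act
   continuous_map_fst continuous_map_snd) (simp_all add: topspace_T)

text \<open>The saturation of an open set is the union of its preimages under the translations by
  group elements.\<close>

lemma open_map_bo: "open_map btot hq bo" unfolding open_map_def
proof (intro allI impI)
 fix U assume U: "openin btot U"
 then have Ut: "U <= topspace btot" by (rule openin_subset)
 have "{p : topspace btot. bo p : bo ` U} = (\<Union>g\<in>carrier G. {p : topspace btot. twist p g : U})"
 proof (intro equalityI subsetI)
  fix p assume "p : {p : topspace btot. bo p : bo ` U}"
  then obtain u where p: "p : topspace btot" and u: "u : U" "bo p = bo u" by blast
  moreover have "u : topspace btot" using u Ut by (rule_tac subsetD)
  ultimately obtain g where "g : carrier G" "u = twist p g" by (elim bo_eqE)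
  then show "p : (\<Union>g\<in>carrier G. {p : topspace btot. twist p g : U})" using p u by blast
 next
  fix p assume "p : (\<Union>g\<in>carrier G. {p : topspace btot. twist p g : U})"
  then obtain g where g: "g : carrier G" and p: "p : topspace btot" "twist p g : U" by blast
  have "bo p : bo ` U" unfolding bo_twist[OF p(1) g, symmetric] using p(2) by (rule imageI)
  then show "p : {p : topspace btot. bo p : bo ` U}" using p(1) by blast
 qed
 moreover have "openin btot ..." by (rule openin_Union, clarify, rule openin_continuous_map_preimage[OF continuous_map_twist U])
 ultimately show "openin hq (bo ` U)" unfolding homotopy_quotient_def openin_quotient_topology using Ut by (simp add: image_mono)
qed

lemmas bo_open_quotient = continuous_map_bo open_map_bo topspace_hq[symmetric]

lemma continuous_map_from_hq:
 assumes "continuous_map btot Z \<Phi>" "!!p. p : topspace btot ==> f (bo p) = \<Phi> p" shows "continuous_map hq Z f"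
 by (rule open_quotient_continuous_map[OF bo_open_quotient assms])

lemma homotopic_from_hq:
 assumes "continuous_map (prod_topology I01 btot) Z (%z. \<Phi> (fst z) (snd z))"
  and inv: "!!s p g. s : {0..1} ==> p : topspace btot ==> g : carrier G ==> \<Phi> s (twist p g) = \<Phi> s p"
  and "!!p. p : topspace btot ==> f0 (bo p) = \<Phi> 0 p" and "!!p. p : topspace btot ==> f1 (bo p) = \<Phi> 1 p"
 shows "homotopic_with (%_. True) hq Z f0 f1"
proof (rule open_quotient_homotopic[OF bo_open_quotient assms(1) _ assms(3,4)])
 fix s p p' assume "s : {0..1::real}" "p : topspace btot" "p' : topspace btot" "bo p = bo p'"
 then show "\<Phi> s p = \<Phi> s p'" using inv[of s p] by (elim bo_eqE) simp_all
qed

lemma homotopic_fibrewise: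
 assumes c: "continuous_map (prod_topology I01 btot) X (%z. \<Psi> (fst z) (snd z))"
  and eq: "!!s p g. s : {0..1} ==> p : topspace btot ==> g : carrier G ==> \<Psi> s (twist p g) = act M (inv\<^bsub>G\<^esub> g) (\<Psi> s p)"
  and f: "!!p. p : topspace btot ==> f0 (bo p) = bo (fst p, \<Psi> 0 p)" "!!p. p : topspace btot ==> f1 (bo p) = bo (fst p, \<Psi> 1 p)"
 shows "homotopic_with (%_. True) hq hq f0 f1"
proof (rule homotopic_from_hq[where \<Phi> = "%s p. bo (fst p, \<Psi> s p)", OF _ _ f])
 have "continuous_map (prod_topology I01 btot) btot (%z. (fst (snd z), \<Psi> (fst z) (snd z)))"
  using continuous_map_compose[OF continuous_map_snd continuous_map_fst] by (intro continuous_map_pairedI c) (simp add: o_def)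
 from continuous_map_compose[OF this continuous_map_bo]
  show "continuous_map (prod_topology I01 btot) hq (%z. bo (fst (snd z), \<Psi> (fst z) (snd z)))" by (simp add: o_def)
 fix s p g assume s: "s : {0..1::real}" and p: "p : topspace btot" and g: "g : carrier G"
 have "(fst p, \<Psi> s p) : topspace btot" using continuous_map_funspace[OF c] s p by (auto simp: Pi_iff)
 moreover have "(fst (twist p g), \<Psi> s (twist p g)) = twist (fst p, \<Psi> s p) g" unfolding eq[OF s p g] by (simp add: twist_def)
 ultimately show "bo (fst (twist p g), \<Psi> s (twist p g)) = bo (fst p, \<Psi> s p)" using bo_twist g by simp
qed

lemma lift_to_hq:
 assumes "!!p g. p : topspace btot ==> g : carrier G ==> \<Phi> (twist p g) = \<Phi> p"
 obtains f where "!!p. p : topspace btot ==> f (bo p) = \<Phi> p"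
proof
 fix p assume p: "p : topspace btot"
 let ?r = "inv_into (topspace btot) bo (bo p)"
 have "bo p : bo ` topspace btot" using p by (rule imageI)
 then have "?r : topspace btot" "bo ?r = bo p" by (rule inv_into_into, rule f_inv_into_f)
 then obtain g where "g : carrier G" "?r = twist p g" using p by (metis bo_eqE)
 then have "\<Phi> ?r = \<Phi> p" using assms p by simp
 then show "(%b. \<Phi> (inv_into (topspace btot) bo b)) (bo p) = \<Phi> p" .
qed

end

lemma homotopy_quotient_map_bo:
 assumes M: "stack_presentation M" and N: "stack_presentation N" and ph: "ph : hom (grp M) (grp N)"
  and f: "f ` topspace (space M) <= topspace (space N)"
  and eq: "!!g x. g : carrier (grp M) ==> x : topspace (space M) ==> f (act M g x) = act N (ph g) (f x)"
  and p: "p : topspace (stack_presentation.btot M)"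
 shows "homotopy_quotient_map N ph f (borel_orbit M p) = borel_orbit N (milnor_map ph (fst p), f (snd p))"
proof -
 interpret M: stack_presentation M by (rule M)
 interpret N: stack_presentation N by (rule N)
 interpret group_hom "grp M" "grp N" ph by unfold_locales (rule ph)
 have mp: "milnor_map ph e : milnor_points (grp N)" if "e : milnor_points (grp M)" for e
  using that ph unfolding milnor_points_iff milnor_map_def by (auto simp: hom_def)
 have "borel_orbit N (milnor_map ph (fst (M.twist p g)), f (snd (M.twist p g)))
   = borel_orbit N (milnor_map ph (fst p), f (snd p))" if g: "g : carrier (grp M)" for g
 proof -
  have "(milnor_map ph (fst (M.twist p g)), f (snd (M.twist p g)))
    = N.twist (milnor_map ph (fst p), f (snd p)) (ph g)" unfolding M.twist_def N.twist_def using p g eq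
   by (auto simp: milnor_map_def milnor_act_def milnor_points_def)
  then show ?thesis using N.bo_twist[of "(milnor_map ph (fst p), f (snd p))" "ph g"] p f g mp by auto
 qed
 then show ?thesis unfolding homotopy_quotient_map_def M.borel_orbit_twist using M.one_closed by auto
qed

text \<open>Such a \<open>c\<close> is a section of the bundle associated to \<open>space N\<close>.
  The map forgets the fibre of \<open>M\<close> and lands on that section; for contractible fibres
  these maps become homotopy inverse to each other.\<close>

lemma borel_change_fibre:
 fixes M :: "('g, 'x) quotient_stack" and N :: "('g, 'y) quotient_stack"
 assumes M: "stack_presentation M" and N: "stack_presentation N" and G: "grp M = grp N" "grp_top M = grp_top N"
  and c: "continuous_map (milnor_space (grp N) (grp_top N)) (space N) c"
   "!!e g. e : milnor_points (grp N) ==> g : carrier (grp N) ==>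
     c (milnor_act (grp N) e g) = act N (inv\<^bsub>grp N\<^esub> g) (c e)"
 shows "\<exists>f. continuous_map (homotopy_quotient M) (homotopy_quotient N) f &
    (\<forall>p\<in>topspace (stack_presentation.btot M). f (borel_orbit M p) = borel_orbit N (fst p, c (fst p)))"
proof -
 interpret M: stack_presentation M by (rule M)
 interpret N: stack_presentation N by (rule N)
 let ?c = "%p. borel_orbit N (fst p, c (fst p))"
 have cp: "(e, c e) : topspace N.btot" if "e : milnor_points (grp M)" for e
  using that continuous_map_funspace[OF c(1)] G by (auto simp: Pi_iff)
 obtain f where f: "!!p. p : topspace M.btot ==> f (borel_orbit M p) = ?c p"
 proof (rule M.lift_to_hq[where \<Phi> = ?c])
  fix p g assume p: "p : topspace M.btot" and g: "g : carrier (grp M)"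
  have "(fst (M.twist p g), c (fst (M.twist p g))) = N.twist (fst p, c (fst p)) g"
   using c(2) p g by (auto simp: M.twist_def N.twist_def G)
  then show "?c (M.twist p g) = ?c p" using N.bo_twist[OF cp] p g G by auto
 qed blast
 have "continuous_map M.btot (homotopy_quotient N) ?c"
  using continuous_map_compose[OF _ N.continuous_map_bo, of M.btot "%p. (fst p, c (fst p))"]
   continuous_map_compose[OF continuous_map_fst, of "milnor_space (grp M) (grp_top M)" "space N" c "space M"]
   c(1) G by (simp add: o_def continuous_map_pairedI continuous_map_fst)
 then have "continuous_map (homotopy_quotient M) (homotopy_quotient N) f" by (rule M.continuous_map_from_hq) (rule f)
 then show ?thesis using f by blast
qed

section \<open>Reduction of the structure group\<close>

lemma (in topological_group) milnor_contractionE: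
 obtains h where
  "continuous_map (prod_topology I01 (prod_topology EG EG)) EG h"
  "!!e e'. h (0, e, e') = e" "!!e e'. h (1, e, e') = e'"
  "!!s e e' g. s : {0..1} ==> e : milnor_points G ==> e' : milnor_points G ==>
    g : carrier G ==> h (s, milnor_act G e g, milnor_act G e' g) = milnor_act G (h (s, e, e')) g"
 using milnor_contraction unfolding homotopic_with_def equivariant2_def by auto

lemma continuous_prod_components:
 "continuous_map (prod_topology I (prod_topology A B)) I fst"
 "continuous_map (prod_topology I (prod_topology A B)) A (%z. fst (snd z))"
 "continuous_map (prod_topology I (prod_topology A B)) B (%z. snd (snd z))"
 using continuous_map_compose[OF continuous_map_snd continuous_map_fst, of I A B]
  continuous_map_compose[OF continuous_map_snd continuous_map_snd, of I A B] by (simp_all add: o_def continuous_map_fst)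

text \<open>\<open>\<Omega>\<close> and \<open>fst\<close> are both equivariant maps into the join,
  hence equivariantly homotopic, while \<open>ka\<close> runs in the fibre at the same time.\<close>

lemma (in stack_presentation) homotopic_id_by_join:
 assumes \<Omega>: "continuous_map btot EG \<Omega>"
   "!!p g. p : topspace btot ==> g : carrier G ==> \<Omega> (twist p g) = milnor_act G (\<Omega> p) g"
  and ka: "continuous_map (prod_topology I01 X) X ka" "!!x. x : topspace X ==> ka (1, x) = x"
   "!!s g x. s : {0..1} ==> g : carrier G ==> x : topspace X ==> ka (s, act M g x) = act M g (ka (s, x))"
  and f: "!!p. p : topspace btot ==> f (bo p) = bo (\<Omega> p, ka (0, snd p))" shows "homotopic_with (%_. True) hq hq f id"
proof -
 obtain H where H:
  "continuous_map (prod_topology I01 (prod_topology EG EG)) EG H"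
  "!!e e'. H (0, e, e') = e" "!!e e'. H (1, e, e') = e'"
  "!!s e e' g. s : {0..1} ==> e : milnor_points G ==> e' : milnor_points G ==>
    g : carrier G ==> H (s, milnor_act G e g, milnor_act G e' g) = milnor_act G (H (s, e, e')) g" by (rule milnor_contractionE) blast
 let ?h = "%s p. (H (s, \<Omega> p, fst p), ka (s, snd p))"
 show ?thesis
 proof (rule homotopic_from_hq[where \<Phi> = "%s p. bo (?h s p)"])
  let ?Z = "prod_topology I01 btot"
  note Z = continuous_prod_components[of "I01" EG X]
  have "continuous_map ?Z EG (%z. \<Omega> (snd z))" using continuous_map_compose[OF continuous_map_snd \<Omega>(1)] by (simp add: o_def)
  then have "continuous_map ?Z btot (%z. ?h (fst z) (snd z))"
   using continuous_map_compose[OF continuous_map_pairedI[OF Z(1) continuous_map_pairedI[OF _ Z(2)]] H(1)]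
    continuous_map_compose[OF continuous_map_pairedI[OF Z(1) Z(3)] ka(1)] by (intro continuous_map_pairedI) (simp_all add: o_def)
  from continuous_map_compose[OF this continuous_map_bo]
  show "continuous_map ?Z hq (%z. bo (?h (fst z) (snd z)))" by (simp add: o_def)
  fix s p g assume s: "s : {0..1::real}" and p: "p : topspace btot" and g: "g : carrier G"
  have p': "fst p : milnor_points G" "snd p : topspace X" "\<Omega> p : milnor_points G"
   using p continuous_map_funspace[OF \<Omega>(1)] by (auto simp: Pi_iff)
  have "?h s p : topspace btot" using continuous_map_funspace[OF H(1)] continuous_map_funspace[OF ka(1)] s p' by (auto simp: Pi_iff)
  moreover have "?h s (twist p g) = twist (?h s p) g"
   using H(4)[OF s p'(3,1) g] ka(3)[OF s _ p'(2)] \<Omega>(2)[OF p g] g by (simp add: twist_def)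
  ultimately show "bo (?h s (twist p g)) = bo (?h s p)" using bo_twist g by simp
 qed (use f H(2,3) ka(2) in auto)
qed

lemma continuous_map_milnor_map:
 assumes G: "topological_group G T" and H: "topological_group H T'" and ph: "ph : hom G H" "continuous_map T T' ph"
  and f: "continuous_map Z (milnor_space G T) f" shows "continuous_map Z (milnor_space H T') (%z. milnor_map ph (f z))"
proof -
 interpret G: topological_group G T by (rule G)
 interpret H: topological_group H T' by (rule H)
 interpret group_hom G H ph by unfold_locales (rule ph(1))
 show ?thesis
 proof (rule continuous_map_into_milnor)
  fix z assume "z : topspace Z"
  then have "f z : milnor_points G" using continuous_map_funspace[OF f] by (auto simp: Pi_iff)
  then show "milnor_map ph (f z) : milnor_points H" unfolding milnor_points_iff milnor_map_def using hom_closed by simp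
 next
  fix k
  show "continuous_map Z euclideanreal (%z. fst (milnor_map ph (f z) k))" using continuous_milnor_fst[OF f] by (simp add: milnor_map_def)
  show "continuous_map (subtopology Z {z. fst (milnor_map ph (f z) k) ~= 0}) T'
    (%z. snd (milnor_map ph (f z) k))" using continuous_map_compose[OF continuous_milnor_snd[OF f G.topspace_T] ph(2)]
   by (simp add: milnor_map_def o_def)
 qed
qed

text \<open>A squeeze at the zeros of \<open>t\<close>, where \<open>u\<close> need not have a
  limit. It is applied to a weight evaluated through a group coordinate of a join point, which is
  meaningful only where the barycentric coordinate is nonzero.\<close>

lemma continuous_map_vanishing_product:
 assumes t: "continuous_map Z euclideanreal t" and u: "continuous_map (subtopology Z {z. t z ~= 0}) euclideanreal u"
  and bound: "!!z. z : topspace Z ==> t z ~= 0 ==> \<bar>u z\<bar> <= 1" shows "continuous_map Z euclideanreal (%z. t z * u z)"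
 unfolding continuous_map
proof (intro conjI allI impI)
 fix V :: "real set" assume "openin euclidean V"
 then have V: "open V" by simp
 let ?U = "{z : topspace Z. t z ~= 0}"
 have U: "openin Z ?U" by (rule openin_nonzero[OF t])
 have "continuous_map (subtopology Z ?U) euclideanreal (%z. t z * u z)"
  by (intro continuous_map_real_mult continuous_map_from_subtopology[OF t]
    continuous_map_from_subtopology_mono[OF u]) auto
 from openin_continuous_map_preimage[OF this \<open>openin euclidean V\<close>]
 have *: "openin Z {z : ?U. t z * u z : V}" using openin_trans_full[OF _ U] by (simp add: Int_def conj_ac)
 show "openin Z {z : topspace Z. t z * u z : V}"
 proof (subst openin_subopen, intro ballI)
  fix z assume z: "z : {z : topspace Z. t z * u z : V}"
  show "\<exists>W. openin Z W & z : W & W <= {z : topspace Z. t z * u z : V}"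
  proof (cases "t z = 0")
   case True
   then have "0 : V" using z by simp
   then obtain e where e: "e > 0" "ball 0 e <= V" using V open_contains_ball by blast
   have "openin Z {y : topspace Z. t y : ball 0 e}" by (rule openin_continuous_map_preimage[OF t]) simp
   moreover have "t y * u y : V" if "y : topspace Z" "t y : ball 0 e" for y
   proof -
    have "\<bar>t y * u y\<bar> <= \<bar>t y\<bar> * 1"
     unfolding abs_mult using bound[OF that(1)] by (cases "t y = 0") (auto intro: mult_left_mono)
    then show ?thesis using that(2) e by (auto simp: subset_iff)
   qed
   ultimately show ?thesis using True z e by (intro exI[of _ "{y : topspace Z. t y : ball 0 e}"]) auto
  qed (use * z in \<open>intro exI[of _ "{z : ?U. t z * u z : V}"], auto\<close>)
 qed
qed simp

text \<open>The stabiliser \<open>P\<close> of the point \<open>f r0\<close> retracts onto a subgroup \<open>j L\<close> through the family \<open>\<sigma>\<close>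
 of endomorphisms; every point of \<open>space M\<close> is moved by \<open>ka\<close> into the orbit of \<open>f r0\<close>, and the maps
 \<open>sec i\<close> are sections of the orbit map over a finite cover with partition of unity \<open>w\<close>.\<close>

locale levi_reduction = L: stack_presentation L + M: stack_presentation M
 for L :: "('l, 'r) quotient_stack" and M :: "('g, 'x) quotient_stack" +
 fixes j :: "'l => 'g" and f :: "'r => 'x" and r0 :: 'r and ka\<^sub>R :: "real \<times> 'r => 'r"
  and ka :: "real \<times> 'x => 'x" and P :: "'g set" and \<pi> :: "'g => 'l" and \<sigma> :: "real \<times> 'g => 'g"
  and m :: nat and w :: "nat => 'x => real" and sec :: "nat => 'x => 'g"
 assumes homj: "j : hom (grp L) (grp M)" and j_cont: "continuous_map (grp_top L) (grp_top M) j"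
  and f_cont: "continuous_map (space L) (space M) f"
  and f_equiv: "!!l r. l : carrier (grp L) ==> r : topspace (space L) ==> f (act L l r) = act M (j l) (f r)"
  and r0: "r0 : topspace (space L)" and kaR_cont: "continuous_map (prod_topology I01 (space L)) (space L) ka\<^sub>R"
  and kaR_0: "!!r. r : topspace (space L) ==> ka\<^sub>R (0, r) = r0" and kaR_1: "!!r. r : topspace (space L) ==> ka\<^sub>R (1, r) = r"
  and kaR_equiv: "!!s l r. s : {0..1} ==> l : carrier (grp L) ==> r : topspace (space L) ==>
     ka\<^sub>R (s, act L l r) = act L l (ka\<^sub>R (s, r))" and ka_cont: "continuous_map (prod_topology I01 (space M)) (space M) ka"
  and ka_1: "!!x. x : topspace (space M) ==> ka (1, x) = x"
  and ka_equiv: "!!s g x. s : {0..1} ==> g : carrier (grp M) ==> x : topspace (space M) ==>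
     ka (s, act M g x) = act M g (ka (s, x))" and ka_f: "!!r. r : topspace (space L) ==> ka (0, f r) = f r0"
  and P_def: "P = {g : carrier (grp M). act M g (f r0) = f r0}"
  and \<pi>_cont: "continuous_map (subtopology (grp_top M) P) (grp_top L) \<pi>"
  and \<pi>_mult: "!!g h. g : P ==> h : P ==> \<pi> (g \<otimes>\<^bsub>grp M\<^esub> h) = \<pi> g \<otimes>\<^bsub>grp L\<^esub> \<pi> h"
  and \<pi>_j: "!!l. l : carrier (grp L) ==> \<pi> (j l) = l"
  and \<sigma>_cont: "continuous_map (prod_topology I01 (subtopology (grp_top M) P)) (grp_top M) \<sigma>"
  and \<sigma>_P: "!!s g. s : {0..1} ==> g : P ==> \<sigma> (s, g) : P" and \<sigma>_mult: "!!s g h. s : {0..1} ==> g : P ==> h : P ==>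
     \<sigma> (s, g \<otimes>\<^bsub>grp M\<^esub> h) = \<sigma> (s, g) \<otimes>\<^bsub>grp M\<^esub> \<sigma> (s, h)"
  and \<sigma>_0: "!!g. g : P ==> \<sigma> (0, g) = j (\<pi> g)" and \<sigma>_1: "!!g. g : P ==> \<sigma> (1, g) = g"
  and w_cont: "!!i. i < m ==> continuous_map (space M) euclideanreal (w i)"
  and w_nonneg: "!!i x. i < m ==> x : topspace (space M) ==> 0 <= w i x"
  and w_sum: "!!x. x : topspace (space M) ==> (\<Sum>i<m. w i x) = 1"
  and sec_cont: "!!i. i < m ==> continuous_map (subtopology (space M) {x. w i x ~= 0}) (grp_top M) (sec i)"
  and sec: "!!i x. i < m ==> x : topspace (space M) ==> w i x ~= 0 ==> act M (sec i x) (f r0) = ka (0, x)"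
begin

sublocale j: group_hom "grp L" "grp M" j by unfold_locales (rule homj)

abbreviation "G' == grp M"
abbreviation mult' (infixl "\<star>" 70) where "g \<star> h == g \<otimes>\<^bsub>G'\<^esub> h"
abbreviation "s0 == f r0"

lemma s0: "s0 : topspace (space M)" using continuous_map_funspace[OF f_cont] r0 by (auto simp: Pi_iff)

lemma f_closed: "r : topspace (space L) ==> f r : topspace (space M)" using continuous_map_funspace[OF f_cont] by (auto simp: Pi_iff)

text \<open>An equivariant contraction to a point forces that point to be fixed.\<close>

lemma r0_fixed: "l : carrier (grp L) ==> act L l r0 = r0" using kaR_equiv[of 0 l r0] kaR_0[OF r0] kaR_0[OF L.act_closed[OF _ r0]] r0 by simp

lemma P_carrier: "g : P ==> g : carrier G'" by (simp add: P_def)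

lemma stab_transporter:
 assumes "g : carrier G'" "h : carrier G'" "act M g s0 = act M h s0" shows "inv\<^bsub>G'\<^esub> g \<star> h : P"
 using assms s0 by (simp add: P_def M.act_mult)
  (metis M.act_mult M.act_one M.inv_closed M.l_inv)

lemma jP: "l : carrier (grp L) ==> j l : P" using f_equiv[of l r0] r0 r0_fixed by (simp add: P_def)

lemma \<pi>_closed: "g : P ==> \<pi> g : carrier (grp L)"
 using continuous_map_funspace[OF \<pi>_cont] L.topspace_T M.topspace_T P_carrier by (auto simp: Pi_iff)

lemma sec_closed: "i < m ==> x : topspace (space M) ==> w i x ~= 0 ==> sec i x : carrier G'"
 using continuous_map_funspace[OF sec_cont[of i]] M.topspace_T by (auto simp: Pi_iff)

lemma w_le_1: "i < m ==> x : topspace (space M) ==> w i x <= 1" using member_le_sum[of i "{..<m}" "%i. w i x"] w_nonneg w_sum by simp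

lemma w_nonzero:
 assumes "x : topspace (space M)"
 obtains i where "i < m" "w i x ~= 0"
proof -
 have "(\<Sum>i<m. w i x) ~= 0" using w_sum assms by simp
 then show ?thesis using that by (metis lessThan_iff sum.neutral)
qed

lemma m_pos: "m > 0" using w_nonzero[OF s0] by (metis not_less0 gr0I)

text \<open>The index \<open>n\<close> encodes the pair of a join position
  \<open>k = n div m\<close> and a section \<open>i = n mod m\<close>. With \<open>g\<close> the
  group coordinate at \<open>k\<close>, the section moves \<open>f r0\<close> to
  \<open>ka (0, g x) = g (ka (0, x))\<close>. So the new group coordinate \<open>el\<close> moves
  \<open>ka (0, x)\<close> to \<open>f r0\<close>, and the partition of unity distributes the mass
  of position \<open>k\<close> over the sections.\<close>

definition wt :: "(nat => real \<times> 'g) => 'x => nat => real" where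
 "wt e x n = fst (e (n div m)) * w (n mod m) (act M (snd (e (n div m))) x)"

definition el :: "(nat => real \<times> 'g) => 'x => nat => 'g" where
 "el e x n = inv\<^bsub>G'\<^esub> sec (n mod m) (act M (snd (e (n div m))) x) \<star> snd (e (n div m))"

context
 fixes e x
 assumes e: "e : milnor_points G'" and x: "x : topspace (space M)"
begin

lemma gx: "act M (snd (e k)) x : topspace (space M)" using M.act_closed milnor_pointsD(2)[OF e] x by simp

lemma wt_nonneg: "0 <= wt e x n" unfolding wt_def using milnor_pointsD(1)[OF e] w_nonneg[OF _ gx] m_pos by simp

lemma wt_sums: "finite {n. wt e x n ~= 0}" "wt e x sums 1"
proof -
 obtain K where "{k. fst (e k) ~= 0} <= {..<K}" using milnor_pointsD(3)[OF e] unfolding finite_nat_iff_bounded by blast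
 then have K: "fst (e k) = 0" if "K <= k" for k using that by (auto simp: subset_iff not_less[symmetric])
 have 0: "wt e x n = 0" if "n ~: {..<K * m}" for n
  using that K[of "n div m"] m_pos by (simp add: wt_def less_eq_div_iff_mult_less_eq not_less)
 then have "{n. wt e x n ~= 0} <= {..<K * m}" by blast
 then show "finite {n. wt e x n ~= 0}" by (rule finite_subset) simp
 have "(\<Sum>n<K * m. wt e x n) = (\<Sum>k<K. \<Sum>n=k*m..<k*m+m. wt e x n)" by (rule sum.nat_group[symmetric])
 also have "... = (\<Sum>k<K. fst (e k))"
 proof (rule sum.cong[OF refl])
  fix k
  have "(\<Sum>n=k*m..<k*m+m. wt e x n) = (\<Sum>i<m. wt e x (k * m + i))"
   by (rule sum.reindex_bij_witness[where i = "%i. k * m + i" and j = "%n. n - k * m"]) auto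
  also have "... = (\<Sum>i<m. fst (e k) * w i (act M (snd (e k)) x))" by (rule sum.cong) (auto simp: wt_def)
  also have "... = fst (e k)" using w_sum[OF gx] by (simp add: sum_distrib_left[symmetric])
  finally show "(\<Sum>n=k*m..<k*m+m. wt e x n) = fst (e k)" .
 qed
 also have "... = 1" using sums_unique2[OF sums_finite milnor_pointsD(4)[OF e], of "{..<K}"] K by simp
 finally show "wt e x sums 1" using sums_finite[of "{..<K * m}" "wt e x"] 0 by simp
qed

lemma el_closed:
 assumes "wt e x n ~= 0" shows "el e x n : carrier G'" "sec (n mod m) (act M (snd (e (n div m))) x) : carrier G'"
proof -
 show "sec (n mod m) (act M (snd (e (n div m))) x) : carrier G'" using assms sec_closed[OF _ gx] m_pos by (simp add: wt_def)
 then show "el e x n : carrier G'" using milnor_pointsD(2)[OF e] by (simp add: el_def)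
qed

text \<open>\<open>h\<close> moves the base point to \<open>ka (0, x)\<close> and \<open>el\<close>
  moves it back.\<close>

lemma el_P:
 assumes n: "wt e x n ~= 0" and h: "h : carrier G'" "act M h s0 = ka (0, x)" shows "el e x n \<star> h : P"
proof -
 let ?g = "snd (e (n div m))"
 let ?s = "sec (n mod m) (act M ?g x)"
 have g: "?g : carrier G'" using milnor_pointsD(2)[OF e] .
 have s: "?s : carrier G'" by (rule el_closed[OF n])
 have "act M ?s s0 = ka (0, act M ?g x)" using sec[OF _ gx] n m_pos by (simp add: wt_def)
 also have "... = act M (?g \<star> h) s0" using ka_equiv[of 0 ?g x] g x h s0 by (simp add: M.act_mult)
 finally have "inv\<^bsub>G'\<^esub> ?s \<star> (?g \<star> h) : P" using stab_transporter[OF s] g h by simp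
 then show ?thesis using g s h by (simp add: el_def M.m_assoc)
qed

text \<open>The group coordinate \<open>k g\<close> applied to \<open>inv g x\<close> is
  \<open>k\<close> applied to \<open>x\<close>: the sections are evaluated at the same points, so
  the weights do not change and only the trailing factor of \<open>el\<close> gains
  \<open>g\<close>.\<close>

lemma wt_twist:
 assumes g: "g : carrier G'" shows "wt (milnor_act G' e g) (act M (inv\<^bsub>G'\<^esub> g) x) n = wt e x n"
  and "wt e x n ~= 0 ==> el (milnor_act G' e g) (act M (inv\<^bsub>G'\<^esub> g) x) n = el e x n \<star> g"
proof -
 have *: "act M (snd (milnor_act G' e g k)) (act M (inv\<^bsub>G'\<^esub> g) x) = act M (snd (e k)) x"
  if "fst (e k) ~= 0" for k using that milnor_pointsD(2)[OF e, of k] g x by (simp add: milnor_act_def M.act_mult[symmetric] M.m_assoc)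
 then show "wt (milnor_act G' e g) (act M (inv\<^bsub>G'\<^esub> g) x) n = wt e x n"
  by (cases "fst (e (n div m)) = 0") (auto simp: wt_def milnor_act_def)
 assume n: "wt e x n ~= 0"
 then have k: "fst (e (n div m)) ~= 0" by (auto simp: wt_def)
 show "el (milnor_act G' e g) (act M (inv\<^bsub>G'\<^esub> g) x) n = el e x n \<star> g"
  using el_closed(2)[OF n] milnor_pointsD(2)[OF e] g k unfolding el_def *[OF k] by (simp add: milnor_act_def M.m_assoc)
qed

end

lemma continuous_wt:
 assumes e: "continuous_map Z M.EG e" and x: "continuous_map Z (space M) x" shows "continuous_map Z euclideanreal (%z. wt (e z) (x z) n)"
  and "continuous_map (subtopology Z {z. wt (e z) (x z) n ~= 0}) (grp_top M) (%z. el (e z) (x z) n)"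
proof -
 let ?k = "n div m" and ?i = "n mod m"
 have i: "?i < m" using m_pos by simp
 let ?Zk = "subtopology Z {z. fst (e z ?k) ~= 0}"
 have g: "continuous_map ?Zk (grp_top M) (%z. snd (e z ?k))" by (rule continuous_milnor_snd[OF e M.topspace_T])
 have gx: "continuous_map ?Zk (space M) (%z. act M (snd (e z ?k)) (x z))"
  by (rule M.continuous_map_act[OF g continuous_map_from_subtopology[OF x]])
 have u: "continuous_map ?Zk euclideanreal (%z. w ?i (act M (snd (e z ?k)) (x z)))" using continuous_map_compose[OF gx w_cont[OF i]]
   by (simp add: o_def)
 show "continuous_map Z euclideanreal (%z. wt (e z) (x z) n)" unfolding wt_def
 proof (rule continuous_map_vanishing_product[OF continuous_milnor_fst[OF e] u])
  fix z assume z: "z : topspace Z"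
  have "e z : milnor_points G'" "x z : topspace (space M)"
   using continuous_map_funspace[OF e] continuous_map_funspace[OF x] z by (auto simp: Pi_iff)
  then have "act M (snd (e z ?k)) (x z) : topspace (space M)" by (simp add: M.act_closed milnor_pointsD(2))
  then show "\<bar>w ?i (act M (snd (e z ?k)) (x z))\<bar> <= 1" using w_nonneg[OF i] w_le_1[OF i] by simp
 qed
 let ?W = "{z. wt (e z) (x z) n ~= 0}"
 have W: "?W <= {z. fst (e z ?k) ~= 0}" by (auto simp: wt_def)
 have "continuous_map (subtopology Z ?W) (subtopology (space M) {x. w ?i x ~= 0})
   (%z. act M (snd (e z ?k)) (x z))" unfolding continuous_map_in_subtopology
  using continuous_map_from_subtopology_mono[OF gx W] by (auto simp: wt_def)
 from continuous_map_compose[OF this sec_cont[OF i]]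
 show "continuous_map (subtopology Z ?W) (grp_top M) (%z. el (e z) (x z) n)"
  unfolding el_def using continuous_map_from_subtopology_mono[OF g W]
  by (intro M.continuous_map_mult M.continuous_map_inv) (auto simp: o_def)
qed

lemma continuous_mpt_el:
 assumes "topological_group H T'" and e: "continuous_map Z M.EG e" and x: "continuous_map Z (space M) x"
  and u: "!!n. continuous_map (subtopology Z {z. wt (e z) (x z) n ~= 0}) T' (%z. u z (el (e z) (x z) n))"
 shows "continuous_map Z (milnor_space H T') (%z. mpt H (wt (e z) (x z)) (%n. u z (el (e z) (x z) n)))"
proof -
 interpret H: topological_group H T' by (rule assms(1))
 have "e z : milnor_points G'" "x z : topspace (space M)" if "z : topspace Z" for z
  using continuous_map_funspace[OF e] continuous_map_funspace[OF x] that by (auto simp: Pi_iff)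
 note wt_nonneg[OF this] wt_sums[OF this]
 then show ?thesis by (intro continuous_map_mpt u H.topspace_T H.monoid_axioms continuous_wt(1)[OF e x]) auto
qed


definition basic :: "'x => 'g => bool" where
 "basic x h \<longleftrightarrow> h : carrier G' & act M h s0 = ka (0, x)"

text \<open>The group coordinates \<open>el\<close> are brought into the stabiliser by a frame
  \<open>h\<close> and then sent through a homomorphism \<open>ps\<close>. With \<open>\<pi>\<close>
  this is the homotopy inverse, and with \<open>\<sigma>\<close> at time \<open>s\<close> it is the
  homotopy from its composite with the inclusion; both therefore share one proof of well-definedness
  and continuity.\<close>

definition push :: "('h, 'y) quotient_stack => ('g => 'h) => 'y => (nat => real \<times> 'g) => 'x => 'g => ((nat => real \<times> 'h) \<times> 'y) set" where
 "push N ps y e x h = borel_orbit N (mpt (grp N) (wt e x) (%n. ps (el e x n \<star> h)), y)"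

definition pushes :: "('h, 'y) quotient_stack => ('g => 'h) => 'y => bool" where
 "pushes N ps y \<longleftrightarrow> stack_presentation N & y : topspace (space N) & (\<forall>p\<in>P. ps p : carrier (grp N) &
   act N (ps p) y = y & (\<forall>q\<in>P. ps (p \<star> q) = ps p \<otimes>\<^bsub>grp N\<^esub> ps q))"

lemma pushes_\<pi>: "pushes L \<pi> r0" using L.stack_presentation_axioms r0 r0_fixed \<pi>_closed \<pi>_mult by (simp add: pushes_def)

lemma pushes_\<sigma>: "s : {0..1} ==> pushes M (%g. \<sigma> (s, g)) s0"
 unfolding pushes_def using M.stack_presentation_axioms s0 \<sigma>_mult[of s]
 by (intro conjI ballI) (use \<sigma>_P[of s] in "force simp: P_def")+

lemma basic_exists:
 assumes "x : topspace (space M)" obtains h where "basic x h"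
 using w_nonzero[OF assms] sec[OF _ assms] sec_closed[OF _ assms] by (metis basic_def)

lemma basic_twist:
 assumes "basic x h" "g : carrier G'" "x : topspace (space M)"
 shows "basic (act M (inv\<^bsub>G'\<^esub> g) x) (inv\<^bsub>G'\<^esub> g \<star> h)"
 using assms s0 ka_equiv[of 0 "inv\<^bsub>G'\<^esub> g" x] by (simp add: basic_def M.act_mult)

context
 fixes e x
 assumes e: "e : milnor_points G'" and x: "x : topspace (space M)"
begin

lemma mpt_wt_closed:
 assumes "group H" "!!n. wt e x n ~= 0 ==> u n : carrier H" shows "mpt H (wt e x) u : milnor_points H"
 using assms by (intro mpt_in_milnor_points wt_nonneg[OF e x] wt_sums[OF e x] group.is_monoid) auto

lemma basic_change:
 assumes "basic x h" "basic x h'"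
 obtains p where "p : P" "h' = h \<star> p"
proof
 show "inv\<^bsub>G'\<^esub> h \<star> h' : P" using assms by (intro stab_transporter) (auto simp: basic_def)
 show "h' = h \<star> (inv\<^bsub>G'\<^esub> h \<star> h')" using assms by (simp add: basic_def M.m_assoc[symmetric])
qed

text \<open>Two frames at \<open>x\<close> differ by a right factor \<open>p\<close> in the
  stabiliser. Then \<open>ps p\<close> translates the join point on the right and fixes
  \<open>y\<close>, so the orbit is the same.\<close>

lemma push_change:
 assumes N: "pushes N ps y" and h: "basic x h" "basic x h'" shows "push N ps y e x h' = push N ps y e x h"
proof -
 interpret N: stack_presentation N using N by (simp add: pushes_def)
 have ps: "ps p : carrier (grp N)" "act N (ps p) y = y" "q : P ==> ps (p \<star> q) = ps p \<otimes>\<^bsub>grp N\<^esub> ps q"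
  and y: "y : topspace (space N)" if "p : P" for p q using N that by (auto simp: pushes_def)
 obtain p where p: "p : P" "h' = h \<star> p" using basic_change[OF h] by blast
 have elP: "el e x n \<star> h : P" if "wt e x n ~= 0" for n using el_P[OF e x that] h(1) by (simp add: basic_def)
 let ?d = "mpt (grp N) (wt e x) (%n. ps (el e x n \<star> h))"
 have "mpt (grp N) (wt e x) (%n. ps (el e x n \<star> h')) = milnor_act (grp N) ?d (ps p)" unfolding milnor_act_mpt
 proof (rule mpt_cong)
  fix n assume n: "wt e x n ~= 0"
  have "el e x n \<star> h' = (el e x n \<star> h) \<star> p"
   using el_closed(1)[OF e x n] h(1) p P_carrier by (simp add: M.m_assoc basic_def)
  then show "ps (el e x n \<star> h') = ps (el e x n \<star> h) \<otimes>\<^bsub>grp N\<^esub> ps p"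
   using ps(3)[OF elP[OF n] p(1)] by simp
 qed simp
 moreover have "?d : milnor_points (grp N)" by (rule mpt_wt_closed) (auto intro: ps(1) elP)
 moreover have "act N (inv\<^bsub>grp N\<^esub> ps p) y = y"
  using N.act_mult[of "inv\<^bsub>grp N\<^esub> ps p" "ps p" y] N.act_one ps(1,2) y p(1) by simp
 ultimately show ?thesis unfolding push_def using N.bo_twist[of "(?d, y)" "ps p"] y ps(1) p(1) by (simp add: N.twist_def)
qed

text \<open>The factor \<open>g\<close> that \<open>el\<close> gains on the right cancels against
  the inverse in front of \<open>h\<close>.\<close>

lemma push_twist:
 assumes h: "basic x h" and g: "g : carrier G'"
 shows "push N ps y (milnor_act G' e g) (act M (inv\<^bsub>G'\<^esub> g) x) (inv\<^bsub>G'\<^esub> g \<star> h) = push N ps y e x h"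
proof -
 have *: "el (milnor_act G' e g) (act M (inv\<^bsub>G'\<^esub> g) x) n \<star> (inv\<^bsub>G'\<^esub> g \<star> h) = el e x n \<star> h"
  if n: "wt e x n ~= 0" for n using el_closed(1)[OF e x n] g h
  by (simp add: wt_twist(2)[OF e x g n] basic_def M.m_assoc) (simp add: M.m_assoc[symmetric])
 show ?thesis unfolding push_def
  by (intro arg_cong[of _ _ "borel_orbit N"] prod_eqI mpt_cong; simp; (rule mpt_cong)?; simp add: wt_twist(1)[OF e x g] *)
qed

end

definition base :: "'x => 'g" where "base x = (SOME h. basic x h)"

lemma base: "x : topspace (space M) ==> basic x (base x)" unfolding base_def using basic_exists by (metis someI)

lemma push_base_twist:
 assumes "pushes N ps y" "p : topspace M.btot" "g : carrier G'"
 shows "push N ps y (fst (M.twist p g)) (snd (M.twist p g)) (base (snd (M.twist p g))) = push N ps y (fst p) (snd p) (base (snd p))"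
proof -
 obtain e x where p: "p = (e, x)" "e : milnor_points G'" "x : topspace (space M)" using assms(2) by (cases p) auto
 let ?e = "milnor_act G' e g" and ?x = "act M (inv\<^bsub>G'\<^esub> g) x"
 have E: "?e : milnor_points G'" "?x : topspace (space M)" using p assms(3) M.milnor_act_closed M.act_closed by auto
 show ?thesis using push_change[OF E assms(1) basic_twist[OF base[OF p(3)] assms(3) p(3)] base[OF E(2)]]
   push_twist[OF p(2,3) base[OF p(3)] assms(3)] by (simp add: p(1) M.twist_def)
qed

context
 fixes N :: "('h, 'y) quotient_stack" and y :: 'y and Z :: "'z topology" and ps :: "'z => 'g => 'h" and e x
 assumes N: "!!z. z : topspace Z ==> pushes N (ps z) y" and ps: "!!U p. continuous_map (subtopology Z U) (subtopology (grp_top M) P) p ==>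
   continuous_map (subtopology Z U) (grp_top N) (%z. ps z (p z))" and e: "continuous_map Z M.EG e" and x: "continuous_map Z (space M) x"
begin

lemma continuous_push:
 assumes h: "continuous_map (subtopology Z V) (grp_top M) h" "!!z. z : topspace (subtopology Z V) ==> basic (x z) (h z)"
 shows "continuous_map (subtopology Z V) (homotopy_quotient N) (%z. push N (ps z) y (e z) (x z) (h z))"
proof (cases "topspace Z = {}")
 case False
 then obtain z where "z : topspace Z" by blast
 then have N': "stack_presentation N" "y : topspace (space N)" using N[of z] by (auto simp: pushes_def)
 interpret N: stack_presentation N by (rule N')
 let ?Z = "subtopology Z V"
 note e' = continuous_map_from_subtopology[OF e, of V] and x' = continuous_map_from_subtopology[OF x, of V]
 have ex: "e z : milnor_points G'" "x z : topspace (space M)" if "z : topspace Z" for z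
  using continuous_map_funspace[OF e] continuous_map_funspace[OF x] that by (auto simp: Pi_iff)
 have "continuous_map (subtopology ?Z {z. wt (e z) (x z) n ~= 0}) (subtopology (grp_top M) P)
   (%z. el (e z) (x z) n \<star> h z)" for n unfolding continuous_map_in_subtopology
  using continuous_wt(2)[OF e' x'] continuous_map_from_subtopology[OF h(1)] h(2) ex
  by (auto intro!: M.continuous_map_mult el_P simp: basic_def)
 then have "continuous_map ?Z N.EG (%z. mpt (grp N) (wt (e z) (x z)) (%n. ps z (el (e z) (x z) n \<star> h z)))"
  by (intro continuous_mpt_el[where u = "%z y. ps z (y \<star> h z)", OF N.topological_group_axioms e' x'])
   (simp add: subtopology_subtopology ps)
 from continuous_map_compose[OF continuous_map_pairedI[OF this] N.continuous_map_bo, of "%_. y"] N'(2)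
 show ?thesis unfolding push_def by (simp add: o_def)
qed (simp add: continuous_map_on_empty)

text \<open>A continuous choice of \<open>base\<close> exists only locally, but the result does not depend on the choice.\<close>

lemma continuous_push_base: "continuous_map Z (homotopy_quotient N) (%z. push N (ps z) y (e z) (x z) (base (x z)))"
proof (rule continuous_map_locallyI)
 fix z assume z: "z : topspace Z"
 have ex: "e z : milnor_points G'" "x z : topspace (space M)" if "z : topspace Z" for z
  using continuous_map_funspace[OF e] continuous_map_funspace[OF x] that by (auto simp: Pi_iff)
 obtain i where i: "i < m" "w i (x z) ~= 0" using w_nonzero[OF ex(2)[OF z]] by blast
 let ?U = "{z : topspace Z. w i (x z) ~= 0}"
 \<comment> \<open>On this set the section \<open>sec i\<close> is a continuous frame that may
   replace \<open>base\<close>.\<close>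
 have U: "openin Z ?U" using continuous_map_compose[OF x w_cont[OF i(1)]] by (intro openin_nonzero) (simp add: o_def)
 have "continuous_map (subtopology Z ?U) (subtopology (space M) {x. w i x ~= 0}) x"
  unfolding continuous_map_in_subtopology using continuous_map_from_subtopology[OF x] by auto
 from continuous_map_compose[OF this sec_cont[OF i(1)]]
  have b: "continuous_map (subtopology Z ?U) (grp_top M) (%z. sec i (x z))" by (simp add: o_def)
 have c: "basic (x z) (sec i (x z))" if "z : topspace (subtopology Z ?U)" for z
  using that ex sec[OF i(1)] sec_closed[OF i(1)] by (auto simp: basic_def)
 have "continuous_map (subtopology Z ?U) (homotopy_quotient N) (%z. push N (ps z) y (e z) (x z) (base (x z)))"
  by (rule continuous_map_eq[OF continuous_push[OF b c]], assumption) (rule push_change; use c ex base N in simp)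
 then show "\<exists>U. openin Z U & z : U & continuous_map (subtopology Z U) (homotopy_quotient N) (%z. push N (ps z) y (e z) (x z) (base (x z)))"
  using U z i(2) by blast
qed

end

section \<open>The induced map and its homotopy inverse\<close>

abbreviation "incl == homotopy_quotient_map M j f"

lemma incl_bo:
 "p : topspace L.btot ==> incl (L.bo p) = M.bo (milnor_map j (fst p), f (snd p))"
 by (rule homotopy_quotient_map_bo[OF L.stack_presentation_axioms M.stack_presentation_axioms homj])
  (use f_closed f_equiv in auto)

lemma continuous_milnor_j:
 "continuous_map Z L.EG e ==> continuous_map Z M.EG (%z. milnor_map j (e z))"
 by (rule continuous_map_milnor_map[OF L.topological_group_axioms M.topological_group_axioms homj j_cont])

lemma milnor_j_closed: "e : milnor_points (grp L) ==> milnor_map j e : milnor_points G'"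
 using continuous_map_funspace[OF continuous_milnor_j[OF continuous_map_id]] by (auto simp: Pi_iff)

lemma milnor_j_act:
 "e : milnor_points (grp L) ==> l : carrier (grp L) ==>
   milnor_map j (milnor_act (grp L) e l) = milnor_act G' (milnor_map j e) (j l)"
 by (rule ext) (simp add: milnor_map_def milnor_act_def milnor_pointsD(2))

lemma continuous_incl: "continuous_map L.hq M.hq incl"
proof (rule L.continuous_map_from_hq[where f = incl, rotated], erule incl_bo)
 have "continuous_map L.btot M.btot (%p. (milnor_map j (fst p), f (snd p)))" using continuous_map_compose[OF continuous_map_snd f_cont]
  by (intro continuous_map_pairedI continuous_milnor_j continuous_map_fst) (simp add: o_def)
 from continuous_map_compose[OF this M.continuous_map_bo]
  show "continuous_map L.btot M.hq (%p. M.bo (milnor_map j (fst p), f (snd p)))" by (simp add: o_def)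
qed

text \<open>The inverse \<open>g\<close> is \<open>push\<close> along \<open>\<pi>\<close>.
  Following it by the inclusion is \<open>push\<close> along \<open>j\<close> after
  \<open>\<pi>\<close>, which is \<open>\<sigma>\<close> at time \<open>0\<close>; moving the time
  to \<open>1\<close> gives \<open>push\<close> along the identity, and that differs from the
  identity only by an equivariant change of the join coordinate and by \<open>ka\<close>. In the
  other order only the latter kind of change remains.\<close>

theorem homotopy_equivalence_incl: "homotopy_equivalence L.hq M.hq incl"
proof -
 let ?\<Psi> = "%p. push L \<pi> r0 (fst p) (snd p) (base (snd p))"
 let ?\<Theta> = "%s p. push M (%g. \<sigma> (s, g)) s0 (fst p) (snd p) (base (snd p))"
 obtain g where g: "!!p. p : topspace M.btot ==> g (M.bo p) = ?\<Psi> p"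
  by (rule M.lift_to_hq[where \<Phi> = ?\<Psi>]) (use push_base_twist[OF pushes_\<pi>] in blast)+
 have g_cont: "continuous_map M.hq L.hq g" by (rule M.continuous_map_from_hq[where f = g, rotated], erule g)
   (intro continuous_push_base pushes_\<pi> continuous_map_fst continuous_map_snd,
    use continuous_map_compose[OF _ \<pi>_cont] in \<open>simp add: o_def\<close>)
 obtain k where k: "!!p. p : topspace M.btot ==> k (M.bo p) = ?\<Theta> 1 p"
  by (rule M.lift_to_hq[where \<Phi> = "?\<Theta> 1"]) (use push_base_twist[OF pushes_\<sigma>[of 1]] in auto)
 have basic_el: "el (fst p) (snd p) n \<star> base (snd p) : P"
  if "p : topspace M.btot" "wt (fst p) (snd p) n ~= 0" for p n
 proof -
  have "fst p : milnor_points G'" "snd p : topspace (space M)" using that(1) by auto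
  then show ?thesis using el_P[OF _ _ that(2)] base[of "snd p"] by (simp add: basic_def)
 qed

 have "homotopic_with (%_. True) M.hq M.hq (incl \<circ> g) k"
 proof (rule M.homotopic_from_hq[where \<Phi> = ?\<Theta>])
  show "continuous_map (prod_topology I01 M.btot) M.hq (%z. ?\<Theta> (fst z) (snd z))"
  proof (rule continuous_push_base[where ps = "%z g. \<sigma> (fst z, g)", OF _ _ continuous_prod_components(2,3)])
   fix U q assume "continuous_map (subtopology (prod_topology I01 M.btot) U) (subtopology (grp_top M) P) q"
   from continuous_map_compose[OF continuous_map_pairedI[OF continuous_map_from_subtopology[OF continuous_prod_components(1)] this] \<sigma>_cont]
   show "continuous_map (subtopology (prod_topology I01 M.btot) U) (grp_top M) (%z. \<sigma> (fst z, q z))" by (simp add: o_def)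
  qed (auto intro!: pushes_\<sigma>)
  show "?\<Theta> s (M.twist p g) = ?\<Theta> s p" if "s : {0..1}" "p : topspace M.btot" "g : carrier G'" for s p g
   by (rule push_base_twist[OF pushes_\<sigma>[OF that(1)] that(2,3)])
  fix p assume p: "p : topspace M.btot"
  then have p': "fst p : milnor_points G'" "snd p : topspace (space M)" by auto
  let ?d = "mpt (grp L) (wt (fst p) (snd p)) (%n. \<pi> (el (fst p) (snd p) n \<star> base (snd p)))"
  have "?d : milnor_points (grp L)" by (rule mpt_wt_closed[OF p' L.group_axioms]) (auto intro: \<pi>_closed basic_el p)
  then have "incl (?\<Psi> p) = M.bo (milnor_map j ?d, s0)" unfolding push_def using incl_bo[of "(?d, r0)"] r0 by simp
  also have "... = ?\<Theta> 0 p" unfolding push_def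
   by (simp add: milnor_map_mpt) (intro arg_cong[of _ _ M.bo] prod_eqI; simp; rule mpt_cong; simp add: \<sigma>_0 basic_el[OF p])
  finally show "(incl \<circ> g) (M.bo p) = ?\<Theta> 0 p" using g[OF p] by simp
  show "k (M.bo p) = ?\<Theta> 1 p" by (rule k[OF p])
 qed
 moreover
 let ?\<Omega> = "%p. mpt G' (wt (fst p) (snd p)) (el (fst p) (snd p))"
 have "homotopic_with (%_. True) M.hq M.hq k id"
 proof (rule M.homotopic_id_by_join[where \<Omega> = ?\<Omega> and ka = ka, OF _ _ ka_cont ka_1 ka_equiv])
  show "continuous_map M.btot M.EG ?\<Omega>"
   by (rule continuous_mpt_el[where u = "%_ y. y", OF M.topological_group_axioms continuous_map_fst continuous_map_snd
      continuous_wt(2)[OF continuous_map_fst continuous_map_snd]])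
  fix p assume p: "p : topspace M.btot"
  then have p': "fst p : milnor_points G'" "snd p : topspace (space M)" by auto
  show "?\<Omega> (M.twist p h) = milnor_act G' (?\<Omega> p) h" if h: "h : carrier G'" for h unfolding milnor_act_mpt
   by (rule mpt_cong) (simp_all add: M.twist_def wt_twist[OF p' h])
  let ?h = "base (snd p)"
  let ?d = "mpt G' (wt (fst p) (snd p)) (%n. el (fst p) (snd p) n \<star> ?h)"
  have h: "?h : carrier G'" "act M ?h s0 = ka (0, snd p)" using base[OF p'(2)] by (auto simp: basic_def)
  have d: "(?d, s0) : topspace M.btot" using s0 by (auto intro!: mpt_wt_closed[OF p' M.group_axioms] P_carrier basic_el[OF p])
  \<comment> \<open>Twisting by the inverse of the frame removes it from the group coordinates and
    moves the base point to \<open>ka (0, snd p)\<close>, so the result no longer depends on the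
    frame.\<close>
  have "M.twist (?d, s0) (inv\<^bsub>G'\<^esub> ?h) = (?\<Omega> p, ka (0, snd p))" unfolding M.twist_def fst_conv snd_conv milnor_act_mpt
   using h el_closed(1)[OF p'] by (auto intro!: mpt_cong simp: M.m_assoc)
  then have "M.bo (?\<Omega> p, ka (0, snd p)) = M.bo (?d, s0)" using M.bo_twist[OF d, of "inv\<^bsub>G'\<^esub> ?h"] h by simp
  also have "... = ?\<Theta> 1 p"
   unfolding push_def by (intro arg_cong[of _ _ M.bo] prod_eqI; simp; rule mpt_cong; simp add: \<sigma>_1 basic_el[OF p])
  finally show "k (M.bo p) = M.bo (?\<Omega> p, ka (0, snd p))" using k[OF p] by simp
 qed
 ultimately have FG: "homotopic_with (%_. True) M.hq M.hq (incl \<circ> g) id" by (rule homotopic_with_trans)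

 let ?\<Lambda> = "%p. mpt (grp L) (wt (milnor_map j (fst p)) (f (snd p))) (%n. \<pi> (el (milnor_map j (fst p)) (f (snd p)) n))"
 \<comment> \<open>Since \<open>ka\<close> collapses the image of \<open>f\<close> to the base
   point, the unit is a frame there, and the coordinates \<open>el\<close> themselves lie in the
   stabiliser.\<close>
 have one: "basic (f (snd p)) \<one>\<^bsub>G'\<^esub>" if "p : topspace L.btot" for p
  using that ka_f[of "snd p"] M.act_one[OF s0] by (auto simp: basic_def)
 have jp: "milnor_map j (fst p) : milnor_points G'" "f (snd p) : topspace (space M)" if "p : topspace L.btot" for p
  using that milnor_j_closed f_closed by auto
 have el1: "el (milnor_map j (fst p)) (f (snd p)) n : P"
  if "p : topspace L.btot" "wt (milnor_map j (fst p)) (f (snd p)) n ~= 0" for p n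
  using el_P[OF jp[OF that(1)] that(2), of "\<one>\<^bsub>G'\<^esub>"] one[OF that(1)] el_closed(1)[OF jp[OF that(1)] that(2)]
  by (simp add: basic_def)
 have "homotopic_with (%_. True) L.hq L.hq (g \<circ> incl) id"
 proof (rule L.homotopic_id_by_join[where \<Omega> = ?\<Lambda> and ka = ka\<^sub>R, OF _ _ kaR_cont kaR_1 kaR_equiv])
  have je: "continuous_map L.btot M.EG (%p. milnor_map j (fst p))" by (rule continuous_milnor_j[OF continuous_map_fst])
  have fr: "continuous_map L.btot (space M) (%p. f (snd p))" using continuous_map_compose[OF continuous_map_snd f_cont]
   by (simp add: o_def)
  have "continuous_map (subtopology L.btot {p. wt (milnor_map j (fst p)) (f (snd p)) n ~= 0})
    (subtopology (grp_top M) P) (%p. el (milnor_map j (fst p)) (f (snd p)) n)" for n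
   unfolding continuous_map_in_subtopology using continuous_wt(2)[OF je fr, of n] el1 by auto
  from continuous_map_compose[OF this \<pi>_cont]
  show "continuous_map L.btot L.EG ?\<Lambda>"
   by (intro continuous_mpt_el[where u = "%_ y. \<pi> y", OF L.topological_group_axioms je fr]) (simp add: o_def)
  fix p assume p: "p : topspace L.btot"
  then have p': "fst p : milnor_points (grp L)" "snd p : topspace (space L)" by auto
  show "?\<Lambda> (L.twist p l) = milnor_act (grp L) (?\<Lambda> p) l" if l: "l : carrier (grp L)" for l
  proof -
   have "milnor_map j (fst (L.twist p l)) = milnor_act G' (milnor_map j (fst p)) (j l)"
    "f (snd (L.twist p l)) = act M (inv\<^bsub>G'\<^esub> (j l)) (f (snd p))"
    using p' l by (simp_all add: L.twist_def milnor_j_act f_equiv)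
   then show ?thesis unfolding milnor_act_mpt
    using l by (intro mpt_cong) (simp_all add: wt_twist[OF jp[OF p]] \<pi>_mult el1[OF p] jP \<pi>_j)
  qed
  have "g (incl (L.bo p)) = push L \<pi> r0 (milnor_map j (fst p)) (f (snd p)) (base (f (snd p)))"
   using g[of "(milnor_map j (fst p), f (snd p))"] jp[OF p] incl_bo[OF p] by simp
  also have "... = push L \<pi> r0 (milnor_map j (fst p)) (f (snd p)) \<one>\<^bsub>G'\<^esub>"
   by (rule push_change[OF jp[OF p] pushes_\<pi> one[OF p] base[OF jp(2)[OF p]]])
  also have "... = L.bo (?\<Lambda> p, r0)" unfolding push_def
   by (intro arg_cong[of _ _ L.bo] prod_eqI; simp; rule mpt_cong; simp add: el_closed(1)[OF jp[OF p]])
  finally show "(g \<circ> incl) (L.bo p) = L.bo (?\<Lambda> p, ka\<^sub>R (0, snd p))" using kaR_0[OF p'(2)] by simp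
 qed
 then show ?thesis unfolding homotopy_equivalence_def using continuous_incl g_cont FG by blast
qed

end

section \<open>Matrix groups and representation spaces\<close>

lemma continuous_map_complex_mult:
 "continuous_map X euclidean f ==> continuous_map X euclidean g ==>
   continuous_map X euclidean (%x. f x * g x :: complex)" by (simp add: continuous_map_atin tendsto_mult)

lemma continuous_map_complex_prod:
 "finite I ==> (!!i. i : I ==> continuous_map X euclidean (%x. f x i :: complex)) ==>
   continuous_map X euclidean (%x. prod (f x) I)" by (simp add: continuous_map_atin tendsto_prod)

lemma continuous_map_complex_inverse:
 "continuous_map X euclidean f ==> (!!x. x : topspace X ==> f x ~= 0) ==>
   continuous_map X euclidean (%x. inverse (f x) :: complex)" by (simp add: continuous_map_atin tendsto_inverse)

lemma continuous_map_cmod: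
 "continuous_map X euclidean f ==> continuous_map X euclideanreal (%x. cmod (f x))" by (simp add: continuous_map_atin tendsto_norm)

lemma continuous_map_of_real_mult:
 "continuous_map X euclideanreal f ==> continuous_map X euclidean g ==>
   continuous_map X euclidean (%x. complex_of_real (f x) * g x)" by (simp add: continuous_map_atin tendsto_mult tendsto_of_real)

lemma topspace_mat_topology [simp]: "topspace (mat_topology r k) = carrier_mat r k"
 by (auto simp: mat_topology_def topspace_pullback_topology)

lemma continuous_map_mat_topology:
 "continuous_map Z (mat_topology r k) f \<longleftrightarrow>
   (\<forall>z\<in>topspace Z. f z : carrier_mat r k) &
   (\<forall>i<r. \<forall>j<k. continuous_map Z euclidean (%z. f z $$ (i, j)))"
proof safe
 assume f: "continuous_map Z (mat_topology r k) f"
 show "f z : carrier_mat r k" if "z : topspace Z" for z using continuous_map_funspace[OF f] that by auto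
 fix i j assume ij: "i < r" "j < k"
 have "continuous_map (mat_topology r k) euclidean ((%x. x (i, j)) \<circ> (%A. \<lambda>ij\<in>{..<r} \<times> {..<k}. A $$ ij :: complex))"
  unfolding mat_topology_def by (rule continuous_map_pullback) (use ij in "intro continuous_map_product_coordinates, simp")
 from continuous_map_compose[OF f this]
 show "continuous_map Z euclidean (%z. f z $$ (i, j))" using ij by (simp add: o_def)
next
 assume f: "\<forall>z\<in>topspace Z. f z : carrier_mat r k" "\<forall>i<r. \<forall>j<k. continuous_map Z euclidean (%z. f z $$ (i, j))"
 show "continuous_map Z (mat_topology r k) f" unfolding mat_topology_def
 proof (rule continuous_map_pullback')
  show "continuous_map Z (product_topology (%_. euclidean) ({..<r} \<times> {..<k})) ((%A. \<lambda>ij\<in>{..<r} \<times> {..<k}. A $$ ij) \<circ> f)"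
   by (rule continuous_map_coordinatewise_then_product) (use f in "auto simp: o_def")
  show "topspace Z <= f -` carrier_mat r k" using f by auto
 qed
qed

lemma continuous_map_matI:
 assumes "!!z. z : topspace Z ==> f z : carrier_mat r k" and "!!i j. i < r ==> j < k ==> continuous_map Z euclidean (%z. f z $$ (i, j))"
 shows "continuous_map Z (mat_topology r k) f" using assms by (simp add: continuous_map_mat_topology)

lemma continuous_map_matD:
 assumes "continuous_map Z (mat_topology r k) f" shows "z : topspace Z ==> f z : carrier_mat r k"
  and "i < r ==> j < k ==> continuous_map Z euclidean (%z. f z $$ (i, j))" using assms by (auto simp: continuous_map_mat_topology)

lemma continuous_map_mat_mult:
 assumes f: "continuous_map Z (mat_topology r k) f" and g: "continuous_map Z (mat_topology k l) g"
 shows "continuous_map Z (mat_topology r l) (%z. f z * g z)"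
proof (rule continuous_map_matI)
 fix z assume "z : topspace Z"
 then show "f z * g z : carrier_mat r l" by (intro mult_carrier_mat[OF continuous_map_matD(1)[OF f] continuous_map_matD(1)[OF g]])
next
 fix i j assume ij: "i < r" "j < l"
 have "continuous_map Z euclidean (%z. \<Sum>n<k. f z $$ (i, n) * g z $$ (n, j))"
  by (intro continuous_map_sum continuous_map_complex_mult continuous_map_matD(2)[OF f] continuous_map_matD(2)[OF g])
   (use ij in auto)
 then show "continuous_map Z euclidean (%z. (f z * g z) $$ (i, j))"
 proof (rule continuous_map_eq)
  fix z assume "z : topspace Z"
  then have "f z : carrier_mat r k" "g z : carrier_mat k l" using continuous_map_matD(1)[OF f] continuous_map_matD(1)[OF g] by auto
  then show "(\<Sum>n<k. f z $$ (i, n) * g z $$ (n, j)) = (f z * g z) $$ (i, j)" using ij by (simp add: scalar_prod_def lessThan_atLeast0)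
 qed
qed

lemma continuous_map_det:
 assumes f: "continuous_map Z (mat_topology n n) f" shows "continuous_map Z euclidean (%z. det (f z))"
proof -
 have "continuous_map Z euclidean (%z. \<Sum>p | p permutes {0..<n}. signof p * (\<Prod>i=0..<n. f z $$ (i, p i)))"
  by (intro continuous_map_sum continuous_map_complex_mult continuous_map_complex_prod continuous_map_matD(2)[OF f]
    continuous_map_canonical_const)
   (auto simp: finite_permutations dest: permutes_in_image[of _ _ "_ :: nat"])
 then show ?thesis by (rule continuous_map_eq) (simp add: det_def'[OF continuous_map_matD(1)[OF f]])
qed

lemma continuous_map_cofactor:
 assumes f: "continuous_map Z (mat_topology n n) f" and ij: "i < n" "j < n" shows "continuous_map Z euclidean (%z. cofactor (f z) i j)"
proof -
 have fc: "f z : carrier_mat n n" if "z : topspace Z" for z using continuous_map_matD(1)[OF f that] .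
 have "continuous_map Z (mat_topology (n - 1) (n - 1)) (%z. mat_delete (f z) i j)"
 proof (rule continuous_map_matI)
  fix z assume "z : topspace Z"
  then show "mat_delete (f z) i j : carrier_mat (n - 1) (n - 1)" using fc mat_delete_carrier by blast
 next
  fix i' j' assume i'j': "i' < n - 1" "j' < n - 1"
  have "continuous_map Z euclidean (%z. f z $$ (insert_index i i', insert_index j j'))"
   by (rule continuous_map_matD(2)[OF f]) (use i'j' ij in "auto simp: insert_index_def")
  then show "continuous_map Z euclidean (%z. mat_delete (f z) i j $$ (i', j'))"
  proof (rule continuous_map_eq)
   fix z assume "z : topspace Z"
   then have "f z : carrier_mat n n" by (rule fc)
   then show "f z $$ (insert_index i i', insert_index j j') = mat_delete (f z) i j $$ (i', j')"
    using i'j' by (auto simp: mat_delete_def insert_index_def)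
  qed
 qed
 from continuous_map_det[OF this] show ?thesis unfolding cofactor_def by (intro continuous_map_complex_mult) auto
qed

section \<open>General linear groups as topological groups\<close>

lemma carrier_general_linear: "carrier (GL n) = {A : carrier_mat n n. det A ~= 0}"
proof -
 have "A : Units (ring_mat TYPE(complex) n ()) \<longleftrightarrow> A : carrier_mat n n & det A ~= 0" for A
  using unit_imp_det_non_zero[of A n "()"] det_non_zero_imp_unit[of A n "()"] by (auto simp: Units_def ring_mat_def)
 then show ?thesis by (auto simp: general_linear_def units_of_def)
qed

lemma mult_general_linear [simp]: "(\<otimes>\<^bsub>GL n\<^esub>) = (*)" by (simp add: general_linear_def units_of_def ring_mat_def)

lemma one_general_linear [simp]: "\<one>\<^bsub>GL n\<^esub> = 1\<^sub>m n" by (simp add: general_linear_def units_of_def ring_mat_def)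

lemma group_general_linear: "group (GL n)"
proof -
 interpret ring "ring_mat TYPE(complex) n ()" by (rule ring_mat)
 show ?thesis unfolding general_linear_def by (rule units_group)
qed

text \<open>The adjugate formula expresses the abstract inverse by cofactors, which is how inversion
  is seen to be continuous.\<close>

lemma inv_general_linear:
 assumes "A : carrier (GL n)" shows "inv\<^bsub>GL n\<^esub> A = inverse (det A) \<cdot>\<^sub>m adj_mat A"
proof -
 interpret group "GL n" by (rule group_general_linear)
 have A: "A : carrier_mat n n" "det A ~= 0" using assms by (auto simp: carrier_general_linear)
 let ?B = "inverse (det A) \<cdot>\<^sub>m adj_mat A"
 have B: "?B : carrier_mat n n" using adj_mat(1)[OF A(1)] by simp
 have BA: "?B * A = 1\<^sub>m n" unfolding mult_smult_assoc_mat[OF adj_mat(1)[OF A(1)] A(1)] adj_mat(3)[OF A(1)]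
  using A(2) by (intro eq_matI) auto
 have "det ?B * det A = 1" using det_mult[OF B A(1)] BA by simp
 then have "?B : carrier (GL n)" using B by (auto simp: carrier_general_linear)
 then show ?thesis using inv_equality[of ?B A] BA assms by simp
qed

definition gl_topology :: "nat => complex mat topology" where
 "gl_topology n = subtopology (mat_topology n n) (carrier (GL n))"

lemma topspace_gl_topology [simp]: "topspace (gl_topology n) = carrier (GL n)" by (auto simp: gl_topology_def carrier_general_linear)

lemma continuous_map_gl_topology:
 "continuous_map Z (gl_topology n) f \<longleftrightarrow>
   continuous_map Z (mat_topology n n) f & (\<forall>z\<in>topspace Z. f z : carrier (GL n))"
 by (auto simp: gl_topology_def continuous_map_in_subtopology)

lemma topological_group_general_linear: "topological_group (GL n) (gl_topology n)"
proof -
 interpret group "GL n" by (rule group_general_linear)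
 have id: "continuous_map (gl_topology n) (mat_topology n n) (%A. A)"
  unfolding gl_topology_def by (intro continuous_map_from_subtopology) simp
 show ?thesis
 proof unfold_locales
  have 1: "continuous_map (prod_topology (gl_topology n) (gl_topology n)) (mat_topology n n) fst"
   and 2: "continuous_map (prod_topology (gl_topology n) (gl_topology n)) (mat_topology n n) snd"
   using continuous_map_compose[OF continuous_map_fst id] continuous_map_compose[OF continuous_map_snd id] by (simp_all add: o_def)
  have "(A * B) : carrier (GL n)"
   if "A : carrier (GL n)" "B : carrier (GL n)" for A B using m_closed[OF that] by simp
  then show "continuous_map (prod_topology (gl_topology n) (gl_topology n)) (gl_topology n)
    (%(x, y). x \<otimes>\<^bsub>GL n\<^esub> y)"
   using continuous_map_mat_mult[OF 1 2] by (auto simp: continuous_map_gl_topology case_prod_unfold)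
  have "continuous_map (gl_topology n) (mat_topology n n) (%A. inverse (det A) \<cdot>\<^sub>m adj_mat A)"
  proof (rule continuous_map_matI)
   fix i j assume ij: "i < n" "j < n"
   have "continuous_map (gl_topology n) euclidean (%A. inverse (det A) * cofactor A j i)"
    by (intro continuous_map_complex_mult continuous_map_complex_inverse continuous_map_det[OF id]
      continuous_map_cofactor[OF id] ij) (simp add: carrier_general_linear)
   then show "continuous_map (gl_topology n) euclidean (%A. (inverse (det A) \<cdot>\<^sub>m adj_mat A) $$ (i, j))"
    by (rule continuous_map_eq) (use ij in "auto simp: adj_mat_def carrier_general_linear")
  qed (auto simp: carrier_general_linear intro!: smult_carrier_mat adj_mat(1))
  then have "continuous_map (gl_topology n) (mat_topology n n) (%A. inv\<^bsub>GL n\<^esub> A)"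
   by (rule continuous_map_eq) (simp add: inv_general_linear)
  then show "continuous_map (gl_topology n) (gl_topology n) (%A. inv\<^bsub>GL n\<^esub> A)" by (simp add: continuous_map_gl_topology)
 qed simp
qed

lemma topological_group_product:
 assumes "!!i. i : I ==> topological_group (G i) (T i)" shows "topological_group (product_group I G) (product_topology T I)"
proof -
 have G: "group (G i)" if "i : I" for i using assms[OF that] by (simp add: topological_group_def)
 have T: "topspace (T i) = carrier (G i)" if "i : I" for i using topological_group.topspace_T[OF assms[OF that]] .
 interpret group "product_group I G" by (rule product_group) (rule G)
 show ?thesis
 proof unfold_locales
  show top: "topspace (product_topology T I) = carrier (product_group I G)" using T by (auto simp: PiE_def Pi_def)
  let ?T = "product_topology T I"
  show "continuous_map (prod_topology ?T ?T) ?T (%(x, y). x \<otimes>\<^bsub>product_group I G\<^esub> y)"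
  proof (rule continuous_map_coordinatewise_then_product)
   fix i assume i: "i : I"
   have "continuous_map (prod_topology ?T ?T) (T i) (%z. fst z i)"
    "continuous_map (prod_topology ?T ?T) (T i) (%z. snd z i)"
    using continuous_map_compose[OF continuous_map_fst continuous_map_product_coordinates[OF i]]
     continuous_map_compose[OF continuous_map_snd continuous_map_product_coordinates[OF i]] by (simp_all add: o_def)
   from topological_group.continuous_map_mult[OF assms[OF i] this]
   show "continuous_map (prod_topology ?T ?T) (T i) (%z. (case z of (x, y) => x \<otimes>\<^bsub>product_group I G\<^esub> y) i)"
    using i by (simp add: case_prod_unfold)
  qed auto
  have "continuous_map ?T ?T (%x. \<lambda>i\<in>I. inv\<^bsub>G i\<^esub> x i)"
  proof (rule continuous_map_coordinatewise_then_product)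
   fix i assume i: "i : I"
   have "continuous_map ?T (T i) (%x. x i)" by (rule continuous_map_product_coordinates[OF i])
   from topological_group.continuous_map_inv[OF assms[OF i] this]
   show "continuous_map ?T (T i) (%x. (\<lambda>i\<in>I. inv\<^bsub>G i\<^esub> x i) i)" using i by simp
  qed auto
  then show "continuous_map ?T ?T (%x. inv\<^bsub>product_group I G\<^esub> x)"
   by (rule continuous_map_eq) (use G top in "simp add: inv_product_group")
 qed
qed

section \<open>The base change action on representations\<close>

lemma moduli_stack_simps [simp]:
 "grp (moduli_stack Q dv) = BG Q dv"
 "grp_top (moduli_stack Q dv) = product_topology (%i. gl_topology (dv i)) (verts Q)"
 "space (moduli_stack Q dv) = rep_space Q dv"
 "act (moduli_stack Q dv) = base_change Q dv" by (simp_all add: moduli_stack_def gl_topology_def)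

lemma stratum_stack_simps [simp]:
 "grp (stratum_stack Q d dv l) = BG Q dv"
 "grp_top (stratum_stack Q d dv l) = product_topology (%i. gl_topology (dv i)) (verts Q)"
 "space (stratum_stack Q d dv l) = subtopology (rep_space Q dv) (stratum Q d dv l)"
 "act (stratum_stack Q d dv l) = base_change Q dv"
 "grp_coords (stratum_stack Q d dv l) = grp_coords (moduli_stack Q dv)"
 "space_coords (stratum_stack Q d dv l) = space_coords (moduli_stack Q dv)"
 by (simp_all add: stratum_stack_def moduli_stack_def gl_topology_def)

lemma topological_group_base_change:
 "topological_group (BG Q dv) (product_topology (%i. gl_topology (dv i)) (verts Q))"
 unfolding base_change_group_def by (rule topological_group_product) (rule topological_group_general_linear)

lemma carrier_base_change_group: "carrier (BG Q dv) = (\<Pi>\<^sub>E i\<in>verts Q. carrier (GL (dv i)))"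
 by (simp add: base_change_group_def)

lemma inv_base_change_group:
 "g : carrier (BG Q dv) ==>
   inv\<^bsub>BG Q dv\<^esub> g = (\<lambda>i\<in>verts Q. inv\<^bsub>GL (dv i)\<^esub> g i)"
 unfolding base_change_group_def using group_general_linear by (simp add: inv_product_group)

lemma topspace_rep_space:
 "topspace (rep_space Q dv) = (\<Pi>\<^sub>E a\<in>arcs Q. carrier_mat (dv (head Q a)) (dv (tail Q a)))" by (simp add: rep_space_def)

lemma gl_carrier_mat: "A : carrier (GL n) ==> A : carrier_mat n n" by (simp add: carrier_general_linear)

lemma gl_inv_carrier_mat: "A : carrier (GL n) ==> inv\<^bsub>GL n\<^esub> A : carrier_mat n n"
 using group.inv_closed[OF group_general_linear] gl_carrier_mat by blast

lemma gl_inv_mult: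
 assumes "A : carrier (GL n)" "B : carrier (GL n)"
 shows "inv\<^bsub>GL n\<^esub> (A * B) = inv\<^bsub>GL n\<^esub> B * inv\<^bsub>GL n\<^esub> A"
 using group.inv_mult_group[OF group_general_linear assms] by simp

lemma gl_inv_cancel:
 assumes "A : carrier (GL n)" shows "inv\<^bsub>GL n\<^esub> A * A = 1\<^sub>m n" "A * inv\<^bsub>GL n\<^esub> A = 1\<^sub>m n"
 using group.l_inv[OF group_general_linear assms] group.r_inv[OF group_general_linear assms] by simp_all

context wf_digraph begin

lemma stack_presentation_moduli_stack: "stack_presentation (moduli_stack G dv)"
proof -
 interpret topological_group "grp (moduli_stack G dv)" "grp_top (moduli_stack G dv)" using topological_group_base_change by simp
 let ?T = "product_topology (%i. gl_topology (dv i)) (verts G)"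
 let ?Z = "prod_topology ?T (rep_space G dv)"
 show ?thesis
 proof unfold_locales
  have "continuous_map ?Z (rep_space G dv) (%z. base_change G dv (fst z) (snd z))" unfolding rep_space_def
  proof (rule continuous_map_coordinatewise_then_product)
   fix a assume a: "a : arcs G"
   have v: "tail G a : verts G" "head G a : verts G" using a by auto
   have id: "continuous_map (gl_topology n) (mat_topology n n) (%A. A)" for n
    unfolding gl_topology_def by (intro continuous_map_from_subtopology) simp
   have c: "continuous_map ?Z (gl_topology (dv i)) (%z. fst z i)" if "i : verts G" for i
    using continuous_map_compose[OF continuous_map_fst continuous_map_product_coordinates[OF that]] by (simp add: o_def)
   have 1: "continuous_map ?Z (mat_topology (dv (head G a)) (dv (head G a))) (%z. fst z (head G a))"
    using continuous_map_compose[OF c[OF v(2)] id] by (simp add: o_def)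
   have 2: "continuous_map ?Z (mat_topology (dv (tail G a)) (dv (tail G a)))
     (%z. inv\<^bsub>GL (dv (tail G a))\<^esub> fst z (tail G a))"
    using continuous_map_compose[OF topological_group.continuous_map_inv[OF topological_group_general_linear c[OF v(1)]] id]
   by (simp add: o_def)
   have 3: "continuous_map ?Z (mat_topology (dv (head G a)) (dv (tail G a))) (%z. snd z a)"
    using continuous_map_compose[OF continuous_map_snd continuous_map_product_coordinates[OF a]]
    unfolding rep_space_def by (simp add: o_def)
   have "continuous_map ?Z (mat_topology (dv (head G a)) (dv (tail G a))) (%z. base_change G dv (fst z) (snd z) a)"
    using continuous_map_mat_mult[OF continuous_map_mat_mult[OF 1 3] 2] a by (simp add: base_change_def)
   then show "continuous_map (prod_topology ?T (product_topology (%a. mat_topology (dv (head G a)) (dv (tail G a))) (arcs G)))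
     (mat_topology (dv (head G a)) (dv (tail G a))) (%z. base_change G dv (fst z) (snd z) a)" by (simp add: rep_space_def)
  qed (auto simp: base_change_def)
  then show "continuous_map (prod_topology (grp_top (moduli_stack G dv)) (space (moduli_stack G dv)))
    (space (moduli_stack G dv)) (%(g, x). act (moduli_stack G dv) g x)" by (simp add: case_prod_unfold)
 next
  fix rh assume "rh : topspace (space (moduli_stack G dv))"
  then have rh: "rh : (\<Pi>\<^sub>E a\<in>arcs G. carrier_mat (dv (head G a)) (dv (tail G a)))" by (simp add: topspace_rep_space)
  have 1: "inv\<^bsub>GL n\<^esub> (1\<^sub>m n) = 1\<^sub>m n" for n
   using group.is_monoid[OF group_general_linear, THEN monoid.inv_one] by simp
  show "act (moduli_stack G dv) \<one>\<^bsub>grp (moduli_stack G dv)\<^esub> rh = rh"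
  proof (rule ext)
   fix a
   show "act (moduli_stack G dv) \<one>\<^bsub>grp (moduli_stack G dv)\<^esub> rh a = rh a"
    using PiE_mem[OF rh, of a] PiE_arb[OF rh, of a] by (cases "a : arcs G") (simp_all add: base_change_def base_change_group_def 1)
  qed
 next
  fix g h rh assume g: "g : carrier (grp (moduli_stack G dv))" and h: "h : carrier (grp (moduli_stack G dv))"
   and "rh : topspace (space (moduli_stack G dv))"
  then have rh: "rh : (\<Pi>\<^sub>E a\<in>arcs G. carrier_mat (dv (head G a)) (dv (tail G a)))" by (simp add: topspace_rep_space)
  show "act (moduli_stack G dv) (g \<otimes>\<^bsub>grp (moduli_stack G dv)\<^esub> h) rh = act (moduli_stack G dv) g (act (moduli_stack G dv) h rh)"
  proof (rule ext)
   fix a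
   show "act (moduli_stack G dv) (g \<otimes>\<^bsub>grp (moduli_stack G dv)\<^esub> h) rh a = act (moduli_stack G dv) g (act (moduli_stack G dv) h rh) a"
   proof (cases "a : arcs G")
    case True
    let ?t = "tail G a" and ?h = "head G a"
    have v: "?t : verts G" "?h : verts G" using True by auto
    have gl: "g ?t : carrier (GL (dv ?t))" "h ?t : carrier (GL (dv ?t))"
     "g ?h : carrier (GL (dv ?h))" "h ?h : carrier (GL (dv ?h))" using g h v by (auto simp: carrier_base_change_group)
    note m = gl_carrier_mat[OF gl(3)] gl_carrier_mat[OF gl(4)] gl_inv_carrier_mat[OF gl(1)] gl_inv_carrier_mat[OF gl(2)]
     PiE_mem[OF rh True]
    have "g ?h * h ?h * rh a * (inv\<^bsub>GL (dv ?t)\<^esub> h ?t * inv\<^bsub>GL (dv ?t)\<^esub> g ?t)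
      = g ?h * (h ?h * rh a * inv\<^bsub>GL (dv ?t)\<^esub> h ?t) * inv\<^bsub>GL (dv ?t)\<^esub> g ?t"
     using m by (simp add: assoc_mult_mat[of _ "dv ?h" "dv ?h" _ "dv ?t" _ "dv ?t"]
       assoc_mult_mat[of _ "dv ?h" "dv ?h" _ "dv ?h" _ "dv ?t"] assoc_mult_mat[of _ "dv ?h" "dv ?t" _ "dv ?t" _ "dv ?t"])
    then show ?thesis using True v by (simp add: base_change_def base_change_group_def gl_inv_mult[OF gl(1,2)])
   qed (simp add: base_change_def)
  qed
 qed
qed

end

lemma stack_presentation_restrict:
 assumes "stack_presentation M" and "grp N = grp M" "grp_top N = grp_top M" "space N = subtopology (space M) S" "act N = act M"
  and inv: "!!g x. g : carrier (grp M) ==> x : topspace (space M) ==> x : S ==> act M g x : S" shows "stack_presentation N"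
proof -
 interpret M: stack_presentation M by (rule assms(1))
 interpret topological_group "grp N" "grp_top N" using M.topological_group_axioms by (simp add: assms)
 show ?thesis
 proof unfold_locales
  have "continuous_map (prod_topology (grp_top M) (subtopology (space M) S)) (space M) (%(g, x). act M g x)"
   using continuous_map_from_subtopology[OF M.continuous_act, of "topspace (grp_top M) \<times> S"]
   by (simp add: prod_topology_subtopology(2))
  then show "continuous_map (prod_topology (grp_top N) (space N)) (space N) (%(g, x). act N g x)"
   using inv M.topspace_T by (auto simp: assms continuous_map_in_subtopology)
 qed (auto simp: assms M.act_one M.act_mult)
qed

section \<open>Rank and invertible minors\<close>

text \<open>Zero rows pad \<open>C\<close> to a square matrix, which is singular because its
  transpose kills a unit vector at an added row.\<close>

lemma wide_matrix_kernel:
 fixes C :: "complex mat"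
 assumes C: "C : carrier_mat r s" and rs: "r < s"
 obtains v where "v : carrier_vec s" "v ~= 0\<^sub>v s" "C *\<^sub>v v = 0\<^sub>v r"
proof -
 let ?M = "mat s s (%(i, j). if i < r then C $$ (i, j) else 0)"
 have M: "?M : carrier_mat s s" "transpose_mat ?M : carrier_mat s s" by auto
 have "transpose_mat ?M *\<^sub>v unit_vec s r = 0\<^sub>v s"
  using rs by (intro eq_vecI) (auto simp: scalar_prod_def unit_vec_def if_distrib cong: if_cong)
 moreover have "unit_vec s r ~= (0\<^sub>v s :: complex vec)" using rs by (metis index_unit_vec(2) index_zero_vec(1) zero_neq_one)
 ultimately have "det (transpose_mat ?M) = 0" using det_0_iff_vec_prod_zero_field[OF M(2)] unit_vec_carrier by blast
 then have "det ?M = 0" using det_transpose[OF M(1)] by simp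
 then obtain v where v: "v : carrier_vec s" "v ~= 0\<^sub>v s" "?M *\<^sub>v v = 0\<^sub>v s"
  using det_0_iff_vec_prod_zero_field[OF M(1)] by blast
 have "C *\<^sub>v v = 0\<^sub>v r"
 proof (rule eq_vecI)
  fix i assume "i < dim_vec (0\<^sub>v r :: complex vec)"
  then have i: "i < r" by simp
  then have "(?M *\<^sub>v v) $ i = (C *\<^sub>v v) $ i" using C v(1) rs by (auto simp: scalar_prod_def intro!: sum.cong)
  then show "(C *\<^sub>v v) $ i = (0\<^sub>v r) $ i" using v(3) i rs by simp
 qed (use C in auto)
 then show ?thesis using that v by blast
qed

definition injective_mat :: "complex mat => bool" where
 "injective_mat A \<longleftrightarrow> (\<forall>v\<in>carrier_vec (dim_col A). A *\<^sub>v v = 0\<^sub>v (dim_row A) --> v = 0\<^sub>v (dim_col A))"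

lemma injective_mat_le:
 assumes "A : carrier_mat r s" "injective_mat A" shows "s <= r"
proof (rule ccontr)
 assume "\<not> s <= r"
 then obtain v where "v : carrier_vec s" "v ~= 0\<^sub>v s" "A *\<^sub>v v = 0\<^sub>v r"
  using wide_matrix_kernel[OF assms(1)] by (metis not_le)
 then show False using assms by (auto simp: injective_mat_def)
qed

lemma injective_mat_factor:
 assumes "B : carrier_mat n l" "C : carrier_mat l m" "injective_mat (B * C)" shows "injective_mat C" unfolding injective_mat_def
proof (intro ballI impI)
 fix v assume v: "v : carrier_vec (dim_col C)" "C *\<^sub>v v = 0\<^sub>v (dim_row C)"
 have "(B * C) *\<^sub>v v = B *\<^sub>v (C *\<^sub>v v)" using assms(1,2) v(1) by (auto intro!: assoc_mult_mat_vec)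
 also have "... = 0\<^sub>v n" unfolding v(2) using assms(1,2) by auto
 finally show "v = 0\<^sub>v (dim_col C)" using assms v(1) by (auto simp: injective_mat_def)
qed

text \<open>A maximal independent set of columns spans the others. The first factor consists of
  actual columns of \<open>A\<close>, so that minors of \<open>A\<close> can be read off from
  it.\<close>

lemma column_basis:
 fixes A :: "complex mat"
 assumes A: "A : carrier_mat n m"
 obtains js C where "!!k. k < vec_space.rank n A ==> js k < m"
  "injective_mat (mat n (vec_space.rank n A) (%(i, k). A $$ (i, js k)))"
  "C : carrier_mat (vec_space.rank n A) m"
  "A = mat n (vec_space.rank n A) (%(i, k). A $$ (i, js k)) * C"
proof -
 interpret vec_space "TYPE(complex)" n .
 have cA: "set (cols A) <= carrier_vec n" using cols_dim A by blast
 have li0: "lin_indpt {}" using finite_lin_indpt2[of "{}"] by auto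
 obtain U where U: "finite U" "maximal U (%T. T <= set (cols A) & lin_indpt T)"
  using maximal_exists_superset[of "set (cols A)" "%T. T <= set (cols A) & lin_indpt T" "{}"] li0 by auto
 have r: "rank A = card U" by (rule rank_card_indpt[OF A U(2)])
 have Us: "U <= set (cols A)" "lin_indpt U" using U(2) by (auto simp: maximal_def)
 have span: "v : span U" if v: "v : set (cols A)" for v
 proof (cases "v : U")
  case False
  have "\<not> lin_indpt (U \<union> {v})"
   using U(2) False Us(1) v unfolding maximal_def by (metis Un_insert_right Un_empty_right insertI1 insert_subset subset_insertI)
  then show ?thesis using lin_dep_iff_in_span[of U v] Us cA v False by auto
 qed (use span_mem Us cA in blast)
 obtain us where us: "set us = U" "distinct us" using U(1) finite_distinct_list by blast
 have len: "length us = rank A" using r us distinct_card by fastforce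
 have "\<forall>k<rank A. \<exists>j<m. us ! k = col A j"
 proof (intro allI impI)
  fix k assume "k < rank A"
  then have "us ! k : set (cols A)" using len us(1) Us(1) nth_mem by (metis subsetD)
  then show "\<exists>j<m. us ! k = col A j" using A by (auto simp: cols_def)
 qed
 then obtain js where js: "!!k. k < rank A ==> js k < m & us ! k = col A (js k)" by metis
 let ?B = "mat n (rank A) (%(i, k). A $$ (i, js k))"
 have B: "?B : carrier_mat n (rank A)" by simp
 have colB: "col ?B k = us ! k" if "k < rank A" for k using js[OF that] that A by (intro eq_vecI) auto
 have colsB: "cols ?B = us" by (rule nth_equalityI) (use len colB in "auto simp: cols_def")
 have inj: "injective_mat ?B" unfolding injective_mat_def
 proof (intro ballI impI, rule ccontr)
  fix v assume v: "v : carrier_vec (dim_col ?B)" "?B *\<^sub>v v = 0\<^sub>v (dim_row ?B)" "v ~= 0\<^sub>v (dim_col ?B)"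
  have "lin_dep (set (cols ?B))" by (rule lin_depI[OF B, of v]) (use v us colsB in auto)
  then show False using colsB us Us by simp
 qed
 have "\<exists>w\<in>carrier_vec (rank A). col A j = ?B *\<^sub>v w" if "j < m" for j
 proof -
  have "col A j : span U" using span that A by (auto simp: cols_def)
  then obtain a where "lincomb a U = col A j" using finite_in_span[OF U(1)] Us cA by (metis subset_trans)
  then have "col A j = ?B *\<^sub>v vec (rank A) (%i. a (col ?B i))" using mat_mult_eq_lincomb[OF B, of a] colsB us by simp
  then show ?thesis by (rule bexI) simp
 qed
 then obtain w where w: "!!j. j < m ==> w j : carrier_vec (rank A) & col A j = ?B *\<^sub>v w j" by metis
 let ?C = "mat (rank A) m (%(k, j). w j $ k)"
 have fac: "A = ?B * ?C"
 proof (rule eq_matI)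
  fix i j assume "i < dim_row (?B * ?C)" "j < dim_col (?B * ?C)"
  then have ij: "i < n" "j < m" by auto
  have "col ?C j = w j" using w[OF ij(2)] ij by (intro eq_vecI) auto
  then have "(?B * ?C) $$ (i, j) = (?B *\<^sub>v w j) $ i" using ij by simp
  also have "... = A $$ (i, j)" using w[OF ij(2)] ij A by (metis carrier_matD index_col)
  finally show "A $$ (i, j) = (?B * ?C) $$ (i, j)" by simp
 qed (use A in auto)
 show ?thesis
 proof (rule that[of js ?C])
  show "js k < m" if "k < rank A" for k using js[OF that] by (rule conjunct1)
  show "injective_mat ?B" by (rule inj)
  show "?C : carrier_mat (rank A) m" by simp
  show "A = ?B * ?C" by (rule fac)
 qed
qed

text \<open>Selected columns of a product are \<open>B\<close> times selected columns of
  \<open>C\<close>. If they are independent, so are those columns of \<open>C\<close>, which have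
  only \<open>l\<close> entries each.\<close>

lemma rank_le_factor:
 fixes B :: "complex mat"
 assumes B: "B : carrier_mat n l" and C: "C : carrier_mat l m" shows "vec_space.rank n (B * C) <= l"
proof -
 let ?A = "B * C" and ?r = "vec_space.rank n (B * C)"
 have A: "?A : carrier_mat n m" using B C by simp
 obtain js C' where js: "!!k. k < ?r ==> js k < m" and inj: "injective_mat (mat n ?r (%(i, k). ?A $$ (i, js k)))"
  by (rule column_basis[OF A]) (rule that, assumption+)
 have "mat n ?r (%(i, k). ?A $$ (i, js k)) = B * mat l ?r (%(i, k). C $$ (i, js k))"
  using B C js by (intro eq_matI) (auto simp: scalar_prod_def)
 then have "injective_mat (mat l ?r (%(i, k). C $$ (i, js k)))"
  using inj injective_mat_factor[OF B, of "mat l ?r (%(i, k). C $$ (i, js k))" ?r] by simp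
 then show ?thesis using injective_mat_le[of "mat l ?r (%(i, k). C $$ (i, js k))" l ?r] by simp
qed

lemma rank_factorE:
 fixes A :: "complex mat"
 assumes "A : carrier_mat n m"
 obtains B C where "B : carrier_mat n (vec_space.rank n A)" "C : carrier_mat (vec_space.rank n A) m" "A = B * C"
proof -
 obtain js C where "C : carrier_mat (vec_space.rank n A) m"
  "A = mat n (vec_space.rank n A) (%(i, k). A $$ (i, js k)) * C" by (rule column_basis[OF assms]) (rule that, assumption+)
 then show ?thesis using that[of "mat n (vec_space.rank n A) (%(i, k). A $$ (i, js k))" C] by simp
qed

lemma rank_general_linear_le:
 fixes A :: "complex mat"
 assumes A: "A : carrier_mat n m" and g: "g : carrier_mat n n" and h: "h : carrier_mat m m"
 shows "vec_space.rank n (g * A * h) <= vec_space.rank n A"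
proof -
 obtain B C where BC: "B : carrier_mat n (vec_space.rank n A)" "C : carrier_mat (vec_space.rank n A) m" "A = B * C"
  by (rule rank_factorE[OF A]) (rule that, assumption+)
 have "g * A * h = g * (B * C) * h" using BC(3) by simp
 also have "... = (g * B) * (C * h)" using assoc_mult_mat[OF g BC(1,2)] assoc_mult_mat[OF mult_carrier_mat[OF g BC(1)] BC(2) h] by simp
 finally show ?thesis using rank_le_factor[of "g * B" n "vec_space.rank n A" "C * h" m] BC(1,2) g h by simp
qed

lemma rank_general_linear:
 fixes A :: "complex mat"
 assumes A: "A : carrier_mat n m" and g: "g : carrier (GL n)" and h: "h : carrier (GL m)"
 shows "vec_space.rank n (g * A * inv\<^bsub>GL m\<^esub> h) = vec_space.rank n A"
proof (rule antisym)
 let ?gi = "inv\<^bsub>GL n\<^esub> g" and ?hi = "inv\<^bsub>GL m\<^esub> h"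
 note c = gl_carrier_mat[OF g] gl_carrier_mat[OF h] gl_inv_carrier_mat[OF g] gl_inv_carrier_mat[OF h]
 show "vec_space.rank n (g * A * ?hi) <= vec_space.rank n A" by (rule rank_general_linear_le[OF A c(1,4)])
 have Ah: "A * ?hi : carrier_mat n m" using A c by simp
 have "?gi * (g * A * ?hi) = (?gi * g) * (A * ?hi)" using assoc_mult_mat[OF c(1) A c(4)] assoc_mult_mat[OF c(3) c(1) Ah] by simp
 then have "?gi * (g * A * ?hi) * h = A * ?hi * h" by (simp only: gl_inv_cancel[OF g] left_mult_one_mat[OF Ah])
 also have "... = A" using assoc_mult_mat[OF A c(4) c(2)] gl_inv_cancel[OF h] A by simp
 finally have "?gi * (g * A * ?hi) * h = A" .
 then show "vec_space.rank n A <= vec_space.rank n (g * A * ?hi)"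
  using rank_general_linear_le[OF mult_carrier_mat[OF mult_carrier_mat[OF c(1) A] c(4)] c(3,2)] by (simp only:)
qed

text \<open>A column basis of the transpose selects rows of \<open>A\<close>. Injectivity of
  \<open>A\<close> passes to the selected rows, injectivity of the basis gives the opposite
  inequality, and so the selection is square.\<close>

lemma injective_mat_row_minor:
 assumes A: "A : carrier_mat n r" and inj: "injective_mat A"
 obtains rs where "!!k. k < r ==> rs k < n" "det (mat r r (%(k, j). A $$ (rs k, j))) ~= 0"
proof -
 let ?T = "transpose_mat A" and ?s = "vec_space.rank r (transpose_mat A)"
 have T: "?T : carrier_mat r n" using A by simp
 obtain rs C where rs: "!!k. k < ?s ==> rs k < n" and injT: "injective_mat (mat r ?s (%(i, k). ?T $$ (i, rs k)))"
  and C: "C : carrier_mat ?s n" "?T = mat r ?s (%(i, k). ?T $$ (i, rs k)) * C" by (rule column_basis[OF T]) (rule that, assumption+)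
 let ?B = "mat r ?s (%(i, k). ?T $$ (i, rs k))"
 have "A = transpose_mat (?B * C)" using C(2) by (metis transpose_transpose)
 also have "... = transpose_mat C * transpose_mat ?B" using C(1) by (intro transpose_mult[of _ r ?s _ n]) auto
 finally have "injective_mat (transpose_mat ?B)"
  using inj injective_mat_factor[of "transpose_mat C" n ?s "transpose_mat ?B" r] C(1) by simp
 then have "r <= ?s" using injective_mat_le[of "transpose_mat ?B" ?s r] by simp
 moreover have "?s <= r" using injective_mat_le[OF _ injT, of r ?s] by simp
 ultimately have s: "?s = r" by simp
 have "det ?B ~= 0" using injT det_0_iff_vec_prod_zero_field[of ?B r] s by (auto simp: injective_mat_def)
 moreover have "transpose_mat ?B = mat r r (%(k, j). A $$ (rs k, j))" using A rs s by (intro eq_matI) auto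
 ultimately have "det (mat r r (%(k, j). A $$ (rs k, j))) ~= 0" using det_transpose[of ?B r] s by simp
 then show ?thesis using that rs s by auto
qed

lemma rank_minor:
 fixes A :: "complex mat"
 assumes A: "A : carrier_mat n m" and l: "vec_space.rank n A = l"
 obtains rs js where "!!k. k < l ==> rs k < n" "!!k. k < l ==> js k < m"
  "det (mat l l (%(i, k). A $$ (rs i, js k))) ~= 0"
proof -
 obtain js C where js: "!!k. k < l ==> js k < m" and inj: "injective_mat (mat n l (%(i, k). A $$ (i, js k)))"
  by (rule column_basis[OF A, unfolded l]) (rule that, assumption+)
 obtain rs where rs: "!!k. k < l ==> rs k < n"
  "det (mat l l (%(k, j). mat n l (%(i, k). A $$ (i, js k)) $$ (rs k, j))) ~= 0"
  by (rule injective_mat_row_minor[OF mat_carrier inj]) (rule that, assumption+)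
 have "mat l l (%(k, j). mat n l (%(i, k). A $$ (i, js k)) $$ (rs k, j)) = mat l l (%(i, k). A $$ (rs i, js k))"
  using rs(1) by (intro eq_matI) auto
 then show ?thesis using that[of rs js] rs js by simp
qed

text \<open>Factoring the product through its rank also factors the minor, and an invertible
  \<open>l\<close> by \<open>l\<close> minor cannot pass through fewer than \<open>l\<close>
  dimensions.\<close>

lemma rank_eq_of_minor:
 fixes B :: "complex mat"
 assumes B: "B : carrier_mat n l" and C: "C : carrier_mat l m" and rs: "!!k. k < l ==> rs k < n" and js: "!!k. k < l ==> js k < m"
  and minor: "det (mat l l (%(i, k). (B * C) $$ (rs i, js k))) ~= 0" shows "vec_space.rank n (B * C) = l"
proof (rule antisym)
 show "vec_space.rank n (B * C) <= l" by (rule rank_le_factor[OF B C])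
 let ?r = "vec_space.rank n (B * C)"
 have "B * C : carrier_mat n m" using B C by simp
 from rank_factorE[OF this] obtain B' C' where BC: "B' : carrier_mat n ?r" "C' : carrier_mat ?r m" "B * C = B' * C'" by (metis (no_types))
 let ?M = "mat l l (%(i, k). (B * C) $$ (rs i, js k))"
 have "?M = mat l ?r (%(i, k). B' $$ (rs i, k)) * mat ?r l (%(i, k). C' $$ (i, js k))"
  using BC(1,2) rs js unfolding BC(3) by (intro eq_matI) (auto simp: scalar_prod_def)
 moreover have "injective_mat ?M" using det_0_iff_vec_prod_zero_field[of ?M l] minor by (auto simp: injective_mat_def)
 ultimately have "injective_mat (mat ?r l (%(i, k). C' $$ (i, js k)))"
  using injective_mat_factor[of "mat l ?r (%(i, k). B' $$ (rs i, k))" l ?r "mat ?r l (%(i, k). C' $$ (i, js k))" l] by simp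
 then show "l <= ?r" using injective_mat_le[of "mat ?r l (%(i, k). C' $$ (i, js k))" ?r l] by simp
qed

lemma minor_injective:
 assumes "det (mat l l (%(i, k). (A :: complex mat) $$ (rs i, js k))) ~= 0" shows "inj_on rs {..<l}" "inj_on js {..<l}"
proof -
 let ?M = "mat l l (%(i, k). A $$ (rs i, js k))"
 show "inj_on rs {..<l}"
 proof (rule inj_onI, rule ccontr)
  fix i j assume ij: "i : {..<l}" "j : {..<l}" "rs i = rs j" "i ~= j"
  have "det ?M = 0" by (rule det_identical_rows[OF _ ij(4)]) (use ij in "auto intro!: eq_vecI")
  then show False using assms by simp
 qed
 show "inj_on js {..<l}"
 proof (rule inj_onI, rule ccontr)
  fix i j assume ij: "i : {..<l}" "j : {..<l}" "js i = js j" "i ~= j"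
  have "det ?M = 0" by (rule det_identical_cols[OF _ ij(4)]) (use ij in "auto intro!: eq_vecI")
  then show False using assms by simp
 qed
qed

text \<open>Moves chosen indices to the last \<open>l\<close> positions, where the normal form has
  its identity block. Pivot positions are thereby indexed by a finite set of permutations and the
  pivot can always be read in the lower right corner.\<close>

lemma permutation_extending:
 assumes f: "inj_on f {..<l}" "!!k. k < l ==> f k < a + (l::nat)"
 obtains p where "p permutes {0..<a + l}" "!!k. k < l ==> p (a + k) = f k"
proof -
 let ?F = "f ` {..<l}"
 have "card ({..<a + l} - ?F) = card {..<a}" using f by (subst card_Diff_subset) (auto simp: card_image)
 then obtain h where h: "bij_betw h {..<a} ({..<a + l} - ?F)" using finite_same_card_bij by (metis finite_Diff finite_lessThan)
 define p where "p = (%x. if x < a then h x else if x < a + l then f (x - a) else x)"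
 have "bij_betw (%x. f (x - a)) {a..<a + l} ?F"
 proof (rule bij_betw_trans[of "%x. x - a" _ "{..<l}" f, unfolded o_def])
  show "bij_betw (%x. x - a) {a..<a + l} {..<l}" by (rule bij_betw_byWitness[where f' = "%x. x + a"]) auto
  show "bij_betw f {..<l} ?F" using f(1) by (rule inj_on_imp_bij_betw)
 qed
 then have "bij_betw p {a..<a + l} ?F" by (rule bij_betw_cong[THEN iffD1, rotated]) (auto simp: p_def)
 moreover have "bij_betw p {..<a} ({..<a + l} - ?F)" using h by (rule bij_betw_cong[THEN iffD1, rotated]) (auto simp: p_def)
 ultimately have "bij_betw p ({..<a} \<union> {a..<a + l}) (({..<a + l} - ?F) \<union> ?F)" by (intro bij_betw_combine) auto
 moreover have "{..<a} \<union> {a..<a + l} = {0..<a + l}" "({..<a + l} - ?F) \<union> ?F = {0..<a + l}" using f(2) by auto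
 ultimately have "p permutes {0..<a + l}" by (intro bij_imp_permutes) (auto simp: p_def)
 then show ?thesis using that[of p] by (simp add: p_def)
qed

section \<open>Normal forms of matrices of fixed rank\<close>

definition block_id :: "nat => nat => nat => complex mat" where
 "block_id a b l = four_block_mat (0\<^sub>m a b) (0\<^sub>m a l) (0\<^sub>m l b) (1\<^sub>m l)"

lemma block_id_carrier: "block_id a b l : carrier_mat (a + l) (b + l)" by (simp add: block_id_def)

section \<open>Block matrices and stabilisers of the rank normal form\<close>

lemma block_split:
 fixes A :: "complex mat"
 assumes "A : carrier_mat (n1 + n2) (m1 + m2)"
 obtains B C D E where "B : carrier_mat n1 m1" "C : carrier_mat n1 m2" "D : carrier_mat n2 m1" "E : carrier_mat n2 m2"
  "A = four_block_mat B C D E"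
proof -
 obtain B C D E where "split_block A n1 m1 = (B, C, D, E)" by (metis prod_cases4)
 from split_block[OF this, of n2 m2] assms that show ?thesis by auto
qed

lemma four_block_mat_cases:
 assumes "A : carrier_mat n1 m1" "D : carrier_mat n2 m2" "i < n1 + n2" "j < m1 + m2" shows "four_block_mat A B C D $$ (i, j) =
  (if i < n1 then if j < m1 then A $$ (i, j) else B $$ (i, j - m1)
   else if j < m1 then C $$ (i - n1, j) else D $$ (i - n1, j - m1))" using assms by (auto simp: index_mat_four_block)

lemma four_block_mat_eqD:
 fixes A :: "'a::zero mat"
 assumes "four_block_mat A B C D = four_block_mat A' B' C' D'"
  "A : carrier_mat n1 m1" "B : carrier_mat n1 m2" "C : carrier_mat n2 m1" "D : carrier_mat n2 m2"
  "A' : carrier_mat n1 m1" "B' : carrier_mat n1 m2" "C' : carrier_mat n2 m1" "D' : carrier_mat n2 m2"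
 shows "A = A'" "B = B'" "C = C'" "D = D'"
proof -
 have "four_block_mat A B C D $$ (i, j) = four_block_mat A' B' C' D' $$ (i, j)" for i j using assms(1) by simp
 note e = this[of i j for i j] this[of i "j + m1" for i j] this[of "i + n1" j for i j] this[of "i + n1" "j + m1" for i j]
 note f = four_block_mat_cases[OF assms(2,5)] four_block_mat_cases[OF assms(6,9)]
 have "A $$ (i, j) = A' $$ (i, j)" if "i < n1" "j < m1" for i j using e(1)[of i j] that by (simp add: f)
 moreover have "B $$ (i, j) = B' $$ (i, j)" if "i < n1" "j < m2" for i j using e(2)[of i j] that by (simp add: f)
 moreover have "C $$ (i, j) = C' $$ (i, j)" if "i < n2" "j < m1" for i j using e(3)[of i j] that by (simp add: f)
 moreover have "D $$ (i, j) = D' $$ (i, j)" if "i < n2" "j < m2" for i j using e(4)[of i j] that by (simp add: f)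
 ultimately show "A = A'" "B = B'" "C = C'" "D = D'"
  by (rule_tac [!] eq_matI) (simp_all add: assms(2-9)[THEN carrier_matD(1)] assms(2-9)[THEN carrier_matD(2)])
qed

text \<open>A pair stabilising the normal form has components triangular of opposite kinds at the
  two vertices; the flag \<open>low\<close> (upper right block zero) lets both be treated at
  once.\<close>

definition block_tri :: "bool => nat => nat => complex mat => bool" where
 "block_tri low a l g \<longleftrightarrow> (\<exists>A B C D. A : carrier_mat a a & B : carrier_mat a l & C : carrier_mat l a &
   D : carrier_mat l l & g = four_block_mat A B C D & (if low then B = 0\<^sub>m a l else C = 0\<^sub>m l a))"

lemma block_triE:
 assumes "block_tri low a l g"
 obtains A B C D where "A : carrier_mat a a" "B : carrier_mat a l" "C : carrier_mat l a" "D : carrier_mat l l"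
  "g = four_block_mat A B C D" "if low then B = 0\<^sub>m a l else C = 0\<^sub>m l a" using assms unfolding block_tri_def by blast

definition upper_left :: "nat => complex mat => complex mat" where
 "upper_left a g = mat a a (%(i, j). g $$ (i, j))"

definition lower_right :: "nat => nat => complex mat => complex mat" where
 "lower_right a l g = mat l l (%(i, j). g $$ (a + i, a + j))"

text \<open>On triangular matrices and for \<open>s\<close> nonzero this is conjugation by a block
  scalar matrix, hence multiplicative. At \<open>s = 0\<close> it degenerates to the projection onto
  the diagonal blocks.\<close>

definition off_scale :: "nat => real => complex mat => complex mat" where
 "off_scale a s g = mat (dim_row g) (dim_col g)
   (%(i, j). if (i < a) = (j < a) then g $$ (i, j) else complex_of_real s * g $$ (i, j))"

lemma block_parts:
 assumes "A : carrier_mat a a" "B : carrier_mat a l" "C : carrier_mat l a" "D : carrier_mat l l"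
 shows "upper_left a (four_block_mat A B C D) = A" "lower_right a l (four_block_mat A B C D) = D"
  "off_scale a s (four_block_mat A B C D) =
    four_block_mat A (complex_of_real s \<cdot>\<^sub>m B) (complex_of_real s \<cdot>\<^sub>m C) D"
proof -
 note e = four_block_mat_cases[OF assms(1,4)]
 show "upper_left a (four_block_mat A B C D) = A" using assms by (intro eq_matI) (auto simp: upper_left_def e)
 show "lower_right a l (four_block_mat A B C D) = D" using assms by (intro eq_matI) (auto simp: lower_right_def e)
 show "off_scale a s (four_block_mat A B C D) =
    four_block_mat A (complex_of_real s \<cdot>\<^sub>m B) (complex_of_real s \<cdot>\<^sub>m C) D"
  using assms by (intro eq_matI) (auto simp: off_scale_def e)
qed

lemma stabiliser_blocks:
 assumes g: "g : carrier_mat (a + l) (a + l)" and h: "h : carrier_mat (b + l) (b + l)" and eq: "g * block_id a b l = block_id a b l * h"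
 shows "block_tri True a l g" "block_tri False b l h" "lower_right a l g = lower_right b l h"
proof -
 obtain A E B C where 1: "A : carrier_mat a a" "E : carrier_mat a l" "B : carrier_mat l a" "C : carrier_mat l l"
  "g = four_block_mat A E B C" by (rule block_split[OF g])
 obtain A' E' B' C' where 2: "A' : carrier_mat b b" "E' : carrier_mat b l" "B' : carrier_mat l b" "C' : carrier_mat l l"
  "h = four_block_mat A' E' B' C'" by (rule block_split[OF h])
 have "g * block_id a b l = four_block_mat (0\<^sub>m a b) E (0\<^sub>m l b) C"
  unfolding block_id_def 1(5) by (subst mult_four_block_mat[OF 1(1-4)]) (use 1 in auto)
 moreover have "block_id a b l * h = four_block_mat (0\<^sub>m a b) (0\<^sub>m a l) B' C'"
  unfolding block_id_def 2(5) by (subst mult_four_block_mat[OF _ _ _ _ 2(1-4)]) (use 2 in auto)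
 ultimately have "four_block_mat (0\<^sub>m a b) E (0\<^sub>m l b) C = four_block_mat (0\<^sub>m a b) (0\<^sub>m a l) B' C'"
  using eq by simp
 note e = four_block_mat_eqD[OF this _ 1(2) _ 1(4) _ _ 2(3,4)]
 have E: "E = 0\<^sub>m a l" "B' = 0\<^sub>m l b" "C = C'" using e by auto
 show "block_tri True a l g" "block_tri False b l h" unfolding block_tri_def if_True if_False using 1 2 E by blast+
 show "lower_right a l g = lower_right b l h" using 1 2 E by (simp add: block_parts)
qed

text \<open>Triangularity kills the products of two off-diagonal blocks, the only terms that would
  enter the diagonal or scale with the square of \<open>s\<close>.\<close>

lemma block_tri_mult:
 assumes "block_tri low a l g" "block_tri low a l h" shows "upper_left a (g * h) = upper_left a g * upper_left a h"
  "lower_right a l (g * h) = lower_right a l g * lower_right a l h"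
  "off_scale a s (g * h) = off_scale a s g * off_scale a s h"
proof -
 obtain A B C D where 1: "A : carrier_mat a a" "B : carrier_mat a l" "C : carrier_mat l a" "D : carrier_mat l l"
  "g = four_block_mat A B C D" "if low then B = 0\<^sub>m a l else C = 0\<^sub>m l a" by (rule block_triE[OF assms(1)])
 obtain A' B' C' D' where 2: "A' : carrier_mat a a" "B' : carrier_mat a l" "C' : carrier_mat l a" "D' : carrier_mat l l"
  "h = four_block_mat A' B' C' D'" "if low then B' = 0\<^sub>m a l else C' = 0\<^sub>m l a" by (rule block_triE[OF assms(2)])
 let ?k = "complex_of_real s"
 have z: "k \<cdot>\<^sub>m 0\<^sub>m r q = 0\<^sub>m r q" for k :: complex and r q by (intro eq_matI) auto
 have gh: "g * h = four_block_mat (A * A') (A * B' + B * D') (C * A' + D * C') (D * D')"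
  unfolding 1(5) 2(5) mult_four_block_mat[OF 1(1-4) 2(1-4)] by (cases low) (use 1 2 in "auto intro!: cong_four_block_mat")
 have c: "A * A' : carrier_mat a a" "A * B' + B * D' : carrier_mat a l" "C * A' + D * C' : carrier_mat l a" "D * D' : carrier_mat l l"
  using 1 2 by auto
 note p = block_parts[OF c, folded gh] block_parts[OF 1(1-4), folded 1(5)] block_parts[OF 2(1-4), folded 2(5)]
 show "upper_left a (g * h) = upper_left a g * upper_left a h"
  "lower_right a l (g * h) = lower_right a l g * lower_right a l h" by (simp_all only: p)
 have cs: "?k \<cdot>\<^sub>m B : carrier_mat a l" "?k \<cdot>\<^sub>m C : carrier_mat l a" "?k \<cdot>\<^sub>m B' : carrier_mat a l" "?k \<cdot>\<^sub>m C' : carrier_mat l a" using 1 2 by auto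
 show "off_scale a s (g * h) = off_scale a s g * off_scale a s h" unfolding p mult_four_block_mat[OF 1(1) cs(1,2) 1(4) 2(1) cs(3,4) 2(4)]
  by (cases low) (use 1 2 in "auto simp: z add_smult_distrib_left_mat[of _ a l] add_smult_distrib_left_mat[of _ l a]
     mult_smult_assoc_mat[of _ a l] mult_smult_distrib[of _ a a] mult_smult_assoc_mat[of _ l a] mult_smult_distrib[of _ l l]
    intro!: cong_four_block_mat")
qed

lemma block_tri:
 assumes "block_tri low a l g" shows "det g = det (upper_left a g) * det (lower_right a l g)" "det (off_scale a s g) = det g"
  "off_scale a s g : carrier_mat (a + l) (a + l)" "block_tri low a l (off_scale a s g)"
  "lower_right a l (off_scale a s g) = lower_right a l g" "off_scale a 1 g = g"
  "off_scale a 0 g = four_block_mat (upper_left a g) (0\<^sub>m a l) (0\<^sub>m l a) (lower_right a l g)"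
proof -
 obtain A B C D where 1: "A : carrier_mat a a" "B : carrier_mat a l" "C : carrier_mat l a" "D : carrier_mat l l"
  "g = four_block_mat A B C D" "if low then B = 0\<^sub>m a l else C = 0\<^sub>m l a" by (rule block_triE[OF assms])
 note p = block_parts[OF 1(1-4), folded 1(5)]
 have c: "complex_of_real s \<cdot>\<^sub>m B : carrier_mat a l" "complex_of_real s \<cdot>\<^sub>m C : carrier_mat l a" for s using 1 by auto
 have z: "if low then complex_of_real s \<cdot>\<^sub>m B = 0\<^sub>m a l else complex_of_real s \<cdot>\<^sub>m C = 0\<^sub>m l a" for s
  using 1(6) by (auto intro!: eq_matI)
 have d: "det (four_block_mat A (complex_of_real s \<cdot>\<^sub>m B) (complex_of_real s \<cdot>\<^sub>m C) D) = det A * det D" for s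
  using z[of s] det_four_block_mat_upper_right_zero[OF 1(1) _ c(2)[of s] 1(4)]
   det_four_block_mat_lower_left_zero[OF 1(1) c(1)[of s] _ 1(4)] by (auto split: if_splits)
 have "complex_of_real 1 \<cdot>\<^sub>m B = B" "complex_of_real 1 \<cdot>\<^sub>m C = C" using 1 by (auto intro!: eq_matI)
 then show o: "off_scale a 1 g = g" unfolding p using 1 by simp
 then have "det g = det (off_scale a 1 g)" by simp
 also have "... = det A * det D" unfolding p by (rule d)
 finally show dg: "det g = det (upper_left a g) * det (lower_right a l g)" unfolding p .
 show "det (off_scale a s g) = det g" using dg d[of s] unfolding p by simp
 show "off_scale a s g : carrier_mat (a + l) (a + l)" unfolding p using 1(1,4) by (rule four_block_carrier_mat)
 show "lower_right a l (off_scale a s g) = lower_right a l g" unfolding p(3) block_parts(2)[OF 1(1) c 1(4)] p(2) ..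
 show "block_tri low a l (off_scale a s g)" unfolding block_tri_def p(3) using 1(1,4) c[of s] z[of s] by blast
 have "complex_of_real 0 \<cdot>\<^sub>m B = 0\<^sub>m a l" "complex_of_real 0 \<cdot>\<^sub>m C = 0\<^sub>m l a" using 1 by (auto intro!: eq_matI)
 then show "off_scale a 0 g = four_block_mat (upper_left a g) (0\<^sub>m a l) (0\<^sub>m l a) (lower_right a l g)" unfolding p by simp
qed

section \<open>Block Gauss elimination along a pivot minor\<close>

definition pivot :: "nat => nat => nat => (nat => nat) => (nat => nat) => complex mat => complex mat" where
 "pivot a b l p q A = mat l l (%(i, j). A $$ (p (a + i), q (b + j)))"

definition row_factor :: "nat => nat => nat => (nat => nat) => (nat => nat) => complex mat => complex mat" where
 "row_factor a b l p q A =
   four_block_mat (1\<^sub>m a) (mat a l (%(i, j). A $$ (p i, q (b + j)))) (0\<^sub>m l a) (pivot a b l p q A)"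

text \<open>Together with \<open>row_factor\<close> these are the elimination factors of the matrix
  rearranged by \<open>p\<close> and \<open>q\<close>: the rearranged matrix times this one equals
  \<open>row_factor\<close> times the normal form. Their entries are rational in those of
  \<open>A\<close>, with the pivot determinant as only denominator.\<close>

definition col_factor :: "nat => nat => nat => (nat => nat) => (nat => nat) => complex mat => complex mat" where
 "col_factor a b l p q A =
   four_block_mat (1\<^sub>m b) (0\<^sub>m b l)
    (- (inv\<^bsub>GL l\<^esub> (pivot a b l p q A) * mat l b (%(i, j). A $$ (p (a + i), q j)))) (1\<^sub>m l)"

text \<open>Row \<open>i\<close> of the argument becomes row \<open>p i\<close>; this undoes the
  rearrangement under which \<open>pivot\<close> reads the matrix.\<close>

definition permute_rows :: "nat => (nat => nat) => complex mat => complex mat" where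
 "permute_rows n p A = mat n n (%(i, j). A $$ (Hilbert_Choice.inv p i, j))"

lemma permute_rows_general_linear:
 assumes "p permutes {0..<n}" "A : carrier (GL n)" shows "permute_rows n p A : carrier (GL n)"
proof -
 have "det (permute_rows n p A) = signof (Hilbert_Choice.inv p) * det A" unfolding permute_rows_def
  using assms by (intro det_permute_rows permutes_inv) (auto simp: carrier_general_linear)
 then show ?thesis using assms(2) by (auto simp: carrier_general_linear permute_rows_def sign_def)
qed

lemma pivot_carrier [simp]: "pivot a b l p q A : carrier_mat l l" by (simp add: pivot_def)

lemma row_factor_general_linear:
 assumes "det (pivot a b l p q A) ~= 0" shows "row_factor a b l p q A : carrier (GL (a + l))"
proof -
 have "det (row_factor a b l p q A) = det (1\<^sub>m a) * det (pivot a b l p q A)"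
  unfolding row_factor_def by (rule det_four_block_mat_lower_left_zero) auto
 then show ?thesis using assms by (simp add: carrier_general_linear row_factor_def)
qed

lemma col_factor_general_linear:
 assumes "det (pivot a b l p q A) ~= 0" shows "col_factor a b l p q A : carrier (GL (b + l))"
proof -
 have "inv\<^bsub>GL l\<^esub> (pivot a b l p q A) : carrier_mat l l"
  using assms by (intro gl_inv_carrier_mat) (simp add: carrier_general_linear)
 then have "det (col_factor a b l p q A) = det (1\<^sub>m b) * det (1\<^sub>m l)" unfolding col_factor_def
  by (intro det_four_block_mat_upper_right_zero[of _ b _ l]) (auto intro!: uminus_carrier_mat mult_carrier_mat)
 then show ?thesis by (simp add: carrier_general_linear col_factor_def)
qed

text \<open>The Schur complement of an invertible pivot as large as the rank is zero. In a rank
  factorisation the pivot is \<open>B2 * C2\<close>, and its inverse cancels \<open>C2\<close> on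
  one side and \<open>B2\<close> on the other.\<close>

lemma low_rank_schur:
 fixes B C :: "complex mat"
 assumes B: "B1 : carrier_mat a l" "B2 : carrier_mat l l" and C: "C1 : carrier_mat l b" "C2 : carrier_mat l l"
  and det: "det (B2 * C2) ~= 0" shows "(B1 * C2) * (inv\<^bsub>GL l\<^esub> (B2 * C2) * (B2 * C1)) = (B1 * C1 :: complex mat)"
proof -
 have "det B2 ~= 0" "det C2 ~= 0" using det det_mult[OF B(2) C(2)] by auto
 then have gl: "B2 : carrier (GL l)" "C2 : carrier (GL l)" using B C by (auto simp: carrier_general_linear)
 note i = gl_inv_carrier_mat[OF gl(1)] gl_inv_carrier_mat[OF gl(2)]
 let ?Bi = "inv\<^bsub>GL l\<^esub> B2" and ?Ci = "inv\<^bsub>GL l\<^esub> C2"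
 have "inv\<^bsub>GL l\<^esub> (B2 * C2) * (B2 * C1) = (?Ci * ?Bi) * (B2 * C1)" by (simp only: gl_inv_mult[OF gl])
 also have "... = ?Ci * (?Bi * (B2 * C1))" by (rule assoc_mult_mat[OF i(2,1) mult_carrier_mat[OF B(2) C(1)]])
 also have "?Bi * (B2 * C1) = (?Bi * B2) * C1" by (rule assoc_mult_mat[OF i(1) B(2) C(1), symmetric])
 also have "... = C1" by (simp only: gl_inv_cancel(1)[OF gl(1)] left_mult_one_mat[OF C(1)])
 finally have 1: "inv\<^bsub>GL l\<^esub> (B2 * C2) * (B2 * C1) = ?Ci * C1" .
 have "(B1 * C2) * (?Ci * C1) = B1 * (C2 * (?Ci * C1))" by (rule assoc_mult_mat[OF B(1) C(2) mult_carrier_mat[OF i(2) C(1)]])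
 also have "C2 * (?Ci * C1) = (C2 * ?Ci) * C1" by (rule assoc_mult_mat[OF C(2) i(2) C(1), symmetric])
 also have "... = C1" by (simp only: gl_inv_cancel(2)[OF gl(2)] left_mult_one_mat[OF C(1)])
 finally show ?thesis unfolding 1 .
qed

lemma mat_mult_entry:
 assumes "A : carrier_mat n k" "B : carrier_mat k m" "i < n" "j < m"
 shows "(A * B) $$ (i, j) = (\<Sum>t = 0..<k. A $$ (i, t) * B $$ (t, j))" using assms by (simp add: scalar_prod_def)

text \<open>Subtracting the pivot columns times \<open>X\<close> clears the first column block, and
  that is also what the left-hand side shows.\<close>

lemma block_schur:
 assumes A: "A11 : carrier_mat a b" "A12 : carrier_mat a l" "A21 : carrier_mat l b" "A22 : carrier_mat l l"
  and X: "X : carrier_mat l b" "A12 * X = A11" "A22 * X = A21"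
 shows "four_block_mat (1\<^sub>m a) A12 (0\<^sub>m l a) A22 * block_id a b l
  = four_block_mat A11 A12 A21 A22 * four_block_mat (1\<^sub>m b) (0\<^sub>m b l) (- X) (1\<^sub>m l)"
proof -
 have mX: "- X : carrier_mat l b" using X(1) by (rule uminus_carrier_mat)
 have 1: "A11 + A12 * (- X) = 0\<^sub>m a b" "A21 + A22 * (- X) = 0\<^sub>m l b"
  unfolding uminus_mult_right_mat[of A12 X, symmetric] uminus_mult_right_mat[of A22 X, symmetric] using A X by (auto intro!: eq_matI)
 have "four_block_mat (1\<^sub>m a) A12 (0\<^sub>m l a) A22 * block_id a b l = four_block_mat (0\<^sub>m a b) A12 (0\<^sub>m l b) A22"
  unfolding block_id_def
  by (subst mult_four_block_mat[OF one_carrier_mat A(2) zero_carrier_mat A(4) zero_carrier_mat zero_carrier_mat zero_carrier_mat one_carrier_mat])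
   (use A in auto)
 also have "... = four_block_mat A11 A12 A21 A22 * four_block_mat (1\<^sub>m b) (0\<^sub>m b l) (- X) (1\<^sub>m l)"
  by (subst mult_four_block_mat[OF A one_carrier_mat zero_carrier_mat mX one_carrier_mat])
   (use A 1 in auto)
 finally show ?thesis .
qed

text \<open>Elimination is done on the rearranged matrix \<open>?A'\<close>, where the Schur
  complement vanishes; the permutations are then carried back into the two transforming
  matrices.\<close>

lemma normal_form:
 fixes A :: "complex mat"
 assumes A: "A : carrier_mat (a + l) (b + l)" and rank: "vec_space.rank (a + l) A = l"
  and p: "p permutes {0..<a + l}" and q: "q permutes {0..<b + l}" and det: "det (pivot a b l p q A) ~= 0"
 shows "permute_rows (a + l) p (row_factor a b l p q A) * block_id a b l
    = A * permute_rows (b + l) q (col_factor a b l p q A)"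
proof -
 let ?A22 = "pivot a b l p q A"
 let ?A11 = "mat a b (%(i, j). A $$ (p i, q j))"
 let ?A12 = "mat a l (%(i, j). A $$ (p i, q (b + j)))"
 let ?A21 = "mat l b (%(i, j). A $$ (p (a + i), q j))"
 let ?H0 = "row_factor a b l p q A" and ?H1 = "col_factor a b l p q A"
 let ?X = "inv\<^bsub>GL l\<^esub> ?A22 * ?A21"
 have pl: "p i < a + l" if "i < a + l" for i using permutes_in_image[OF p, of i] that by simp
 have ql: "q i < b + l" if "i < b + l" for i using permutes_in_image[OF q, of i] that by simp
 obtain B C where BC: "B : carrier_mat (a + l) l" "C : carrier_mat l (b + l)" "A = B * C"
  by (rule rank_factorE[OF A, unfolded rank]) (rule that, assumption+)
 define B1 where "B1 = mat a l (%(i, k). B $$ (p i, k))"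
 define B2 where "B2 = mat l l (%(i, k). B $$ (p (a + i), k))"
 define C1 where "C1 = mat l b (%(k, j). C $$ (k, q j))"
 define C2 where "C2 = mat l l (%(k, j). C $$ (k, q (b + j)))"
 have c: "B1 : carrier_mat a l" "B2 : carrier_mat l l" "C1 : carrier_mat l b" "C2 : carrier_mat l l"
  by (auto simp: B1_def B2_def C1_def C2_def)
 have f: "?A11 = B1 * C1" "?A12 = B1 * C2" "?A21 = B2 * C1" "?A22 = B2 * C2" unfolding BC(3) pivot_def B1_def B2_def C1_def C2_def
  using BC(1,2) pl ql by (auto intro!: eq_matI simp: scalar_prod_def)
 have schur: "?A12 * ?X = ?A11" unfolding f by (rule low_rank_schur[OF c]) (use det f(4) in simp)
 have gl: "?A22 : carrier (GL l)" using det by (simp add: carrier_general_linear)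
 have X: "?X : carrier_mat l b" using gl_inv_carrier_mat[OF gl] by simp
 have "?A22 * ?X = (?A22 * inv\<^bsub>GL l\<^esub> ?A22) * ?A21"
  by (rule assoc_mult_mat[OF pivot_carrier gl_inv_carrier_mat[OF gl] mat_carrier, symmetric])
 then have AX: "?A22 * ?X = ?A21" by (simp only: gl_inv_cancel(2)[OF gl] left_mult_one_mat[OF mat_carrier])
 let ?A' = "four_block_mat ?A11 ?A12 ?A21 ?A22"
 have H: "?H0 * block_id a b l = ?A' * ?H1" unfolding row_factor_def col_factor_def
  by (rule block_schur[OF mat_carrier mat_carrier mat_carrier pivot_carrier X schur AX])
 have A': "?A' $$ (i, j) = A $$ (p i, q j)" if "i < a + l" "j < b + l" for i j
  using that by (subst four_block_mat_cases[of _ a b _ l l]) (auto simp: pivot_def)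
 have H1c: "?H1 : carrier_mat (b + l) (b + l)" "?H0 : carrier_mat (a + l) (a + l)"
  using col_factor_general_linear[OF det] row_factor_general_linear[OF det] by (auto dest: gl_carrier_mat)
 show ?thesis
 proof (rule eq_matI)
  fix i k assume "i < dim_row (A * permute_rows (b + l) q ?H1)" "k < dim_col (A * permute_rows (b + l) q ?H1)"
  then have ik: "i < a + l" "k < b + l" using A by (auto simp: permute_rows_def)
  let ?i = "Hilbert_Choice.inv p i"
  have i: "?i < a + l" "p ?i = i" using permutes_in_image[OF permutes_inv[OF p], of i] ik permutes_inverses(1)[OF p] by auto
  have P: "permute_rows (a + l) p ?H0 : carrier_mat (a + l) (a + l)"
   "permute_rows (b + l) q ?H1 : carrier_mat (b + l) (b + l)" by (auto simp: permute_rows_def)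
  have A'c: "?A' : carrier_mat (a + l) (b + l)" by simp
  have "(permute_rows (a + l) p ?H0 * block_id a b l) $$ (i, k)
    = (\<Sum>t = 0..<a + l. ?H0 $$ (?i, t) * block_id a b l $$ (t, k))"
   unfolding mat_mult_entry[OF P(1) block_id_carrier ik] using ik by (simp add: permute_rows_def)
  also have "... = (?H0 * block_id a b l) $$ (?i, k)" by (rule mat_mult_entry[OF H1c(2) block_id_carrier i(1) ik(2), symmetric])
  also have "... = (?A' * ?H1) $$ (?i, k)" unfolding H ..
  also have "... = (\<Sum>j = 0..<b + l. A $$ (i, q j) * ?H1 $$ (j, k))" unfolding mat_mult_entry[OF A'c H1c(1) i(1) ik(2)]
   by (rule sum.cong[OF refl]) (simp only: A'[OF i(1)] i(2) atLeastLessThan_iff)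
  \<comment> \<open>Re-indexing the sum along \<open>q\<close> turns the column permutation of
    \<open>A\<close> into a row permutation of the other factor.\<close>
  also have "... = (\<Sum>j = 0..<b + l. A $$ (i, q j) * ?H1 $$ (Hilbert_Choice.inv q (q j), k))"
   by (simp only: permutes_inverses(2)[OF q])
  also have "... = (\<Sum>j = 0..<b + l. A $$ (i, j) * ?H1 $$ (Hilbert_Choice.inv q j, k))"
   using sum.permute[OF q, of "%j. A $$ (i, j) * ?H1 $$ (Hilbert_Choice.inv q j, k)"] by (simp only: o_def)
  also have "... = (A * permute_rows (b + l) q ?H1) $$ (i, k)"
   unfolding mat_mult_entry[OF A P(2) ik] using ik by (simp add: permute_rows_def)
  finally show "(permute_rows (a + l) p ?H0 * block_id a b l) $$ (i, k) = (A * permute_rows (b + l) q ?H1) $$ (i, k)" .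
 qed (use A block_id_carrier[of a b l] in "auto simp: permute_rows_def")
qed

lemma pivot_exists:
 fixes A :: "complex mat"
 assumes A: "A : carrier_mat (a + l) (b + l)" and rank: "vec_space.rank (a + l) A = l"
 obtains p q where "p permutes {0..<a + l}" "q permutes {0..<b + l}" "det (pivot a b l p q A) ~= 0"
proof -
 obtain rs js where rs: "!!k. k < l ==> rs k < a + l" and js: "!!k. k < l ==> js k < b + l"
  and m: "det (mat l l (%(i, k). A $$ (rs i, js k))) ~= 0" by (rule rank_minor[OF A rank]) (rule that, assumption+)
 obtain p where p: "p permutes {0..<a + l}" "!!k. k < l ==> p (a + k) = rs k"
  by (rule permutation_extending[OF minor_injective(1)[OF m] rs]) (assumption, rule that, assumption+)
 obtain q where q: "q permutes {0..<b + l}" "!!k. k < l ==> q (b + k) = js k"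
  by (rule permutation_extending[OF minor_injective(2)[OF m] js]) (assumption, rule that, assumption+)
 have "pivot a b l p q A = mat l l (%(i, k). A $$ (rs i, js k))" unfolding pivot_def using p(2) q(2) by (intro eq_matI) auto
 then show ?thesis using that p(1) q(1) m by simp
qed

lemma continuous_map_four_block:
 assumes "continuous_map Z (mat_topology n1 m1) A" "continuous_map Z (mat_topology n1 m2) B"
  "continuous_map Z (mat_topology n2 m1) C" "continuous_map Z (mat_topology n2 m2) D"
 shows "continuous_map Z (mat_topology (n1 + n2) (m1 + m2)) (%z. four_block_mat (A z) (B z) (C z) (D z))"
proof (rule continuous_map_matI)
 fix z assume "z : topspace Z"
 then show "four_block_mat (A z) (B z) (C z) (D z) : carrier_mat (n1 + n2) (m1 + m2)"
  using continuous_map_matD(1)[OF assms(1)] continuous_map_matD(1)[OF assms(4)] by (intro four_block_carrier_mat) auto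
next
 fix i j assume ij: "i < n1 + n2" "j < m1 + m2"
 have "continuous_map Z euclidean (%z. if i < n1 then if j < m1 then A z $$ (i, j) else B z $$ (i, j - m1)
   else if j < m1 then C z $$ (i - n1, j) else D z $$ (i - n1, j - m1))"
  using ij continuous_map_matD(2)[OF assms(1)] continuous_map_matD(2)[OF assms(2)]
   continuous_map_matD(2)[OF assms(3)] continuous_map_matD(2)[OF assms(4)] by (cases "i < n1"; cases "j < m1") auto
 then show "continuous_map Z euclidean (%z. four_block_mat (A z) (B z) (C z) (D z) $$ (i, j))" by (rule continuous_map_eq)
   (use ij continuous_map_matD(1)[OF assms(1)] continuous_map_matD(1)[OF assms(4)] in
    \<open>simp add: four_block_mat_cases[of _ n1 m1 _ n2 m2]\<close>)
qed

lemma continuous_map_mat_const: "A : carrier_mat r k ==> continuous_map Z (mat_topology r k) (%_. A)" by simp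

lemma continuous_map_submatrix:
 assumes A: "continuous_map Z (mat_topology r k) A" and "!!i. i < r' ==> f i < r" "!!j. j < k' ==> g j < k"
 shows "continuous_map Z (mat_topology r' k') (%z. mat r' k' (%(i, j). A z $$ (f i, g j)))"
 by (rule continuous_map_matI) (use assms(2,3) continuous_map_matD(2)[OF A] in auto)

lemma continuous_map_factors:
 assumes A: "continuous_map Z (mat_topology (a + l) (b + l)) A" and p: "p permutes {0..<a + l}" and q: "q permutes {0..<b + l}"
 shows "continuous_map Z (mat_topology l l) (%z. pivot a b l p q (A z))"
  and "(!!z. z : topspace Z ==> det (pivot a b l p q (A z)) ~= 0) ==>
    continuous_map Z (gl_topology (a + l)) (%z. permute_rows (a + l) p (row_factor a b l p q (A z)))"
  and "(!!z. z : topspace Z ==> det (pivot a b l p q (A z)) ~= 0) ==>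
    continuous_map Z (gl_topology (b + l)) (%z. permute_rows (b + l) q (col_factor a b l p q (A z)))"
proof -
 have pl: "p i < a + l" if "i < a + l" for i using permutes_in_image[OF p, of i] that by simp
 have ql: "q i < b + l" if "i < b + l" for i using permutes_in_image[OF q, of i] that by simp
 have pil: "Hilbert_Choice.inv p i < a + l" if "i < a + l" for i using permutes_in_image[OF permutes_inv[OF p], of i] that by simp
 have qil: "Hilbert_Choice.inv q i < b + l" if "i < b + l" for i using permutes_in_image[OF permutes_inv[OF q], of i] that by simp
 show pc: "continuous_map Z (mat_topology l l) (%z. pivot a b l p q (A z))"
  unfolding pivot_def by (rule continuous_map_submatrix[OF A]) (use pl ql in auto)
 assume nz: "!!z. z : topspace Z ==> det (pivot a b l p q (A z)) ~= 0"
 have "continuous_map Z (mat_topology (a + l) (a + l)) (%z. row_factor a b l p q (A z))" unfolding row_factor_def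
  by (intro continuous_map_four_block continuous_map_mat_const pc continuous_map_submatrix[OF A])
   (use pl ql in auto)
 then have "continuous_map Z (mat_topology (a + l) (a + l)) (%z. permute_rows (a + l) p (row_factor a b l p q (A z)))"
  unfolding permute_rows_def by (rule continuous_map_submatrix) (use pil in auto)
 then show "continuous_map Z (gl_topology (a + l)) (%z. permute_rows (a + l) p (row_factor a b l p q (A z)))"
  unfolding continuous_map_gl_topology using permute_rows_general_linear[OF p] row_factor_general_linear nz by blast
 have "continuous_map Z (gl_topology l) (%z. pivot a b l p q (A z))"
  unfolding continuous_map_gl_topology using pc nz by (simp add: carrier_general_linear)
 from topological_group.continuous_map_inv[OF topological_group_general_linear this]
 have pic: "continuous_map Z (mat_topology l l) (%z. inv\<^bsub>GL l\<^esub> (pivot a b l p q (A z)))"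
  unfolding continuous_map_gl_topology by simp
 have "continuous_map Z (mat_topology l b) (%z. inv\<^bsub>GL l\<^esub> (pivot a b l p q (A z)) * mat l b (%(i, j). A z $$ (p (a + i), q j)))"
  by (intro continuous_map_mat_mult[OF pic] continuous_map_submatrix[OF A]) (use pl ql in auto)
 then have "continuous_map Z (mat_topology l b) (%z. - (inv\<^bsub>GL l\<^esub> (pivot a b l p q (A z)) * mat l b (%(i, j). A z $$ (p (a + i), q j))))"
  (is "continuous_map Z _ (%z. - ?Y z)")
 proof (intro continuous_map_matI)
  assume Y: "continuous_map Z (mat_topology l b) ?Y"
  show "- ?Y z : carrier_mat l b" if "z : topspace Z" for z using continuous_map_matD(1)[OF Y that] by (intro uminus_carrier_mat)
  fix i j assume ij: "i < l" "j < b"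
  have "continuous_map Z euclidean (%z. - (?Y z $$ (i, j)))" by (intro continuous_map_minus continuous_map_matD(2)[OF Y] ij)
  then show "continuous_map Z euclidean (%z. (- ?Y z) $$ (i, j))"
  proof (rule continuous_map_eq)
   fix z assume "z : topspace Z"
   then have "?Y z : carrier_mat l b" by (rule continuous_map_matD(1)[OF Y])
   then show "- (?Y z $$ (i, j)) = (- ?Y z) $$ (i, j)" using ij by (subst index_uminus_mat) (simp_all only: carrier_matD)
  qed
 qed
 then have "continuous_map Z (mat_topology (b + l) (b + l)) (%z. col_factor a b l p q (A z))"
  unfolding col_factor_def by (intro continuous_map_four_block continuous_map_mat_const) auto
 then have "continuous_map Z (mat_topology (b + l) (b + l)) (%z. permute_rows (b + l) q (col_factor a b l p q (A z)))"
  unfolding permute_rows_def by (rule continuous_map_submatrix) (use qil in auto)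
 then show "continuous_map Z (gl_topology (b + l)) (%z. permute_rows (b + l) q (col_factor a b l p q (A z)))"
  unfolding continuous_map_gl_topology using permute_rows_general_linear[OF q] col_factor_general_linear nz by blast
qed

section \<open>Block diagonal embeddings\<close>

definition diag2 :: "nat => nat => complex mat => complex mat => complex mat" where
 "diag2 m n A D = four_block_mat A (0\<^sub>m m n) (0\<^sub>m n m) D"

lemma diag2_carrier:
 "A : carrier_mat m m ==> D : carrier_mat n n ==> diag2 m n A D : carrier_mat (m + n) (m + n)" by (simp add: diag2_def)

lemma diag2_mult:
 assumes "A : carrier_mat m m" "D : carrier_mat n n" "A' : carrier_mat m m" "D' : carrier_mat n n"
 shows "diag2 m n A D * diag2 m n A' D' = diag2 m n (A * A') (D * D')" unfolding diag2_def
 by (subst mult_four_block_mat[OF assms(1) zero_carrier_mat zero_carrier_mat assms(2,3) zero_carrier_mat zero_carrier_mat assms(4)])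
  (use assms in auto)

lemma det_diag2:
 assumes "A : carrier_mat m m" "D : carrier_mat n n" shows "det (diag2 m n A D) = det A * det D"
 unfolding diag2_def by (rule det_four_block_mat_upper_right_zero[OF assms(1) refl zero_carrier_mat assms(2)])

lemma diag2_general_linear:
 assumes "A : carrier (GL m)" "D : carrier (GL n)" shows "diag2 m n A D : carrier (GL (m + n))"
 using assms diag2_carrier[of A m D n] det_diag2[of A m D n] by (auto simp: carrier_general_linear)

lemma diag2_inv:
 assumes A: "A : carrier (GL m)" and D: "D : carrier (GL n)" shows "inv\<^bsub>GL (m + n)\<^esub> (diag2 m n A D) =
  diag2 m n (inv\<^bsub>GL m\<^esub> A) (inv\<^bsub>GL n\<^esub> D)"
proof -
 interpret group "GL (m + n)" by (rule group_general_linear)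
 let ?A = "inv\<^bsub>GL m\<^esub> A" and ?D = "inv\<^bsub>GL n\<^esub> D"
 have i: "?A : carrier (GL m)" "?D : carrier (GL n)" using group.inv_closed[OF group_general_linear] A D by auto
 have "diag2 m n ?A ?D * diag2 m n A D = diag2 m n (1\<^sub>m m) (1\<^sub>m n)"
  by (simp only: diag2_mult[OF gl_carrier_mat[OF i(1)] gl_carrier_mat[OF i(2)] gl_carrier_mat[OF A] gl_carrier_mat[OF D]]
    gl_inv_cancel[OF A] gl_inv_cancel[OF D])
 also have "... = 1\<^sub>m (m + n)" by (simp add: diag2_def)
 finally show ?thesis using inv_equality[OF _ diag2_general_linear[OF A D] diag2_general_linear[OF i]] by simp
qed

lemma diag2_conj:
 assumes A: "A : carrier (GL m)" and D: "D : carrier (GL n)" and A': "A' : carrier (GL m')" and D': "D' : carrier (GL n')"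
  and X: "X : carrier_mat m m'" and Y: "Y : carrier_mat m n'" and Z: "Z : carrier_mat n m'" and W: "W : carrier_mat n n'"
 shows "diag2 m n A D * four_block_mat X Y Z W * inv\<^bsub>GL (m' + n')\<^esub> (diag2 m' n' A' D')
  = four_block_mat (A * X * inv\<^bsub>GL m'\<^esub> A') (A * Y * inv\<^bsub>GL n'\<^esub> D')
    (D * Z * inv\<^bsub>GL m'\<^esub> A') (D * W * inv\<^bsub>GL n'\<^esub> D')"
proof -
 note c = gl_carrier_mat[OF A] gl_carrier_mat[OF D] gl_inv_carrier_mat[OF A'] gl_inv_carrier_mat[OF D']
 have "diag2 m n A D * four_block_mat X Y Z W = four_block_mat (A * X) (A * Y) (D * Z) (D * W)" unfolding diag2_def
  by (subst mult_four_block_mat[OF c(1) zero_carrier_mat zero_carrier_mat c(2) X Y Z W])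
   (use c X Y Z W in "auto intro!: cong_four_block_mat")
 then show ?thesis unfolding diag2_inv[OF A' D'] unfolding diag2_def
  by (simp only:, subst mult_four_block_mat[of _ m m' _ n' _ n _ _ m' _ n'])
   (use c X Y Z W in "auto intro!: cong_four_block_mat mult_carrier_mat")
qed

lemma off_scale_trivial: "A : carrier_mat n n ==> off_scale n s A = A" by (intro eq_matI) (auto simp: off_scale_def)

lemma upper_left_trivial: "A : carrier_mat n n ==> upper_left n A = A" by (intro eq_matI) (auto simp: upper_left_def)

lemma diag2_trivial: "A : carrier_mat m m ==> diag2 m 0 A (1\<^sub>m 0) = A" by (intro eq_matI) (auto simp: diag2_def)

section \<open>The strata\<close>

locale unlinking = fin_digraph Q for Q :: "('v, 'e) pre_digraph" +
 fixes c d :: 'e and ep :: "'v option => nat"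
 assumes c: "c : arcs Q" and d: "d : arcs Q" and cd: "tail Q c ~= head Q c"
  "tail Q d = head Q c" "head Q d = tail Q c"
begin

abbreviation "U == unlink Q c d"
abbreviation "dv == unlink_dim Q c ep"
abbreviation "l == ep None"
abbreviation "v0 == head Q d"
abbreviation "v1 == tail Q d"
abbreviation "n0 i == ep (Some i)"

text \<open>The size of the starred block at a vertex. Taking it to be \<open>0\<close> away from
  the two-cycle gives all vertices and arrows the same four-block shape, with empty blocks where
  nothing is added.\<close>

definition ex :: "'v => nat" where "ex i = (if i = v0 \<or> i = v1 then l else 0)"

lemma dv_eq: "dv i = n0 i + ex i" using cd by (auto simp: unlink_dim_def ex_def)

lemma v01: "v0 ~= v1" "v0 : verts Q" "v1 : verts Q" "c ~= d"
proof -
 show "v0 ~= v1" using cd by metis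
 show "v0 : verts Q" "v1 : verts Q" by (rule head_in_verts[OF d], rule tail_in_verts[OF d])
 show "c ~= d" using cd by metis
qed

lemma ex_v [simp]: "ex v0 = l" "ex v1 = l" by (auto simp: ex_def)

lemma verts_U [simp]: "verts U = insert None (Some ` verts Q)" by (simp add: unlink_def)

lemma head_U [simp]: "head U x = unlink_head Q x" and tail_U [simp]: "tail U x = unlink_tail Q x" by (simp_all add: unlink_def)

lemma arcs_U:
 "Plain a : arcs U \<longleftrightarrow> a : arcs Q & a ~= c & a ~= d"
 "From_star a : arcs U \<longleftrightarrow> a : arcs Q & a ~= c & a ~= d & tail Q a : {v0, v1}"
 "To_star a : arcs U \<longleftrightarrow> a : arcs Q & a ~= c & a ~= d & head Q a : {v0, v1}"
 "Loop_star a : arcs U \<longleftrightarrow> a : arcs Q & a ~= d & tail Q a : {v0, v1} & head Q a : {v0, v1}"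
proof -
 have Z: "{tail Q c, head Q c} = {v0, v1}" "tail Q c : {v0, v1}" "head Q c : {v0, v1}" using cd by auto
 have "Plain a : arrows_from Q c d a' \<longleftrightarrow> a' = a & a ~= c & a ~= d"
  "From_star a : arrows_from Q c d a' \<longleftrightarrow> a' = a & a ~= c & a ~= d & tail Q a : {v0, v1}"
  "To_star a : arrows_from Q c d a' \<longleftrightarrow> a' = a & a ~= c & a ~= d & head Q a : {v0, v1}"
  "Loop_star a : arrows_from Q c d a' \<longleftrightarrow> a' = a & a ~= d & tail Q a : {v0, v1} & head Q a : {v0, v1}" for a'
  unfolding arrows_from_def Z(1) Let_def using Z(2,3) v01(4) by (auto split: if_splits)
 then show "Plain a : arcs U \<longleftrightarrow> a : arcs Q & a ~= c & a ~= d"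
  "From_star a : arcs U \<longleftrightarrow> a : arcs Q & a ~= c & a ~= d & tail Q a : {v0, v1}"
  "To_star a : arcs U \<longleftrightarrow> a : arcs Q & a ~= c & a ~= d & head Q a : {v0, v1}"
  "Loop_star a : arcs U \<longleftrightarrow> a : arcs Q & a ~= d & tail Q a : {v0, v1} & head Q a : {v0, v1}"
  unfolding unlink_def by auto
qed

lemma arcs_U_cases:
 assumes "x : arcs U"
 obtains a where "a : arcs Q" "x = Plain a" | a where "a : arcs Q" "x = From_star a"
 | a where "a : arcs Q" "x = To_star a" | a where "a : arcs Q" "x = Loop_star a" using assms by (cases x) (auto simp: arcs_U)

sublocale U: wf_digraph U
proof
 fix x assume "x : arcs U"
 then show "tail U x : verts U" "head U x : verts U" by (cases rule: arcs_U_cases; auto)+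
qed

abbreviation "GU == BG U ep"
abbreviation "GQ == BG Q dv"

definition corner :: "('v option => complex mat) => 'v => complex mat" where
 "corner g i = (if i = v0 \<or> i = v1 then g None else 1\<^sub>m 0)"

definition ph :: "('v option => complex mat) => 'v => complex mat" where
 "ph g = (\<lambda>i\<in>verts Q. diag2 (n0 i) (ex i) (g (Some i)) (corner g i))"

text \<open>In \<open>f\<close>, a block without an arrow of the unlinked quiver is either empty or
  belongs to \<open>c\<close>, of which only the corner between the two starred parts survives. Zero
  is the right value in both cases.\<close>

definition part :: "('e unlink_arrow => complex mat) => 'e unlink_arrow => nat => nat => complex mat" where
 "part rh x r k = (if x : arcs U then rh x else 0\<^sub>m r k)"

definition f :: "('e unlink_arrow => complex mat) => 'e => complex mat" where
 "f rh = (\<lambda>a\<in>arcs Q. if a = d then block_id (n0 v0) (n0 v1) l else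
   four_block_mat (part rh (Plain a) (n0 (head Q a)) (n0 (tail Q a)))
    (part rh (From_star a) (n0 (head Q a)) (ex (tail Q a)))
    (part rh (To_star a) (ex (head Q a)) (n0 (tail Q a)))
    (part rh (Loop_star a) (ex (head Q a)) (ex (tail Q a))))"

abbreviation "RU == topspace (rep_space U ep)"
abbreviation "RQ == topspace (rep_space Q dv)"

lemma RU_mem: "rh : RU ==> x : arcs U ==> rh x : carrier_mat (ep (unlink_head Q x)) (ep (unlink_tail Q x))"
 unfolding topspace_rep_space by (drule PiE_mem) auto

lemma part_carrier:
 assumes "rh : RU" "a : arcs Q" shows "part rh (Plain a) (n0 (head Q a)) (n0 (tail Q a)) : carrier_mat (n0 (head Q a)) (n0 (tail Q a))"
  "part rh (From_star a) (n0 (head Q a)) (ex (tail Q a)) : carrier_mat (n0 (head Q a)) (ex (tail Q a))"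
  "part rh (To_star a) (ex (head Q a)) (n0 (tail Q a)) : carrier_mat (ex (head Q a)) (n0 (tail Q a))"
  "part rh (Loop_star a) (ex (head Q a)) (ex (tail Q a)) : carrier_mat (ex (head Q a)) (ex (tail Q a))"
 using RU_mem[OF assms(1), of "Plain a"] RU_mem[OF assms(1), of "From_star a"]
  RU_mem[OF assms(1), of "To_star a"] RU_mem[OF assms(1), of "Loop_star a"] by (auto simp: part_def ex_def arcs_U)

lemma GU_mem: "g : carrier GU ==> i : verts Q ==> g (Some i) : carrier (GL (n0 i))"
 "g : carrier GU ==> g None : carrier (GL l)" by (auto simp: carrier_base_change_group)

lemma GQ_mem: "g : carrier GQ ==> i : verts Q ==> g i : carrier (GL (n0 i + ex i))"
 by (auto simp: carrier_base_change_group dv_eq[symmetric])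

lemma corner_GL: "g : carrier GU ==> corner g i : carrier (GL (ex i))"
 using GU_mem(2) by (auto simp: corner_def ex_def carrier_general_linear)

lemma ph_closed: "g : carrier GU ==> ph g : carrier GQ" using diag2_general_linear[OF GU_mem(1) corner_GL]
 by (auto simp: ph_def carrier_base_change_group dv_eq)

lemma ph_hom: "ph : hom GU GQ"
proof (rule homI)
 fix g h assume g: "g : carrier GU" and h: "h : carrier GU"
 show "ph (g \<otimes>\<^bsub>GU\<^esub> h) = ph g \<otimes>\<^bsub>GQ\<^esub> ph h"
 proof (rule ext)
  fix i
  show "ph (g \<otimes>\<^bsub>GU\<^esub> h) i = (ph g \<otimes>\<^bsub>GQ\<^esub> ph h) i"
  proof (cases "i : verts Q")
   case True
   have "corner (g \<otimes>\<^bsub>GU\<^esub> h) i = corner g i * corner h i" by (simp add: corner_def base_change_group_def)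
   then show ?thesis using True diag2_mult[OF gl_carrier_mat[OF GU_mem(1)[OF g True]] gl_carrier_mat[OF corner_GL[OF g, of i]]
      gl_carrier_mat[OF GU_mem(1)[OF h True]] gl_carrier_mat[OF corner_GL[OF h, of i]]] by (simp add: ph_def base_change_group_def)
  qed (simp add: ph_def base_change_group_def)
 qed
qed (rule ph_closed)

lemma f_closed:
 assumes "rh : RU" shows "f rh : RQ" unfolding topspace_rep_space
proof (rule PiE_I)
 fix a assume a: "a : arcs Q"
 show "f rh a : carrier_mat (dv (head Q a)) (dv (tail Q a))"
  using a block_id_carrier[of "n0 v0" "n0 v1" l] four_block_carrier_mat[OF part_carrier(1,4)[OF assms a]] by (auto simp: f_def dv_eq)
qed (simp add: f_def)

lemma zero_conj: "A : carrier_mat r r ==> B : carrier_mat k k ==> A * 0\<^sub>m r k * B = 0\<^sub>m r k" by auto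

text \<open>Blocks without an arrow are zero and stay zero under multiplication, so every block
  transforms like a map between its own two spaces.\<close>

lemma part_base_change:
 assumes g: "g : carrier GU" and a: "a : arcs Q" shows "part (base_change U ep g rh) (Plain a) (n0 (head Q a)) (n0 (tail Q a)) =
   g (Some (head Q a)) * part rh (Plain a) (n0 (head Q a)) (n0 (tail Q a)) * inv\<^bsub>GL (n0 (tail Q a))\<^esub> (g (Some (tail Q a)))"
  and "part (base_change U ep g rh) (From_star a) (n0 (head Q a)) (ex (tail Q a)) =
   g (Some (head Q a)) * part rh (From_star a) (n0 (head Q a)) (ex (tail Q a)) * inv\<^bsub>GL (ex (tail Q a))\<^esub> (corner g (tail Q a))"
  and "part (base_change U ep g rh) (To_star a) (ex (head Q a)) (n0 (tail Q a)) =
   corner g (head Q a) * part rh (To_star a) (ex (head Q a)) (n0 (tail Q a)) * inv\<^bsub>GL (n0 (tail Q a))\<^esub> (g (Some (tail Q a)))"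
  and "part (base_change U ep g rh) (Loop_star a) (ex (head Q a)) (ex (tail Q a)) =
   corner g (head Q a) * part rh (Loop_star a) (ex (head Q a)) (ex (tail Q a)) * inv\<^bsub>GL (ex (tail Q a))\<^esub> (corner g (tail Q a))"
proof -
 have v: "head Q a : verts Q" "tail Q a : verts Q" using a by auto
 note c = gl_carrier_mat[OF GU_mem(1)[OF g v(1)]] gl_carrier_mat[OF corner_GL[OF g, of "head Q a"]]
  gl_inv_carrier_mat[OF GU_mem(1)[OF g v(2)]] gl_inv_carrier_mat[OF corner_GL[OF g, of "tail Q a"]]
 note z = zero_conj[OF c(1,3)] zero_conj[OF c(1,4)] zero_conj[OF c(2,3)] zero_conj[OF c(2,4)]
 have co: "i : {v0, v1} ==> corner g i = g None & ex i = l" for i by (auto simp: corner_def ex_def)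
 show "part (base_change U ep g rh) (Plain a) (n0 (head Q a)) (n0 (tail Q a)) =
   g (Some (head Q a)) * part rh (Plain a) (n0 (head Q a)) (n0 (tail Q a)) * inv\<^bsub>GL (n0 (tail Q a))\<^esub> (g (Some (tail Q a)))"
  using z by (simp add: part_def base_change_def)
 show "part (base_change U ep g rh) (From_star a) (n0 (head Q a)) (ex (tail Q a)) =
   g (Some (head Q a)) * part rh (From_star a) (n0 (head Q a)) (ex (tail Q a)) * inv\<^bsub>GL (ex (tail Q a))\<^esub> (corner g (tail Q a))"
  using z co[of "tail Q a"] by (auto simp: part_def base_change_def arcs_U)
 show "part (base_change U ep g rh) (To_star a) (ex (head Q a)) (n0 (tail Q a)) =
   corner g (head Q a) * part rh (To_star a) (ex (head Q a)) (n0 (tail Q a)) * inv\<^bsub>GL (n0 (tail Q a))\<^esub> (g (Some (tail Q a)))"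
  using z co[of "head Q a"] by (auto simp: part_def base_change_def arcs_U)
 show "part (base_change U ep g rh) (Loop_star a) (ex (head Q a)) (ex (tail Q a)) =
   corner g (head Q a) * part rh (Loop_star a) (ex (head Q a)) (ex (tail Q a)) * inv\<^bsub>GL (ex (tail Q a))\<^esub> (corner g (tail Q a))"
  using z co[of "head Q a"] co[of "tail Q a"] by (auto simp: part_def base_change_def arcs_U)
qed

lemma f_equivariant:
 assumes g: "g : carrier GU" and rh: "rh : RU" shows "f (base_change U ep g rh) = base_change Q dv (ph g) (f rh)"
proof (rule ext)
 fix a
 show "f (base_change U ep g rh) a = base_change Q dv (ph g) (f rh) a"
 proof (cases "a : arcs Q")
  case a: True
  have v: "head Q a : verts Q" "tail Q a : verts Q" using a by auto
  note gl = GU_mem(1)[OF g v(1)] corner_GL[OF g, of "head Q a"] GU_mem(1)[OF g v(2)] corner_GL[OF g, of "tail Q a"]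
  show ?thesis
  proof (cases "a = d")
   case False
   then show ?thesis using a v diag2_conj[OF gl part_carrier[OF rh a]] part_base_change[OF g a, of rh]
    by (simp add: f_def base_change_def[of Q] ph_def dv_eq)
  next
   case True
   have cc: "corner g v0 = g None" "corner g v1 = g None" by (auto simp: corner_def)
   note glt = gl[unfolded True cc ex_v]
   \<comment> \<open>Both ends of \<open>d\<close> carry the same corner \<open>g None\<close>,
     which therefore fixes the identity block.\<close>
   have 1: "g None * 1\<^sub>m l * inv\<^bsub>GL l\<^esub> g None = 1\<^sub>m l"
    using gl_carrier_mat[OF glt(2)] gl_inv_cancel[OF glt(2)] by simp
   show ?thesis using a v diag2_conj[OF glt zero_carrier_mat zero_carrier_mat zero_carrier_mat one_carrier_mat] True 1
     gl_carrier_mat[OF glt(1)] gl_inv_carrier_mat[OF glt(3)] gl_carrier_mat[OF glt(2)] gl_inv_carrier_mat[OF glt(4)]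
    by (simp add: f_def base_change_def[of Q] ph_def dv_eq block_id_def cc)
  qed
 qed (simp add: f_def base_change_def)
qed

end

lemma continuous_map_mat_scale:
 assumes s: "continuous_map Z euclideanreal s" and A: "continuous_map Z (mat_topology r k) A"
 shows "continuous_map Z (mat_topology r k) (%z. complex_of_real (s z) \<cdot>\<^sub>m A z)"
proof (rule continuous_map_matI)
 show "complex_of_real (s z) \<cdot>\<^sub>m A z : carrier_mat r k" if "z : topspace Z" for z
  using continuous_map_matD(1)[OF A that] by simp
 fix i j assume ij: "i < r" "j < k"
 have "continuous_map Z euclidean (%z. complex_of_real (s z) * A z $$ (i, j))"
  by (intro continuous_map_of_real_mult s continuous_map_matD(2)[OF A] ij)
 then show "continuous_map Z euclidean (%z. (complex_of_real (s z) \<cdot>\<^sub>m A z) $$ (i, j))"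
 proof (rule continuous_map_eq)
  fix z assume "z : topspace Z"
  then have "A z : carrier_mat r k" by (rule continuous_map_matD(1)[OF A])
  then show "complex_of_real (s z) * A z $$ (i, j) = (complex_of_real (s z) \<cdot>\<^sub>m A z) $$ (i, j)" using ij by simp
 qed
qed

lemma scale_conj:
 fixes A X B :: "complex mat"
 assumes "A : carrier_mat r r" "X : carrier_mat r k" "B : carrier_mat k k"
 shows "A * (s \<cdot>\<^sub>m X) * B = s \<cdot>\<^sub>m (A * X * B)"
 using assms by (simp add: mult_smult_distrib[of _ r r _ k] mult_smult_assoc_mat[of _ r k _ k])

lemma scale_0 [simp]: "A : carrier_mat r k ==> complex_of_real 0 \<cdot>\<^sub>m A = 0\<^sub>m r k" by (intro eq_matI) auto

lemma scale_1 [simp]: "complex_of_real 1 \<cdot>\<^sub>m A = A" by (intro eq_matI) auto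

lemma gl_continuous_inclusion: "continuous_map Z (gl_topology n) f ==> continuous_map Z (mat_topology n n) f"
 by (simp add: continuous_map_gl_topology)

context wf_digraph begin

definition rep_scale :: "real \<times> ('b => complex mat) => 'b => complex mat" where
 "rep_scale = (%(s, rh). \<lambda>a\<in>arcs G. complex_of_real s \<cdot>\<^sub>m rh a)"

lemma base_change_scale:
 assumes "g : carrier (BG G \<gamma>)" "rh : topspace (rep_space G \<gamma>)" "a : arcs G"
 shows "g (head G a) * (s \<cdot>\<^sub>m rh a) * inv\<^bsub>GL (\<gamma> (tail G a))\<^esub> (g (tail G a)) = s \<cdot>\<^sub>m base_change G \<gamma> g rh a"
proof -
 have "g i : carrier (GL (\<gamma> i))" if "i : verts G" for i using PiE_mem[OF assms(1)[unfolded carrier_base_change_group] that] .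
 note gl = this[OF head_in_verts[OF assms(3)]] this[OF tail_in_verts[OF assms(3)]]
 show ?thesis
  using scale_conj[OF gl_carrier_mat[OF gl(1)] PiE_mem[OF assms(2)[unfolded topspace_rep_space] assms(3)] gl_inv_carrier_mat[OF gl(2)]] assms(3)
  by (simp add: base_change_def)
qed

lemma continuous_rep_scale:
 "continuous_map (prod_topology I01 (rep_space G \<gamma>)) (rep_space G \<gamma>) rep_scale"
proof -
 let ?Z = "prod_topology I01 (rep_space G \<gamma>)"
 have s: "continuous_map ?Z euclideanreal fst" by (rule continuous_map_into_fulltopology[OF continuous_map_fst])
 show ?thesis unfolding rep_scale_def rep_space_def case_prod_unfold
 proof (rule continuous_map_coordinatewise_then_product; unfold rep_space_def[symmetric])
  fix a assume a: "a : arcs G"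
  have "continuous_map (rep_space G \<gamma>) (mat_topology (\<gamma> (head G a)) (\<gamma> (tail G a))) (%rh. rh a)"
   unfolding rep_space_def by (rule continuous_map_product_coordinates[OF a])
  from continuous_map_mat_scale[OF s continuous_map_compose[OF continuous_map_snd this, unfolded o_def]]
  show "continuous_map ?Z (mat_topology (\<gamma> (head G a)) (\<gamma> (tail G a))) (%z. (\<lambda>a\<in>arcs G. complex_of_real (fst z) \<cdot>\<^sub>m snd z a) a)"
   using a by simp
 qed simp
qed

lemma rep_scale:
 assumes r: "rh : topspace (rep_space G \<gamma>)"
 shows "rep_scale (0, rh) = (\<lambda>a\<in>arcs G. 0\<^sub>m (\<gamma> (head G a)) (\<gamma> (tail G a)))" "rep_scale (1, rh) = rh"
  "g : carrier (BG G \<gamma>) ==> rep_scale (s, base_change G \<gamma> g rh) = base_change G \<gamma> g (rep_scale (s, rh))"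
 using scale_0[OF PiE_mem[OF r[unfolded topspace_rep_space]]] PiE_arb[OF r[unfolded topspace_rep_space]] base_change_scale[OF _ r]
 by (auto simp: rep_scale_def base_change_def[of G \<gamma> g "restrict _ _"] fun_eq_iff)

end

lemma block_id_rank: "vec_space.rank (a + l) (block_id a b l) = l"
proof -
 let ?B = "mat (a + l) l (%(i, k). if i = a + k then 1 else 0) :: complex mat"
 let ?C = "mat l (b + l) (%(k, j). if j = b + k then 1 else 0) :: complex mat"
 have "(?B * ?C) $$ (i, j) = block_id a b l $$ (i, j)" if ij: "i < a + l" "j < b + l" for i j
 proof -
  have "(?B * ?C) $$ (i, j) = (\<Sum>k = 0..<l. (if i = a + k then 1 else 0) * (if j = b + k then 1 else 0))"
   unfolding mat_mult_entry[OF mat_carrier mat_carrier ij] using ij by (intro sum.cong) auto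
  also have "... = (if i < a \<or> j < b then 0 else if i - a = j - b then 1 else 0)"
  proof (cases "i < a \<or> j < b")
   case False
   have "(\<Sum>k = 0..<l. (if i = a + k then 1 else 0) * (if j = b + k then 1 else (0::complex)))
     = (\<Sum>k = 0..<l. if k = i - a then (if i - a = j - b then 1 else 0) else 0)" using False by (intro sum.cong) auto
   moreover have "i - a < l" "j - b < l" using False ij by arith+
   ultimately show ?thesis using False by simp
  qed (auto intro!: sum.neutral)
  also have "... = block_id a b l $$ (i, j)" unfolding block_id_def using ij by (subst four_block_mat_cases[of _ a b _ l l]) auto
  finally show ?thesis .
 qed
 then have eq: "?B * ?C = block_id a b l" using block_id_carrier[of a b l] by (intro eq_matI) auto
 have "mat l l (%(i, k). block_id a b l $$ (a + i, b + k)) = 1\<^sub>m l" unfolding block_id_def by (intro eq_matI) auto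
 then have "det (mat l l (%(i, k). (?B * ?C) $$ (a + i, b + k))) ~= 0" unfolding eq by simp
 then have "vec_space.rank (a + l) (?B * ?C) = l" by (intro rank_eq_of_minor[of _ _ _ _ "b + l" "%i. a + i" "%k. b + k"]) auto
 then show ?thesis unfolding eq .
qed

text \<open>The converse of \<open>stabiliser_blocks\<close>; it shows that scaling off-diagonal
  blocks stays inside the stabiliser.\<close>

lemma block_id_commute:
 assumes "block_tri True a l g" "block_tri False b l h" "lower_right a l g = lower_right b l h"
 shows "g * block_id a b l = block_id a b l * h"
proof -
 obtain A E B C where 1: "A : carrier_mat a a" "E : carrier_mat a l" "B : carrier_mat l a" "C : carrier_mat l l"
  "g = four_block_mat A E B C" "if True then E = 0\<^sub>m a l else B = 0\<^sub>m l a" by (rule block_triE[OF assms(1)])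
 obtain A' B' E' C' where 2: "A' : carrier_mat b b" "B' : carrier_mat b l" "E' : carrier_mat l b" "C' : carrier_mat l l"
  "h = four_block_mat A' B' E' C'" "if False then B' = 0\<^sub>m b l else E' = 0\<^sub>m l b" by (rule block_triE[OF assms(2)])
 have CC: "C = C'" using assms(3) block_parts(2)[OF 1(1-4)] block_parts(2)[OF 2(1-4)] 1(5) 2(5) by simp
 have "g * block_id a b l = four_block_mat (0\<^sub>m a b) (0\<^sub>m a l) (0\<^sub>m l b) C"
  unfolding block_id_def 1(5) by (subst mult_four_block_mat[OF 1(1-4)]) (use 1 in auto)
 also have "... = block_id a b l * h" unfolding block_id_def 2(5) CC by (subst mult_four_block_mat[OF _ _ _ _ 2(1-4)]) (use 2 in auto)
 finally show ?thesis .
qed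

context unlinking begin

abbreviation "TU == product_topology (%i. gl_topology (ep i)) (verts U)"
abbreviation "TQ == product_topology (%i. gl_topology (dv i)) (verts Q)"

lemma TU_coord:
 "i : verts Q ==> continuous_map TU (mat_topology (n0 i) (n0 i)) (%g. g (Some i))"
 "continuous_map TU (mat_topology l l) (%g. g None)"
proof -
 have *: "continuous_map TU (mat_topology (ep i) (ep i)) (%g. g i)" if "i : verts U" for i
  by (rule gl_continuous_inclusion[OF continuous_map_product_coordinates[OF that]])
 show "i : verts Q ==> continuous_map TU (mat_topology (n0 i) (n0 i)) (%g. g (Some i))" by (rule *) simp
 show "continuous_map TU (mat_topology l l) (%g. g None)" by (rule *) simp
qed

lemma TQ_coord: "i : verts Q ==> continuous_map TQ (mat_topology (n0 i + ex i) (n0 i + ex i)) (%g. g i)"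
 using gl_continuous_inclusion[OF continuous_map_product_coordinates[of i "verts Q" "%i. gl_topology (dv i)"]] by (simp add: dv_eq)

lemma continuous_map_TQ:
 assumes h: "!!z. z : topspace Z ==> h z : carrier GQ"
  and c: "!!i. i : verts Q ==> continuous_map Z (mat_topology (n0 i + ex i) (n0 i + ex i)) (%z. h z i)" shows "continuous_map Z TQ h"
proof (rule continuous_map_coordinatewise_then_product)
 fix i assume i: "i : verts Q"
 show "continuous_map Z (gl_topology (dv i)) (%z. h z i)"
  unfolding continuous_map_gl_topology dv_eq by (intro conjI c[OF i] ballI GQ_mem[OF h i])
next
 fix i z assume i: "i ~: verts Q" and z: "z : topspace Z"
 show "h z i = undefined" using h[OF z, unfolded carrier_base_change_group] i by (rule PiE_arb)
qed

lemma continuous_map_TU: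
 assumes h: "!!z. z : topspace Z ==> h z : carrier GU"
  and c: "!!i. i : verts Q ==> continuous_map Z (mat_topology (n0 i) (n0 i)) (%z. h z (Some i))"
  and c': "continuous_map Z (mat_topology l l) (%z. h z None)" shows "continuous_map Z TU h"
proof (rule continuous_map_coordinatewise_then_product)
 fix i assume i: "i : verts U"
 show "continuous_map Z (gl_topology (ep i)) (%z. h z i)"
 proof (cases i)
  case None
  show ?thesis unfolding continuous_map_gl_topology None by (intro conjI c' ballI GU_mem(2)[OF h])
 next
  case (Some j)
  then have j: "j : verts Q" using i by auto
  show ?thesis unfolding continuous_map_gl_topology Some by (intro conjI c[OF j] ballI GU_mem(1)[OF h j])
 qed
next
 fix i z assume i: "i ~: verts U" and z: "z : topspace Z"
 show "h z i = undefined" using h[OF z, unfolded carrier_base_change_group] i by (rule PiE_arb)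
qed

lemma topspace_TU: "topspace TU = carrier GU" and topspace_TQ: "topspace TQ = carrier GQ" by (simp_all add: carrier_base_change_group)

lemma ph_continuous: "continuous_map TU TQ ph"
proof (rule continuous_map_TQ)
 show "ph g : carrier GQ" if "g : topspace TU" for g using ph_closed that unfolding topspace_TU .
 fix i assume i: "i : verts Q"
 have "continuous_map TU (mat_topology (ex i) (ex i)) (%g. corner g i)"
  using TU_coord(2) by (cases "i = v0 \<or> i = v1") (auto simp: corner_def ex_def)
 then have "continuous_map TU (mat_topology (n0 i + ex i) (n0 i + ex i)) (%g. diag2 (n0 i) (ex i) (g (Some i)) (corner g i))"
  unfolding diag2_def by (intro continuous_map_four_block TU_coord(1)[OF i] continuous_map_mat_const) auto
 then show "continuous_map TU (mat_topology (n0 i + ex i) (n0 i + ex i)) (%g. ph g i)" using i by (simp add: ph_def)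
qed

lemma RU_coord: "x : arcs U ==> continuous_map (rep_space U ep) (mat_topology (ep (unlink_head Q x)) (ep (unlink_tail Q x))) (%rh. rh x)"
 unfolding rep_space_def using continuous_map_product_coordinates[of x "arcs U" "%x. mat_topology (ep (head U x)) (ep (tail U x))"]
 by (simp only: head_U tail_U)

lemma RQ_coord: "a : arcs Q ==> continuous_map (rep_space Q dv) (mat_topology (dv (head Q a)) (dv (tail Q a))) (%rh. rh a)"
 unfolding rep_space_def by (rule continuous_map_product_coordinates)

lemma part_continuous:
 assumes "r = ep (unlink_head Q x) \<or> x ~: arcs U" "k = ep (unlink_tail Q x) \<or> x ~: arcs U"
 shows "continuous_map (rep_space U ep) (mat_topology r k) (%rh. part rh x r k)"
 using assms RU_coord[of x] by (cases "x : arcs U") (auto simp: part_def)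

lemma f_continuous: "continuous_map (rep_space U ep) (rep_space Q dv) f"
proof -
 have "continuous_map (rep_space U ep) (product_topology (%a. mat_topology (dv (head Q a)) (dv (tail Q a))) (arcs Q)) f"
 proof (rule continuous_map_coordinatewise_then_product)
  fix a assume a: "a : arcs Q"
  show "continuous_map (rep_space U ep) (mat_topology (dv (head Q a)) (dv (tail Q a))) (%rh. f rh a)"
  proof (cases "a = d")
   case True
   then show ?thesis using a block_id_carrier[of "n0 v0" "n0 v1" l] by (simp add: f_def dv_eq)
  next
   case False
   have "continuous_map (rep_space U ep) (mat_topology (n0 (head Q a) + ex (head Q a)) (n0 (tail Q a) + ex (tail Q a)))
    (%rh. four_block_mat (part rh (Plain a) (n0 (head Q a)) (n0 (tail Q a)))
    (part rh (From_star a) (n0 (head Q a)) (ex (tail Q a)))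
    (part rh (To_star a) (ex (head Q a)) (n0 (tail Q a)))
    (part rh (Loop_star a) (ex (head Q a)) (ex (tail Q a))))"
    by (intro continuous_map_four_block part_continuous) (auto simp: ex_def arcs_U)
   then show ?thesis using a False by (simp add: f_def dv_eq)
  qed
 qed (auto simp: f_def)
 then show ?thesis by (simp add: rep_space_def)
qed

abbreviation "LU == moduli_stack U ep"
abbreviation "MS == stratum_stack Q d dv l"
abbreviation "S == stratum Q d dv l"

lemma S_iff: "rh : S \<longleftrightarrow> rh : RQ & vec_space.rank (n0 v0 + l) (rh d) = l" by (simp add: stratum_def dv_eq)

lemma S_d: "rh : RQ ==> rh d : carrier_mat (n0 v0 + l) (n0 v1 + l)"
 using d unfolding topspace_rep_space by (drule_tac PiE_mem[of _ _ _ d]) (auto simp: dv_eq)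

lemma f_S: "rh : RU ==> f rh : S" unfolding S_iff using f_closed block_id_rank[of "n0 v0" l "n0 v1"] d by (simp add: f_def)

lemma base_change_S:
 assumes g: "g : carrier GQ" and rh: "rh : S" shows "base_change Q dv g rh : S"
proof -
 interpret Q: stack_presentation "moduli_stack Q dv" by (rule stack_presentation_moduli_stack)
 have "vec_space.rank (n0 v0 + l) (g v0 * rh d * inv\<^bsub>GL (n0 v1 + l)\<^esub> (g v1)) = l"
  using rank_general_linear[OF S_d GQ_mem[OF g v01(2), unfolded ex_v] GQ_mem[OF g v01(3), unfolded ex_v]] rh by (simp add: S_iff)
 then show ?thesis unfolding S_iff using Q.act_closed[of g rh] g rh d by (simp add: S_iff base_change_def dv_eq)
qed

lemma presentation_LU: "stack_presentation LU" by (rule U.stack_presentation_moduli_stack)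

lemma presentation_MS: "stack_presentation MS" by (rule stack_presentation_restrict[OF stack_presentation_moduli_stack[of dv], where S = S])
  (use base_change_S in auto)

section \<open>The base point, its stabiliser and the block projections\<close>

definition r0 where "r0 = (\<lambda>x\<in>arcs U. 0\<^sub>m (ep (unlink_head Q x)) (ep (unlink_tail Q x)) :: complex mat)"

lemma r0_mem: "r0 : RU" by (auto simp: r0_def topspace_rep_space)

lemma f_r0: "f r0 = (\<lambda>a\<in>arcs Q. if a = d then block_id (n0 v0) (n0 v1) l else 0\<^sub>m (dv (head Q a)) (dv (tail Q a)))"
proof (rule ext)
 fix a
 have "part r0 (Plain a) (n0 (head Q a)) (n0 (tail Q a)) = 0\<^sub>m (n0 (head Q a)) (n0 (tail Q a))"
  "part r0 (From_star a) (n0 (head Q a)) (ex (tail Q a)) = 0\<^sub>m (n0 (head Q a)) (ex (tail Q a))"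
  "part r0 (To_star a) (ex (head Q a)) (n0 (tail Q a)) = 0\<^sub>m (ex (head Q a)) (n0 (tail Q a))"
  "part r0 (Loop_star a) (ex (head Q a)) (ex (tail Q a)) = 0\<^sub>m (ex (head Q a)) (ex (tail Q a))"
  by (auto simp: part_def r0_def arcs_U ex_def)
 then show "f r0 a = (\<lambda>a\<in>arcs Q. if a = d then block_id (n0 v0) (n0 v1) l else 0\<^sub>m (dv (head Q a)) (dv (tail Q a))) a"
  by (auto simp: f_def dv_eq)
qed

definition P where "P = {g : carrier GQ. base_change Q dv g (f r0) = f r0}"

text \<open>At the base point every arrow but \<open>d\<close> is zero, so only \<open>d\<close>
  imposes a condition.\<close>

lemma P_iff:
 "g : P \<longleftrightarrow> g : carrier GQ & g v0 * block_id (n0 v0) (n0 v1) l = block_id (n0 v0) (n0 v1) l * g v1"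
proof (cases "g : carrier GQ")
 case g: True
 let ?D = "block_id (n0 v0) (n0 v1) l"
 note gl = GQ_mem[OF g v01(2), unfolded ex_v] GQ_mem[OF g v01(3), unfolded ex_v]
 note c = gl_carrier_mat[OF gl(1)] gl_carrier_mat[OF gl(2)] gl_inv_carrier_mat[OF gl(2)]
 have "g (head Q a) * 0\<^sub>m (dv (head Q a)) (dv (tail Q a)) * inv\<^bsub>GL (dv (tail Q a))\<^esub> (g (tail Q a)) = 0\<^sub>m (dv (head Q a)) (dv (tail Q a))"
  if "a : arcs Q" for a unfolding dv_eq using that g by (intro zero_conj gl_carrier_mat gl_inv_carrier_mat GQ_mem) auto
 then have "base_change Q dv g (f r0) = f r0 \<longleftrightarrow> g v0 * ?D * inv\<^bsub>GL (n0 v1 + l)\<^esub> (g v1) = ?D"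
  using d by (auto simp: f_r0 base_change_def fun_eq_iff dv_eq)
 also have "... \<longleftrightarrow> g v0 * ?D = ?D * g v1"
 proof
  assume "g v0 * ?D * inv\<^bsub>GL (n0 v1 + l)\<^esub> (g v1) = ?D"
  then have "g v0 * ?D * inv\<^bsub>GL (n0 v1 + l)\<^esub> (g v1) * g v1 = ?D * g v1" by simp
  then show "g v0 * ?D = ?D * g v1"
   unfolding assoc_mult_mat[OF mult_carrier_mat[OF c(1) block_id_carrier] c(3,2)] gl_inv_cancel(1)[OF gl(2)]
   using right_mult_one_mat[OF mult_carrier_mat[OF c(1) block_id_carrier]] by simp
 next
  assume "g v0 * ?D = ?D * g v1"
  then have "g v0 * ?D * inv\<^bsub>GL (n0 v1 + l)\<^esub> (g v1) = ?D * g v1 * inv\<^bsub>GL (n0 v1 + l)\<^esub> (g v1)" by simp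
  then show "g v0 * ?D * inv\<^bsub>GL (n0 v1 + l)\<^esub> (g v1) = ?D"
   unfolding assoc_mult_mat[OF block_id_carrier c(2,3)] gl_inv_cancel(2)[OF gl(2)] using right_mult_one_mat[OF block_id_carrier] by simp
 qed
 finally show ?thesis using g by (simp add: P_def)
qed (simp add: P_def)

lemma P_blocks:
 assumes "g : P" shows "g : carrier GQ" "block_tri True (n0 v0) l (g v0)" "block_tri False (n0 v1) l (g v1)"
  "lower_right (n0 v0) l (g v0) = lower_right (n0 v1) l (g v1)"
  "i : verts Q ==> i ~= v0 ==> i ~= v1 ==> ex i = 0 & g i : carrier_mat (n0 i) (n0 i)"
proof -
 show g: "g : carrier GQ" using assms by (simp add: P_def)
 note c = gl_carrier_mat[OF GQ_mem[OF g v01(2), unfolded ex_v]] gl_carrier_mat[OF GQ_mem[OF g v01(3), unfolded ex_v]]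
 show "block_tri True (n0 v0) l (g v0)" "block_tri False (n0 v1) l (g v1)"
  "lower_right (n0 v0) l (g v0) = lower_right (n0 v1) l (g v1)" using stabiliser_blocks[OF c] assms by (auto simp: P_iff)
 show "ex i = 0 & g i : carrier_mat (n0 i) (n0 i)" if "i : verts Q" "i ~= v0" "i ~= v1"
  using gl_carrier_mat[OF GQ_mem[OF g that(1)]] that by (simp add: ex_def)
qed

lemma P_I:
 assumes "g : carrier GQ" "block_tri True (n0 v0) l (g v0)" "block_tri False (n0 v1) l (g v1)"
  "lower_right (n0 v0) l (g v0) = lower_right (n0 v1) l (g v1)" shows "g : P"
 unfolding P_iff using assms(1) block_id_commute[OF assms(2-4)] by simp

definition \<pi> :: "('v => complex mat) => 'v option => complex mat" where
 "\<pi> g = (\<lambda>i\<in>verts U. case i of None => lower_right (n0 v0) l (g v0) | Some j => upper_left (n0 j) (g j))"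

definition \<sigma> :: "real \<times> ('v => complex mat) => 'v => complex mat" where
 "\<sigma> = (%(s, g). \<lambda>i\<in>verts Q. off_scale (n0 i) s (g i))"

lemma P_mult_entries:
 assumes g: "g : P" and h: "h : P" and i: "i : verts Q"
 shows "upper_left (n0 i) (g i * h i) = upper_left (n0 i) (g i) * upper_left (n0 i) (h i)"
  "off_scale (n0 i) s (g i * h i) = off_scale (n0 i) s (g i) * off_scale (n0 i) s (h i)"
  "lower_right (n0 v0) l (g v0 * h v0) = lower_right (n0 v0) l (g v0) * lower_right (n0 v0) l (h v0)"
proof -
 note G = P_blocks[OF g] and H = P_blocks[OF h]
 show "lower_right (n0 v0) l (g v0 * h v0) = lower_right (n0 v0) l (g v0) * lower_right (n0 v0) l (h v0)"
  by (rule block_tri_mult(2)[OF G(2) H(2)])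
 consider "i = v0" | "i = v1" | "i ~= v0" "i ~= v1" by blast
 then have "upper_left (n0 i) (g i * h i) = upper_left (n0 i) (g i) * upper_left (n0 i) (h i) &
  off_scale (n0 i) s (g i * h i) = off_scale (n0 i) s (g i) * off_scale (n0 i) s (h i)"
 proof cases
  case 1
  then show ?thesis using block_tri_mult(1,3)[OF G(2) H(2)] by simp
 next
  case 2
  then show ?thesis using block_tri_mult(1,3)[OF G(3) H(3)] by simp
 next
  case 3
  then have "g i : carrier_mat (n0 i) (n0 i)" "h i : carrier_mat (n0 i) (n0 i)" using G(5)[OF i] H(5)[OF i] by auto
  then show ?thesis by (simp add: upper_left_trivial off_scale_trivial)
 qed
 then show "upper_left (n0 i) (g i * h i) = upper_left (n0 i) (g i) * upper_left (n0 i) (h i)"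
  "off_scale (n0 i) s (g i * h i) = off_scale (n0 i) s (g i) * off_scale (n0 i) s (h i)" by auto
qed

lemma P_entries:
 assumes g: "g : P" and i: "i : verts Q"
 shows "upper_left (n0 i) (g i) : carrier (GL (n0 i))" "lower_right (n0 v0) l (g v0) : carrier (GL l)"
  "off_scale (n0 i) s (g i) : carrier (GL (n0 i + ex i))" "off_scale (n0 i) 1 (g i) = g i"
  "off_scale (n0 i) 0 (g i) = diag2 (n0 i) (ex i) (upper_left (n0 i) (g i)) (if i = v0 \<or> i = v1 then lower_right (n0 v0) l (g v0) else 1\<^sub>m 0)"
proof -
 note G = P_blocks[OF g]
 have det: "det (g i) ~= 0" if "i : verts Q" for i using GQ_mem[OF G(1) that] by (simp add: carrier_general_linear)
 note d0 = block_tri[OF G(2)] and d1 = block_tri[OF G(3)]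
 have cul: "upper_left n A : carrier_mat n n" "lower_right n m A : carrier_mat m m" for n m A
  by (auto simp: upper_left_def lower_right_def)
 show "lower_right (n0 v0) l (g v0) : carrier (GL l)" using det[OF v01(2)] d0(1) cul by (auto simp: carrier_general_linear)
 consider "i = v0" | "i = v1" | "i ~= v0" "i ~= v1" by blast
 then have "upper_left (n0 i) (g i) : carrier (GL (n0 i)) & off_scale (n0 i) s (g i) : carrier (GL (n0 i + ex i))
  & off_scale (n0 i) 1 (g i) = g i & off_scale (n0 i) 0 (g i) =
   diag2 (n0 i) (ex i) (upper_left (n0 i) (g i)) (if i = v0 \<or> i = v1 then lower_right (n0 v0) l (g v0) else 1\<^sub>m 0)"
 proof cases
  case 1
  then show ?thesis using det[OF i] d0(1-3,6,7) cul by (auto simp: carrier_general_linear diag2_def)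
 next
  case 2
  then show ?thesis using det[OF i] d1(1-3,6,7) cul G(4) by (auto simp: carrier_general_linear diag2_def)
 next
  case 3
  then have "g i : carrier_mat (n0 i) (n0 i)" "ex i = 0" using G(5)[OF i] by auto
  then show ?thesis using det[OF i] 3 by (simp add: upper_left_trivial off_scale_trivial diag2_trivial carrier_general_linear)
 qed
 then show "upper_left (n0 i) (g i) : carrier (GL (n0 i))"
  "off_scale (n0 i) s (g i) : carrier (GL (n0 i + ex i))" "off_scale (n0 i) 1 (g i) = g i"
  "off_scale (n0 i) 0 (g i) = diag2 (n0 i) (ex i) (upper_left (n0 i) (g i)) (if i = v0 \<or> i = v1 then lower_right (n0 v0) l (g v0) else 1\<^sub>m 0)"
  by auto
qed

lemma \<pi>_closed: "g : P ==> \<pi> g : carrier GU" using P_entries(1,2) v01(2) by (auto simp: \<pi>_def carrier_base_change_group)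

lemma \<pi>_mult: "g : P ==> h : P ==> \<pi> (g \<otimes>\<^bsub>GQ\<^esub> h) = \<pi> g \<otimes>\<^bsub>GU\<^esub> \<pi> h"
 using P_mult_entries v01(2) by (auto simp: \<pi>_def base_change_group_def fun_eq_iff)

lemma \<pi>_ph: "g : carrier GU ==> \<pi> (ph g) = g"
proof (rule ext)
 fix i assume g: "g : carrier GU"
 have "upper_left (n0 j) (ph g j) = g (Some j)" if "j : verts Q" for j
  using that block_parts(1)[OF gl_carrier_mat[OF GU_mem(1)[OF g that]] zero_carrier_mat zero_carrier_mat gl_carrier_mat[OF corner_GL[OF g, of j]]]
  by (simp add: ph_def diag2_def)
 moreover have "lower_right (n0 v0) l (ph g v0) = g None"
  using v01(2) block_parts(2)[OF gl_carrier_mat[OF GU_mem(1)[OF g v01(2)]] zero_carrier_mat zero_carrier_mat gl_carrier_mat[OF GU_mem(2)[OF g]]]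
  by (simp add: ph_def diag2_def corner_def)
 ultimately show "\<pi> (ph g) i = g i" using PiE_arb[of g "verts U" "%i. carrier (GL (ep i))" i] g
  by (cases "i : verts U") (auto simp: \<pi>_def carrier_base_change_group)
qed

lemma \<sigma>_P: "g : P ==> \<sigma> (s, g) : P"
proof (rule P_I)
 assume g: "g : P"
 note G = P_blocks[OF g]
 note d0 = block_tri[OF G(2)] and d1 = block_tri[OF G(3)]
 show "\<sigma> (s, g) : carrier GQ" using P_entries(3)[OF g] by (auto simp: \<sigma>_def carrier_base_change_group dv_eq)
 show "block_tri True (n0 v0) l (\<sigma> (s, g) v0)" "block_tri False (n0 v1) l (\<sigma> (s, g) v1)"
  "lower_right (n0 v0) l (\<sigma> (s, g) v0) = lower_right (n0 v1) l (\<sigma> (s, g) v1)"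
  using d0(4,5) d1(4,5) G(2-4) v01 by (simp_all add: \<sigma>_def)
qed

lemma \<sigma>_mult: "g : P ==> h : P ==> \<sigma> (s, g \<otimes>\<^bsub>GQ\<^esub> h) = \<sigma> (s, g) \<otimes>\<^bsub>GQ\<^esub> \<sigma> (s, h)"
 using P_mult_entries(2) by (auto simp: \<sigma>_def base_change_group_def fun_eq_iff)

lemma \<sigma>_0: "g : P ==> \<sigma> (0, g) = ph (\<pi> g)"
 using P_entries(5) by (auto simp: \<sigma>_def ph_def \<pi>_def corner_def fun_eq_iff)

lemma \<sigma>_1: "g : P ==> \<sigma> (1, g) = g" using P_entries(4) PiE_arb[of g "verts Q" "%i. carrier (GL (dv i))"]
 by (auto simp: \<sigma>_def fun_eq_iff P_def carrier_base_change_group restrict_def)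

lemma \<pi>_continuous: "continuous_map (subtopology TQ P) TU \<pi>"
proof (rule continuous_map_TU)
 show "\<pi> g : carrier GU" if "g : topspace (subtopology TQ P)" for g using \<pi>_closed that by simp
 show "continuous_map (subtopology TQ P) (mat_topology (n0 i) (n0 i)) (%g. \<pi> g (Some i))" if "i : verts Q" for i
  using that continuous_map_submatrix[OF continuous_map_from_subtopology[OF TQ_coord[OF that]], of "n0 i" "%j. j" "n0 i" "%j. j"]
  by (simp add: \<pi>_def upper_left_def)
 show "continuous_map (subtopology TQ P) (mat_topology l l) (%g. \<pi> g None)"
  using continuous_map_submatrix[OF continuous_map_from_subtopology[OF TQ_coord[OF v01(2)]], of l "%j. n0 v0 + j" l "%j. n0 v0 + j"]
  by (simp add: \<pi>_def lower_right_def)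
qed

lemma \<sigma>_continuous: "continuous_map (prod_topology I01 (subtopology TQ P)) TQ \<sigma>"
proof (rule continuous_map_TQ)
 let ?Z = "prod_topology I01 (subtopology TQ P)"
 show "\<sigma> z : carrier GQ" if "z : topspace ?Z" for z using \<sigma>_P P_blocks(1) that by (cases z) auto
 fix i assume i: "i : verts Q"
 have s: "continuous_map ?Z euclideanreal fst" by (rule continuous_map_into_fulltopology[OF continuous_map_fst])
 have g: "continuous_map ?Z (mat_topology (n0 i + ex i) (n0 i + ex i)) (%z. snd z i)"
  using continuous_map_compose[OF continuous_map_snd continuous_map_from_subtopology[OF TQ_coord[OF i]]] by (simp add: o_def)
 have "continuous_map ?Z (mat_topology (n0 i + ex i) (n0 i + ex i)) (%z. off_scale (n0 i) (fst z) (snd z i))"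
 proof (rule continuous_map_matI)
  fix p q assume pq: "p < n0 i + ex i" "q < n0 i + ex i"
  note e = continuous_map_matD(2)[OF g pq]
  have "continuous_map ?Z euclidean (%z. if (p < n0 i) = (q < n0 i) then snd z i $$ (p, q) else complex_of_real (fst z) * snd z i $$ (p, q))"
  proof (cases "(p < n0 i) = (q < n0 i)")
   case True
   then show ?thesis using e by (simp only: True if_True simp_thms)
  next
   case False
   then show ?thesis using continuous_map_of_real_mult[OF s e] by (simp only: False if_False)
  qed
  then show "continuous_map ?Z euclidean (%z. off_scale (n0 i) (fst z) (snd z i) $$ (p, q))"
  proof (rule continuous_map_eq)
   fix z assume "z : topspace ?Z"
   then have "snd z i : carrier_mat (n0 i + ex i) (n0 i + ex i)" by (rule continuous_map_matD(1)[OF g])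
   then show "(if (p < n0 i) = (q < n0 i) then snd z i $$ (p, q) else complex_of_real (fst z) * snd z i $$ (p, q)) =
    off_scale (n0 i) (fst z) (snd z i) $$ (p, q)" using pq by (simp add: off_scale_def)
  qed
 next
  fix z assume "z : topspace ?Z"
  then have "snd z i : carrier_mat (n0 i + ex i) (n0 i + ex i)" by (rule continuous_map_matD(1)[OF g])
  then show "off_scale (n0 i) (fst z) (snd z i) : carrier_mat (n0 i + ex i) (n0 i + ex i)" by (simp add: off_scale_def)
 qed
 then show "continuous_map ?Z (mat_topology (n0 i + ex i) (n0 i + ex i)) (%z. \<sigma> z i)"
  using i by (simp add: \<sigma>_def case_prod_unfold)
qed

end

section \<open>Pivot sections over the stratum and the homotopy equivalence\<close>

context unlinking begin

text \<open>A finite index set for the cover. Many pairs select the same pivot positions, which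
  merely repeats members of the cover.\<close>

definition perms where "perms = {p. p permutes {0..<n0 v0 + l}} \<times> {q. q permutes {0..<n0 v1 + l}}"

definition pq where "pq = (SOME h. bij_betw h {..<card perms} perms)"

lemma pq: "bij_betw pq {..<card perms} perms"
proof -
 have "finite perms" by (simp add: perms_def finite_permutations)
 then have "\<exists>h. bij_betw h {..<card perms} perms" using ex_bij_betw_nat_finite[of perms] by (simp add: atLeast0LessThan)
 then show ?thesis unfolding pq_def by (rule someI_ex)
qed

lemma pq_mem: "k < card perms ==> fst (pq k) permutes {0..<n0 v0 + l}"
 "k < card perms ==> snd (pq k) permutes {0..<n0 v1 + l}" using bij_betwE[OF pq] by (auto simp: perms_def mem_Times_iff)

abbreviation "piv k rh == pivot (n0 v0) (n0 v1) l (fst (pq k)) (snd (pq k)) (rh d)"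

text \<open>On the stratum this is nonzero exactly where the pivot is invertible, so each section is
  defined on the whole set where its weight is nonzero. Some pivot of size \<open>l\<close> is
  always invertible, which keeps the denominator positive.\<close>

definition weight :: "nat => ('e => complex mat) => real" where
 "weight k rh = cmod (det (piv k rh)) / (\<Sum>k<card perms. cmod (det (piv k rh)))"

definition sec :: "nat => ('e => complex mat) => 'v => complex mat" where
 "sec k rh = (\<lambda>i\<in>verts Q.
   if i = v0 then permute_rows (n0 v0 + l) (fst (pq k)) (row_factor (n0 v0) (n0 v1) l (fst (pq k)) (snd (pq k)) (rh d))
   else if i = v1 then permute_rows (n0 v1 + l) (snd (pq k)) (col_factor (n0 v0) (n0 v1) l (fst (pq k)) (snd (pq k)) (rh d))
   else 1\<^sub>m (n0 i + ex i))"

text \<open>Contracts all arrows except \<open>d\<close>. Leaving \<open>d\<close> alone preserves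
  its rank and hence the stratum; at time \<open>0\<close> the matrix of \<open>d\<close> is all
  that remains, so the pivot sections reach it from the base point.\<close>

definition ka :: "real \<times> ('e => complex mat) => 'e => complex mat" where
 "ka = (%(s, rh). \<lambda>a\<in>arcs Q. if a = d then rh a else complex_of_real s \<cdot>\<^sub>m rh a)"

lemma weight_sum_pos:
 assumes "rh : S" shows "0 < (\<Sum>k<card perms. cmod (det (piv k rh)))"
proof -
 have r: "rh : RQ" "vec_space.rank (n0 v0 + l) (rh d) = l" using assms by (auto simp: S_iff)
 obtain p q where p: "p permutes {0..<n0 v0 + l}" and q: "q permutes {0..<n0 v1 + l}"
  and det: "det (pivot (n0 v0) (n0 v1) l p q (rh d)) ~= 0" by (rule pivot_exists[OF S_d[OF r(1)] r(2)]) (rule that, assumption+)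
 have "(p, q) : pq ` {..<card perms}" using pq p q by (simp add: bij_betw_def perms_def)
 then obtain k where k: "k < card perms" "pq k = (p, q)" by (elim imageE) (rule that, auto)
 show ?thesis by (rule sum_pos2[of _ k]) (use k det in auto)
qed

lemma d_continuous: "continuous_map (rep_space Q dv) (mat_topology (n0 v0 + l) (n0 v1 + l)) (%rh. rh d)"
 using RQ_coord[OF d] by (simp add: dv_eq)

lemma weight_continuous:
 assumes "k < card perms" shows "continuous_map (subtopology (rep_space Q dv) S) euclideanreal (weight k)"
proof -
 have *: "continuous_map (subtopology (rep_space Q dv) S) euclideanreal (%rh. cmod (det (piv k rh)))"
  if "k < card perms" for k by (intro continuous_map_cmod continuous_map_det)
   (rule continuous_map_factors(1)[OF continuous_map_from_subtopology[OF d_continuous] pq_mem[OF that]])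
 show ?thesis unfolding weight_def
 proof (rule continuous_map_real_divide)
  show "continuous_map (subtopology (rep_space Q dv) S) euclideanreal (%rh. \<Sum>k<card perms. cmod (det (piv k rh)))"
   by (intro continuous_map_sum *) auto
  show "(\<Sum>k<card perms. cmod (det (piv k rh))) ~= 0" if "rh : topspace (subtopology (rep_space Q dv) S)" for rh
   using weight_sum_pos[of rh] that by simp
 qed (rule *[OF assms])
qed

lemma weight_nonneg: "0 <= weight k rh" by (auto simp: weight_def intro!: divide_nonneg_nonneg sum_nonneg)

lemma weight_sum: "rh : S ==> (\<Sum>k<card perms. weight k rh) = 1"
 using weight_sum_pos[of rh] by (simp add: weight_def sum_divide_distrib[symmetric])

lemma weight_det: "weight k rh ~= 0 ==> det (piv k rh) ~= 0" by (auto simp: weight_def)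

lemma sec_continuous:
 assumes k: "k < card perms" shows "continuous_map (subtopology (subtopology (rep_space Q dv) S) {rh. weight k rh ~= 0}) TQ (sec k)"
proof (rule continuous_map_coordinatewise_then_product)
 let ?Z = "subtopology (subtopology (rep_space Q dv) S) {rh. weight k rh ~= 0}"
 have nz: "det (piv k z) ~= 0" if "z : topspace ?Z" for z using that weight_det by simp
 have "continuous_map ?Z (mat_topology (n0 v0 + l) (n0 v1 + l)) (%rh. rh d)" by (intro continuous_map_from_subtopology d_continuous)
 note cf = continuous_map_factors[OF this pq_mem[OF k]]
 show "continuous_map ?Z (gl_topology (dv i)) (%rh. sec k rh i)" if i: "i : verts Q" for i
 proof -
  consider "i = v0" | "i = v1" | "i ~= v0" "i ~= v1" by blast
  then show ?thesis
  proof cases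
   case 1
   have e: "sec k rh v0 = permute_rows (n0 v0 + l) (fst (pq k)) (row_factor (n0 v0) (n0 v1) l (fst (pq k)) (snd (pq k)) (rh d))" for rh
    using v01 by (simp add: sec_def)
   show ?thesis unfolding 1 e dv_eq[of v0] ex_v by (rule cf(2)) (rule nz)
  next
   case 2
   have e: "sec k rh v1 = permute_rows (n0 v1 + l) (snd (pq k)) (col_factor (n0 v0) (n0 v1) l (fst (pq k)) (snd (pq k)) (rh d))" for rh
    using v01 by (simp add: sec_def)
   show ?thesis unfolding 2 e dv_eq[of v1] ex_v by (rule cf(3)) (rule nz)
  next
   case 3
   have 1: "(1\<^sub>m (n0 i + ex i) :: complex mat) : carrier (GL (n0 i + ex i))" by (simp add: carrier_general_linear)
   have e: "sec k rh i = 1\<^sub>m (n0 i + ex i)" for rh using i 3 by (simp add: sec_def)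
   show ?thesis unfolding continuous_map_gl_topology dv_eq[of i] e by (intro conjI ballI 1 continuous_map_mat_const one_carrier_mat)
  qed
 qed
qed (simp add: sec_def)

lemma sec:
 assumes k: "k < card perms" and rh: "rh : S" and w: "weight k rh ~= 0" shows "base_change Q dv (sec k rh) (f r0) = ka (0, rh)"
proof (rule ext)
 fix a
 let ?p = "fst (pq k)" and ?q = "snd (pq k)"
 note dt = weight_det[OF w]
 have rh': "rh : RQ" "vec_space.rank (n0 v0 + l) (rh d) = l" using rh by (auto simp: S_iff)
 have gl: "sec k rh i : carrier (GL (dv i))" if "i : verts Q" for i
  using that permute_rows_general_linear[OF pq_mem(1)[OF k] row_factor_general_linear[OF dt]]
   permute_rows_general_linear[OF pq_mem(2)[OF k] col_factor_general_linear[OF dt]] by (auto simp: sec_def dv_eq carrier_general_linear)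
 show "base_change Q dv (sec k rh) (f r0) a = ka (0, rh) a"
 proof (cases "a : arcs Q")
  case a: True
  then have v: "head Q a : verts Q" "tail Q a : verts Q" by auto
  show ?thesis
  proof (cases "a = d")
   case False
   have "rh a : carrier_mat (dv (head Q a)) (dv (tail Q a))" using PiE_mem[OF rh'(1)[unfolded topspace_rep_space] a] .
   then show ?thesis using False a zero_conj[OF gl_carrier_mat[OF gl[OF v(1)]] gl_inv_carrier_mat[OF gl[OF v(2)]]]
     scale_0 by (simp add: base_change_def f_r0 ka_def)
  next
   case True
   let ?H0 = "sec k rh v0" and ?H1 = "sec k rh v1"
   have H1: "?H1 : carrier (GL (n0 v1 + l))" using gl[OF v01(3)] by (simp add: dv_eq)
   have "?H0 * block_id (n0 v0) (n0 v1) l = rh d * ?H1"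
    using normal_form[OF S_d[OF rh'(1)] rh'(2) pq_mem[OF k] dt] v01 by (simp add: sec_def)
   then have "?H0 * block_id (n0 v0) (n0 v1) l * inv\<^bsub>GL (n0 v1 + l)\<^esub> ?H1 = rh d * ?H1 * inv\<^bsub>GL (n0 v1 + l)\<^esub> ?H1" by simp
   also have "... = rh d"
    unfolding assoc_mult_mat[OF S_d[OF rh'(1)] gl_carrier_mat[OF H1] gl_inv_carrier_mat[OF H1]] gl_inv_cancel(2)[OF H1]
    by (rule right_mult_one_mat[OF S_d[OF rh'(1)]])
   finally show ?thesis using True a by (simp add: base_change_def f_r0 ka_def dv_eq)
  qed
 qed (simp add: base_change_def ka_def)
qed

lemma ka_continuous:
 "continuous_map (prod_topology I01 (subtopology (rep_space Q dv) S)) (subtopology (rep_space Q dv) S) ka"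
proof -
 let ?Z = "prod_topology I01 (subtopology (rep_space Q dv) S)"
 have s: "continuous_map ?Z euclideanreal fst" by (rule continuous_map_into_fulltopology[OF continuous_map_fst])
 have "continuous_map ?Z (product_topology (%a. mat_topology (dv (head Q a)) (dv (tail Q a))) (arcs Q)) ka"
 proof (rule continuous_map_coordinatewise_then_product)
  fix a assume a: "a : arcs Q"
  have c: "continuous_map ?Z (mat_topology (dv (head Q a)) (dv (tail Q a))) (%z. snd z a)"
   using continuous_map_compose[OF continuous_map_snd continuous_map_from_subtopology[OF RQ_coord[OF a]], unfolded o_def] .
  show "continuous_map ?Z (mat_topology (dv (head Q a)) (dv (tail Q a))) (%z. ka z a)"
  proof (cases "a = d")
   case True
   then show ?thesis using c a by (simp add: ka_def case_prod_unfold)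
  next
   case False
   then show ?thesis using continuous_map_mat_scale[OF s c] a by (simp add: ka_def case_prod_unfold)
  qed
 qed (simp add: ka_def case_prod_unfold)
 then have c: "continuous_map ?Z (rep_space Q dv) ka" unfolding rep_space_def[of Q] .
 show ?thesis unfolding continuous_map_in_subtopology
 proof (intro conjI c funcsetI)
  fix z assume z: "z : topspace ?Z"
  then have "ka z : RQ" using continuous_map_funspace[OF c] by (simp only: Pi_iff)
  moreover have "ka z d = snd z d" using d by (simp add: ka_def case_prod_unfold)
  moreover have "snd z : S" using z by auto
  ultimately show "ka z : S" by (simp only: S_iff)
 qed
qed

lemma homotopy_equivalence_unlinking:
 "homotopy_equivalence (homotopy_quotient LU) (homotopy_quotient MS) (homotopy_quotient_map MS ph f)"
proof -
 interpret L: stack_presentation LU by (rule presentation_LU)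
 interpret M: stack_presentation MS by (rule presentation_MS)
 interpret levi_reduction LU MS ph f r0 U.rep_scale ka P \<pi> \<sigma> "card perms" weight sec
 proof (unfold_locales, unfold moduli_stack_simps stratum_stack_simps topspace_subtopology)
  show "ph : hom GU GQ" by (rule ph_hom)
  show "continuous_map TU TQ ph" by (rule ph_continuous)
  show "continuous_map (rep_space U ep) (subtopology (rep_space Q dv) S) f"
   unfolding continuous_map_in_subtopology using f_continuous f_S by auto
  show "f (base_change U ep g r) = base_change Q dv (ph g) (f r)" if "g : carrier GU" "r : RU" for g r using that by (rule f_equivariant)
  show "r0 : RU" by (rule r0_mem)
  show "continuous_map (prod_topology I01 (rep_space U ep)) (rep_space U ep) U.rep_scale" by (rule U.continuous_rep_scale)
  show "U.rep_scale (0, r) = r0" if "r : RU" for r using U.rep_scale(1)[OF that] by (simp add: r0_def)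
  show "U.rep_scale (1, r) = r" if "r : RU" for r by (rule U.rep_scale(2)[OF that])
  show "U.rep_scale (s, base_change U ep g r) = base_change U ep g (U.rep_scale (s, r))"
   if "s : {0..1}" "g : carrier GU" "r : RU" for s g r by (rule U.rep_scale(3)[OF that(3,2)])
  show "continuous_map (prod_topology I01 (subtopology (rep_space Q dv) S)) (subtopology (rep_space Q dv) S) ka" by (rule ka_continuous)
  show "ka (1, x) = x" if "x : RQ \<inter> S" for x
  proof -
   have "x : RQ" using that by simp
   from PiE_arb[OF this[unfolded topspace_rep_space]] show ?thesis by (auto simp: ka_def fun_eq_iff)
  qed
  show "ka (s, base_change Q dv g x) = base_change Q dv g (ka (s, x))"
   if "s : {0..1}" "g : carrier GQ" "x : RQ \<inter> S" for s g x using base_change_scale[OF that(2) IntD1[OF that(3)]]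
   by (auto simp: ka_def base_change_def[of Q dv g "restrict _ _"] base_change_def[of Q dv g x] fun_eq_iff)
  show "ka (0, f r) = f r0" if r: "r : RU" for r
  proof (rule ext)
   fix a
   have "f r d = block_id (n0 v0) (n0 v1) l" using d by (simp add: f_def)
   then show "ka (0, f r) a = f r0 a" using scale_0[OF PiE_mem[OF f_closed[OF r, unfolded topspace_rep_space], of a]]
    by (auto simp: ka_def f_r0)
  qed
  show "P = {g : carrier GQ. base_change Q dv g (f r0) = f r0}" by (rule P_def)
  show "continuous_map (subtopology TQ P) TU \<pi>" by (rule \<pi>_continuous)
  show "\<pi> (g \<otimes>\<^bsub>GQ\<^esub> h) = \<pi> g \<otimes>\<^bsub>GU\<^esub> \<pi> h" if "g : P" "h : P" for g h using that by (rule \<pi>_mult)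
  show "\<pi> (ph g) = g" if "g : carrier GU" for g using that by (rule \<pi>_ph)
  show "continuous_map (prod_topology I01 (subtopology TQ P)) TQ \<sigma>" by (rule \<sigma>_continuous)
  show "\<sigma> (s, g) : P" if "g : P" for s g using that by (rule \<sigma>_P)
  show "\<sigma> (s, g \<otimes>\<^bsub>GQ\<^esub> h) = \<sigma> (s, g) \<otimes>\<^bsub>GQ\<^esub> \<sigma> (s, h)" if "g : P" "h : P" for s g h using that by (rule \<sigma>_mult)
  show "\<sigma> (0, g) = ph (\<pi> g)" if "g : P" for g using that by (rule \<sigma>_0)
  show "\<sigma> (1, g) = g" if "g : P" for g using that by (rule \<sigma>_1)
  show "continuous_map (subtopology (rep_space Q dv) S) euclideanreal (weight i)" if "i < card perms" for i
   using that by (rule weight_continuous)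
  show "0 <= weight i x" for i x by (rule weight_nonneg)
  show "(\<Sum>i<card perms. weight i x) = 1" if "x : RQ \<inter> S" for x using that by (intro weight_sum) simp
  show "continuous_map (subtopology (subtopology (rep_space Q dv) S) {x. weight i x ~= 0}) TQ (sec i)" if "i < card perms" for i
   using that by (rule sec_continuous)
  show "base_change Q dv (sec i x) (f r0) = ka (0, x)" if "i < card perms" "x : RQ \<inter> S" "weight i x ~= 0" for i x
   using sec[OF that(1) IntD2[OF that(2)] that(3)] .
 qed
 show ?thesis by (rule homotopy_equivalence_incl)
qed

section \<open>Regularity of the morphism in coordinates\<close>

lemma regular_group: "regular_map (carrier GU) (grp_coords LU) (grp_coords MS) ph" unfolding regular_map_def
proof
 fix h assume "h : grp_coords MS"
 then consider (entry) i p q where "i : verts Q" "p < n0 i + ex i" "q < n0 i + ex i" "h = (%g. g i $$ (p, q))"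
  | (det) i where "i : verts Q" "h = (%g. inverse (det (g i)))" by (auto simp: moduli_stack_def dv_eq)
 then show "\<exists>r\<in>generated_algebra (grp_coords LU). \<forall>g\<in>carrier GU. h (ph g) = r g"
 proof cases
  case entry
  have e: "ph g i $$ (p, q) = (if p < n0 i then if q < n0 i then g (Some i) $$ (p, q) else 0
    else if q < n0 i then 0 else g None $$ (p - n0 i, q - n0 i))" if g: "g : carrier GU" for g
   using entry(1-3) gl_carrier_mat[OF GU_mem(1)[OF g entry(1)]] gl_carrier_mat[OF GU_mem(2)[OF g]]
   by (auto simp: ph_def diag2_def corner_def ex_def split: if_splits)
  show ?thesis
  proof (cases "(p < n0 i) = (q < n0 i)")
   case False
   then have "h (ph g) = 0" if "g : carrier GU" for g using e[OF that] entry(4) by auto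
   then show ?thesis by (intro bexI[OF _ generated_algebra.const[of 0]]) auto
  next
   case True
   show ?thesis
   proof (cases "p < n0 i")
    case p: True
    then have "h (ph g) = g (Some i) $$ (p, q)" if "g : carrier GU" for g using e[OF that] entry(4) True by auto
    moreover have "(%g. g (Some i) $$ (p, q)) : grp_coords LU" using p True entry(1) by (auto simp: moduli_stack_def)
    ultimately show ?thesis by (intro bexI[OF _ generated_algebra.gen]) auto
   next
    case p: False
    then have "h (ph g) = g None $$ (p - n0 i, q - n0 i)" if "g : carrier GU" for g using e[OF that] entry(4) True by auto
    moreover have "p - n0 i < l" "q - n0 i < l" using p True entry(2,3) by (auto simp: ex_def split: if_splits)
    then have "(%g. g None $$ (p - n0 i, q - n0 i)) : grp_coords LU" by (auto simp: moduli_stack_def)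
    ultimately show ?thesis by (intro bexI[OF _ generated_algebra.gen]) auto
   qed
  qed
 next
  case det
  have dd: "det (ph g i) = det (g (Some i)) * det (corner g i)" if g: "g : carrier GU" for g
   using det(1) det_diag2[OF gl_carrier_mat[OF GU_mem(1)[OF g det(1)]] gl_carrier_mat[OF corner_GL[OF g, of i]]] by (simp add: ph_def)
  have 1: "(%g. inverse (det (g (Some i)))) : grp_coords LU" "(%g. inverse (det (g None))) : grp_coords LU"
   using det(1) by (auto simp: moduli_stack_def)
  show ?thesis
  proof (cases "i = v0 \<or> i = v1")
   case True
   \<comment> \<open>The inverse determinant of a block diagonal matrix is a product of two
     coordinate functions.\<close>
   then have "h (ph g) = inverse (det (g (Some i))) * inverse (det (g None))" if "g : carrier GU" for g
    using dd[OF that] det(2) by (simp add: corner_def inverse_mult_distrib)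
   then show ?thesis by (intro bexI[OF _ generated_algebra.mult[OF generated_algebra.gen[OF 1(1)] generated_algebra.gen[OF 1(2)]]]) auto
  next
   case False
   then have "h (ph g) = inverse (det (g (Some i)))" if "g : carrier GU" for g using dd[OF that] det(2) by (simp add: corner_def)
   then show ?thesis by (intro bexI[OF _ generated_algebra.gen[OF 1(1)]]) auto
  qed
 qed
qed

lemma regular_space: "regular_map RU (space_coords LU) (space_coords MS) f" unfolding regular_map_def
proof
 fix h assume "h : space_coords MS"
 then obtain a p q where a: "a : arcs Q" and pq: "p < n0 (head Q a) + ex (head Q a)" "q < n0 (tail Q a) + ex (tail Q a)"
  and h: "h = (%rh. rh a $$ (p, q))" by (auto simp: moduli_stack_def dv_eq)
 show "\<exists>r\<in>generated_algebra (space_coords LU). \<forall>rh\<in>RU. h (f rh) = r rh"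
 proof (cases "a = d")
  case True
  then have "h (f rh) = block_id (n0 v0) (n0 v1) l $$ (p, q)" for rh using a h by (simp add: f_def)
  then show ?thesis by (intro bexI[OF _ generated_algebra.const]) auto
 next
  case False
  have c: "\<exists>r\<in>generated_algebra (space_coords LU). \<forall>rh\<in>RU. part rh x m n $$ (p', q') = r rh"
   if "p' < m" "q' < n" "x : arcs U ==> m = ep (unlink_head Q x) & n = ep (unlink_tail Q x)" for x m n p' q'
  proof (cases "x : arcs U")
   case True
   then have "(%rh. rh x $$ (p', q')) : space_coords LU" using that by (auto simp: moduli_stack_def)
   then show ?thesis using True by (intro bexI[OF _ generated_algebra.gen]) (auto simp: part_def)
  next
   case False
   then show ?thesis using that(1,2) by (intro bexI[OF _ generated_algebra.const[of 0]]) (auto simp: part_def)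
  qed
  let ?h = "head Q a" and ?t = "tail Q a"
  have e: "f rh a $$ (p, q) = (if p < n0 ?h
    then if q < n0 ?t then part rh (Plain a) (n0 ?h) (n0 ?t) $$ (p, q) else part rh (From_star a) (n0 ?h) (ex ?t) $$ (p, q - n0 ?t)
    else if q < n0 ?t then part rh (To_star a) (ex ?h) (n0 ?t) $$ (p - n0 ?h, q) else part rh (Loop_star a) (ex ?h) (ex ?t) $$ (p - n0 ?h, q - n0 ?t))"
   if "rh : RU" for rh using False a pq four_block_mat_cases[OF part_carrier(1,4)[OF that a] pq] by (simp add: f_def)
  have p: "p - n0 ?h < ex ?h" if "\<not> p < n0 ?h" using pq that by arith
  have q: "q - n0 ?t < ex ?t" if "\<not> q < n0 ?t" using pq that by arith
  show ?thesis
  proof (cases "p < n0 ?h"; cases "q < n0 ?t")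
   assume pq': "p < n0 ?h" "q < n0 ?t"
   show ?thesis unfolding h using c[OF pq', of "Plain a"] by (simp add: e pq')
  next
   assume pq': "p < n0 ?h" "\<not> q < n0 ?t"
   show ?thesis unfolding h using c[OF pq'(1) q[OF pq'(2)], of "From_star a"] by (simp add: e pq' arcs_U ex_def)
  next
   assume pq': "\<not> p < n0 ?h" "q < n0 ?t"
   show ?thesis unfolding h using c[OF p[OF pq'(1)] pq'(2), of "To_star a"] by (simp add: e pq' arcs_U ex_def)
  next
   assume pq': "\<not> p < n0 ?h" "\<not> q < n0 ?t"
   show ?thesis unfolding h using c[OF p[OF pq'(1)] q[OF pq'(2)], of "Loop_star a"] by (simp add: e pq' arcs_U ex_def)
  qed
 qed
qed

theorem stack_homotopy_equivalence_unlinking: "stack_homotopy_equivalence LU MS ph f"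
proof -
 have "continuous_map (rep_space U ep) (subtopology (rep_space Q dv) S) f"
  unfolding continuous_map_in_subtopology using f_continuous f_S by auto
 then show ?thesis unfolding stack_homotopy_equivalence_def stack_map_def
  using ph_hom ph_continuous regular_group regular_space f_equivariant homotopy_equivalence_unlinking by simp
qed

end

section \<open>Rational cohomology\<close>

text \<open>Injectivity of the rationals as an abelian group, by Zorn's lemma on graphs of partial
  homomorphisms.\<close>

lemma additive_extension:
 fixes H :: "('a \<Rightarrow>\<^sub>0 int) set" and f :: "('a \<Rightarrow>\<^sub>0 int) => rat"
 assumes "0 : H" and diff: "!!x y. x : H ==> y : H ==> x - y : H" and f: "!!x y. x : H ==> y : H ==> f (x - y) = f x - f y"
 obtains g where "!!x y. g (x + y) = g x + g y" "!!x. x : H ==> g x = f x"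
proof -
 \<comment> \<open>Subgroups of the product that contain the given graph; the condition over
   \<open>0\<close> says that they are single-valued.\<close>
 define \<G> where "\<G> = {\<Gamma> :: (('a \<Rightarrow>\<^sub>0 int) \<times> rat) set. (%x. (x, f x)) ` H <= \<Gamma> &
   (\<forall>p\<in>\<Gamma>. \<forall>q\<in>\<Gamma>. p - q : \<Gamma>) & (\<forall>q. (0, q) : \<Gamma> --> q = 0)}"
 have "f 0 = 0" using f[OF assms(1,1)] by simp
 then have "\<forall>p\<in>(%x. (x, f x)) ` H. \<forall>q\<in>(%x. (x, f x)) ` H. p - q : (%x. (x, f x)) ` H"
  using diff f[symmetric] by simp
 then have G0: "(%x. (x, f x)) ` H : \<G>" unfolding \<G>_def using \<open>f 0 = 0\<close> by blast
 have "\<exists>M\<in>\<G>. \<forall>X\<in>\<G>. M <= X --> X = M"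
 proof (rule subset_Zorn_nonempty)
  show "\<G> ~= {}" using G0 by blast
  fix \<C> assume \<C>: "\<C> ~= {}" "subset.chain \<G> \<C>"
  have "p - q : \<Union>\<C>" if "p : \<Union>\<C>" "q : \<Union>\<C>" for p q
  proof -
   obtain P R where PR: "P : \<C>" "R : \<C>" "p : P" "q : R" using \<open>p : \<Union>\<C>\<close> \<open>q : \<Union>\<C>\<close> by blast
   then have "P <= R \<or> R <= P" using \<C>(2) unfolding subset_chain_def by blast
   then obtain S where S: "S : \<C>" "p : S" "q : S" using PR by blast
   then have "S : \<G>" using \<C>(2) unfolding subset_chain_def by blast
   then have "p - q : S" using S unfolding \<G>_def by blast
   then show ?thesis using S(1) by blast
  qed
  moreover have "(%x. (x, f x)) ` H <= \<Union>\<C>"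
  proof -
   obtain C where "C : \<C>" using \<C>(1) by blast
   moreover have "C : \<G>" using \<C>(2) \<open>C : \<C>\<close> by (auto simp: subset_chain_def)
   ultimately show ?thesis unfolding \<G>_def by (intro subset_trans[OF _ Union_upper]) auto
  qed
  moreover have "q = 0" if q: "(0, q) : \<Union>\<C>" for q
  proof -
   obtain C where C: "C : \<C>" "(0, q) : C" using q by blast
   then have "C : \<G>" using \<C>(2) by (auto simp: subset_chain_def)
   then show ?thesis using C(2) by (simp add: \<G>_def)
  qed
  ultimately show "\<Union>\<C> : \<G>" unfolding \<G>_def by (intro CollectI conjI ballI allI impI) simp_all
 qed
 then obtain M where M: "M : \<G>" and max0: "\<forall>X\<in>\<G>. M <= X --> X = M" by (elim bexE) (rule that)
 have max: "X = M" if "X : \<G>" "M <= X" for X using max0 that by simp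
 have graph: "!!x. x : H ==> (x, f x) : M" and Md: "!!p q. p : M ==> q : M ==> p - q : M" and M0: "!!q. (0, q) : M ==> q = 0"
  using M unfolding \<G>_def mem_Collect_eq by (meson image_subset_iff, meson, meson)
 have zero: "(0, 0) : M" using graph[OF assms(1)] \<open>f 0 = 0\<close> by simp
 have Mm: "(- x, - q) : M" if "(x, q) : M" for x q using Md[OF zero that] by simp
 have Ma: "(x + y, q + r) : M" if "(x, q) : M" "(y, r) : M" for x q y r using Md[OF that(1) Mm[OF that(2)]] by simp
 have Mn: "(frag_cmul (int n) x, of_nat n * q) : M" if "(x, q) : M" for n x q
 proof (induction n)
  case (Suc n)
  then show ?case using Ma[OF Suc that] by (simp add: frag_cmul_distrib algebra_simps)
 qed (simp add: zero)
 have Mz: "(frag_cmul k x, of_int k * q) : M" if "(x, q) : M" for k x q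
 proof (cases k rule: int_cases2)
  case (nonneg n)
  then show ?thesis using Mn[OF that, of n] by simp
 next
  case (nonpos n)
  then show ?thesis using Mm[OF Mn[OF that, of n]] by simp
 qed
 have fun_M: "q = r" if "(x, q) : M" "(x, r) : M" for x q r using M0[of "q - r"] Md[OF that] by simp
 have tot: "\<exists>q. (a, q) : M" for a
 proof -
  \<comment> \<open>If some nonzero multiple of \<open>a\<close> lies in the domain, division forces
    the value at \<open>a\<close>; otherwise \<open>0\<close> is an admissible value.\<close>
  have "\<exists>q. \<forall>k r. (frag_cmul k a, r) : M --> r = of_int k * q"
  proof (cases "\<exists>k r. k ~= 0 & (frag_cmul k a, r) : M")
   case True
   then obtain k r where kr: "k ~= 0" "(frag_cmul k a, r) : M" by blast
   have "r' = of_int k' * (r / of_int k)" if "(frag_cmul k' a, r') : M" for k' r'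
   proof -
    have "(frag_cmul (k * k') a, of_int k * r') : M" "(frag_cmul (k * k') a, of_int k' * r) : M"
     using Mz[OF that, of k] Mz[OF kr(2), of k'] by (simp_all add: mult.commute)
    then have "of_int k * r' = of_int k' * r" by (rule fun_M)
    then show ?thesis using kr(1) by (simp add: field_simps)
   qed
   then show ?thesis by blast
  next
   case False
   then have "r = of_int k * 0" if "(frag_cmul k a, r) : M" for k r using that M0 by (cases "k = 0") auto
   then show ?thesis by blast
  qed
  then obtain q where q: "!!k r. (frag_cmul k a, r) : M ==> r = of_int k * q" by blast
  define N where "N = {(x + frag_cmul k a, r + of_int k * q) |x r k. (x, r) : M}"
  have MN: "M <= N"
  proof
   fix p assume "p : M"
   then show "p : N" unfolding N_def mem_Collect_eq by (intro exI[of _ "fst p"] exI[of _ "snd p"] exI[of _ 0]) simp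
  qed
  have "N : \<G>" unfolding \<G>_def
  proof (intro CollectI conjI ballI allI impI)
   show "(%x. (x, f x)) ` H <= N" using MN graph by blast
   fix p p' assume "p : N" "p' : N"
   then obtain x r k x' r' k' where *: "p = (x + frag_cmul k a, r + of_int k * q)" "(x, r) : M"
    "p' = (x' + frag_cmul k' a, r' + of_int k' * q)" "(x', r') : M" unfolding N_def by blast
   have "(x - x', r - r') : M" using Md[OF *(2,4)] by simp
   moreover have "p - p' = ((x - x') + frag_cmul (k - k') a, (r - r') + of_int (k - k') * q)"
    unfolding * by (simp add: frag_cmul_diff_distrib algebra_simps)
   ultimately show "p - p' : N" unfolding N_def by blast
  next
   fix s assume "(0, s) : N"
   then obtain x r k where x: "x + frag_cmul k a = 0" "s = r + of_int k * q" "(x, r) : M" unfolding N_def by auto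
   then have "frag_cmul (- k) a = x" by (simp add: add_eq_0_iff2)
   then have "r = of_int (- k) * q" using q[of "- k" r] x(3) by simp
   then show "s = 0" using x(2) by simp
  qed
  then have "N = M" using max MN by blast
  moreover have "(a, q) : N" unfolding N_def mem_Collect_eq by (rule exI[of _ 0], rule exI[of _ 0], rule exI[of _ 1]) (use zero in simp)
  ultimately show ?thesis by blast
 qed
 define g where "g a = (THE q. (a, q) : M)" for a
 have g: "(a, g a) : M" for a unfolding g_def using tot[of a] by (elim exE, rule_tac theI) (assumption, rule fun_M)
 show ?thesis
 proof
  show "g (x + y) = g x + g y" for x y using fun_M[OF g Ma[OF g g]] .
  show "g x = f x" if "x : H" for x using fun_M[OF g graph[OF that]] .
 qed
qed

section \<open>Ranks of rational duals of abelian groups\<close>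

definition additive_on :: "('a, 'b) monoid_scheme => ('a => rat) => bool" where
 "additive_on A f \<longleftrightarrow> (\<forall>x\<in>carrier A. \<forall>y\<in>carrier A. f (x \<otimes>\<^bsub>A\<^esub> y) = f x + f y)"

text \<open>\<open>Hom(A, \<rat>)\<close> is the space of functions on some \<open>r\<close> elements of \<open>A\<close>.\<close>

definition dual_rank :: "('a, 'b) monoid_scheme => nat => bool" where
 "dual_rank A r \<longleftrightarrow> (\<exists>b. (\<forall>i<r. b i : carrier A) &
   (\<forall>g :: nat => rat. \<exists>f. additive_on A f & (\<forall>i<r. f (b i) = g i)) &
   (\<forall>f. additive_on A f & (\<forall>i<r. f (b i) = 0) --> (\<forall>a\<in>carrier A. f a = 0)))"

lemma dual_rankE:
 assumes "dual_rank A r"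
 obtains b where "!!i. i < r ==> b i : carrier A"
  "!!g :: nat => rat. \<exists>f. additive_on A f & (\<forall>i<r. f (b i) = g i)"
  "!!f a. additive_on A f ==> (!!i. i < r ==> f (b i) = 0) ==> a : carrier A ==> f a = 0" using assms unfolding dual_rank_def by blast

lemma dual_rankI:
 assumes "!!i. i < r ==> b i : carrier A"
  "!!g :: nat => rat. \<exists>f. additive_on A f & (\<forall>i<r. f (b i) = g i)"
  "!!f a. additive_on A f ==> (!!i. i < r ==> f (b i) = 0) ==> a : carrier A ==> f a = 0" shows "dual_rank A r"
 unfolding dual_rank_def using assms by blast

lemma additive_on_one: "group A ==> additive_on A f ==> f \<one>\<^bsub>A\<^esub> = 0"
 unfolding additive_on_def using group.is_monoid[of A] by (metis add_cancel_right_left monoid.l_one monoid.one_closed)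

lemma additive_on_compose:
 assumes "h : hom A C" "additive_on C f" shows "additive_on A (f \<circ> h)"
 using assms unfolding additive_on_def by (auto simp: hom_def Pi_iff)

lemma dual_rank_iso:
 assumes A: "dual_rank A r" and h: "h : iso A C" and "group A" "group C" shows "dual_rank C r"
proof -
 obtain b where b: "!!i. i < r ==> b i : carrier A"
  "!!g :: nat => rat. \<exists>f. additive_on A f & (\<forall>i<r. f (b i) = g i)"
  "!!f a. additive_on A f ==> (!!i. i < r ==> f (b i) = 0) ==> a : carrier A ==> f a = 0" using A by (rule dual_rankE) blast
 have hA: "h : hom A C" "bij_betw h (carrier A) (carrier C)" using h by (auto simp: iso_def)
 let ?k = "inv_into (carrier A) h"
 have k: "?k : hom C A" using group.iso_set_sym[OF assms(3) h] by (simp add: iso_def)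
 have kh: "?k (h a) = a" if "a : carrier A" for a using hA(2) that by (simp add: bij_betw_inv_into_left)
 show ?thesis
 proof (rule dual_rankI[of r "%i. h (b i)"])
  show "h (b i) : carrier C" if "i < r" for i using b(1)[OF that] hA(2) by (auto simp: bij_betw_def)
  show "\<exists>f. additive_on C f & (\<forall>i<r. f (h (b i)) = g i)" for g
  proof -
   obtain f where f: "additive_on A f" "\<forall>i<r. f (b i) = g i" using b(2) by blast
   show ?thesis by (rule exI[of _ "f \<circ> ?k"]) (use additive_on_compose[OF k f(1)] f(2) b(1) kh in simp)
  qed
  fix f c assume f: "additive_on C f" "!!i. i < r ==> f (h (b i)) = 0" and c: "c : carrier C"
  obtain a where "a : carrier A" "c = h a" using c hA(2) by (auto simp: bij_betw_def)
  then show "f c = 0" using b(3)[OF additive_on_compose[OF hA(1) f(1)], of a] f(2) by simp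
 qed
qed

lemma dual_rank_is_iso: "dual_rank A r ==> A \<cong> C ==> group A ==> group C ==> dual_rank C r"
 unfolding is_iso_def using dual_rank_iso by blast

lemma dual_rank_trivial: "trivial_group A ==> dual_rank A 0"
proof (rule dual_rankI[of 0])
 assume A: "trivial_group A"
 show "\<exists>f. additive_on A f & (\<forall>i<0. f (undefined i) = g i)" for g :: "nat => rat"
  by (rule exI[of _ "%_. 0"]) (simp add: additive_on_def)
 show "f a = 0" if "additive_on A f" "a : carrier A" for f a using A that additive_on_one[of A f] by (simp add: trivial_group_def)
qed simp

text \<open>An extension by the integers splits: a preimage \<open>e\<close> of \<open>1\<close>
  joins the old test elements, and a functional on \<open>A\<close> together with a value at
  \<open>e\<close> determines a functional on \<open>E\<close>.\<close>

lemma dual_rank_extension: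
 assumes A: "dual_rank A r" and gr: "comm_group E" "group A"
  and \<alpha>: "\<alpha> : mon A E" and \<beta>: "\<beta> : epi E integer_group"
  and ex: "kernel E integer_group \<beta> = \<alpha> ` carrier A" shows "dual_rank E (Suc r)"
proof -
 interpret E: comm_group E by (rule gr)
 interpret \<alpha>: group_hom A E \<alpha> using \<alpha> gr E.is_group by (simp add: group_hom_def group_hom_axioms_def mon_def)
 interpret \<beta>: group_hom E integer_group \<beta> using \<beta> E.is_group by (simp add: group_hom_def group_hom_axioms_def epi_def)
 obtain b where b: "!!i. i < r ==> b i : carrier A"
  "!!g :: nat => rat. \<exists>f. additive_on A f & (\<forall>i<r. f (b i) = g i)"
  "!!f a. additive_on A f ==> (!!i. i < r ==> f (b i) = 0) ==> a : carrier A ==> f a = 0" using A by (rule dual_rankE) blast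
 have inj: "inj_on \<alpha> (carrier A)" using \<alpha> by (simp add: mon_def)
 have \<beta>m: "\<beta> (x \<otimes>\<^bsub>E\<^esub> y) = \<beta> x + \<beta> y" if "x : carrier E" "y : carrier E" for x y using \<beta>.hom_mult[OF that] by simp
 have \<beta>1: "\<beta> \<one>\<^bsub>E\<^esub> = 0" using \<beta>.hom_one by simp
 have "\<beta> ` carrier E = UNIV" using \<beta> by (simp add: epi_def)
 then obtain e where e: "e : carrier E" "\<beta> e = 1" by (metis UNIV_I imageE)
 have \<beta>pow: "\<beta> (e [^]\<^bsub>E\<^esub> (k::int)) = k" for k using \<beta>.hom_int_pow[OF e(1), of k] e(2) by simp
 have \<beta>inv: "\<beta> (inv\<^bsub>E\<^esub> x) = - \<beta> x" if "x : carrier E" for x using \<beta>.hom_inv[OF that] by simp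
 \<comment> \<open>The retraction of the splitting: dividing by the right power of \<open>e\<close>
   lands in the kernel, that is, in the image of \<open>A\<close>.\<close>
 define \<gamma> where "\<gamma> x = inv_into (carrier A) \<alpha> (x \<otimes>\<^bsub>E\<^esub> inv\<^bsub>E\<^esub> (e [^]\<^bsub>E\<^esub> \<beta> x))" for x
 have ker: "x \<otimes>\<^bsub>E\<^esub> inv\<^bsub>E\<^esub> (e [^]\<^bsub>E\<^esub> \<beta> x) : \<alpha> ` carrier A" if "x : carrier E" for x
  unfolding ex[symmetric] kernel_def using that e \<beta>m \<beta>pow \<beta>inv by simp
 have \<gamma>: "\<gamma> x : carrier A" "\<alpha> (\<gamma> x) = x \<otimes>\<^bsub>E\<^esub> inv\<^bsub>E\<^esub> (e [^]\<^bsub>E\<^esub> \<beta> x)" if "x : carrier E" for x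
  unfolding \<gamma>_def using inv_into_into[OF ker[OF that]] f_inv_into_f[OF ker[OF that]] .
 have dec: "x = \<alpha> (\<gamma> x) \<otimes>\<^bsub>E\<^esub> e [^]\<^bsub>E\<^esub> \<beta> x" if "x : carrier E" for x
  unfolding \<gamma>(2)[OF that] using that e by (simp add: E.m_assoc)
 have \<gamma>m: "\<gamma> (x \<otimes>\<^bsub>E\<^esub> y) = \<gamma> x \<otimes>\<^bsub>A\<^esub> \<gamma> y" if x: "x : carrier E" and y: "y : carrier E" for x y
 proof (rule inj_onD[OF inj])
  have "e [^]\<^bsub>E\<^esub> (\<beta> x + \<beta> y) = e [^]\<^bsub>E\<^esub> \<beta> x \<otimes>\<^bsub>E\<^esub> e [^]\<^bsub>E\<^esub> \<beta> y" using e by (simp add: E.int_pow_mult)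
  then show "\<alpha> (\<gamma> (x \<otimes>\<^bsub>E\<^esub> y)) = \<alpha> (\<gamma> x \<otimes>\<^bsub>A\<^esub> \<gamma> y)"
   using x y e \<gamma>(1)[OF x] \<gamma>(1)[OF y]
   by (simp add: \<gamma>(2)[OF x] \<gamma>(2)[OF y] \<gamma>(2)[OF E.m_closed[OF x y]] \<beta>m E.inv_mult E.m_ac)
 qed (use \<gamma>(1) x y in auto)
 have \<beta>\<alpha>: "\<beta> (\<alpha> a) = 0" if a: "a : carrier A" for a using ex a by (auto simp: kernel_def)
 have \<gamma>\<alpha>: "\<gamma> (\<alpha> a) = a" if a: "a : carrier A" for a using a inj by (simp add: \<beta>\<alpha> \<gamma>_def)
 have \<gamma>e: "\<gamma> e = \<one>\<^bsub>A\<^esub>"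
  using e inv_into_f_f[OF inj monoid.one_closed[OF group.is_monoid[OF gr(2)]]] by (simp add: \<gamma>_def)
 show ?thesis
 proof (rule dual_rankI[of "Suc r" "%i. if i < r then \<alpha> (b i) else e"])
  show "(if i < r then \<alpha> (b i) else e) : carrier E" for i using b(1) e by simp
  show "\<exists>f. additive_on E f & (\<forall>i<Suc r. f (if i < r then \<alpha> (b i) else e) = g i)" for g
  proof -
   obtain f where f: "additive_on A f" "\<forall>i<r. f (b i) = g i" using b(2) by blast
   have f1: "f \<one>\<^bsub>A\<^esub> = 0" by (rule additive_on_one[OF gr(2) f(1)])
   have "additive_on E (%x. f (\<gamma> x) + of_int (\<beta> x) * g r)" unfolding additive_on_def
   proof (intro ballI)
    fix x y assume xy: "x : carrier E" "y : carrier E"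
    have "f (\<gamma> x \<otimes>\<^bsub>A\<^esub> \<gamma> y) = f (\<gamma> x) + f (\<gamma> y)"
     using f(1) \<gamma>(1) xy unfolding additive_on_def by blast
    then show "f (\<gamma> (x \<otimes>\<^bsub>E\<^esub> y)) + of_int (\<beta> (x \<otimes>\<^bsub>E\<^esub> y)) * g r
      = f (\<gamma> x) + of_int (\<beta> x) * g r + (f (\<gamma> y) + of_int (\<beta> y) * g r)"
     using \<gamma>m[OF xy] \<beta>m[OF xy] by (simp add: algebra_simps)
   qed
   moreover have "f (\<gamma> (if i < r then \<alpha> (b i) else e)) + of_int (\<beta> (if i < r then \<alpha> (b i) else e)) * g r = g i" if "i < Suc r" for i
    using that \<gamma>\<alpha>[OF b(1), of i] \<beta>\<alpha>[OF b(1), of i] f(2) \<gamma>e e(2) f1 by (cases "i < r") (auto simp: less_Suc_eq)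
   ultimately show ?thesis by blast
  qed
  fix f x assume f: "additive_on E f" "!!i. i < Suc r ==> f (if i < r then \<alpha> (b i) else e) = 0" and x: "x : carrier E"
  have "(f \<circ> \<alpha>) (b i) = 0" if "i < r" for i using f(2)[of i] that by simp
  then have 0: "f (\<alpha> a) = 0" if "a : carrier A" for a using b(3)[OF additive_on_compose[OF \<alpha>.homh f(1)] _ that] by simp
  have "f e = 0" using f(2)[of r] by simp
  then have n: "f (e [^]\<^bsub>E\<^esub> (n::nat)) = 0" for n
  proof (induction n)
   case (Suc n)
   then show ?case using f(1) e unfolding additive_on_def by (simp add: E.nat_pow_closed)
  qed (simp add: additive_on_one[OF E.is_group f(1)])
  have "f (e [^]\<^bsub>E\<^esub> (k::int)) = 0" for k
  proof (cases k rule: int_cases2)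
   case (nonneg m)
   then show ?thesis using n by (simp add: int_pow_int)
  next
   case (nonpos m)
   have "f (e [^]\<^bsub>E\<^esub> m \<otimes>\<^bsub>E\<^esub> inv\<^bsub>E\<^esub> (e [^]\<^bsub>E\<^esub> m)) = f (e [^]\<^bsub>E\<^esub> m) + f (inv\<^bsub>E\<^esub> (e [^]\<^bsub>E\<^esub> m))"
    using f(1) e unfolding additive_on_def by (meson E.inv_closed E.nat_pow_closed)
   then have "f (inv\<^bsub>E\<^esub> (e [^]\<^bsub>E\<^esub> m)) = 0" using n additive_on_one[OF E.is_group f(1)] e by simp
   then show ?thesis using nonpos e by (simp add: E.int_pow_neg_int)
  qed
  then have "f (\<alpha> (\<gamma> x)) + f (e [^]\<^bsub>E\<^esub> \<beta> x) = 0" using 0 \<gamma>(1)[OF x] by simp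
  then show "f x = 0"
   using dec[OF x] f(1) \<alpha>.hom_closed[OF \<gamma>(1)[OF x]] E.int_pow_closed[OF e(1), of "\<beta> x"] unfolding additive_on_def by metis
 qed
qed

text \<open>A bijection onto rational functions on \<open>I\<close> that is compatible with the
  operations. The vector space axioms, quotients included, are then pulled back from functions, and
  isomorphism becomes a bijection of index sets.\<close>

definition coordinates :: "(rat, 'a) module => 'i set => ('a => 'i => rat) => bool" where
 "coordinates V I T \<longleftrightarrow> bij_betw T (carrier V) (I \<rightarrow>\<^sub>E UNIV) &
   (\<forall>x\<in>carrier V. \<forall>y\<in>carrier V. x \<oplus>\<^bsub>V\<^esub> y : carrier V & T (x \<oplus>\<^bsub>V\<^esub> y) = (\<lambda>i\<in>I. T x i + T y i)) &
   (\<forall>k. \<forall>x\<in>carrier V. k \<odot>\<^bsub>V\<^esub> x : carrier V & T (k \<odot>\<^bsub>V\<^esub> x) = (\<lambda>i\<in>I. k * T x i)) &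
   \<zero>\<^bsub>V\<^esub> : carrier V & T \<zero>\<^bsub>V\<^esub> = (\<lambda>i\<in>I. 0)"

lemma coordinatesD:
 assumes "coordinates V I T" shows "bij_betw T (carrier V) (I \<rightarrow>\<^sub>E UNIV)"
  "!!x y. x : carrier V ==> y : carrier V ==> x \<oplus>\<^bsub>V\<^esub> y : carrier V"
  "!!x y. x : carrier V ==> y : carrier V ==> T (x \<oplus>\<^bsub>V\<^esub> y) = (\<lambda>i\<in>I. T x i + T y i)"
  "!!k x. x : carrier V ==> k \<odot>\<^bsub>V\<^esub> x : carrier V"
  "!!k x. x : carrier V ==> T (k \<odot>\<^bsub>V\<^esub> x) = (\<lambda>i\<in>I. k * T x i)"
  "\<zero>\<^bsub>V\<^esub> : carrier V" "T \<zero>\<^bsub>V\<^esub> = (\<lambda>i\<in>I. 0)"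
  "!!x. x : carrier V ==> (\<lambda>i\<in>I. T x i) = T x"
  "!!x y. x : carrier V ==> y : carrier V ==> T x = T y ==> x = y"
  "!!f. f : I \<rightarrow>\<^sub>E UNIV ==> \<exists>x\<in>carrier V. T x = f"
proof -
 show b: "bij_betw T (carrier V) (I \<rightarrow>\<^sub>E UNIV)" using assms unfolding coordinates_def by blast
 show "(\<lambda>i\<in>I. T x i) = T x" if "x : carrier V" for x using bij_betw_apply[OF b that] by (rule PiE_restrict)
 show "x = y" if "x : carrier V" "y : carrier V" "T x = T y" for x y using bij_betw_imp_inj_on[OF b] that(3,1,2) by (rule inj_onD)
 show "\<exists>x\<in>carrier V. T x = f" if f: "f : I \<rightarrow>\<^sub>E UNIV" for f
  using f unfolding bij_betw_imp_surj_on[OF b, symmetric] by blast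
qed (use assms in "simp_all add: coordinates_def")

lemma coordinates_vectorspace:
 assumes "coordinates V I T" shows "vectorspace class_ring V"
proof -
 note c = coordinatesD[OF assms]
 have "abelian_group V"
 proof (rule abelian_groupI)
  fix x y z assume x: "x : carrier V" and y: "y : carrier V"
  show "x \<oplus>\<^bsub>V\<^esub> y = y \<oplus>\<^bsub>V\<^esub> x" by (rule c(9)) (use x y in "auto simp: c(2,3) add.commute")
  assume z: "z : carrier V"
  show "x \<oplus>\<^bsub>V\<^esub> y \<oplus>\<^bsub>V\<^esub> z = x \<oplus>\<^bsub>V\<^esub> (y \<oplus>\<^bsub>V\<^esub> z)"
   by (rule c(9)) (use x y z in "auto simp: c(2,3) add.assoc intro!: restrict_ext")
 next
  fix x assume x: "x : carrier V"
  show "\<zero>\<^bsub>V\<^esub> \<oplus>\<^bsub>V\<^esub> x = x"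
   by (rule c(9)) (use x c(8)[OF x] in "auto simp: c(2,3,6,7) cong: restrict_cong")
  have "(- 1) \<odot>\<^bsub>V\<^esub> x \<oplus>\<^bsub>V\<^esub> x = \<zero>\<^bsub>V\<^esub>"
   by (rule c(9)) (use x in "auto simp: c(2-7) cong: restrict_cong")
  then show "\<exists>y\<in>carrier V. y \<oplus>\<^bsub>V\<^esub> x = \<zero>\<^bsub>V\<^esub>" using c(4)[OF x] by blast
 qed (use c in auto)
 then have "module class_ring V"
 proof (intro moduleI)
  show "cring (class_ring :: rat ring)" by (rule class_cring.is_cring)
  fix a b :: rat and x y assume x: "x : carrier V"
  show "a \<odot>\<^bsub>V\<^esub> x : carrier V" by (rule c(4)[OF x])
  show "(a \<oplus>\<^bsub>class_ring\<^esub> b) \<odot>\<^bsub>V\<^esub> x = a \<odot>\<^bsub>V\<^esub> x \<oplus>\<^bsub>V\<^esub> b \<odot>\<^bsub>V\<^esub> x"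
   by (rule c(9)) (use x in "auto simp: c(2-5) algebra_simps intro!: restrict_ext")
  show "(a \<otimes>\<^bsub>class_ring\<^esub> b) \<odot>\<^bsub>V\<^esub> x = a \<odot>\<^bsub>V\<^esub> (b \<odot>\<^bsub>V\<^esub> x)"
   by (rule c(9)) (use x in "auto simp: c(2-5) algebra_simps intro!: restrict_ext")
  show "\<one>\<^bsub>class_ring\<^esub> \<odot>\<^bsub>V\<^esub> x = x"
   by (rule c(9)) (use x c(8)[OF x] in "auto simp: c(2-5) cong: restrict_cong")
  assume y: "y : carrier V"
  show "a \<odot>\<^bsub>V\<^esub> (x \<oplus>\<^bsub>V\<^esub> y) = a \<odot>\<^bsub>V\<^esub> x \<oplus>\<^bsub>V\<^esub> a \<odot>\<^bsub>V\<^esub> y"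
   by (rule c(9)) (use x y in "auto simp: c(2-5) algebra_simps intro!: restrict_ext")
 qed
 then show ?thesis by (simp add: vectorspace_def class_field.field_axioms)
qed

lemma coordinates_isomorphism:
 assumes V: "coordinates V I T" and W: "coordinates W J S" and h: "bij_betw h J I"
 shows "\<exists>F. linear_map class_ring V W F & bij_betw F (carrier V) (carrier W)"
proof -
 note v = coordinatesD[OF V] and w = coordinatesD[OF W]
 define re where "re f = (\<lambda>j\<in>J. f (h j))" for f :: "_ => rat"
 have hJ: "h j : I" if "j : J" for j using h that by (auto simp: bij_betw_def)
 have re: "bij_betw re (I \<rightarrow>\<^sub>E UNIV) (J \<rightarrow>\<^sub>E UNIV)"
 proof (rule bij_betwI[where g = "%f. \<lambda>i\<in>I. f (inv_into J h i)"])
  have i: "inv_into J h i : J" "h (inv_into J h i) = i" if "i : I" for i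
   using h that by (auto simp: bij_betw_def inv_into_into f_inv_into_f)
  have j: "inv_into J h (h j) = j" if "j : J" for j using h that by (auto simp: bij_betw_def)
  show "(\<lambda>i\<in>I. re f (inv_into J h i)) = f" if "f : I \<rightarrow>\<^sub>E UNIV" for f
   using that i PiE_arb[OF that] by (auto simp: re_def fun_eq_iff)
  show "re (\<lambda>i\<in>I. f (inv_into J h i)) = f" if "f : J \<rightarrow>\<^sub>E UNIV" for f
   using that j hJ PiE_arb[OF that] by (auto simp: re_def fun_eq_iff)
 qed (auto simp: re_def)
 define F where "F x = inv_into (carrier W) S (re (T x))" for x
 have F: "bij_betw F (carrier V) (carrier W)" using bij_betw_trans[OF bij_betw_trans[OF v(1) re] bij_betw_inv_into[OF w(1)]]
  by (simp add: F_def[abs_def] o_def)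
 have Fc: "F x : carrier W" if "x : carrier V" for x using F that by (auto simp: bij_betw_def)
 have SF: "S (F x) = re (T x)" if "x : carrier V" for x
 proof -
  have "re (T x) : S ` carrier W" unfolding bij_betw_imp_surj_on[OF w(1)] by (rule bij_betw_apply[OF re bij_betw_apply[OF v(1) that]])
  then show ?thesis unfolding F_def by (rule f_inv_into_f)
 qed
 have "F : module_hom class_ring V W" unfolding module_hom_def
 proof (intro CollectI conjI allI impI)
  show "F : carrier V \<rightarrow> carrier W" using Fc by blast
  show "F (x \<oplus>\<^bsub>V\<^esub> y) = F x \<oplus>\<^bsub>W\<^esub> F y" if "x : carrier V & y : carrier V" for x y
   by (rule w(9)) (use that hJ in "auto simp: Fc SF v(2,3) w(2,3) re_def intro!: restrict_ext")
  show "F (k \<odot>\<^bsub>V\<^esub> x) = k \<odot>\<^bsub>W\<^esub> F x" if "k : carrier class_ring & x : carrier V" for k x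
   by (rule w(9)) (use that hJ in "auto simp: Fc SF v(4,5) w(4,5) re_def intro!: restrict_ext")
 qed
 moreover have "vectorspace class_ring V" "vectorspace class_ring W" using coordinates_vectorspace V W by blast+
 ultimately have "linear_map class_ring V W F" by (simp add: linear_map_def mod_hom_def mod_hom_axioms_def vectorspace_def)
 then show ?thesis using F by blast
qed

lemma coordinates_zero_module: "coordinates zero_module {} (%_ _. undefined)"
 by (auto simp: coordinates_def zero_module_def bij_betw_def restrict_def)

text \<open>For a finite index set the finite support condition is automatic, so the sum has the
  disjoint union of the coordinate sets as coordinates.\<close>

lemma coordinates_direct_sum:
 assumes I: "finite I" and V: "!!i. i : I ==> coordinates (V i) (J i) (T i)"
 shows "coordinates (direct_sum_family I V) (Sigma I J) (%x. \<lambda>(i, j)\<in>Sigma I J. T i (x i) j)"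
proof -
 note v = coordinatesD[OF V]
 let ?C = "\<Pi>\<^sub>E i\<in>I. carrier (V i)"
 let ?T = "%x. \<lambda>(i, j)\<in>Sigma I J. T i (x i) j"
 have fin: "finite {i : I. x i ~= \<zero>\<^bsub>V i\<^esub>}" for x using I by simp
 have inj: "inj_on ?T ?C"
 proof (rule inj_onI)
  fix x y assume x: "x : ?C" and y: "y : ?C" and eq: "?T x = ?T y"
  show "x = y"
  proof (rule PiE_ext[OF x y])
   fix i assume i: "i : I"
   have xi: "x i : carrier (V i)" "y i : carrier (V i)" using x y i by auto
   have "T i (x i) j = T i (y i) j" if "j : J i" for j using fun_cong[OF eq, of "(i, j)"] i that by simp
   then have "(\<lambda>j\<in>J i. T i (x i) j) = (\<lambda>j\<in>J i. T i (y i) j)" by (intro restrict_ext)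
   then show "x i = y i" using v(8)[OF i xi(1)] v(8)[OF i xi(2)] v(9)[OF i xi] by simp
  qed
 qed
 have surj: "\<exists>x\<in>?C. ?T x = f" if f: "f : Sigma I J \<rightarrow>\<^sub>E UNIV" for f
 proof -
  have "\<exists>x\<in>carrier (V i). T i x = (\<lambda>j\<in>J i. f (i, j))" if "i : I" for i by (rule v(10)[OF that]) auto
  then obtain x where x: "!!i. i : I ==> x i : carrier (V i)" "!!i. i : I ==> T i (x i) = (\<lambda>j\<in>J i. f (i, j))" by metis
  have "?T (restrict x I) = f" using x(2) PiE_arb[OF f] by (auto simp: fun_eq_iff)
  moreover have "restrict x I : ?C" using x(1) by auto
  ultimately show ?thesis by blast
 qed
 have "bij_betw ?T ?C (Sigma I J \<rightarrow>\<^sub>E UNIV)" unfolding bij_betw_def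
 proof (intro conjI inj equalityI subsetI)
  fix f :: "_ => rat" assume "f : Sigma I J \<rightarrow>\<^sub>E UNIV"
  then show "f : ?T ` ?C" using surj[of f] by (metis (no_types, lifting) image_eqI)
 next
  fix f assume "f : ?T ` ?C"
  then obtain x where "f = ?T x" by blast
  then show "f : Sigma I J \<rightarrow>\<^sub>E UNIV" by (intro PiE_I) (simp_all only: UNIV_I restrict_apply if_False)
 qed
 moreover have "carrier (direct_sum_family I V) = ?C" using fin by (simp add: direct_sum_family_def)
 moreover have "x \<oplus>\<^bsub>direct_sum_family I V\<^esub> y : ?C &
   ?T (x \<oplus>\<^bsub>direct_sum_family I V\<^esub> y) = (\<lambda>p\<in>Sigma I J. ?T x p + ?T y p)" if xy: "x : ?C" "y : ?C" for x y
 proof -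
  have m: "x i : carrier (V i)" "y i : carrier (V i)" if "i : I" for i using xy that by auto
  have "T i (x i \<oplus>\<^bsub>V i\<^esub> y i) j = T i (x i) j + T i (y i) j" if "i : I" "j : J i" for i j
   using v(3)[OF that(1) m[OF that(1)]] that(2) by simp
  then show ?thesis using v(2)[OF _ m] by (auto simp: direct_sum_family_def fun_eq_iff)
 qed
 moreover have "k \<odot>\<^bsub>direct_sum_family I V\<^esub> x : ?C &
   ?T (k \<odot>\<^bsub>direct_sum_family I V\<^esub> x) = (\<lambda>p\<in>Sigma I J. k * ?T x p)" if x: "x : ?C" for k x
 proof -
  have m: "x i : carrier (V i)" if "i : I" for i using x that by auto
  have "T i (k \<odot>\<^bsub>V i\<^esub> x i) j = k * T i (x i) j" if "i : I" "j : J i" for i j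
   using v(5)[OF that(1) m[OF that(1)]] that(2) by simp
  then show ?thesis using v(4)[OF _ m] by (auto simp: direct_sum_family_def fun_eq_iff)
 qed
 moreover have "\<zero>\<^bsub>direct_sum_family I V\<^esub> : ?C & ?T \<zero>\<^bsub>direct_sum_family I V\<^esub> = (\<lambda>p\<in>Sigma I J. 0)"
  using v(6,7) by (auto simp: direct_sum_family_def fun_eq_iff)
 ultimately show ?thesis unfolding coordinates_def by simp
qed

section \<open>Universal coefficients over the rationals\<close>

lemma cochains_iff:
 "ph : cochains p X \<longleftrightarrow> ph : extensional (singular_chain_set p X) &
   (\<forall>s\<in>singular_chain_set p X. \<forall>t\<in>singular_chain_set p X. ph (s + t) = ph s + ph t)"
 by (auto simp: cochains_def hom_def)

lemma cochain_diff:
 assumes "ph : cochains p X" "singular_chain p X s" "singular_chain p X t" shows "ph (s - t) = ph s - ph t"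
proof -
 have "ph ((s - t) + t) = ph (s - t) + ph t" using assms singular_chain_diff[OF assms(2,3)] unfolding cochains_iff by blast
 then show ?thesis by simp
qed

lemma cochain_zero: "ph : cochains p X ==> ph 0 = 0" using cochain_diff[of ph p X 0 0] by simp

text \<open>A homomorphism on a subgroup of chains extends to a cochain because \<open>\<rat>\<close> is divisible.\<close>

lemma cochain_extension:
 assumes "0 : H" "!!x y. x : H ==> y : H ==> x - y : H" "H <= singular_chain_set p X"
  and "!!x y. x : H ==> y : H ==> f (x - y) = f x - f y"
 obtains ph where "ph : cochains p X" "!!x. x : H ==> ph x = f x"
proof -
 obtain g where g: "!!x y. g (x + y) = g x + g y" "!!x. x : H ==> g x = f x"
  by (rule additive_extension[OF assms(1,2,4)]) (assumption+, rule that)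
 show ?thesis
 proof
  show "restrict g (singular_chain_set p X) : cochains p X" by (simp add: cochains_iff g(1) singular_chain_add)
  show "restrict g (singular_chain_set p X) x = f x" if "x : H" for x using g(2)[OF that] that assms(3) by auto
 qed
qed

lemma carrier_cocycles:
 "carrier (cocycles p X) = {ph : cochains p X. \<forall>s. singular_chain (Suc p) X s --> ph (chain_boundary (Suc p) s) = 0}"
 by (auto simp: cocycles_def)

text \<open>A cochain vanishing on cycles factors through the boundary map, and the resulting
  functional on boundaries extends to all chains by divisibility.\<close>

lemma coboundaryI:
 assumes ph: "ph : cochains p X" and 0: "!!z. singular_relcycle p X {} z ==> ph z = 0" shows "ph : coboundaries p X"
proof -
 let ?C = "singular_chain_set p X"
 define f where "f b = ph (SOME s. s : ?C & chain_boundary p s = b)" for b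
 have f: "f (chain_boundary p s) = ph s" if s: "s : ?C" for s
 proof -
  define t where "t = (SOME t. t : ?C & chain_boundary p t = chain_boundary p s)"
  have t: "t : ?C" "chain_boundary p t = chain_boundary p s"
   using someI[of "%t. t : ?C & chain_boundary p t = chain_boundary p s" s] s unfolding t_def by auto
  then have "singular_relcycle p X {} (t - s)" using s by (simp add: singular_cycle singular_chain_diff chain_boundary_diff)
  then have "ph t = ph s" using 0[of "t - s"] cochain_diff[OF ph, of t s] t s by simp
  then show ?thesis by (simp add: f_def t_def)
 qed
 obtain ps where ps: "ps : cochains (p - 1) X" "!!x. x : chain_boundary p ` ?C ==> ps x = f x"
 proof (rule cochain_extension[of "chain_boundary p ` ?C" "p - 1" X f])
  show "0 : chain_boundary p ` ?C" by (rule image_eqI[of _ _ 0]) auto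
  show "x - y : chain_boundary p ` ?C" if "x : chain_boundary p ` ?C" "y : chain_boundary p ` ?C" for x y
   using that by (auto simp: chain_boundary_diff[symmetric] singular_chain_diff)
  show "chain_boundary p ` ?C <= singular_chain_set (p - 1) X" by (auto simp: singular_chain_boundary)
  show "f (x - y) = f x - f y" if xy: "x : chain_boundary p ` ?C" "y : chain_boundary p ` ?C" for x y
  proof -
   obtain s t where st: "singular_chain p X s" "singular_chain p X t" "x = chain_boundary p s" "y = chain_boundary p t" using xy by blast
   show ?thesis unfolding st(3,4) chain_boundary_diff[symmetric]
    using f[of "s - t"] f[of s] f[of t] st(1,2) by (simp add: singular_chain_diff cochain_diff[OF ph])
  qed
 qed (use that in blast)
 have "ph = (\<lambda>s\<in>?C. ps (chain_boundary p s))" using ph ps(2) f by (auto simp: cochains_iff extensional_def fun_eq_iff)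
 then show ?thesis unfolding coboundaries_def using ps(1) by blast
qed

lemma coboundaryD:
 assumes "w : coboundaries p X" shows "w : carrier (cocycles p X)" "!!z. singular_relcycle p X {} z ==> w z = 0"
proof -
 obtain ps where ps: "ps : cochains (p - 1) X" "w = (\<lambda>s\<in>singular_chain_set p X. ps (chain_boundary p s))"
  using assms unfolding coboundaries_def by blast
 have b: "singular_chain (p - 1) X (chain_boundary p s)" if "singular_chain p X s" for s using singular_chain_boundary[OF that] by simp
 have "w : cochains p X" unfolding cochains_iff ps(2) using ps(1) b by (simp add: singular_chain_add chain_boundary_add cochains_iff)
 then show "w : carrier (cocycles p X)" unfolding carrier_cocycles using cochain_zero[OF ps(1)] singular_chain_boundary[of "Suc p" X]
  by (simp add: ps(2) chain_boundary_boundary_alt)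
 show "w z = 0" if "singular_relcycle p X {} z" for z using that cochain_zero[OF ps(1)] by (simp add: ps(2) singular_cycle)
qed

lemma coboundaries_iff:
 "ph : coboundaries p X \<longleftrightarrow> ph : cochains p X & (\<forall>z. singular_relcycle p X {} z --> ph z = 0)"
 using coboundaryI[of ph p X] coboundaryD[of ph p X] carrier_cocycles[of p X] by blast

lemma cochains_arith:
 assumes "ph : cochains p X" "ps : cochains p X" shows "(\<lambda>s\<in>singular_chain_set p X. ph s + ps s) : cochains p X"
  "(\<lambda>s\<in>singular_chain_set p X. ph s - ps s) : cochains p X"
  "(\<lambda>s\<in>singular_chain_set p X. k * ph s) : cochains p X"
 using assms by (simp_all add: cochains_iff singular_chain_add algebra_simps)

lemma hom_homologous_rel_set:
 "homologous_rel_set p X S : hom (relcycle_group p X S) (Hr (int p) X S)"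
 using normal.r_coset_hom_Mod[OF normal_subgroup_singular_relboundary_relcycle]
 by (simp add: right_coset_singular_relboundary relative_homology_group_def)

lemma homologous_rel_set_add:
 assumes "singular_relcycle p X S a" "singular_relcycle p X S b"
 shows "homologous_rel_set p X S a \<otimes>\<^bsub>Hr (int p) X S\<^esub> homologous_rel_set p X S b = homologous_rel_set p X S (a + b)"
 using hom_mult[OF hom_homologous_rel_set, of a p X S b] assms by simp

text \<open>Describing a class by its values on cycles allows the operations of the quotient module
  to be computed on representatives.\<close>

lemma coset_coboundaries:
 assumes ph: "ph : cochains p X"
 shows "coboundaries p X +>\<^bsub>cocycles p X\<^esub> ph = {ps : cochains p X. \<forall>z. singular_relcycle p X {} z --> ps z = ph z}"
  (is "_ = ?R")
proof -
 have e: "coboundaries p X +>\<^bsub>cocycles p X\<^esub> ph = (%w. \<lambda>s\<in>singular_chain_set p X. w s + ph s) ` coboundaries p X"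
  by (auto simp: a_r_coset_def r_coset_def cocycles_def)
 have cyc: "singular_relcycle p X {} z ==> singular_chain p X z" for z by (simp add: singular_cycle)
 show ?thesis unfolding e
 proof (intro equalityI subsetI)
  fix ps assume "ps : (%w. \<lambda>s\<in>singular_chain_set p X. w s + ph s) ` coboundaries p X"
  then show "ps : ?R" using cochains_arith(1)[OF _ ph] cyc by (auto simp: coboundaries_iff)
 next
  fix ps assume ps: "ps : ?R"
  show "ps : (%w. \<lambda>s\<in>singular_chain_set p X. w s + ph s) ` coboundaries p X"
  proof
   show "(\<lambda>s\<in>singular_chain_set p X. ps s - ph s) : coboundaries p X"
    using ps cyc cochains_arith(2)[OF _ ph] by (auto simp: coboundaries_iff)
   show "ps = (\<lambda>s\<in>singular_chain_set p X. (\<lambda>s\<in>singular_chain_set p X. ps s - ph s) s + ph s)"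
    using ps by (auto simp: cochains_iff extensional_def fun_eq_iff)
  qed
 qed
qed

text \<open>The coordinates are the values at cycles \<open>z i\<close> that represent the test
  elements of \<open>dual_rank\<close>. They are injective because a functional on homology is
  determined there, and surjective because every prescribed functional comes from a cocycle.\<close>

lemma cohomology_coordinates:
 assumes r: "dual_rank (homology_group (int p) X) r" shows "\<exists>T. coordinates (cohomology X (int p)) {..<r} T"
proof -
 let ?H = "homology_group (int p) X" and ?C = "singular_chain_set p X" and ?Z = "singular_relcycle p X {}"
 let ?cl = "%ph. {ps : cochains p X. \<forall>z. ?Z z --> ps z = ph z}"
 let ?V = "cocycles p X"
 obtain b where b: "!!i. i < r ==> b i : carrier ?H"
  "!!g :: nat => rat. \<exists>f. additive_on ?H f & (\<forall>i<r. f (b i) = g i)"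
  "!!f a. additive_on ?H f ==> (!!i. i < r ==> f (b i) = 0) ==> a : carrier ?H ==> f a = 0" using r by (rule dual_rankE) blast
 have "\<exists>z. ?Z z & b i = homologous_rel_set p X {} z" if "i < r" for i
  using b(1)[OF that] unfolding carrier_relative_homology_group by blast
 then obtain z where z: "!!i. i < r ==> ?Z (z i)" "!!i. i < r ==> b i = homologous_rel_set p X {} (z i)" by metis
 have cyc: "?Z z ==> singular_chain p X z" for z by (simp add: singular_cycle)
 have V: "ph : cochains p X" if "ph : carrier ?V" for ph using that by (simp add: carrier_cocycles)
 have bd: "ph x = 0" if "ph : carrier ?V" "singular_relboundary p X {} x" for ph x
  using that by (auto simp: carrier_cocycles singular_boundary)
 have bdI: "ph : carrier ?V" if "ph : cochains p X" "!!x. singular_relboundary p X {} x ==> ph x = 0" for ph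
  using that by (auto simp: carrier_cocycles singular_boundary)
 have det: "ph x = 0" if ph: "ph : carrier ?V" and 0: "!!i. i < r ==> ph (z i) = 0" and x: "?Z x" for ph x
 proof -
  \<comment> \<open>The functional induced on homology; a cocycle takes the same value on all
    representatives of a class.\<close>
  define f where "f A = ph (SOME y. y : A)" for A
  have f: "f (homologous_rel_set p X {} y) = ph y" if y: "?Z y" for y
  proof -
   define y' where "y' = (SOME y'. y' : homologous_rel_set p X {} y)"
   have "y' : homologous_rel_set p X {} y" unfolding y'_def by (rule someI[of _ y]) simp
   then have hr: "singular_relboundary p X {} (y - y')" by (simp add: homologous_rel_def)
   have c: "singular_chain p X y" "singular_chain p X y'"
    using cyc[OF y] \<open>y' : _\<close> homologous_rel_singular_chain[of p X "{}" y y'] by auto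
   have "ph y = ph y'" using bd[OF ph hr] cochain_diff[OF V[OF ph] c] by simp
   then show ?thesis by (simp add: f_def y'_def)
  qed
  have "additive_on ?H f" unfolding additive_on_def carrier_relative_homology_group
  proof (intro ballI, elim imageE)
   fix A B u v assume uv: "A = homologous_rel_set p X {} u" "u : Collect ?Z" "B = homologous_rel_set p X {} v" "v : Collect ?Z"
   then have uvZ: "?Z u" "?Z v" by auto
   show "f (A \<otimes>\<^bsub>?H\<^esub> B) = f A + f B"
    unfolding uv(1,3) homologous_rel_set_add[OF uvZ] f[OF uvZ(1)] f[OF uvZ(2)] f[OF singular_relcycle_add[OF uvZ]]
    using V[OF ph] cyc uvZ by (simp add: cochains_iff)
  qed
  then have "f (homologous_rel_set p X {} x) = 0" by (rule b(3)) (use 0 z f x in "auto simp: carrier_relative_homology_group")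
  then show ?thesis using f[OF x] by simp
 qed
 have agree: "?cl ph = ?cl ps" if ph: "ph : carrier ?V" and ps: "ps : carrier ?V" and eq: "!!i. i < r ==> ph (z i) = ps (z i)" for ph ps
 proof -
  let ?d = "\<lambda>s\<in>?C. ph s - ps s"
  have "?d x = 0" if x: "?Z x" for x
  proof (rule det[OF bdI _ x])
   show "?d : cochains p X" by (rule cochains_arith(2)[OF V[OF ph] V[OF ps]])
   show "?d x = 0" if "singular_relboundary p X {} x" for x
    using bd[OF ph that] bd[OF ps that] singular_boundary_imp_chain[OF that] by simp
   show "?d (z i) = 0" if "i < r" for i using eq[OF that] cyc[OF z(1)[OF that]] by simp
  qed
  then have "ph x = ps x" if "?Z x" for x using that cyc[OF that] by force
  then show ?thesis by auto
 qed
 let ?Q = "cohomology X (int p)"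
 have Q: "?Q = quotient_module ?V (coboundaries p X)" by (simp add: cohomology_def)
 have coset: "coboundaries p X +>\<^bsub>?V\<^esub> ph = ?cl ph" if "ph : cochains p X" for ph by (rule coset_coboundaries[OF that])
 have carQ: "carrier ?Q = ?cl ` carrier ?V" using coset[OF V] by (auto simp: Q quotient_module_def A_RCOSETS_def' a_r_coset_def[symmetric])
 have self: "ph : ?cl ph" if "ph : carrier ?V" for ph using V[OF that] by simp
 have mem: "ps : carrier ?V" if "ph : carrier ?V" "ps : ?cl ph" for ph ps
 proof (rule bdI)
  show "ps x = 0" if x: "singular_relboundary p X {} x" for x
   using bd[OF \<open>ph : carrier ?V\<close> x] singular_relboundary_imp_relcycle[OF x] \<open>ps : ?cl ph\<close> by auto
 qed (use that in simp)
 let ?add = "%ph ps. \<lambda>s\<in>?C. ph s + ps s :: rat" and ?smult = "%k ph. \<lambda>s\<in>?C. k * ph s :: rat"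
 have Vadd: "?add ph ps : carrier ?V" if "ph : carrier ?V" "ps : carrier ?V" for ph ps
 proof (rule bdI)
  show "?add ph ps x = 0" if x: "singular_relboundary p X {} x" for x
   using bd[OF \<open>ph : carrier ?V\<close> x] bd[OF \<open>ps : carrier ?V\<close> x] singular_boundary_imp_chain[OF x] by simp
 qed (rule cochains_arith(1)[OF V[OF that(1)] V[OF that(2)]])
 have Vsmult: "?smult k ph : carrier ?V" if "ph : carrier ?V" for k ph
 proof (rule bdI)
  show "?smult k ph x = 0" if x: "singular_relboundary p X {} x" for x
   using bd[OF \<open>ph : carrier ?V\<close> x] singular_boundary_imp_chain[OF x] by simp
 qed (rule cochains_arith(3)[OF V[OF that] V[OF that]])
 have addQ: "?cl ph \<oplus>\<^bsub>?Q\<^esub> ?cl ps = ?cl (?add ph ps)" if ph: "ph : carrier ?V" and ps: "ps : carrier ?V" for ph ps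
 proof -
  have "?cl ph \<oplus>\<^bsub>?Q\<^esub> ?cl ps = {?add u v |u v. u : ?cl ph & v : ?cl ps}"
   by (auto simp: Q quotient_module_def set_add_def set_mult_def cocycles_def)
  also have "... = ?cl (?add ph ps)"
  proof (intro equalityI subsetI)
   fix t assume "t : {?add u v |u v. u : ?cl ph & v : ?cl ps}"
   then obtain u v where uv: "u : ?cl ph" "v : ?cl ps" "t = ?add u v" by blast
   have "?add u v : cochains p X" using uv by (intro cochains_arith(1)) auto
   then show "t : ?cl (?add ph ps)" using uv cyc by auto
  next
   fix t assume t: "t : ?cl (?add ph ps)"
   let ?v = "\<lambda>s\<in>?C. t s - ph s"
   have "?v : cochains p X" using t V[OF ph] by (intro cochains_arith(2)) auto
   then have "?v : ?cl ps" using t cyc by auto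
   moreover have "t = ?add ph ?v" using t by (auto simp: cochains_iff extensional_def fun_eq_iff)
   ultimately show "t : {?add u v |u v. u : ?cl ph & v : ?cl ps}" using self[OF ph] by blast
  qed
  finally show ?thesis .
 qed
 have smultQ: "k \<odot>\<^bsub>?Q\<^esub> ?cl ph = ?cl (?smult k ph)" if ph: "ph : carrier ?V" for k ph
 proof -
  have "k \<odot>\<^bsub>?Q\<^esub> ?cl ph = (\<Union>v\<in>?cl ph. coboundaries p X +>\<^bsub>?V\<^esub> ?smult k v)"
   by (simp add: Q quotient_module_def cocycles_def)
  also have "... = (\<Union>v\<in>?cl ph. ?cl (?smult k ph))"
  proof (rule SUP_cong[OF refl])
   fix v assume v: "v : ?cl ph"
   then have "?smult k v : cochains p X" by (intro cochains_arith(3)[of v p X v]) auto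
   from coset[OF this] show "coboundaries p X +>\<^bsub>?V\<^esub> ?smult k v = ?cl (?smult k ph)" using v cyc by auto
  qed
  finally show ?thesis using self[OF ph] by blast
 qed
 have zeroV: "(\<lambda>s\<in>?C. 0) : carrier ?V"
 proof (rule bdI)
  show "(\<lambda>s\<in>?C. 0) : cochains p X" by (simp add: cochains_iff singular_chain_add)
 qed (simp add: singular_boundary_imp_chain)
 have zeroQ: "\<zero>\<^bsub>?Q\<^esub> = ?cl (\<lambda>s\<in>?C. 0)" using cyc by (auto simp: Q quotient_module_def coboundaries_iff)
 define T where "T A = (\<lambda>i\<in>{..<r}. (SOME ph. ph : A) (z i))" for A :: "('a chain => rat) set"
 have T: "T (?cl ph) = (\<lambda>i\<in>{..<r}. ph (z i))" if ph: "ph : carrier ?V" for ph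
 proof -
  have "(SOME ph'. ph' : ?cl ph) : ?cl ph" by (rule someI[of _ ph]) (rule self[OF ph])
  then show ?thesis unfolding T_def using z(1) by (auto simp: fun_eq_iff)
 qed
 have bij: "bij_betw T (carrier ?Q) ({..<r} \<rightarrow>\<^sub>E UNIV)" unfolding bij_betw_def
 proof (rule conjI[OF inj_onI equalityI[OF subsetI subsetI]])
  fix A B assume "A : carrier ?Q" "B : carrier ?Q" and TT: "T A = T B"
  then obtain ph ps where *: "ph : carrier ?V" "ps : carrier ?V" "A = ?cl ph" "B = ?cl ps" unfolding carQ by blast
  have "ph (z i) = ps (z i)" if "i < r" for i using fun_cong[OF TT[unfolded *(3,4) T[OF *(1)] T[OF *(2)]], of i] that by simp
  then show "A = B" unfolding *(3,4) by (rule agree[OF *(1,2)])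
 next
  fix g assume "g : T ` carrier ?Q"
  then obtain A where "g = T A" by blast
  then show "g : {..<r} \<rightarrow>\<^sub>E UNIV" unfolding T_def by (intro PiE_I) simp_all
 next
  fix g :: "nat => rat" assume g: "g : {..<r} \<rightarrow>\<^sub>E UNIV"
  obtain f where f: "additive_on ?H f" "\<forall>i<r. f (b i) = g i" using b(2)[of g] by (elim exE conjE) (rule that)
  have fa: "f (homologous_rel_set p X {} (u + v)) = f (homologous_rel_set p X {} u) + f (homologous_rel_set p X {} v)" if "?Z u" "?Z v" for u v
   unfolding homologous_rel_set_add[OF that, symmetric] using f(1) that unfolding additive_on_def carrier_relative_homology_group by simp
  \<comment> \<open>A functional on homology, read on cycles, extends to all chains. Boundaries
    represent the unit class, so the extension is a cocycle.\<close>
  obtain ph where ph: "ph : cochains p X" "!!x. x : Collect ?Z ==> ph x = f (homologous_rel_set p X {} x)"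
  proof (rule cochain_extension[of "Collect ?Z" p X "%x. f (homologous_rel_set p X {} x)"])
   show "f (homologous_rel_set p X {} (x - y)) = f (homologous_rel_set p X {} x) - f (homologous_rel_set p X {} y)"
    if "x : Collect ?Z" "y : Collect ?Z" for x y using fa[of "x - y" y] that by (simp add: singular_relcycle_diff)
  qed (use that cyc in "auto simp: singular_relcycle_diff")
  have "ph : carrier ?V"
  proof (rule bdI[OF ph(1)])
   fix x assume x: "singular_relboundary p X {} x"
   then have "homologous_rel_set p X {} x = \<one>\<^bsub>?H\<^esub>" by (simp add: homologous_rel_set_eq_relboundary)
   then show "ph x = 0"
    using ph(2)[of x] singular_relboundary_imp_relcycle[OF x] additive_on_one[OF group_relative_homology_group f(1)] by simp
  qed
  moreover have "(\<lambda>i\<in>{..<r}. ph (z i)) = g" using ph(2) z f(2) PiE_arb[OF g] by (auto simp: fun_eq_iff)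
  ultimately show "g : T ` carrier ?Q" unfolding carQ using T by (intro image_eqI[of _ _ "?cl ph"]) auto
 qed
 have "coordinates ?Q {..<r} T" unfolding coordinates_def
 proof (intro conjI bij ballI allI)
  fix A B assume "A : carrier ?Q" "B : carrier ?Q"
  then obtain ph ps where *: "ph : carrier ?V" "ps : carrier ?V" "A = ?cl ph" "B = ?cl ps" unfolding carQ by blast
  note ad = Vadd[OF *(1,2)]
  show "A \<oplus>\<^bsub>?Q\<^esub> B : carrier ?Q" unfolding *(3,4) addQ[OF *(1,2)] carQ by (rule imageI[OF ad])
  show "T (A \<oplus>\<^bsub>?Q\<^esub> B) = (\<lambda>i\<in>{..<r}. T A i + T B i)"
   unfolding *(3,4) addQ[OF *(1,2)] T[OF ad] T[OF *(1)] T[OF *(2)] by (intro restrict_ext) (simp add: cyc[OF z(1)])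
 next
  fix k A assume "A : carrier ?Q"
  then obtain ph where *: "ph : carrier ?V" "A = ?cl ph" unfolding carQ by blast
  note ad = Vsmult[OF *(1)]
  show "k \<odot>\<^bsub>?Q\<^esub> A : carrier ?Q" unfolding *(2) smultQ[OF *(1)] carQ by (rule imageI[OF ad])
  show "T (k \<odot>\<^bsub>?Q\<^esub> A) = (\<lambda>i\<in>{..<r}. k * T A i)" unfolding *(2) smultQ[OF *(1)] T[OF ad] T[OF *(1)]
   by (intro restrict_ext) (simp add: cyc[OF z(1)])
 next
  show "\<zero>\<^bsub>?Q\<^esub> : carrier ?Q" unfolding zeroQ carQ by (rule imageI[OF zeroV])
  show "T \<zero>\<^bsub>?Q\<^esub> = (\<lambda>i\<in>{..<r}. 0)"
   unfolding zeroQ T[OF zeroV] by (intro restrict_ext) (simp add: cyc[OF z(1)])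
 qed
 then show ?thesis by blast
qed

section \<open>Spaces filtered by even-dimensional cells\<close>

lemma homology_long_exact_sequence:
 "exact_seq ([homology_group (p - 1) (subtopology X S), Hr p X S, homology_group p X,
   homology_group p (subtopology X S), Hr (p + 1) X S],
  [hom_boundary p X S, hom_induced p X {} X S id, hom_induced p (subtopology X S) {} X {} id, hom_boundary (p + 1) X S])"
 using homology_exactness_axiom_1[of p X S] homology_exactness_axiom_3[of p X S] homology_exactness_axiom_2[of "p + 1" X S] by simp

lemma inclusion_iso_of_trivial_relative:
 assumes "trivial_group (Hr p X S)" "trivial_group (Hr (p + 1) X S)"
 shows "hom_induced p (subtopology X S) {} X {} id : iso (homology_group p (subtopology X S)) (homology_group p X)"
proof (rule very_short_exact_sequence)
 show "exact_seq ([Hr p X S, homology_group p X, homology_group p (subtopology X S), Hr (p + 1) X S],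
  [hom_induced p X {} X S id, hom_induced p (subtopology X S) {} X {} id, hom_boundary (p + 1) X S])"
  using homology_long_exact_sequence[of p X S] by simp
qed (use assms in auto)

text \<open>Vanishing of the two outer terms cuts the long exact sequence down to an extension by
  the integers.\<close>

lemma dual_rank_attach:
 assumes "dual_rank (homology_group p (subtopology X S)) r" "trivial_group (homology_group (p - 1) (subtopology X S))"
  "Hr p X S \<cong> integer_group" "trivial_group (Hr (p + 1) X S)" shows "dual_rank (homology_group p X) (Suc r)"
proof -
 let ?i = "hom_induced p (subtopology X S) {} X {} id" and ?j = "hom_induced p X {} X S id"
 have "short_exact_sequence (Hr p X S) (homology_group p X) (homology_group p (subtopology X S)) ?j ?i"
  unfolding short_exact_sequence_def using homology_long_exact_sequence[of p X S] assms by blast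
 then have ex: "exact_seq ([Hr p X S, homology_group p X, homology_group p (subtopology X S)], [?j, ?i])"
  and j: "?j : epi (homology_group p X) (Hr p X S)" and i: "?i : mon (homology_group p (subtopology X S)) (homology_group p X)"
  by (auto dest: short_exact_sequenceD)
 obtain h where h: "h : iso (Hr p X S) integer_group" using assms(3) by (auto simp: is_iso_def)
 have hk: "h x = 0 \<longleftrightarrow> x = \<one>\<^bsub>Hr p X S\<^esub>" if "x : carrier (Hr p X S)" for x
 proof -
  interpret h: group_hom "Hr p X S" integer_group h using h by (simp add: group_hom_def group_hom_axioms_def iso_def)
  have "inj_on h (carrier (Hr p X S))" using h by (simp add: iso_def bij_betw_def)
  then have "h x = h \<one>\<^bsub>Hr p X S\<^esub> \<longleftrightarrow> x = \<one>\<^bsub>Hr p X S\<^esub>"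
   by (rule inj_on_eq_iff) (use that in simp_all)
  then show ?thesis using h.hom_one by simp
 qed
 show ?thesis
 proof (rule dual_rank_extension[OF assms(1) _ _ i, of "h \<circ> ?j"])
  show "h \<circ> ?j : epi (homology_group p X) integer_group"
  proof -
   have "?j ` carrier (homology_group p X) = carrier (Hr p X S)"
    "h ` carrier (Hr p X S) = carrier integer_group"
    "?j : hom (homology_group p X) (Hr p X S)" "h : hom (Hr p X S) integer_group"
    using j h by (simp_all add: epi_def iso_def bij_betw_def)
   then show ?thesis unfolding epi_def by (simp only: mem_Collect_eq hom_compose image_comp[symmetric])
  qed
  have "kernel (homology_group p X) (Hr p X S) ?j = ?i ` carrier (homology_group p (subtopology X S))" using ex by simp
  moreover have "?j x : carrier (Hr p X S)" for x by (rule hom_induced_carrier)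
  ultimately show "kernel (homology_group p X) integer_group (h \<circ> ?j) = ?i ` carrier (homology_group p (subtopology X S))"
   using hk by (simp add: kernel_def)
 qed auto
qed

lemma dual_rank_attach_trivial:
 assumes "dual_rank (homology_group p (subtopology X S)) r"
  "trivial_group (Hr p X S)" "trivial_group (Hr (p + 1) X S)" shows "dual_rank (homology_group p X) r"
 by (rule dual_rank_iso[OF assms(1) inclusion_iso_of_trivial_relative[OF assms(2,3)]]) auto

lemma trivial_homology_attach:
 assumes "trivial_group (homology_group p (subtopology X S))" "trivial_group (Hr p X S)" shows "trivial_group (homology_group p X)"
proof -
 have "exact_seq ([Hr p X S, homology_group p X, homology_group p (subtopology X S)],
   [hom_induced p X {} X S id, hom_induced p (subtopology X S) {} X {} id])" by (rule homology_exactness_axiom_3)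
 then have k: "kernel (homology_group p X) (Hr p X S) (hom_induced p X {} X S id) =
   hom_induced p (subtopology X S) {} X {} id ` carrier (homology_group p (subtopology X S))"
  and h: "group_hom (homology_group p (subtopology X S)) (homology_group p X) (hom_induced p (subtopology X S) {} X {} id)" by auto
 have "carrier (homology_group p X) <= kernel (homology_group p X) (Hr p X S) (hom_induced p X {} X S id)"
  using assms(2) hom_induced_carrier[of p X "{}" X S id] by (auto simp: kernel_def trivial_group_def)
 also have "... = {\<one>\<^bsub>homology_group p X\<^esub>}"
  unfolding k using assms(1) group_hom.hom_one[OF h] by (simp add: trivial_group_def)
 finally have "carrier (homology_group p X) = {\<one>\<^bsub>homology_group p X\<^esub>}"
  using monoid.one_closed[OF group.is_monoid[OF group_relative_homology_group]] by blast
 then show ?thesis by (simp add: trivial_group_def)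
qed

text \<open>The \<open>N j\<close> are open sets, and \<open>cell\<close> says that adding
  \<open>N j\<close> has the relative homology of attaching a cell of real dimension
  \<open>2 * d j\<close>. The family \<open>F\<close> may already contain other members of the same
  level, so those can be added one at a time.\<close>

locale cell_filtration =
 fixes Y :: "'a topology" and N :: "'j => 'a set" and \<J> :: "'j set" and d :: "'j => nat"
 assumes openin_N: "j : \<J> ==> openin Y (N j)" and cover: "topspace Y = \<Union> (N ` \<J>)"
  and finite_below: "finite {j : \<J>. d j < s}"
  and cell: "finite F ==> F <= \<J> ==> j : \<J> ==> j ~: F ==> (!!i. i : F ==> d i <= d j) ==>
    (!!i. i : \<J> ==> d i < d j ==> i : F) ==>
    (if p = 2 * int (d j)
    then Hr p (subtopology Y (\<Union> (N ` insert j F))) (\<Union> (N ` F)) \<cong> integer_group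
    else trivial_group (Hr p (subtopology Y (\<Union> (N ` insert j F))) (\<Union> (N ` F))))"
begin

abbreviation "part F == subtopology Y (\<Union> (N ` F))"
abbreviation "below s == {j : \<J>. d j < s}"

lemma part_part: "F <= G ==> subtopology (part G) (\<Union> (N ` F)) = part F"
 by (auto simp: subtopology_subtopology intro!: arg_cong[where f = "subtopology Y"])

definition good where
 "good F \<longleftrightarrow> (\<forall>p :: int. odd p --> trivial_group (homology_group p (part F))) &
   (\<forall>k. dual_rank (homology_group (2 * int k) (part F)) (card {j : F. d j = k}))"

text \<open>Relative homology is concentrated in one even degree, so the neighbouring terms of the
  long exact sequence vanish and no connecting map has to be known.\<close>

lemma good_insert:
 assumes F: "finite F" "F <= \<J>" "j : \<J>" "j ~: F" "!!i. i : F ==> d i <= d j" "!!i. i : \<J> ==> d i < d j ==> i : F"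
  and good: "good F" shows "good (insert j F)"
proof -
 let ?X = "part (insert j F)" and ?S = "\<Union> (N ` F)"
 have sub: "subtopology ?X ?S = part F" by (rule part_part) blast
 note c = cell[OF F]
 have odd_rel: "trivial_group (Hr p ?X ?S)" if "odd p" for p :: int using c[of p] that by (auto split: if_splits)
 have "dual_rank (homology_group (2 * int k) ?X) (card {i : insert j F. d i = k})" for k
 proof -
  have r: "dual_rank (homology_group (2 * int k) (subtopology ?X ?S)) (card {i : F. d i = k})" using good unfolding sub good_def by blast
  have o: "trivial_group (Hr (2 * int k + 1) ?X ?S)" by (rule odd_rel) simp
  show ?thesis
  proof (cases "k = d j")
   case True
   have "trivial_group (homology_group (2 * int k - 1) (subtopology ?X ?S))" using good unfolding sub good_def by simp
   moreover have "Hr (2 * int k) ?X ?S \<cong> integer_group" using c[of "2 * int k"] True by simp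
   moreover have "{i : insert j F. d i = k} = insert j {i : F. d i = k}" using True by auto
   ultimately show ?thesis using dual_rank_attach[OF r] o F(1,4) by simp
  next
   case False
   then have "trivial_group (Hr (2 * int k) ?X ?S)" using c[of "2 * int k"] by simp
   moreover have "{i : insert j F. d i = k} = {i : F. d i = k}" using False by auto
   ultimately show ?thesis using dual_rank_attach_trivial[OF r _ o] by simp
  qed
 qed
 moreover have "trivial_group (homology_group p ?X)" if "odd p" for p :: int
  using trivial_homology_attach[of p ?X ?S] odd_rel[OF that] good that unfolding sub good_def by simp
 ultimately show ?thesis by (simp add: good_def)
qed

lemma good_empty: "good {}"
proof -
 have "trivial_group (homology_group p (part {}))" for p by (rule trivial_homology_group_empty) simp
 then show ?thesis by (simp add: good_def dual_rank_trivial)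
qed

lemma good_below: "good (below s)"
proof (induction s)
 case (Suc s)
 have "good (below s \<union> A)" if "finite A" "A <= {j : \<J>. d j = s}" for A using that
 proof (induction A rule: finite_induct)
  case (insert j A)
  have "good (insert j (below s \<union> A))" using insert finite_below[of s] by (intro good_insert) auto
  then show ?case by simp
 qed (use Suc in simp)
 from this[of "{j : \<J>. d j = s}"] have "good (below s \<union> {j : \<J>. d j = s})"
  using finite_subset[OF _ finite_below[of "Suc s"], of "{j : \<J>. d j = s}"] by auto
 moreover have "below s \<union> {j : \<J>. d j = s} = below (Suc s)" by auto
 ultimately show ?case by simp
qed (simp add: good_empty)

abbreviation "incl p A B == hom_induced p (part A) {} (part B) {} id"

lemma incl_compose:
 assumes "A <= B" "B <= C" shows "incl p A C = incl p B C \<circ> incl p A B"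
proof -
 have m: "continuous_map (part A) (part B) id" if "A <= B" for A B
  using that by (auto simp: continuous_map_in_subtopology intro!: continuous_map_from_subtopology)
 show ?thesis using hom_induced_compose_empty[OF m[OF assms(1)] m[OF assms(2)], of p] by simp
qed

lemma incl_refl: "incl p A A : iso (homology_group p (part A)) (homology_group p (part A))"
 by (rule group.iso_eq[OF group_relative_homology_group id_iso]) (simp add: hom_induced_id)

text \<open>The cells added have dimension at least \<open>2 * s\<close>, hence no relative homology
  in degrees \<open>p\<close> and \<open>p + 1\<close>.\<close>

lemma incl_iso:
 assumes "int p < 2 * int s" "int p + 1 < 2 * int s"
 shows "incl p (below s) (below (s + m)) : iso (homology_group p (part (below s))) (homology_group p (part (below (s + m))))"
proof (induction m)
 case 0
 show ?case unfolding add_0_right by (rule incl_refl)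
next
 case (Suc m)
 let ?s = "s + m"
 have "incl p (below ?s) (below ?s \<union> A) : iso (homology_group p (part (below ?s))) (homology_group p (part (below ?s \<union> A)))"
  if "finite A" "A <= {j : \<J>. d j = ?s}" for A using that
 proof (induction A rule: finite_induct)
  case empty
  show ?case unfolding Un_empty_right by (rule incl_refl)
 next
  case (insert j A)
  let ?B = "below ?s \<union> A"
  have j: "j : \<J>" "d j = ?s" using insert by auto
  have B: "finite ?B" "?B <= \<J>" "j ~: ?B" "!!i. i : ?B ==> d i <= d j" "!!i. i : \<J> ==> d i < d j ==> i : ?B"
   using insert finite_below[of ?s] j by auto
  have c: "trivial_group (Hr q (part (insert j ?B)) (\<Union> (N ` ?B)))" if "q ~= 2 * int (d j)" for q
   using cell[OF B(1,2) j(1) B(3), of q] B(4,5) that by simp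
  have st: "incl p ?B (insert j ?B) : iso (homology_group p (part ?B)) (homology_group p (part (insert j ?B)))"
   using inclusion_iso_of_trivial_relative[of p "part (insert j ?B)" "\<Union> (N ` ?B)", OF c c] assms j(2)
   unfolding part_part[OF subset_insertI] by simp
  have IH: "incl p (below ?s) ?B : iso (homology_group p (part (below ?s))) (homology_group p (part ?B))"
   by (rule insert.IH) (use insert.prems in blast)
  have e: "below ?s \<union> insert j A = insert j ?B" by blast
  have "incl p (below ?s) (insert j ?B) = incl p ?B (insert j ?B) \<circ> incl p (below ?s) ?B" by (rule incl_compose) blast+
  then show ?case unfolding e using iso_set_trans[OF IH st] by (simp only:)
 qed
 note step = this
 have f: "finite {j : \<J>. d j = ?s}" by (rule finite_subset[OF _ finite_below[of "Suc ?s"]]) auto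
 have e: "below ?s \<union> {j : \<J>. d j = ?s} = below (Suc ?s)" by auto
 have "incl p (below s) (below (Suc ?s)) = incl p (below ?s) (below (Suc ?s)) \<circ> incl p (below s) (below ?s)"
  by (rule incl_compose) auto
 then show ?case unfolding add_Suc_right using iso_set_trans[OF Suc step[OF f subset_refl, unfolded e]] by (simp only:)
qed

text \<open>Openness of the \<open>N j\<close> enters here: it places compact sets in a finite stage
  of the filtration.\<close>

lemma compact_below:
 assumes "compactin Y K" obtains s where "K <= \<Union> (N ` below s)"
proof -
 have "!!U. U : N ` \<J> ==> openin Y U" "K <= \<Union> (N ` \<J>)" using openin_N compactin_subset_topspace[OF assms] cover by auto
 then obtain \<F> where "finite \<F>" "\<F> <= N ` \<J>" "K <= \<Union> \<F>" using compactinD[OF assms] by metis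
 then obtain A where A: "A <= \<J>" "finite A" "K <= \<Union> (N ` A)" by (metis finite_subset_image)
 have "A <= below (Suc (Max (insert 0 (d ` A))))" using A by (auto simp: less_Suc_eq_le intro!: Max_ge)
 then show ?thesis using that A(3) by blast
qed

lemma chain_below:
 assumes "singular_chain p Y c" obtains s where "s0 <= s" "singular_chain p (part (below s)) c"
proof -
 have "\<exists>s. f ` standard_simplex p <= \<Union> (N ` below s)" if "f : Poly_Mapping.keys c" for f
 proof -
  have "singular_simplex p Y f" using assms that by (auto simp: singular_chain_def)
  then have "continuous_map (subtopology (powertop_real UNIV) (standard_simplex p)) Y f" by (simp add: singular_simplex_def)
  then have "compactin Y (f ` standard_simplex p)"
   by (rule image_compactin[rotated]) (simp add: compactin_subtopology compactin_standard_simplex)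
  then show ?thesis using compact_below by metis
 qed
 then obtain s where s: "!!f. f : Poly_Mapping.keys c ==> f ` standard_simplex p <= \<Union> (N ` below (s f))" by metis
 let ?s = "Max (insert s0 (s ` Poly_Mapping.keys c))"
 have "f ` standard_simplex p <= \<Union> (N ` below ?s)" if f: "f : Poly_Mapping.keys c" for f
 proof -
  have "s f <= ?s" using f by (intro Max_ge) auto
  then have "below (s f) <= below ?s" by auto
  then show ?thesis using s[OF f] by blast
 qed
 then have "singular_chain p (part (below ?s)) c" unfolding singular_chain_subtopology using assms by blast
 moreover have "s0 <= ?s" by (intro Max_ge) auto
 ultimately show ?thesis using that by blast
qed

lemma incl_class:
 assumes "singular_relcycle p (subtopology Y A) {} c" "A <= B"
 shows "hom_induced (int p) (subtopology Y A) {} (subtopology Y B) {} id (homologous_rel_set p (subtopology Y A) {} c)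
  = homologous_rel_set p (subtopology Y B) {} c"
proof -
 have "continuous_map (subtopology Y A) (subtopology Y B) id"
  using assms(2) by (auto simp: continuous_map_in_subtopology intro!: continuous_map_from_subtopology)
 then show ?thesis using hom_induced_chain_map[of "subtopology Y A" "subtopology Y B" id "{}" "{}" p c] assms(1)
  by (simp add: chain_map_ident[of p "subtopology Y A"] singular_cycle)
qed

text \<open>Cycles, and chains bounding them, have compact support and so live in a finite stage;
  the stages already agree in this degree.\<close>

lemma incl_total_iso:
 fixes p s :: nat
 assumes s: "p + 1 < 2 * s"
 shows "hom_induced (int p) (part (below s)) {} Y {} id : iso (homology_group (int p) (part (below s))) (homology_group (int p) Y)"
proof -
 let ?h = "hom_induced (int p) (part (below s)) {} Y {} id"
 have Y: "subtopology Y (topspace Y) = Y" by simp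
 have tot: "?h (homologous_rel_set p (part (below s)) {} c) = homologous_rel_set p Y {} c" if "singular_relcycle p (part (below s)) {} c" for c
  using incl_class[of p "\<Union> (N ` below s)" c "topspace Y"] that cover by fastforce
 have iso: "incl p (below s) (below t) : iso (homology_group p (part (below s))) (homology_group p (part (below t)))" if "s <= t" for t
  using incl_iso[of p s "t - s"] that s by simp
 have cl: "incl p (below s) (below t) (homologous_rel_set p (part (below s)) {} c) = homologous_rel_set p (part (below t)) {} c"
  if "s <= t" "singular_relcycle p (part (below s)) {} c" for t c by (rule incl_class[OF that(2)]) (use that(1) in fastforce)
 interpret h: group_hom "homology_group p (part (below s))" "homology_group p Y" ?h
  by (simp add: group_hom_def group_hom_axioms_def hom_induced_empty_hom)
 have "A : ?h ` carrier (homology_group p (part (below s)))" if A: "A : carrier (homology_group p Y)" for A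
 proof -
  obtain c where c: "singular_relcycle p Y {} c" "A = homologous_rel_set p Y {} c"
   using A unfolding carrier_relative_homology_group by blast
  obtain t where t: "s <= t" "singular_chain p (part (below t)) c" using chain_below[of p c s] c(1) by (metis singular_cycle)
  have ct: "singular_relcycle p (part (below t)) {} c" using c(1) t(2) by (simp add: singular_cycle)
  have "homologous_rel_set p (part (below t)) {} c : incl p (below s) (below t) ` carrier (homology_group p (part (below s)))"
   using iso[OF t(1)] ct by (simp add: iso_iff carrier_relative_homology_group)
  then obtain c' where c': "singular_relcycle p (part (below s)) {} c'"
   "homologous_rel_set p (part (below t)) {} c = incl p (below s) (below t) (homologous_rel_set p (part (below s)) {} c')"
   unfolding carrier_relative_homology_group by blast
  have "homologous_rel p (part (below t)) {} c c'"
   using c'(2) unfolding cl[OF t(1) c'(1)] homologous_rel_set_eq by (simp add: homologous_rel_eq)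
  then have "singular_relboundary p Y {} (c - c')"
   unfolding homologous_rel_def using singular_boundary_mono[of "\<Union> (N ` below t)" "topspace Y" p Y "c - c'"] cover by fastforce
  then have "A = homologous_rel_set p Y {} c'" unfolding c(2) homologous_rel_set_eq by (simp add: homologous_rel_eq homologous_rel_def)
  then have "A = ?h (homologous_rel_set p (part (below s)) {} c')" using tot[OF c'(1)] by simp
  then show ?thesis using c'(1) by (auto simp: carrier_relative_homology_group)
 qed
 moreover have "A = \<one>\<^bsub>homology_group p (part (below s))\<^esub>"
  if A: "A : carrier (homology_group p (part (below s)))" and 1: "?h A = \<one>\<^bsub>homology_group p Y\<^esub>" for A
 proof -
  obtain c where c: "singular_relcycle p (part (below s)) {} c" "A = homologous_rel_set p (part (below s)) {} c"
   using A unfolding carrier_relative_homology_group by blast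
  have "singular_relboundary p Y {} c" using 1 unfolding c(2) tot[OF c(1)] by (simp add: homologous_rel_set_eq_relboundary)
  then obtain e where e: "singular_chain (Suc p) Y e" "chain_boundary (Suc p) e = c" by (auto simp: singular_boundary)
  obtain t where t: "s <= t" "singular_chain (Suc p) (part (below t)) e" using chain_below[of "Suc p" e s] e(1) by metis
  have "singular_relboundary p (part (below t)) {} c" using e(2) t(2) by (auto simp: singular_boundary)
  then have 1: "incl p (below s) (below t) A = \<one>\<^bsub>homology_group p (part (below t))\<^esub>"
   unfolding c(2) cl[OF t(1) c(1)] by (simp add: homologous_rel_set_eq_relboundary)
  have "group_hom (homology_group p (part (below s))) (homology_group p (part (below t))) (incl p (below s) (below t))"
   by (simp add: group_hom_def group_hom_axioms_def hom_induced_empty_hom)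
  from iso[OF t(1), unfolded group_hom.iso_iff[OF this]] show ?thesis using A 1 by blast
 qed
 ultimately show ?thesis unfolding h.iso_iff by (intro conjI subsetI ballI impI)
qed

theorem dual_rank_homology:
 "dual_rank (homology_group (int p) Y) (if even p then card {j : \<J>. d j = p div 2} else 0)"
proof -
 \<comment> \<open>This stage contains every cell of dimension \<open>p\<close>, and
   \<open>p + 1 < 2 * ?s\<close> makes later cells invisible in degree \<open>p\<close>.\<close>
 let ?s = "p + 1"
 have g: "good (below ?s)" by (rule good_below)
 have "dual_rank (homology_group (int p) (part (below ?s))) (if even p then card {j : \<J>. d j = p div 2} else 0)"
 proof (cases "even p")
  case True
  then obtain k where k: "p = 2 * k" by blast
  have e: "{j : below ?s. d j = k} = {j : \<J>. d j = k}" using k by auto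
  have "dual_rank (homology_group (2 * int k) (part (below ?s))) (card {j : below ?s. d j = k})" using g unfolding good_def by blast
  then show ?thesis unfolding e using k by simp
 next
  case False
  then show ?thesis using g by (simp add: good_def dual_rank_trivial)
 qed
 then show ?thesis by (rule dual_rank_iso[OF _ incl_total_iso]) auto
qed

end

section \<open>Relative homology of a punctured Euclidean space\<close>

lemma punctured_Euclidean_space_nsphere:
 fixes n :: nat
 defines "S == topspace (Euclidean_space (Suc n)) - {%_. 0}"
 shows "subtopology (Euclidean_space (Suc n)) S homotopy_equivalent_space nsphere n"
proof -
 let ?X = "subtopology (Euclidean_space (Suc n)) S"
 have X: "?X = subtopology (powertop_real UNIV) S"
  by (auto simp: Euclidean_space_def subtopology_subtopology S_def intro!: arg_cong[where f = "subtopology (powertop_real UNIV)"])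
 have S: "x : S \<longleftrightarrow> (\<forall>i>n. x i = 0) & x ~= (%_. 0)" for x by (simp add: S_def topspace_Euclidean_space Suc_le_eq)
 have tX: "topspace ?X = S" by (auto simp: S_def)
 define nm where "nm x = sqrt (\<Sum>i\<le>n. (x i)\<^sup>2)" for x :: "nat => real"
 have pos: "0 < nm x" if x: "x : S" for x
 proof -
  obtain i where i: "x i ~= 0" using x S by (auto simp: fun_eq_iff)
  then have "i <= n" using x S by (metis not_le)
  then have "0 < (\<Sum>i\<le>n. (x i)\<^sup>2)" using i by (intro sum_pos2[of _ i]) auto
  then show ?thesis by (simp add: nm_def)
 qed
 have nm1: "nm x = 1" if "x : topspace (nsphere n)" for x using that by (auto simp: nsphere nm_def)
 have sub: "topspace (nsphere n) <= S"
 proof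
  fix x assume x: "x : topspace (nsphere n)"
  then have "x ~= (%_. 0)" using nm1[OF x] by (auto simp: nm_def)
  then show "x : S" using x by (simp add: S nsphere)
 qed
 have proj: "continuous_map Z euclideanreal (%z. f z i)" if "continuous_map Z ?X f" for Z f and i :: nat
  using that unfolding X continuous_map_in_subtopology by (simp add: continuous_map_componentwise)
 have cnm: "continuous_map Z euclideanreal (%z. nm (f z))" if "continuous_map Z ?X f" for Z f
  unfolding nm_def by (intro continuous_map_sqrt continuous_map_sum continuous_map_real_pow proj[OF that]) auto
 define r where "r x = (%i. x i / nm x)" for x :: "nat => real"
 have nr: "(\<Sum>i\<le>n. (r x i)\<^sup>2) = 1" if x: "x : S" for x
 proof -
  have "(\<Sum>i\<le>n. (r x i)\<^sup>2) = (\<Sum>i\<le>n. (x i)\<^sup>2) / (nm x)\<^sup>2" by (simp add: r_def power_divide sum_divide_distrib)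
  also have "(\<Sum>i\<le>n. (x i)\<^sup>2) = (nm x)\<^sup>2" by (simp add: nm_def sum_nonneg)
  finally show ?thesis using pos[OF x] by simp
 qed
 have r: "continuous_map ?X (nsphere n) r" unfolding nsphere continuous_map_in_subtopology continuous_map_componentwise_UNIV
 proof (intro conjI allI funcsetI)
  show "continuous_map ?X euclideanreal (%x. r x i)" for i
  proof -
   have "nm x ~= 0" if "x : topspace ?X" for x using pos[of x] that unfolding tX by simp
   moreover have "continuous_map ?X ?X (%x. x)" using continuous_map_id[of ?X] unfolding id_def .
   ultimately show ?thesis unfolding r_def by (intro continuous_map_real_divide proj cnm) assumption+
  qed
  fix x assume "x : topspace ?X"
  then have x: "x : S" using tX by simp
  then show "r x : {x. (\<Sum>i\<le>n. (x i)\<^sup>2) = 1 & (\<forall>i>n. x i = 0)}" using nr[OF x] S by (simp add: r_def)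
 qed
 have i: "continuous_map (nsphere n) ?X id" unfolding X continuous_map_in_subtopology using sub
  by (auto simp: nsphere id_def[symmetric] intro: continuous_map_from_subtopology)
 define H where "H s x = (%i. ((1 - s) / nm x + s) * x i)" for s and x :: "nat => real"
 have H: "H 0 = id \<circ> r" "H 1 = id" by (auto simp: H_def r_def fun_eq_iff)
 have "homotopic_with (%_. True) ?X ?X (H 0) (H 1)"
 proof (rule homotopic_withI)
  let ?Z = "prod_topology I01 ?X"
  have s: "continuous_map ?Z euclideanreal fst" by (rule continuous_map_into_fulltopology[OF continuous_map_fst])
  show "continuous_map ?Z ?X (%z. H (fst z) (snd z))" unfolding H_def X continuous_map_in_subtopology continuous_map_componentwise_UNIV
  proof (intro conjI allI funcsetI; unfold X[symmetric])
   have nz: "nm (snd z) ~= 0" if "z : topspace ?Z" for z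
   proof -
    have "snd z : topspace ?X" using that by (simp only: topspace_prod_topology mem_Times_iff)
    then show ?thesis using pos[of "snd z"] unfolding tX by simp
   qed
   show "continuous_map ?Z euclideanreal (%z. ((1 - fst z) / nm (snd z) + fst z) * snd z i)" for i
    by (rule continuous_map_real_mult[OF continuous_map_add[OF continuous_map_real_divide[OF
       continuous_map_diff[OF _ s] cnm[OF continuous_map_snd] nz] s] proj[OF continuous_map_snd]]) simp
   fix z assume "z : topspace ?Z"
   then have "fst z : {0..1}" "snd z : topspace ?X" by (simp_all only: topspace_prod_topology mem_Times_iff topspace_euclidean_subtopology)
   then have z: "0 <= fst z" "fst z <= 1" "snd z : S" unfolding tX by simp_all
   have "0 < (1 - fst z) / nm (snd z) + fst z"
   proof (cases "fst z = 0")
    case False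
    then show ?thesis using z pos[OF z(3)] by (intro add_nonneg_pos) auto
   qed (use pos[OF z(3)] in simp)
   then show "(%i. ((1 - fst z) / nm (snd z) + fst z) * snd z i) : S" using z(3) unfolding S by (auto simp: fun_eq_iff)
  qed
 qed simp
 then have "homotopic_with (%_. True) ?X ?X (id \<circ> r) id" unfolding H .
 moreover have "homotopic_with (%_. True) (nsphere n) (nsphere n) (r \<circ> id) id"
 proof (rule homotopic_with_equal)
  show "continuous_map (nsphere n) (nsphere n) (r \<circ> id)" by (rule continuous_map_compose[OF i r])
  show "(r \<circ> id) x = id x" if "x : topspace (nsphere n)" for x using nm1[OF that] by (simp add: r_def)
 qed simp_all
 ultimately show ?thesis unfolding homotopy_equivalent_space_def using r i by blast
qed

lemma relative_homology_punctured_Euclidean_space: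
 "if p = int n then Hr p (Euclidean_space n) (topspace (Euclidean_space n) - {%_. 0}) \<cong> integer_group
  else trivial_group (Hr p (Euclidean_space n) (topspace (Euclidean_space n) - {%_. 0}))"
proof (cases n)
 \<comment> \<open>Here the punctured space is empty, and the group is the homology of a
   point.\<close>
 case 0
 have t: "topspace (Euclidean_space 0) = {%_. 0}" by (auto simp: topspace_Euclidean_space)
 then show ?thesis using homology_coefficients[OF t] homology_dimension_axiom[OF t, of p] 0 by simp
next
 case (Suc m)
 let ?E = "Euclidean_space (Suc m)" and ?S = "topspace (Euclidean_space (Suc m)) - {%_. 0}"
 have "(%i. if i = 0 then 1 else 0) : topspace ?E \<inter> ?S" by (auto simp: topspace_Euclidean_space fun_eq_iff)
 then have "Hr p ?E ?S \<cong> reduced_homology_group (p - 1) (subtopology ?E ?S)"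
  by (intro isomorphic_group_relative_homology_of_contractible) auto
 also have "... \<cong> reduced_homology_group (p - 1) (nsphere m)"
  by (rule homotopy_equivalent_space_imp_isomorphic_reduced_homology_groups[OF punctured_Euclidean_space_nsphere])
 finally have iso: "Hr p ?E ?S \<cong> reduced_homology_group (p - 1) (nsphere m)" .
 show ?thesis
 proof (cases "p = int n")
  case True
  then have "reduced_homology_group (p - 1) (nsphere m) \<cong> integer_group" using reduced_homology_group_nsphere(1)[of m] Suc by simp
  then show ?thesis using iso_trans[OF iso] True Suc by simp
 next
  case False
  then have "trivial_group (reduced_homology_group (p - 1) (nsphere m))" using reduced_homology_group_nsphere(2)[of "p - 1" m] Suc by simp
  then show ?thesis using isomorphic_group_triviality[OF iso] False Suc by simp
 qed
qed

section \<open>Infinite Stiefel manifolds\<close>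

lemma continuous_map_mat_add:
 assumes A: "continuous_map Z (mat_topology r k) A" and B: "continuous_map Z (mat_topology r k) B"
 shows "continuous_map Z (mat_topology r k) (%z. A z + B z)"
proof (rule continuous_map_matI)
 show "A z + B z : carrier_mat r k" if "z : topspace Z" for z
  using continuous_map_matD(1)[OF A that] continuous_map_matD(1)[OF B that] by simp
 fix i j assume ij: "i < r" "j < k"
 have "continuous_map Z euclidean (%z. A z $$ (i, j) + B z $$ (i, j))"
  by (intro continuous_map_add continuous_map_matD(2)[OF A] continuous_map_matD(2)[OF B] ij)
 then show "continuous_map Z euclidean (%z. (A z + B z) $$ (i, j))"
 proof (rule continuous_map_eq)
  show "A z $$ (i, j) + B z $$ (i, j) = (A z + B z) $$ (i, j)" if "z : topspace Z" for z
   using continuous_map_matD(1)[OF B that] ij by simp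
 qed
qed

text \<open>At each vertex a matrix with \<open>dv i\<close> rows and infinitely many columns, all
  of which may be nonzero: a plain product instead of a limit of finite matrices.\<close>

definition frame_space :: "('v, 'e) pre_digraph => ('v => nat) => ('v \<times> nat => complex mat) topology" where
 "frame_space Q dv = product_topology (%p. mat_topology (dv (fst p)) 1) (verts Q \<times> UNIV)"

definition minor :: "('v => nat) => 'v => (nat => nat) => ('v \<times> nat => complex mat) => complex mat" where
 "minor dv i h x = mat (dv i) (dv i) (%(r, j). x (i, h j) $$ (r, 0))"

definition full_rank :: "('v, 'e) pre_digraph => ('v => nat) => ('v \<times> nat => complex mat) set" where
 "full_rank Q dv = {x. \<forall>i\<in>verts Q. \<exists>h. det (minor dv i h x) ~= 0}"

definition frame_act :: "('v, 'e) pre_digraph => ('v => complex mat) => ('v \<times> nat => complex mat) => 'v \<times> nat => complex mat" where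
 "frame_act Q g x = (\<lambda>p\<in>verts Q \<times> UNIV. g (fst p) * x p)"

text \<open>The group acts freely on full-rank frames by row operations, so the homotopy quotient
  stands for a product of infinite Grassmannians.\<close>

definition frame_stack :: "('v, 'e) pre_digraph => ('v => nat) => ('v => complex mat, 'v \<times> nat => complex mat) quotient_stack" where
 "frame_stack Q dv = \<lparr>grp = BG Q dv, grp_top = product_topology (%i. gl_topology (dv i)) (verts Q),
   grp_coords = {}, space = subtopology (frame_space Q dv) (full_rank Q dv), space_coords = {}, act = frame_act Q\<rparr>"

lemma frame_stack_simps [simp]:
 "grp (frame_stack Q dv) = BG Q dv"
 "grp_top (frame_stack Q dv) = product_topology (%i. gl_topology (dv i)) (verts Q)"
 "space (frame_stack Q dv) = subtopology (frame_space Q dv) (full_rank Q dv)"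
 "act (frame_stack Q dv) = frame_act Q" by (simp_all add: frame_stack_def)

lemma topspace_frame_space: "topspace (frame_space Q dv) = (\<Pi>\<^sub>E p\<in>verts Q \<times> UNIV. carrier_mat (dv (fst p)) 1)"
 by (simp add: frame_space_def)

lemma frame_space_mem: "x : topspace (frame_space Q dv) ==> i : verts Q ==> x (i, n) : carrier_mat (dv i) 1"
 unfolding topspace_frame_space by (drule PiE_mem[of _ _ _ "(i, n)"]) auto

lemma frame_space_coord: "i : verts Q ==> continuous_map (frame_space Q dv) (mat_topology (dv i) 1) (%x. x (i, n))"
 using continuous_map_product_coordinates[of "(i, n)" "verts Q \<times> UNIV" "%p. mat_topology (dv (fst p)) 1"]
 by (simp add: frame_space_def)

lemma continuous_map_frame_space:
 assumes "!!i n. i : verts Q ==> continuous_map Z (mat_topology (dv i) 1) (%z. f z (i, n))"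
  and "!!z. z : topspace Z ==> f z : extensional (verts Q \<times> UNIV)" shows "continuous_map Z (frame_space Q dv) f"
 unfolding frame_space_def
proof (rule continuous_map_coordinatewise_then_product)
 show "continuous_map Z (mat_topology (dv (fst p)) 1) (%z. f z p)" if "p : verts Q \<times> UNIV" for p
  using assms(1)[of "fst p" "snd p"] that by auto
 show "f z p = undefined" if "p ~: verts Q \<times> UNIV" "z : topspace Z" for p z
  using assms(2)[OF that(2)] that(1) by (rule extensional_arb)
qed

lemma minor_carrier [simp]: "minor dv i h x : carrier_mat (dv i) (dv i)" by (simp add: minor_def)

lemma minor_frame_act:
 assumes i: "i : verts Q" and x: "x : topspace (frame_space Q dv)" and g: "g i : carrier_mat (dv i) (dv i)"
 shows "minor dv i h (frame_act Q g x) = g i * minor dv i h x"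
proof (rule eq_matI)
 fix r j assume "r < dim_row (g i * minor dv i h x)" "j < dim_col (g i * minor dv i h x)"
 then have rj: "r < dv i" "j < dv i" using g minor_carrier[of dv i h x] by auto
 show "minor dv i h (frame_act Q g x) $$ (r, j) = (g i * minor dv i h x) $$ (r, j)"
  unfolding mat_mult_entry[OF g minor_carrier[of dv i h x] rj] using rj i mat_mult_entry[OF g frame_space_mem[OF x i] rj(1), of 0 "h j"]
  by (simp add: minor_def frame_act_def)
qed (use g in "simp_all add: minor_def")

lemma minor_continuous:
 assumes "i : verts Q" shows "continuous_map (frame_space Q dv) (mat_topology (dv i) (dv i)) (minor dv i h)"
proof (rule continuous_map_matI)
 fix r j assume rj: "r < dv i" "j < dv i"
 have "continuous_map (frame_space Q dv) euclidean (%x. x (i, h j) $$ (r, 0))"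
  by (rule continuous_map_matD(2)[OF frame_space_coord[OF assms]]) (use rj in auto)
 then show "continuous_map (frame_space Q dv) euclidean (%x. minor dv i h x $$ (r, j))" using rj by (simp add: minor_def)
qed simp

lemma det_minor_scaled:
 assumes i: "i : verts Q" and x: "x : topspace (frame_space Q dv)" and d: "!!j. j < dv i ==> c j ~= 0"
  and z: "!!j. j < dv i ==> z (i, h' j) = c j \<cdot>\<^sub>m x (i, h j)" and det: "det (minor dv i h x) ~= 0"
 shows "det (minor dv i h' z) ~= 0"
proof -
 let ?n = "dv i"
 have "minor dv i h' z = minor dv i h x * mat_diag ?n c" unfolding mat_diag_mult_right[OF minor_carrier]
 proof (rule eq_matI)
  fix r j assume "r < dim_row (mat ?n ?n (%(r, j). minor dv i h x $$ (r, j) * c j))"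
   "j < dim_col (mat ?n ?n (%(r, j). minor dv i h x $$ (r, j) * c j))"
  then have rj: "r < ?n" "j < ?n" by auto
  then show "minor dv i h' z $$ (r, j) = mat ?n ?n (%(r, j). minor dv i h x $$ (r, j) * c j) $$ (r, j)"
   using z[OF rj(2)] frame_space_mem[OF x i, of "h j"] by (simp add: minor_def)
 qed (simp_all add: minor_def)
 moreover have "det (mat_diag ?n c * mat_diag ?n (%j. inverse (c j))) = 1"
 proof -
  have "mat_diag ?n c * mat_diag ?n (%j. inverse (c j)) = 1\<^sub>m ?n"
   unfolding mat_diag_diag by (rule eq_matI) (use d in "auto simp: mat_diag_def")
  then show ?thesis by simp
 qed
 then have "det (mat_diag ?n c) ~= 0" using det_mult[OF mat_diag_dim mat_diag_dim, of ?n c "%j. inverse (c j)"] by auto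
 ultimately show ?thesis using det det_mult[OF minor_carrier mat_diag_dim, of dv i h x c] by simp
qed

lemma frame_act_closed:
 assumes g: "g : carrier (BG Q dv)" and x: "x : topspace (frame_space Q dv)" shows "frame_act Q g x : topspace (frame_space Q dv)"
  "x : full_rank Q dv ==> frame_act Q g x : full_rank Q dv"
proof -
 have gi: "g i : carrier (GL (dv i))" if "i : verts Q" for i using g that by (auto simp: carrier_base_change_group)
 show "frame_act Q g x : topspace (frame_space Q dv)" unfolding topspace_frame_space
 proof (rule PiE_I)
  fix p :: "'a \<times> nat" assume p: "p : verts Q \<times> UNIV"
  then show "frame_act Q g x p : carrier_mat (dv (fst p)) 1"
   using mult_carrier_mat[OF gl_carrier_mat[OF gi[of "fst p"]] frame_space_mem[OF x, of "fst p" "snd p"]] by (auto simp: frame_act_def)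
 qed (simp add: frame_act_def)
 assume fr: "x : full_rank Q dv"
 show "frame_act Q g x : full_rank Q dv" unfolding full_rank_def
 proof (intro CollectI ballI)
  fix i assume i: "i : verts Q"
  then obtain h where h: "det (minor dv i h x) ~= 0" using fr by (auto simp: full_rank_def)
  have "det (minor dv i h (frame_act Q g x)) = det (g i) * det (minor dv i h x)"
   unfolding minor_frame_act[where g = g and dv = dv, OF i x gl_carrier_mat[OF gi[OF i]]] by (rule det_mult[OF gl_carrier_mat[OF gi[OF i]] minor_carrier[of dv i h x]])
  then show "\<exists>h. det (minor dv i h (frame_act Q g x)) ~= 0"
   using h gi[OF i] by (intro exI[of _ h]) (simp add: carrier_general_linear)
 qed
qed

lemma stack_presentation_frame_stack: "stack_presentation (frame_stack Q dv)"
proof -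
 interpret topological_group "BG Q dv" "product_topology (%i. gl_topology (dv i)) (verts Q)" by (rule topological_group_base_change)
 interpret G: topological_group "grp (frame_stack Q dv)" "grp_top (frame_stack Q dv)"
  unfolding frame_stack_simps by (rule topological_group_axioms)
 let ?T = "product_topology (%i. gl_topology (dv i)) (verts Q)"
 let ?X = "subtopology (frame_space Q dv) (full_rank Q dv)"
 let ?Z = "prod_topology ?T ?X"
 show ?thesis
 proof (unfold_locales, unfold frame_stack_simps case_prod_unfold)
  show "continuous_map ?Z ?X (%z. frame_act Q (fst z) (snd z))" unfolding continuous_map_in_subtopology
  proof (intro conjI funcsetI)
   show "continuous_map ?Z (frame_space Q dv) (%z. frame_act Q (fst z) (snd z))"
   proof (rule continuous_map_frame_space)
    fix i n assume i: "i : verts Q"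
    have 1: "continuous_map ?Z (mat_topology (dv i) (dv i)) (%z. fst z i)"
     using gl_continuous_inclusion[OF continuous_map_compose[OF continuous_map_fst continuous_map_product_coordinates[OF i]]]
     by (simp add: o_def)
    have 2: "continuous_map ?Z (mat_topology (dv i) 1) (%z. snd z (i, n))"
     using continuous_map_compose[OF continuous_map_snd continuous_map_from_subtopology[OF frame_space_coord[OF i]]]
   by (simp add: o_def)
    show "continuous_map ?Z (mat_topology (dv i) 1) (%z. frame_act Q (fst z) (snd z) (i, n))"
     using continuous_map_mat_mult[OF 1 2] i by (simp add: frame_act_def)
   qed (simp add: frame_act_def)
   fix z assume "z : topspace ?Z"
   then have "fst z : carrier (BG Q dv)" "snd z : topspace (frame_space Q dv)" "snd z : full_rank Q dv"
    using topspace_T by (auto simp: mem_Times_iff)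
   then show "frame_act Q (fst z) (snd z) : full_rank Q dv" by (rule frame_act_closed(2))
  qed
 next
  fix x assume "x : topspace ?X"
  then have x: "x : topspace (frame_space Q dv)" by simp
  show "frame_act Q \<one>\<^bsub>BG Q dv\<^esub> x = x"
  proof (rule ext)
   fix p
   show "frame_act Q \<one>\<^bsub>BG Q dv\<^esub> x p = x p"
    using frame_space_mem[OF x, of "fst p" "snd p"] PiE_arb[OF x[unfolded topspace_frame_space], of p]
    by (cases "fst p : verts Q") (auto simp: frame_act_def base_change_group_def mem_Times_iff)
  qed
 next
  fix g h x assume g: "g : carrier (BG Q dv)" and h: "h : carrier (BG Q dv)" and "x : topspace ?X"
  then have x: "x : topspace (frame_space Q dv)" by simp
  show "frame_act Q (g \<otimes>\<^bsub>BG Q dv\<^esub> h) x = frame_act Q g (frame_act Q h x)"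
  proof (rule ext)
   fix p :: "'a \<times> nat"
   show "frame_act Q (g \<otimes>\<^bsub>BG Q dv\<^esub> h) x p = frame_act Q g (frame_act Q h x) p"
   proof (cases "fst p : verts Q")
    case i: True
    have "g (fst p) : carrier_mat (dv (fst p)) (dv (fst p))" "h (fst p) : carrier_mat (dv (fst p)) (dv (fst p))"
     using g h i gl_carrier_mat by (auto simp: carrier_base_change_group)
    then show ?thesis using assoc_mult_mat[OF _ _ frame_space_mem[OF x i, of "snd p"]] i
     by (simp add: frame_act_def base_change_group_def mem_Times_iff)
   qed (simp add: frame_act_def mem_Times_iff)
  qed
 qed
qed

text \<open>Column \<open>n\<close> combines one column of each frame. The group acts on every
  column linearly, so all such recombinations are equivariant; the frame versions of shuffling and
  interleaving are instances.\<close>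

definition mix :: "('v, 'e) pre_digraph => (nat => real) => (nat => nat) => (nat => real) => (nat => nat) =>
  ('v \<times> nat => complex mat) => ('v \<times> nat => complex mat) => 'v \<times> nat => complex mat" where
 "mix Q a p b q x y = (\<lambda>v\<in>verts Q \<times> UNIV. complex_of_real (a (snd v)) \<cdot>\<^sub>m x (fst v, p (snd v)) + complex_of_real (b (snd v)) \<cdot>\<^sub>m y (fst v, q (snd v)))"

lemma mix_act:
 assumes x: "x : topspace (frame_space Q dv)" and y: "y : topspace (frame_space Q dv)" and g: "g : carrier (BG Q dv)"
 shows "mix Q a p b q (frame_act Q g x) (frame_act Q g y) = frame_act Q g (mix Q a p b q x y)"
proof (rule ext)
 fix v :: "'a \<times> nat"
 show "mix Q a p b q (frame_act Q g x) (frame_act Q g y) v = frame_act Q g (mix Q a p b q x y) v"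
 proof (cases "fst v : verts Q")
  case i: True
  have gi: "g (fst v) : carrier_mat (dv (fst v)) (dv (fst v))" using g i gl_carrier_mat by (auto simp: carrier_base_change_group)
  note xy = frame_space_mem[OF x i, of "p (snd v)"] frame_space_mem[OF y i, of "q (snd v)"]
  show ?thesis using i xy mult_add_distrib_mat[OF gi smult_carrier_mat[OF xy(1)] smult_carrier_mat[OF xy(2)]]
    mult_smult_distrib[OF gi xy(1)] mult_smult_distrib[OF gi xy(2)] by (simp add: mix_def frame_act_def mem_Times_iff)
 qed (simp add: mix_def frame_act_def mem_Times_iff)
qed

lemma mix_continuous:
 assumes "!!n. continuous_map Z euclideanreal (%z. a z n)" "!!n. continuous_map Z euclideanreal (%z. b z n)"
  and f: "continuous_map Z (frame_space Q dv) f" and g: "continuous_map Z (frame_space Q dv) g"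
 shows "continuous_map Z (frame_space Q dv) (%z. mix Q (a z) p (b z) q (f z) (g z))"
proof (rule continuous_map_frame_space)
 fix i n assume i: "i : verts Q"
 have "continuous_map Z (mat_topology (dv i) 1) (%z. f z (i, p n))" "continuous_map Z (mat_topology (dv i) 1) (%z. g z (i, q n))"
  using continuous_map_compose[OF f frame_space_coord[OF i]] continuous_map_compose[OF g frame_space_coord[OF i]] by (simp_all add: o_def)
 then have "continuous_map Z (mat_topology (dv i) 1) (%z. complex_of_real (a z n) \<cdot>\<^sub>m f z (i, p n) + complex_of_real (b z n) \<cdot>\<^sub>m g z (i, q n))"
  by (intro continuous_map_mat_add continuous_map_mat_scale assms(1,2))
 then show "continuous_map Z (mat_topology (dv i) 1) (%z. mix Q (a z) p (b z) q (f z) (g z) (i, n))" using i by (simp add: mix_def)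
qed (simp add: mix_def)

text \<open>Every column \<open>m\<close> of \<open>z\<close> reappears, up to a nonzero scalar, at
  position \<open>c m\<close>, so a nonzero minor of \<open>z\<close> reappears as well.\<close>

lemma mix_full_rank:
 assumes x: "x : topspace (frame_space Q dv)" and y: "y : topspace (frame_space Q dv)" and z: "z : topspace (frame_space Q dv)"
  and fr: "z : full_rank Q dv"
  and c: "!!m. a (c m) ~= 0 & b (c m) = 0 & p (c m) = m & x = z \<or> b (c m) ~= 0 & a (c m) = 0 & q (c m) = m & y = z"
 shows "mix Q a p b q x y : full_rank Q dv" unfolding full_rank_def
proof (intro CollectI ballI)
 fix i assume i: "i : verts Q"
 then obtain h where h: "det (minor dv i h z) ~= 0" using fr by (auto simp: full_rank_def)
 have 0: "complex_of_real s \<cdot>\<^sub>m A + 0 \<cdot>\<^sub>m B = complex_of_real s \<cdot>\<^sub>m A" "0 \<cdot>\<^sub>m B + complex_of_real s \<cdot>\<^sub>m A = complex_of_real s \<cdot>\<^sub>m A"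
  if "A : carrier_mat r k" "B : carrier_mat r k" for A B :: "complex mat" and r k s using that by (auto intro!: eq_matI)
 have "det (minor dv i (%j. c (h j)) (mix Q a p b q x y)) ~= 0"
 proof (rule det_minor_scaled[OF i z _ _ h])
  fix j
  let ?d = "complex_of_real (if b (c (h j)) = 0 then a (c (h j)) else b (c (h j)))"
  show "?d ~= 0" using c[of "h j"] by auto
  note xy = frame_space_mem[OF x i] frame_space_mem[OF y i]
  show "mix Q a p b q x y (i, c (h j)) = ?d \<cdot>\<^sub>m z (i, h j)"
   using c[of "h j"] i 0(1)[OF xy] 0(2)[OF xy(2,1)] by (auto simp: mix_def)
 qed
 then show "\<exists>h. det (minor dv i h (mix Q a p b q x y)) ~= 0" by blast
qed

text \<open>The travel plan of \<open>shuffle\<close>, applied to columns. Columns could be added,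
  but keeping them separate is what preserves full rank.\<close>

definition shuffle_frame :: "('v, 'e) pre_digraph => real => ('v \<times> nat => complex mat) => 'v \<times> nat => complex mat" where
 "shuffle_frame Q s x = mix Q (%n. shuffle_weight n s) id
   (%n. if even n then 1 - shuffle_weight (n div 2) s else 0) (%n. n div 2) x x"

definition interleave_frame ::
 "('v, 'e) pre_digraph => real => ('v \<times> nat => complex mat) => ('v \<times> nat => complex mat) => 'v \<times> nat => complex mat" where
 "interleave_frame Q s x y = mix Q (%n. if even n then 1 - s else 0) (%n. n div 2) (%n. if odd n then s else 0) (%n. n div 2) x y"

context
 fixes Q :: "('v, 'e) pre_digraph" and dv X
 defines "X == space (frame_stack Q dv)"
begin

lemma X_eq: "X = subtopology (frame_space Q dv) (full_rank Q dv)" by (simp add: X_def)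

lemma X_iff: "x : topspace X \<longleftrightarrow> x : topspace (frame_space Q dv) & x : full_rank Q dv" by (simp add: X_eq)

lemma continuous_shuffle_frame:
 assumes t: "continuous_map Z I01 t" and x: "continuous_map Z X x" shows "continuous_map Z X (%z. shuffle_frame Q (t z) (x z))"
 unfolding X_eq continuous_map_in_subtopology
proof (intro conjI funcsetI)
 note t' = continuous_map_into_fulltopology[OF t] and x' = continuous_map_into_fulltopology[OF x[unfolded X_eq]]
 have "continuous_map Z euclideanreal (%z. if even n then 1 - shuffle_weight (n div 2) (t z) else 0)" for n
  using continuous_map_shuffle_weight[OF t'] by (cases "even n") (simp_all add: continuous_map_diff)
 then show "continuous_map Z (frame_space Q dv) (%z. shuffle_frame Q (t z) (x z))"
  unfolding shuffle_frame_def by (intro mix_continuous continuous_map_shuffle_weight t' x')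
 fix z assume "z : topspace Z"
 then have s: "t z <= 1" and x: "x z : topspace (frame_space Q dv)" "x z : full_rank Q dv"
  using continuous_map_funspace[OF t] continuous_map_funspace[OF x] by (auto simp: Pi_iff X_eq)
 show "shuffle_frame Q (t z) (x z) : full_rank Q dv" unfolding shuffle_frame_def
 \<comment> \<open>Column \<open>m\<close> is found unmixed at position \<open>m\<close> once its
   own weight is nonzero, and still at position \<open>2 * m\<close> before.\<close>
 proof (rule mix_full_rank[where z = "x z" and c = "%m. if shuffle_weight m (t z) = 0 then 2 * m else m", OF x(1) x(1) x], goal_cases)
  case (1 m)
  have "shuffle_weight (2 * m) (t z) = 0" if "shuffle_weight m (t z) = 0" using shuffle_disjoint[of "2 * m" "t z"] s that by auto
  then show ?case using shuffle_disjoint[of m "t z"] s by auto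
 qed
qed

lemma continuous_interleave_frame:
 assumes t: "continuous_map Z I01 t" and x: "continuous_map Z X x" and y: "continuous_map Z X y"
 shows "continuous_map Z X (%z. interleave_frame Q (t z) (x z) (y z))" unfolding X_eq continuous_map_in_subtopology
proof (intro conjI funcsetI)
 have "continuous_map Z euclideanreal (%z. if even n then 1 - t z else 0)" "continuous_map Z euclideanreal (%z. if odd n then t z else 0)" for n
  using continuous_map_into_fulltopology[OF t] by (cases "even n"; simp add: continuous_map_diff)+
 then show "continuous_map Z (frame_space Q dv) (%z. interleave_frame Q (t z) (x z) (y z))" unfolding interleave_frame_def
  by (intro mix_continuous continuous_map_into_fulltopology[OF x[unfolded X_eq]] continuous_map_into_fulltopology[OF y[unfolded X_eq]])
 fix z assume "z : topspace Z"
 then have "x z : topspace X" "y z : topspace X" using continuous_map_funspace[OF x] continuous_map_funspace[OF y] by (auto simp: Pi_iff)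
 then have xy: "x z : topspace (frame_space Q dv)" "x z : full_rank Q dv" "y z : topspace (frame_space Q dv)" "y z : full_rank Q dv"
  by (simp_all add: X_iff)
 show "interleave_frame Q (t z) (x z) (y z) : full_rank Q dv" unfolding interleave_frame_def
  \<comment> \<open>At time \<open>1\<close> the odd positions carry \<open>y\<close>; at all other
    times the even positions carry \<open>x\<close> with nonzero factor.\<close>
  using mix_full_rank[where c = "%m. 2 * m + 1", OF xy(1,3,3,4)] mix_full_rank[where c = "%m. 2 * m", OF xy(1,3,1,2)]
  by (cases "t z = 1") simp_all
qed

lemma shuffle_frame_ends:
 assumes x: "x : topspace X" and y: "y : topspace X"
 shows "shuffle_frame Q 1 x = x" "shuffle_frame Q 0 x = interleave_frame Q 0 x y" "interleave_frame Q 1 x y = interleave_frame Q 1 y y"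
proof -
 have "shuffle_frame Q 1 x (i, n) = x (i, n) & shuffle_frame Q 0 x (i, n) = interleave_frame Q 0 x y (i, n) &
  interleave_frame Q 1 x y (i, n) = interleave_frame Q 1 y y (i, n)" for i n
 proof (cases "i : verts Q")
  case True
  note c = frame_space_mem[OF conjunct1[OF x[unfolded X_iff]] True] frame_space_mem[OF conjunct1[OF y[unfolded X_iff]] True]
  have "shuffle_weight (n div 2) 0 = 0" if "n ~= 0" "even n" using that by (intro shuffle_weight_start) auto
  then show ?thesis using True c(1)[of n] c(1)[of "n div 2"] c(2)[of "n div 2"] shuffle_weight_start[of n]
   by (cases "n = 0") (auto simp: shuffle_frame_def interleave_frame_def mix_def intro!: eq_matI)
 next
  case False
  then show ?thesis using x PiE_arb[of x "verts Q \<times> UNIV" "%p. carrier_mat (dv (fst p)) 1" "(i, n)"]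
   by (simp add: X_iff topspace_frame_space shuffle_frame_def interleave_frame_def mix_def)
 qed
 then show "shuffle_frame Q 1 x = x" "shuffle_frame Q 0 x = interleave_frame Q 0 x y" "interleave_frame Q 1 x y = interleave_frame Q 1 y y"
  by (auto intro!: ext)
qed

end

text \<open>All equivariant maps into the space of frames are homotopic: the columns of the point are moved
 to the even positions, and then those of the given map take over in the odd positions.\<close>

lemma frame_stack_homotopic_id:
 assumes c: "continuous_map (milnor_space (BG Q dv) (product_topology (%i. gl_topology (dv i)) (verts Q))) (space (frame_stack Q dv)) c"
   "!!e g. e : milnor_points (BG Q dv) ==> g : carrier (BG Q dv) ==>
    c (milnor_act (BG Q dv) e g) = frame_act Q (inv\<^bsub>BG Q dv\<^esub> g) (c e)"
  and f: "!!p. p : topspace (stack_presentation.btot (frame_stack Q dv)) ==>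
   f (borel_orbit (frame_stack Q dv) p) = borel_orbit (frame_stack Q dv) (fst p, interleave_frame Q 1 (c (fst p)) (c (fst p)))"
 shows "homotopic_with (%_. True) (homotopy_quotient (frame_stack Q dv)) (homotopy_quotient (frame_stack Q dv)) f id"
proof -
 interpret stack_presentation "frame_stack Q dv" by (rule stack_presentation_frame_stack)
 let ?Z = "prod_topology I01 btot" and ?X = "space (frame_stack Q dv)"
 have s: "continuous_map ?Z I01 fst" by (rule continuous_map_fst)
 have y: "continuous_map ?Z ?X (%z. snd (snd z))" by (rule continuous_prod_components)
 have ce: "continuous_map ?Z ?X (%z. c (fst (snd z)))" using continuous_map_compose[OF continuous_prod_components(2) c(1), of "I01" ?X]
   by (simp add: o_def)
 have cX: "c (fst p) : topspace ?X" "snd p : topspace ?X" "fst p : milnor_points (BG Q dv)" if "p : topspace btot" for p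
  using continuous_map_funspace[OF c(1)] that by (auto simp: Pi_iff)
 have tw: "snd (twist p g) = frame_act Q (inv\<^bsub>BG Q dv\<^esub> g) (snd p)"
  "c (fst (twist p g)) = frame_act Q (inv\<^bsub>BG Q dv\<^esub> g) (c (fst p))"
  if "p : topspace btot" "g : carrier (BG Q dv)" for p g using c(2)[OF cX(3)[OF that(1)] that(2)] by (simp_all add: twist_def)
 have mixact: "mix Q a p b q (frame_act Q (inv\<^bsub>BG Q dv\<^esub> g) x) (frame_act Q (inv\<^bsub>BG Q dv\<^esub> g) y) =
   frame_act Q (inv\<^bsub>BG Q dv\<^esub> g) (mix Q a p b q x y)"
  if "x : topspace ?X" "y : topspace ?X" "g : carrier (BG Q dv)" for a p b q g x y
  by (rule mix_act[where dv = dv]) (use that inv_closed[of g] in auto)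
 \<comment> \<open>The common end of the two homotopies below, with all columns spread over the even
   positions.\<close>
 obtain k where k: "k (bo p) = bo (fst p, shuffle_frame Q 0 (snd p))" if "p : topspace btot" for p
 proof (rule lift_to_hq[where \<Phi> = "%p. bo (fst p, shuffle_frame Q 0 (snd p))"])
  fix p g assume p: "p : topspace btot" and g: "g : carrier G"
  have "continuous_map ?X ?X (shuffle_frame Q 0)" by (rule continuous_shuffle_frame[where t = "%_. 0"]) (simp_all add: id_def[symmetric])
  then have "(fst p, shuffle_frame Q 0 (snd p)) : topspace btot"
   using continuous_map_funspace[of ?X ?X "shuffle_frame Q 0"] p by (auto simp: Pi_iff)
  moreover have "(fst (twist p g), shuffle_frame Q 0 (snd (twist p g))) = twist (fst p, shuffle_frame Q 0 (snd p)) g"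
   using g tw[OF p] mixact[OF cX(2,2)[OF p]] by (auto simp: twist_def shuffle_frame_def)
  ultimately show "bo (fst (twist p g), shuffle_frame Q 0 (snd (twist p g))) = bo (fst p, shuffle_frame Q 0 (snd p))"
   using bo_twist[OF _ g] by simp
 qed blast
 have "homotopic_with (%_. True) hq hq k id"
 proof (rule homotopic_fibrewise[where \<Psi> = "%s p. shuffle_frame Q s (snd p)"])
  show "continuous_map ?Z ?X (%z. shuffle_frame Q (fst z) (snd (snd z)))" by (rule continuous_shuffle_frame[OF s y])
  show "shuffle_frame Q s (snd (twist p g)) = act (frame_stack Q dv) (inv\<^bsub>G\<^esub> g) (shuffle_frame Q s (snd p))"
   if "p : topspace btot" "g : carrier G" for s p g
   using that(2) tw[OF that(1)] mixact[OF cX(2,2)[OF that(1)]] by (auto simp: shuffle_frame_def)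
  show "id (bo p) = bo (fst p, shuffle_frame Q 1 (snd p))" if "p : topspace btot" for p
   using shuffle_frame_ends(1)[OF cX(2,1)[OF that]] by simp
 qed (rule k)
 moreover have "homotopic_with (%_. True) hq hq k f"
 proof (rule homotopic_fibrewise[where \<Psi> = "%s p. interleave_frame Q s (snd p) (c (fst p))"])
  show "continuous_map ?Z ?X (%z. interleave_frame Q (fst z) (snd (snd z)) (c (fst (snd z))))"
   by (rule continuous_interleave_frame[OF s y ce])
  show "interleave_frame Q s (snd (twist p g)) (c (fst (twist p g))) = act (frame_stack Q dv) (inv\<^bsub>G\<^esub> g) (interleave_frame Q s (snd p) (c (fst p)))"
   if "p : topspace btot" "g : carrier G" for s p g
   using that(2) tw[OF that(1)] mixact[OF cX(2,1)[OF that(1)]] by (simp add: interleave_frame_def)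
  fix p assume p: "p : topspace btot"
  note e = shuffle_frame_ends[OF cX(2,1)[OF p]]
  show "k (bo p) = bo (fst p, interleave_frame Q 0 (snd p) (c (fst p)))" using k[OF p] e(2) by simp
  show "f (bo p) = bo (fst p, interleave_frame Q 1 (snd p) (c (fst p)))" using f[OF p] e(3) by simp
 qed
 ultimately show ?thesis by (meson homotopic_with_symD homotopic_with_trans)
qed

text \<open>The barycentric coordinate \<open>fst (e k)\<close> is cut off at a level below which it may not stay for all \<open>k\<close>;
 this makes the column blocks, which are undefined where the coordinate vanishes, continuous.\<close>

definition cutoff :: "nat => real => real" where
 "cutoff k t = max 0 (t - (1 / 2) ^ (k + 2))"

lemma cutoff_exists:
 assumes "e : milnor_points G" obtains k where "cutoff k (fst (e k)) ~= 0"
proof -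
 have "\<exists>k. (1 / 2) ^ (k + 2) < fst (e k)"
 proof (rule ccontr)
  assume "\<nexists>k. (1 / 2) ^ (k + 2) < fst (e k)"
  then have le: "fst (e k) <= (1 / 4) * (1 / 2) ^ k" for k by (simp add: not_less power_add mult.commute)
  \<comment> \<open>The cutoff levels add up to \<open>1 / 2\<close>, less than the total mass
    \<open>1\<close>.\<close>
  have "(%k. (1 / 4) * (1 / 2) ^ k :: real) sums ((1 / 4) * (1 / (1 - 1 / 2)))" by (intro sums_mult geometric_sums) simp
  then have "1 <= (1 / 4) * (1 / (1 - 1 / 2) :: real)" by (rule sums_le[OF le milnor_pointsD(4)[OF assms]])
  then show False by simp
 qed
 then obtain k where "(1 / 2) ^ (k + 2) < fst (e k)" by blast
 then have "cutoff k (fst (e k)) ~= 0" by (simp add: cutoff_def)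
 then show ?thesis by (rule that)
qed

text \<open>Block \<open>n div dv i\<close> of columns is a scaled inverse of a group coordinate.
  The inverse turns the right action on the join into the left action on frames, and one block with
  nonzero cutoff already gives full rank. If \<open>dv i = 0\<close> the columns have no
  entries.\<close>

definition bundle_frame :: "('v, 'e) pre_digraph => ('v => nat) => (nat => real \<times> ('v => complex mat)) => 'v \<times> nat => complex mat" where
 "bundle_frame Q dv e = (\<lambda>(i, n)\<in>verts Q \<times> UNIV. complex_of_real (cutoff (n div dv i) (fst (e (n div dv i)))) \<cdot>\<^sub>m
   mat (dv i) 1 (%(r, _). (inv\<^bsub>GL (dv i)\<^esub> (snd (e (n div dv i)) i)) $$ (r, n mod dv i)))"

lemma milnor_coord_GL:
 assumes "e : milnor_points (BG Q dv)" "i : verts Q" shows "snd (e k) i : carrier (GL (dv i))"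
 using milnor_pointsD(2)[OF assms(1), of k] assms(2) by (auto simp: carrier_base_change_group)

lemma bundle_frame_closed:
 assumes e: "e : milnor_points (BG Q dv)" shows "bundle_frame Q dv e : topspace (frame_space Q dv)" "bundle_frame Q dv e : full_rank Q dv"
proof -
 show "bundle_frame Q dv e : topspace (frame_space Q dv)" unfolding topspace_frame_space by (rule PiE_I) (auto simp: bundle_frame_def)
 obtain k where k: "cutoff k (fst (e k)) ~= 0" by (rule cutoff_exists[OF e])
 let ?t = "complex_of_real (cutoff k (fst (e k)))"
 show "bundle_frame Q dv e : full_rank Q dv" unfolding full_rank_def
 proof (intro CollectI ballI exI)
  fix i assume i: "i : verts Q"
  let ?g = "inv\<^bsub>GL (dv i)\<^esub> (snd (e k) i)"
  have g: "?g : carrier (GL (dv i))" using group.inv_closed[OF group_general_linear milnor_coord_GL[OF e i]] .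
  have "minor dv i (%j. k * dv i + j) (bundle_frame Q dv e) = ?t \<cdot>\<^sub>m ?g"
   using gl_carrier_mat[OF g] i by (intro eq_matI) (auto simp: minor_def bundle_frame_def)
  then show "det (minor dv i (%j. k * dv i + j) (bundle_frame Q dv e)) ~= 0"
   using k g gl_carrier_mat[OF g] by (simp add: carrier_general_linear)
 qed
qed

lemma bundle_frame_continuous:
 "continuous_map (milnor_space (BG Q dv) (product_topology (%i. gl_topology (dv i)) (verts Q)))
   (frame_space Q dv) (bundle_frame Q dv)"
proof (rule continuous_map_frame_space)
 fix i n assume i: "i : verts Q"
 interpret topological_group "BG Q dv" "product_topology (%i. gl_topology (dv i)) (verts Q)" by (rule topological_group_base_change)
 define k where "k = n div dv i"
 let ?F = "%e. complex_of_real (cutoff k (fst (e k))) \<cdot>\<^sub>m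
   mat (dv i) 1 (%(r, _). (inv\<^bsub>GL (dv i)\<^esub> (snd (e k) i)) $$ (r, n mod dv i))"
 have id: "continuous_map EG EG (%e. e)" using continuous_map_id[of EG] unfolding id_def .
 have t: "continuous_map EG euclideanreal (%e. fst (e k))" by (rule continuous_milnor_fst[OF id])
 have ct: "continuous_map EG euclideanreal (%e. cutoff k (fst (e k)))"
  unfolding cutoff_def by (intro continuous_map_real_max continuous_map_diff t continuous_map_canonical_const)
 have "continuous_map EG (mat_topology (dv i) 1) ?F"
 proof (rule continuous_map_locallyI)
  fix e assume e: "e : topspace EG"
  show "\<exists>U. openin EG U & e : U & continuous_map (subtopology EG U) (mat_topology (dv i) 1) ?F"
  proof (cases "fst (e k) = 0")
   case False
   let ?U = "{e : topspace EG. fst (e k) ~= 0}"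
   have "continuous_map (subtopology EG {e. fst (e k) ~= 0}) (gl_topology (dv i)) (%e. snd (e k) i)"
    using continuous_map_compose[OF continuous_milnor_snd[OF id topspace_T, of k] continuous_map_product_coordinates[OF i]]
   by (simp add: o_def)
   then have "continuous_map (subtopology EG ?U) (gl_topology (dv i)) (%e. snd (e k) i)"
    by (rule continuous_map_from_subtopology_mono) auto
   from gl_continuous_inclusion[OF topological_group.continuous_map_inv[OF topological_group_general_linear this]]
   have g: "continuous_map (subtopology EG ?U) (mat_topology (dv i) (dv i)) (%e. inv\<^bsub>GL (dv i)\<^esub> (snd (e k) i))" .
   have "continuous_map (subtopology EG ?U) (mat_topology (dv i) 1) ?F"
   proof (rule continuous_map_mat_scale[OF continuous_map_from_subtopology[OF ct]], rule continuous_map_matI)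
    fix r j assume rj: "r < dv i" "j < (1 :: nat)"
    then have "n mod dv i < dv i" by simp
    from continuous_map_matD(2)[OF g rj(1) this]
    show "continuous_map (subtopology EG ?U) euclidean (%e. mat (dv i) 1 (%(r, _). (inv\<^bsub>GL (dv i)\<^esub> (snd (e k) i)) $$ (r, n mod dv i)) $$ (r, j))"
     using rj by simp
   qed simp
   then show ?thesis using e False openin_nonzero[OF t] by blast
  next
   case True
   let ?U = "{e : topspace EG. fst (e k) : {..<(1 / 2) ^ (k + 2)}}"
   have "openin EG ?U" by (rule openin_continuous_map_preimage[OF t]) simp
   moreover have "e : ?U" using e True by simp
   moreover have "continuous_map (subtopology EG ?U) (mat_topology (dv i) 1) ?F"
   proof (rule continuous_map_eq[OF continuous_map_mat_const[OF zero_carrier_mat]])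
    fix e assume "e : topspace (subtopology EG ?U)"
    then have "cutoff k (fst (e k)) = 0" by (simp add: cutoff_def)
    then show "0\<^sub>m (dv i) 1 = ?F e" by (intro eq_matI) auto
   qed
   ultimately show ?thesis by blast
  qed
 qed
 then show "continuous_map EG (mat_topology (dv i) 1) (%e. bundle_frame Q dv e (i, n))" using i by (simp add: bundle_frame_def k_def)
qed (simp add: bundle_frame_def)

lemma bundle_frame_act:
 assumes e: "e : milnor_points (BG Q dv)" and g: "g : carrier (BG Q dv)"
 shows "bundle_frame Q dv (milnor_act (BG Q dv) e g) = frame_act Q (inv\<^bsub>BG Q dv\<^esub> g) (bundle_frame Q dv e)"
proof (rule ext)
 fix v :: "'a \<times> nat"
 show "bundle_frame Q dv (milnor_act (BG Q dv) e g) v = frame_act Q (inv\<^bsub>BG Q dv\<^esub> g) (bundle_frame Q dv e) v"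
 proof (cases "v : verts Q \<times> UNIV")
  case True
  then obtain i n where v: "v = (i, n)" "i : verts Q" by auto
  define k where "k = n div dv i"
  note gi = milnor_coord_GL[OF e v(2), of k]
  have hi: "g i : carrier (GL (dv i))" using g v(2) by (auto simp: carrier_base_change_group)
  let ?A = "inv\<^bsub>GL (dv i)\<^esub> (g i)" and ?B = "inv\<^bsub>GL (dv i)\<^esub> (snd (e k) i)"
  note c = gl_inv_carrier_mat[OF hi] gl_inv_carrier_mat[OF gi]
  let ?t = "complex_of_real (cutoff k (fst (e k)))"
  define M where "M = mat (dv i) 1 (%(r, _). ?B $$ (r, n mod dv i))"
  let ?e' = "milnor_act (BG Q dv) e g"
  define M' where "M' = mat (dv i) 1 (%(r, _). (inv\<^bsub>GL (dv i)\<^esub> (snd (?e' k) i)) $$ (r, n mod dv i))"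
  have M: "M : carrier_mat (dv i) 1" "M' : carrier_mat (dv i) 1" by (simp_all add: M_def M'_def)
  have AB: "mat (dv i) 1 (%(r, _). (?A * ?B) $$ (r, n mod dv i)) = ?A * mat (dv i) 1 (%(r, _). ?B $$ (r, n mod dv i))"
  proof (rule eq_matI)
   fix r j assume "r < dim_row (?A * mat (dv i) 1 (%(r, _). ?B $$ (r, n mod dv i)))" "j < dim_col (?A * mat (dv i) 1 (%(r, _). ?B $$ (r, n mod dv i)))"
   then have r: "r < dv i" "j < 1" using c by auto
   then have m: "n mod dv i < dv i" by simp
   show "mat (dv i) 1 (%(r, _). (?A * ?B) $$ (r, n mod dv i)) $$ (r, j) = (?A * mat (dv i) 1 (%(r, _). ?B $$ (r, n mod dv i))) $$ (r, j)"
    using r mat_mult_entry[OF c r(1) m] mat_mult_entry[OF c(1) mat_carrier r, of "%(r, _). ?B $$ (r, n mod dv i)"] by simp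
  qed (use c in auto)
  have "?t \<cdot>\<^sub>m M' = ?t \<cdot>\<^sub>m (?A * M)"
  proof (cases "?t = 0")
   case True
   then show ?thesis using M c by (auto intro!: eq_matI)
  next
   case False
   then have "snd (?e' k) i = snd (e k) i * g i"
    using v(2) milnor_pointsD(1)[OF e, of k] by (auto simp: milnor_act_def base_change_group_def cutoff_def)
   then show ?thesis using AB gl_inv_mult[OF gi hi] by (simp add: M_def M'_def)
  qed
  also have "... = ?A * (?t \<cdot>\<^sub>m M)" using mult_smult_distrib[OF c(1) M(1), of ?t] by simp
  finally have "?t \<cdot>\<^sub>m M' = ?A * (?t \<cdot>\<^sub>m M)" .
  moreover have "bundle_frame Q dv ?e' v = ?t \<cdot>\<^sub>m M'" using v by (simp add: bundle_frame_def M'_def k_def milnor_act_def)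
  moreover have "frame_act Q (inv\<^bsub>BG Q dv\<^esub> g) (bundle_frame Q dv e) v = ?A * (?t \<cdot>\<^sub>m M)"
   using v by (simp add: frame_act_def bundle_frame_def M_def k_def inv_base_change_group[OF g])
  ultimately show ?thesis by (simp only:)
 qed (auto simp: bundle_frame_def frame_act_def)
qed

text \<open>Both fibres are equivariantly contractible in the sense that all equivariant maps from
  the join agree up to homotopy, so the two Borel constructions are compared by choosing one section
  of each.\<close>

theorem (in wf_digraph) moduli_stack_frame_stack:
 "homotopy_quotient (moduli_stack G dv) homotopy_equivalent_space homotopy_quotient (frame_stack G dv)"
proof -
 interpret M: stack_presentation "moduli_stack G dv" by (rule stack_presentation_moduli_stack)
 interpret N: stack_presentation "frame_stack G dv" by (rule stack_presentation_frame_stack)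
 let ?GG = "BG G dv" and ?X = "space (frame_stack G dv)"
 let ?EG = "milnor_space ?GG (product_topology (%i. gl_topology (dv i)) (verts G))"
 let ?z = "\<lambda>a\<in>arcs G. 0\<^sub>m (dv (head G a)) (dv (tail G a)) :: complex mat"
 have z: "?z : topspace (rep_space G dv)" by (auto simp: topspace_rep_space)
 \<comment> \<open>The zero representation is fixed by the group, so the constant map is an
   equivariant section.\<close>
 have zero: "base_change G dv g ?z = ?z" if "g : carrier ?GG" for g
  using rep_scale(1,3)[OF z] rep_scale(1)[of "base_change G dv g ?z" dv] that M.act_closed[of g ?z] z by simp
 \<comment> \<open>\<open>frame_stack_homotopic_id\<close> ends at the copy in the odd positions, so
   that copy \<open>?c\<close> is the section used.\<close>
 let ?b = "bundle_frame G dv" and ?c = "%e. interleave_frame G 1 (bundle_frame G dv e) (bundle_frame G dv e)"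
 have b: "continuous_map ?EG ?X ?b"
  unfolding frame_stack_simps continuous_map_in_subtopology using bundle_frame_continuous bundle_frame_closed(2) by auto
 have c: "continuous_map ?EG ?X ?c" by (rule continuous_interleave_frame[where t = "%_. 1", OF _ b b]) simp
 have act: "?c (milnor_act ?GG e g) = frame_act G (inv\<^bsub>?GG\<^esub> g) (?c e)" if "e : milnor_points ?GG" "g : carrier ?GG" for e g
  unfolding bundle_frame_act[OF that] interleave_frame_def
  by (rule mix_act[OF bundle_frame_closed(1)[OF that(1)] bundle_frame_closed(1)[OF that(1)] M.inv_closed[of g, unfolded moduli_stack_simps, OF that(2)]])
 have "\<exists>f. continuous_map M.hq N.hq f & (\<forall>p\<in>topspace M.btot. f (M.bo p) = N.bo (fst p, ?c (fst p)))"
  by (rule borel_change_fibre[OF M.stack_presentation_axioms N.stack_presentation_axioms])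
   (use c act in "simp_all only: moduli_stack_simps frame_stack_simps")
 then obtain f where f: "continuous_map M.hq N.hq f" "!!p. p : topspace M.btot ==> f (M.bo p) = N.bo (fst p, ?c (fst p))" by blast
 have "\<exists>g. continuous_map N.hq M.hq g & (\<forall>p\<in>topspace N.btot. g (N.bo p) = M.bo (fst p, ?z))"
  by (rule borel_change_fibre[OF N.stack_presentation_axioms M.stack_presentation_axioms, where c = "%_. ?z"])
   (use z zero M.inv_closed in "simp_all add: continuous_map_const")
 then obtain g where g: "continuous_map N.hq M.hq g" "!!p. p : topspace N.btot ==> g (N.bo p) = M.bo (fst p, ?z)" by blast
 have "homotopic_with (%_. True) M.hq M.hq (g \<circ> f) id"
 proof (rule M.homotopic_id_by_join[where \<Omega> = fst and ka = rep_scale])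
  fix p assume p: "p : topspace M.btot"
  have "(fst p, ?c (fst p)) : topspace N.btot" using continuous_map_funspace[OF c] p by (auto simp: Pi_iff)
  then show "(g \<circ> f) (M.bo p) = M.bo (fst p, rep_scale (0, snd p))" using f(2) g(2) p rep_scale(1)[of "snd p" dv] by auto
 qed (auto simp: M.twist_def rep_scale continuous_rep_scale continuous_map_fst)
 moreover have "homotopic_with (%_. True) N.hq N.hq (f \<circ> g) id"
  by (rule frame_stack_homotopic_id[OF b bundle_frame_act]) (use f(2) g(2) z in auto)
 ultimately show ?thesis unfolding homotopy_equivalent_space_def using f(1) g(1) by blast
qed

section \<open>Schubert cells\<close>

lemma enumerate_finite:
 assumes "finite S" shows "bij_betw (enumerate S) {..<card S} S" "j < card S ==> enumerate S j : S" "j < card S ==> j <= enumerate S j"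
  "i < j ==> j < card S ==> enumerate S i < enumerate S j"
proof -
 show "bij_betw (enumerate S) {..<card S} S" by (rule finite_bij_enumerate[OF assms])
 show "j < card S ==> enumerate S j : S" by (rule finite_enumerate_in_set[OF assms])
 show "j < card S ==> j <= enumerate S j" by (rule finite_le_enumerate[OF assms])
 show "i < j ==> j < card S ==> enumerate S i < enumerate S j" by (rule finite_enumerate_mono[OF _ assms])
qed

text \<open>The size of the partition attached to a Schubert symbol, with parts given by how far
  each pivot column is moved from its minimal place.\<close>

definition weight_set :: "nat set => nat" where
 "weight_set S = (\<Sum>j<card S. enumerate S j - j)"

text \<open>Turns the weight into a sum of elements, so that exchanges and shifts can be handled
  without knowing how they change the enumeration.\<close>

lemma weight_set_sum:
 assumes "finite S" shows "weight_set S + \<Sum> {..<card S} = \<Sum> S"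
proof -
 have "weight_set S + \<Sum> {..<card S} = (\<Sum>j<card S. enumerate S j - j + j)" by (simp add: weight_set_def sum.distrib)
 also have "... = (\<Sum>j<card S. enumerate S j)" by (rule sum.cong) (use enumerate_finite(3)[OF assms] in auto)
 also have "... = \<Sum> S" using sum.reindex_bij_betw[OF enumerate_finite(1)[OF assms], of "%x. x"] by simp
 finally show ?thesis .
qed

lemma weight_set_exchange:
 assumes S: "finite S" and r: "a : S" "k ~: S" "k < a"
 shows "finite (insert k (S - {a}))" "card (insert k (S - {a})) = card S" "weight_set (insert k (S - {a})) < weight_set S"
proof -
 show f: "finite (insert k (S - {a}))" using S by simp
 show c: "card (insert k (S - {a})) = card S" using S r by (simp add: card_Diff_singleton card_gt_0_iff) (metis card_gt_0_iff Suc_pred empty_iff)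
 have "\<Sum> S = a + \<Sum> (S - {a})" by (rule sum.remove[OF S r(1)])
 moreover have "\<Sum> (insert k (S - {a})) = k + \<Sum> (S - {a})" using S r(2) by simp
 ultimately have "\<Sum> (insert k (S - {a})) < \<Sum> S" using r(3) by simp
 then show "weight_set (insert k (S - {a})) < weight_set S" using weight_set_sum[OF S] weight_set_sum[OF f] c by simp
qed

lemma weight_set_mono:
 assumes "finite S" "finite T" "card S = card T" "!!j. j < card T ==> enumerate S j <= enumerate T j"
 shows "weight_set S <= weight_set T" "weight_set S = weight_set T ==> S = T"
proof -
 have le: "enumerate S j - j <= enumerate T j - j" if "j < card T" for j using assms(4)[OF that] by simp
 then show "weight_set S <= weight_set T" unfolding weight_set_def assms(3) by (intro sum_mono) simp
 assume eq: "weight_set S = weight_set T"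
 have "enumerate S j = enumerate T j" if j: "j < card T" for j
 proof (rule ccontr)
  assume "enumerate S j ~= enumerate T j"
  then have "enumerate S j - j < enumerate T j - j" using assms(4)[OF j] enumerate_finite(3)[OF assms(1), of j] j assms(3) by simp
  then have "weight_set S < weight_set T" unfolding weight_set_def assms(3) by (intro sum_strict_mono_ex1) (use le j in auto)
  then show False using eq by simp
 qed
 then have "enumerate S ` {..<card T} = enumerate T ` {..<card T}" by (intro image_cong) auto
 then show "S = T" using enumerate_finite(1)[OF assms(1)] enumerate_finite(1)[OF assms(2)] assms(3) by (simp add: bij_betw_def)
qed

lemma finite_weight_set_le: "finite {S. finite S & card S = n & weight_set S <= s}"
proof (rule finite_subset)
 show "{S. finite S & card S = n & weight_set S <= s} <= Pow {..s + n}"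
 proof (intro subsetI PowI)
  fix S x assume "S : {S. finite S & card S = n & weight_set S <= s}" and x: "x : S"
  then have S: "finite S" "weight_set S <= s" "x : S" and n: "n = card S" by auto
  then obtain j where j: "j < card S" "x = enumerate S j" using enumerate_finite(1)[OF S(1)] by (auto simp: bij_betw_def)
  have "enumerate S j - j <= weight_set S" unfolding weight_set_def using j(1) by (intro member_le_sum) auto
  then show "x : {..s + n}" using j S(2) n by simp
 qed
qed simp

section \<open>Column minors and pivot exchange\<close>

definition column_minor :: "nat => (nat => nat) => (nat => nat => complex) => complex mat" where
 "column_minor n h y = mat n n (%(r, j). y r (h j))"

lemma column_minor_carrier [simp]: "column_minor n h y : carrier_mat n n" by (simp add: column_minor_def)

lemma det_column_minor_inj:
 assumes "det (column_minor n h y) ~= 0" shows "inj_on h {..<n}"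
proof (rule inj_onI, rule ccontr)
 fix i j assume ij: "i : {..<n}" "j : {..<n}" "h i = h j" "i ~= j"
 have "det (column_minor n h y) = 0"
  by (rule det_identical_columns[OF column_minor_carrier ij(4)]) (use ij in "auto simp: column_minor_def")
 then show False using assms by simp
qed

lemma det_column_minor_permute:
 assumes h: "bij_betw h {..<n} S" and h': "bij_betw h' {..<n} S" and det: "det (column_minor n h y) ~= 0"
 shows "det (column_minor n h' y) ~= 0"
proof -
 define p where "p j = (if j < n then inv_into {..<n} h (h' j) else j)" for j
 have hp: "h (p j) = h' j" "p j < n" if "j < n" for j
 proof -
  have "h' j : h ` {..<n}" using bij_betw_imp_surj_on[OF h] bij_betwE[OF h'] that by auto
  then show "h (p j) = h' j" "p j < n" using that f_inv_into_f[of "h' j" h "{..<n}"] inv_into_into[of "h' j" h "{..<n}"] by (auto simp: p_def)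
 qed
 have "inj_on p {..<n}"
 proof (rule inj_onI)
  fix i j assume "i : {..<n}" "j : {..<n}" "p i = p j"
  then have "h' i = h' j" using hp by (metis lessThan_iff)
  then show "i = j" using bij_betw_imp_inj_on[OF h'] \<open>i : {..<n}\<close> \<open>j : {..<n}\<close> by (auto dest: inj_onD)
 qed
 then have "bij_betw p {..<n} {..<n}" using hp(2) by (intro bij_betw_imageI endo_inj_surj) auto
 then have "p permutes {..<n}" by (intro bij_imp_permutes) (auto simp: p_def)
 then have p: "p permutes {0..<n}" by (simp add: atLeast0LessThan)
 have "det (column_minor n h' y) = det (transpose_mat (column_minor n h' y))" by (simp add: det_transpose[OF column_minor_carrier])
 also have "transpose_mat (column_minor n h' y) = mat n n (%(j, r). transpose_mat (column_minor n h y) $$ (p j, r))"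
  using hp by (intro eq_matI) (auto simp: column_minor_def)
 also have "det ... = signof p * det (transpose_mat (column_minor n h y))" by (rule det_permute_rows[OF _ p]) simp
 also have "... ~= 0" using det by (simp add: det_transpose[OF column_minor_carrier] sign_def)
 finally show ?thesis .
qed

text \<open>With the pivot columns equal to the identity, replacing pivot \<open>r\<close> by column
  \<open>k\<close> gives the determinant \<open>y r k\<close> by Cramer's rule; sorting the new
  pivots changes only the sign.\<close>

lemma det_column_minor_exchange:
 assumes S: "finite S" "card S = n" and 1: "column_minor n (enumerate S) y = 1\<^sub>m n"
  and r: "r < n" and k: "k ~: S" and nz: "y r k ~= 0" shows "det (column_minor n (enumerate (insert k (S - {enumerate S r}))) y) ~= 0"
proof (rule det_column_minor_permute)
 let ?h = "(enumerate S)(r := k)" and ?T = "insert k (S - {enumerate S r})"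
 have b: "bij_betw (enumerate S) {..<n} S" using enumerate_finite(1)[OF S(1)] S(2) by simp
 show "bij_betw ?h {..<n} ?T"
 proof (rule bij_betw_imageI)
  show "inj_on ?h {..<n}" using bij_betw_imp_inj_on[OF b] bij_betw_imp_surj_on[OF b] k by (auto simp: inj_on_def)
  show "?h ` {..<n} = ?T"
  proof -
   have "?h ` {..<n} = insert k (enumerate S ` ({..<n} - {r}))" using r by auto
   also have "enumerate S ` ({..<n} - {r}) = S - {enumerate S r}"
    using inj_on_image_set_diff[OF bij_betw_imp_inj_on[OF b], of "{..<n}" "{r}"] r bij_betw_imp_surj_on[OF b] by simp
   finally show ?thesis .
  qed
 qed
 have "card ?T = n" using S k b r by (metis bij_betwE card_Suc_Diff1 card_insert_disjoint finite_Diff insert_Diff_single insert_iff lessThan_iff Diff_iff)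
 then show "bij_betw (enumerate ?T) {..<n} ?T" using enumerate_finite(1)[of ?T] S(1) by simp
 have "column_minor n ?h y = replace_col (1\<^sub>m n) (1\<^sub>m n *\<^sub>v vec n (%i. y i k)) r"
 proof (rule eq_matI)
  fix i j assume "i < dim_row (replace_col (1\<^sub>m n) (1\<^sub>m n *\<^sub>v vec n (%i. y i k)) r)" "j < dim_col (replace_col (1\<^sub>m n) (1\<^sub>m n *\<^sub>v vec n (%i. y i k)) r)"
  then have ij: "i < n" "j < n" by (auto simp: replace_col_def)
  have "column_minor n (enumerate S) y $$ (i, j) = (1\<^sub>m n :: complex mat) $$ (i, j)" using 1 by simp
  then show "column_minor n ?h y $$ (i, j) = replace_col (1\<^sub>m n) (1\<^sub>m n *\<^sub>v vec n (%i. y i k)) r $$ (i, j)"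
   using ij by (auto simp: column_minor_def replace_col_def)
 qed (auto simp: column_minor_def replace_col_def)
 then have "det (column_minor n ?h y) = vec n (%i. y i k) $ r * det (1\<^sub>m n)"
  using cramer_lemma_mat[OF one_carrier_mat vec_carrier r, of "%i. y i k"] by simp
 then show "det (column_minor n ?h y) ~= 0" using nz r by simp
qed

text \<open>If the \<open>j\<close>-th column of \<open>T\<close> came before the
  \<open>j\<close>-th pivot, rows from \<open>j\<close> on would vanish in the first
  \<open>j + 1\<close> columns of the minor. By pigeonhole every permutation meets this zero block,
  so all terms of the determinant vanish.\<close>

lemma det_column_minor_echelon:
 assumes S: "finite S" "card S = n" and T: "finite T" "card T = n" and z: "!!r k. r < n ==> k < enumerate S r ==> y r k = 0"
  and det: "det (column_minor n (enumerate T) y) ~= 0" and j: "j < n" shows "enumerate S j <= enumerate T j"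
proof (rule ccontr)
 assume "\<not> enumerate S j <= enumerate T j"
 then have lt: "enumerate T j < enumerate S j" by simp
 have zero: "y i (enumerate T t) = 0" if "t <= j" "j <= i" "i < n" for i t
 proof (rule z[OF that(3)])
  have "enumerate T t <= enumerate T j" using enumerate_finite(4)[OF T(1), of t j] that(1) T(2) j by (cases "t = j") auto
  moreover have "enumerate S j <= enumerate S i" using enumerate_finite(4)[OF S(1), of j i] that S(2) by (cases "i = j") auto
  ultimately show "enumerate T t < enumerate S i" using lt by simp
 qed
 have *: "(\<Prod>i = 0..<n. column_minor n (enumerate T) y $$ (i, p i)) = 0" if p: "p permutes {0..<n}" for p
 proof -
  have "\<not> p ` {j..<n} <= {Suc j..<n}"
  proof
   assume "p ` {j..<n} <= {Suc j..<n}"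
   moreover have "inj_on p {j..<n}" using permutes_inj[OF p] by (rule inj_on_subset) simp
   ultimately have "card {j..<n} <= card {Suc j..<n}" by (intro card_inj_on_le) auto
   then show False using j by simp
  qed
  then obtain i where i: "j <= i" "i < n" "p i ~: {Suc j..<n}" by (meson atLeastLessThan_iff image_subsetI)
  then have pi: "p i < n" "p i <= j" using permutes_in_image[OF p, of i] by auto
  have "column_minor n (enumerate T) y $$ (i, p i) = 0" using zero[OF pi(2) i(1,2)] i(2) pi(1) by (simp add: column_minor_def)
  then show ?thesis using i(2) by (intro prod_zero) auto
 qed
 have "det (column_minor n (enumerate T) y) = 0"
  unfolding det_def'[OF column_minor_carrier] by (intro sum.neutral ballI) (simp only: mem_Collect_eq * mult_zero_right)
 then show False using det by simp
qed

section \<open>Pivot cells and their free coordinates\<close>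

definition schubert_index :: "('v, 'e) pre_digraph => ('v => nat) => ('v => nat set) set" where
 "schubert_index Q dv = (\<Pi>\<^sub>E i\<in>verts Q. {S. finite S & card S = dv i})"

definition weight :: "('v, 'e) pre_digraph => ('v => nat set) => nat" where
 "weight Q S = (\<Sum>i\<in>verts Q. weight_set (S i))"

definition pivot_cell :: "('v, 'e) pre_digraph => ('v => nat) => ('v => nat set) => ('v \<times> nat => complex mat) set" where
 "pivot_cell Q dv S = {x : topspace (frame_space Q dv). \<forall>i\<in>verts Q. det (minor dv i (enumerate (S i)) x) ~= 0}"

text \<open>Positions left of the pivot of their row and outside the pivot columns. Their vanishing
  is the echelon condition, and row \<open>r\<close> has \<open>enumerate (S i) r - r\<close> of
  them.\<close>

definition free_coords :: "('v, 'e) pre_digraph => ('v => nat) => ('v => nat set) => ('v \<times> nat \<times> nat) set" where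
 "free_coords Q dv S = (SIGMA i:verts Q. SIGMA r:{..<dv i}. {..<enumerate (S i) r} - S i)"

lemma schubert_indexD:
 assumes "S : schubert_index Q dv" "i : verts Q" shows "finite (S i)" "card (S i) = dv i"
 using assms by (auto simp: schubert_index_def dest: PiE_mem)

lemma card_free_coords:
 assumes Q: "finite (verts Q)" and S: "S : schubert_index Q dv"
 shows "finite (free_coords Q dv S)" "card (free_coords Q dv S) = weight Q S"
proof -
 show "finite (free_coords Q dv S)" unfolding free_coords_def using Q by (intro finite_SigmaI) auto
 have "card ({..<enumerate (S i) r} - S i) = enumerate (S i) r - r" if i: "i : verts Q" and r: "r < dv i" for i r
 proof -
  note D = schubert_indexD[OF S i] and e = enumerate_finite[OF schubert_indexD(1)[OF S i]]
  have r': "r < card (S i)" using r D by simp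
  have "{..<enumerate (S i) r} \<inter> S i = enumerate (S i) ` {..<r}"
  proof (intro equalityI subsetI)
   fix k assume k: "k : {..<enumerate (S i) r} \<inter> S i"
   then obtain j where j: "j < card (S i)" "k = enumerate (S i) j" using e(1) by (auto simp: bij_betw_def)
   then have "\<not> r < j" "r ~= j" using k e(4)[of r j] by auto
   then show "k : enumerate (S i) ` {..<r}" unfolding j(2) by (intro imageI) simp
  next
   fix k assume "k : enumerate (S i) ` {..<r}"
   then obtain j where "k = enumerate (S i) j" "j < r" by auto
   then show "k : {..<enumerate (S i) r} \<inter> S i" using e(2)[of j] e(4)[of j r] r' by simp
  qed
  moreover have "inj_on (enumerate (S i)) {..<r}" using bij_betw_imp_inj_on[OF e(1)] by (rule inj_on_subset) (use r' in auto)
  ultimately have "card ({..<enumerate (S i) r} \<inter> S i) = r" by (simp add: card_image)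
  then show ?thesis by (simp add: card_Diff_subset_Int)
 qed
 then show "card (free_coords Q dv S) = weight Q S" unfolding free_coords_def weight_def weight_set_def using Q schubert_indexD(2)[OF S]
  by (simp add: card_SigmaI)
qed

lemma finite_weight_below:
 assumes Q: "finite (verts Q)" shows "finite {S : schubert_index Q dv. weight Q S < s}"
proof (rule finite_subset)
 show "{S : schubert_index Q dv. weight Q S < s} <= (\<Pi>\<^sub>E i\<in>verts Q. {S. finite S & card S = dv i & weight_set S <= s})"
 proof (intro subsetI PiE_I)
  fix S i assume "S : {S : schubert_index Q dv. weight Q S < s}" and i: "i : verts Q"
  then have S: "S : schubert_index Q dv" "weight Q S < s" by auto
  have "weight_set (S i) <= weight Q S" unfolding weight_def using i Q by (intro member_le_sum) auto
  then show "S i : {S. finite S & card S = dv i & weight_set S <= s}" using S schubert_indexD[OF S(1) i] by auto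
 qed (auto simp: schubert_index_def)
 show "finite (\<Pi>\<^sub>E i\<in>verts Q. {S. finite S & card S = dv i & weight_set S <= s})"
  by (rule finite_PiE[OF Q]) (rule finite_weight_set_le)
qed

lemma minor_column_minor: "minor dv i h x = column_minor (dv i) h (%r k. x (i, k) $$ (r, 0))" by (simp add: minor_def column_minor_def)

text \<open>A nonzero free coordinate allows an exchange to a pivot set of smaller weight. If all
  vanish, the matrix is in echelon form, every nonvanishing minor dominates \<open>S\<close>
  entrywise, and within weight at most that of \<open>S\<close> only \<open>S\<close> itself is
  possible.\<close>

lemma slice_in_lower_cells:
 assumes Q: "finite (verts Q)" and S: "S : schubert_index Q dv"
  and y: "y : topspace (frame_space Q dv)" "!!i. i : verts Q ==> minor dv i (enumerate (S i)) y = 1\<^sub>m (dv i)"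
  and F: "F <= schubert_index Q dv" "S ~: F" "!!T. T : F ==> weight Q T <= weight Q S"
   "!!T. T : schubert_index Q dv ==> weight Q T < weight Q S ==> T : F"
 shows "y : \<Union> (pivot_cell Q dv ` F) \<longleftrightarrow> (\<exists>(i, r, k)\<in>free_coords Q dv S. y (i, k) $$ (r, 0) ~= 0)"
proof
 assume "y : \<Union> (pivot_cell Q dv ` F)"
 then obtain T where T: "T : F" "y : pivot_cell Q dv T" by auto
 show "\<exists>(i, r, k)\<in>free_coords Q dv S. y (i, k) $$ (r, 0) ~= 0"
 proof (rule ccontr)
  assume "\<not> ?thesis"
  then have z: "y (i, k) $$ (r, 0) = 0" if "i : verts Q" "r < dv i" "k < enumerate (S i) r" "k ~: S i" for i r k
   using that by (auto simp: free_coords_def)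
  have le: "weight_set (S i) <= weight_set (T i) & (weight_set (S i) = weight_set (T i) --> S i = T i)" if i: "i : verts Q" for i
  proof -
   note DS = schubert_indexD[OF S i] and DT = schubert_indexD[OF subsetD[OF F(1) T(1)] i]
   have "enumerate (S i) j <= enumerate (T i) j" if j: "j < dv i" for j
   proof (rule det_column_minor_echelon[OF DS DT _ _ j, where y = "%r k. y (i, k) $$ (r, 0)"])
    show "det (column_minor (dv i) (enumerate (T i)) (%r k. y (i, k) $$ (r, 0))) ~= 0"
     using T(2) i by (simp add: pivot_cell_def minor_column_minor)
    fix r k assume rk: "r < dv i" "k < enumerate (S i) r"
    show "y (i, k) $$ (r, 0) = 0"
    proof (cases "k : S i")
     case True
     then obtain j where j: "j < dv i" "k = enumerate (S i) j" using enumerate_finite(1)[OF DS(1)] DS(2) by (auto simp: bij_betw_def)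
     then have "minor dv i (enumerate (S i)) y $$ (r, j) = 0" using rk y(2)[OF i] by auto
     then show ?thesis using rk(1) j by (simp add: minor_def)
    qed (use z[OF i rk] in simp)
   qed
   then show ?thesis using weight_set_mono[OF DS(1) DT(1)] DS(2) DT(2) by simp
  qed
  have "weight_set (S i) = weight_set (T i)" if i: "i : verts Q" for i
  proof (rule ccontr)
   assume "weight_set (S i) ~= weight_set (T i)"
   then have "weight Q S < weight Q T" unfolding weight_def
    by (intro sum_strict_mono_ex1[OF Q]) (use le i in "auto intro!: bexI[of _ i] simp: le_neq_implies_less")
   then show False using F(3)[OF T(1)] by simp
  qed
  then have "S = T" by (intro PiE_ext[OF S[unfolded schubert_index_def] subsetD[OF F(1) T(1), unfolded schubert_index_def]]) (use le in blast)
  then show False using F(2) T(1) by simp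
 qed
next
 assume "\<exists>(i, r, k)\<in>free_coords Q dv S. y (i, k) $$ (r, 0) ~= 0"
 then obtain i r k where i: "i : verts Q" and r: "r < dv i" and k: "k ~: S i" "k < enumerate (S i) r" and nz: "y (i, k) $$ (r, 0) ~= 0"
  by (auto simp: free_coords_def)
 note D = schubert_indexD[OF S i]
 let ?U = "insert k (S i - {enumerate (S i) r})"
 define T where "T = S(i := ?U)"
 have a: "enumerate (S i) r : S i" using enumerate_finite(2)[OF D(1)] D(2) r by simp
 note ex = weight_set_exchange[OF D(1) a k]
 have TI: "T : schubert_index Q dv" using S i ex(1,2) D(2) by (auto simp: T_def schubert_index_def PiE_iff extensional_def)
 have "weight Q T < weight Q S" unfolding weight_def
  by (intro sum_strict_mono_ex1[OF Q]) (use ex(3) i in "auto simp: T_def intro!: bexI[of _ i]")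
 then have TF: "T : F" by (rule F(4)[OF TI])
 have "det (minor dv j (enumerate (T j)) y) ~= 0" if j: "j : verts Q" for j
 proof (cases "j = i")
  case True
  show ?thesis unfolding True T_def fun_upd_same minor_column_minor
   by (rule det_column_minor_exchange[OF D _ r k(1)]) (use y(2)[OF i] nz in "simp_all add: minor_column_minor")
 next
  case False
  then show ?thesis using y(2)[OF j] by (simp add: T_def)
 qed
 then show "y : \<Union> (pivot_cell Q dv ` F)" using TF y(1) by (auto simp: pivot_cell_def)
qed

lemma full_rank_pivot_cells:
 "topspace (frame_space Q dv) \<inter> full_rank Q dv = \<Union> (pivot_cell Q dv ` schubert_index Q dv)"
proof (intro equalityI subsetI)
 fix x assume x: "x : topspace (frame_space Q dv) \<inter> full_rank Q dv"
 then obtain h where h: "!!i. i : verts Q ==> det (minor dv i (h i) x) ~= 0" unfolding full_rank_def by (auto dest!: bchoice)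
 define S where "S = (\<lambda>i\<in>verts Q. h i ` {..<dv i})"
 have c: "finite (S i) & card (S i) = dv i & bij_betw (h i) {..<dv i} (S i)" if i: "i : verts Q" for i
 proof -
  have "inj_on (h i) {..<dv i}" by (rule det_column_minor_inj[OF h[OF i, unfolded minor_column_minor]])
  then show ?thesis using i by (simp add: S_def card_image bij_betw_def)
 qed
 then have "S : schubert_index Q dv" by (auto simp: schubert_index_def S_def)
 moreover have "det (minor dv i (enumerate (S i)) x) ~= 0" if i: "i : verts Q" for i
  using det_column_minor_permute[OF conjunct2[OF conjunct2[OF c[OF i]]] _ h[OF i, unfolded minor_column_minor]]
   enumerate_finite(1)[of "S i"] c[OF i] by (simp add: minor_column_minor)
 ultimately show "x : \<Union> (pivot_cell Q dv ` schubert_index Q dv)" using x by (auto simp: pivot_cell_def)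
next
 fix x assume "x : \<Union> (pivot_cell Q dv ` schubert_index Q dv)"
 then show "x : topspace (frame_space Q dv) \<inter> full_rank Q dv" by (auto simp: pivot_cell_def full_rank_def)
qed

lemma openin_pivot_cell:
 assumes Q: "finite (verts Q)" shows "openin (frame_space Q dv) (pivot_cell Q dv S)"
proof -
 have o: "openin (frame_space Q dv) {x : topspace (frame_space Q dv). det (minor dv i (enumerate (S i)) x) : - {0}}" if i: "i : verts Q" for i
  by (rule openin_continuous_map_preimage[OF continuous_map_det[OF minor_continuous[OF i]]]) auto
 show ?thesis
 proof (cases "verts Q = {}")
  case True then show ?thesis by (simp add: pivot_cell_def)
 next
  case False
  have "pivot_cell Q dv S = (\<Inter>i\<in>verts Q. {x : topspace (frame_space Q dv). det (minor dv i (enumerate (S i)) x) : - {0}})"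
   using False by (auto simp: pivot_cell_def)
  then show ?thesis using openin_INT2[OF Q False o] by simp
 qed
qed

section \<open>Normal forms on one pivot cell\<close>

locale schubert_cell = M: stack_presentation "frame_stack Q dv" for Q :: "('v, 'e) pre_digraph" and dv :: "'v => nat" +
 fixes S :: "'v => nat set"
 assumes finite_verts: "finite (verts Q)" and index: "S : schubert_index Q dv"
begin

abbreviation "e == %i. enumerate (S i)"
abbreviation "FS == frame_space Q dv"
abbreviation "GG == BG Q dv"
abbreviation "N == pivot_cell Q dv"

text \<open>The pivot minors form a group element that translates equivariantly. Dividing by it
  makes the pivot columns the identity, so \<open>slice\<close> is a global slice: the cell is the
  product of the group and the slice.\<close>

definition "\<mu> x = (\<lambda>i\<in>verts Q. minor dv i (e i) x)"
definition "nform x = frame_act Q (inv\<^bsub>GG\<^esub> (\<mu> x)) x"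
definition "slice = {y : topspace FS. \<forall>i\<in>verts Q. minor dv i (e i) y = 1\<^sub>m (dv i)}"

lemma N_X: "N T <= topspace FS \<inter> full_rank Q dv" by (auto simp: pivot_cell_def full_rank_def)

lemma slice_N: "y : slice ==> y : N S" by (auto simp: slice_def pivot_cell_def)

lemma \<mu>_carrier: "x : N S ==> \<mu> x : carrier GG"
 by (auto simp: \<mu>_def carrier_base_change_group carrier_general_linear pivot_cell_def)

lemma act_N:
 assumes g: "g : carrier GG" and x: "x : N T" shows "frame_act Q g x : N T"
proof -
 have x': "x : topspace FS" using x by (simp add: pivot_cell_def)
 have "det (minor dv i (enumerate (T i)) (frame_act Q g x)) ~= 0" if i: "i : verts Q" for i
 proof -
  have gi: "g i : carrier_mat (dv i) (dv i)" "det (g i) ~= 0" using g i by (auto simp: carrier_base_change_group carrier_general_linear)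
  show ?thesis unfolding minor_frame_act[where g = g and dv = dv, OF i x' gi(1)] det_mult[OF gi(1) minor_carrier[of dv i "enumerate (T i)" x]]
   using gi(2) x i by (simp add: pivot_cell_def)
 qed
 then show ?thesis using frame_act_closed(1)[OF g x'] by (simp add: pivot_cell_def)
qed

lemma act_\<mu>:
 assumes g: "g : carrier GG" and x: "x : N S" shows "\<mu> (frame_act Q g x) = g \<otimes>\<^bsub>GG\<^esub> \<mu> x"
proof
 fix i
 have x': "x : topspace FS" using x by (simp add: pivot_cell_def)
 show "\<mu> (frame_act Q g x) i = (g \<otimes>\<^bsub>GG\<^esub> \<mu> x) i"
 proof (cases "i : verts Q")
  case True
  then have gi: "g i : carrier_mat (dv i) (dv i)" using g by (auto simp: carrier_base_change_group carrier_general_linear)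
  show ?thesis using True minor_frame_act[where g = g and dv = dv, OF True x' gi] by (simp add: \<mu>_def base_change_group_def)
 qed (simp add: \<mu>_def base_change_group_def)
qed

lemmas group_simps = M.inv_closed[unfolded frame_stack_simps] M.l_inv[unfolded frame_stack_simps] M.r_inv[unfolded frame_stack_simps]
 M.inv_mult_group[unfolded frame_stack_simps] M.m_closed[unfolded frame_stack_simps] M.m_assoc[unfolded frame_stack_simps]
 M.r_one[unfolded frame_stack_simps]

lemma act_act: "g : carrier GG ==> h : carrier GG ==> x : N S ==> frame_act Q g (frame_act Q h x) = frame_act Q (g \<otimes>\<^bsub>GG\<^esub> h) x"
 using M.act_mult[of g h x] subsetD[OF N_X[of S], of x] by simp

lemma act_unit: "x : N S ==> frame_act Q \<one>\<^bsub>GG\<^esub> x = x" using M.act_one[of x] subsetD[OF N_X[of S], of x] by simp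

lemma nform_act: "g : carrier GG ==> x : N S ==> nform (frame_act Q g x) = nform x"
 unfolding nform_def by (simp add: act_\<mu> group_simps \<mu>_carrier act_act)

lemma nform_slice: "x : N S ==> nform x : slice"
proof -
 assume x: "x : N S"
 then have "nform x : N S" unfolding nform_def by (intro act_N group_simps \<mu>_carrier)
 moreover have eq: "\<mu> (nform x) = \<one>\<^bsub>GG\<^esub>" unfolding nform_def using x by (simp add: act_\<mu> group_simps \<mu>_carrier)
 have "minor dv i (e i) (nform x) = 1\<^sub>m (dv i)" if "i : verts Q" for i
  using fun_cong[OF eq, of i] that by (simp add: \<mu>_def base_change_group_def)
 ultimately show ?thesis by (simp add: slice_def pivot_cell_def)
qed

lemma slice_nform: "y : slice ==> nform y = y"
proof -
 assume y: "y : slice"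
 have "\<mu> y = \<one>\<^bsub>GG\<^esub>" using y by (auto simp: slice_def \<mu>_def base_change_group_def)
 then show ?thesis unfolding nform_def using act_unit[OF slice_N[OF y]] M.inv_one[unfolded frame_stack_simps] by simp
qed

lemma nform_N: "x : N S ==> nform x : N T \<longleftrightarrow> x : N T"
proof
 assume x: "x : N S"
 show "x : N T" if n: "nform x : N T"
 proof -
  have "frame_act Q (\<mu> x) (nform x) = x" unfolding nform_def using x by (simp add: act_act group_simps \<mu>_carrier act_unit)
  then show ?thesis using act_N[OF \<mu>_carrier[OF x] n] by simp
 qed
 show "nform x : N T" if "x : N T" unfolding nform_def using that x by (intro act_N group_simps \<mu>_carrier)
qed

lemma continuous_\<mu>: "continuous_map (subtopology FS (N S)) (grp_top (frame_stack Q dv)) \<mu>" unfolding frame_stack_simps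
proof (rule continuous_map_coordinatewise_then_product)
 fix i assume i: "i : verts Q"
 have "continuous_map (subtopology FS (N S)) (mat_topology (dv i) (dv i)) (%x. \<mu> x i)"
  using continuous_map_from_subtopology[OF minor_continuous[OF i]] i by (simp add: \<mu>_def)
 moreover have "\<mu> x i : carrier (GL (dv i))" if "x : N S" for x
  using \<mu>_carrier[OF that] i by (auto simp: carrier_base_change_group)
 ultimately show "continuous_map (subtopology FS (N S)) (gl_topology (dv i)) (%x. \<mu> x i)" by (simp add: continuous_map_gl_topology)
qed (simp add: \<mu>_def)

lemma continuous_nform: "continuous_map (subtopology FS (N S)) FS nform"
proof -
 have sub: "subtopology (space (frame_stack Q dv)) (N S) = subtopology FS (N S)"
  using N_X[of S] by (simp add: subtopology_subtopology inf_absorb2)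
 have "continuous_map (subtopology FS (N S)) (space (frame_stack Q dv)) (%x. x)"
  unfolding sub[symmetric] by (rule continuous_map_from_subtopology) simp
 from M.continuous_map_act[OF M.continuous_map_inv[OF continuous_\<mu>] this]
 show ?thesis unfolding nform_def frame_stack_simps by (rule continuous_map_into_fulltopology)
qed

definition "ze = (SOME z. bij_betw z {..<weight Q S} (free_coords Q dv S))"

lemma ze: "bij_betw ze {..<weight Q S} (free_coords Q dv S)"
proof -
 obtain z where "bij_betw z {..<weight Q S} (free_coords Q dv S)"
  using ex_bij_betw_nat_finite[OF card_free_coords(1)[OF finite_verts index]]
  unfolding card_free_coords(2)[OF finite_verts index] atLeast0LessThan by (rule exE)
 then show ?thesis unfolding ze_def by (rule someI[where P = "%z. bij_betw z {..<weight Q S} (free_coords Q dv S)"])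
qed

lemma ze_div:
 assumes "k < 2 * weight Q S"
 obtains i r m where "ze (k div 2) = (i, r, m)" "(i, r, m) : free_coords Q dv S" "i : verts Q" "r < dv i" "m ~: S i" "m < e i r"
proof -
 have "k div 2 : {..<weight Q S}" unfolding lessThan_iff by (rule less_mult_imp_div_less) (use assms in "simp add: mult.commute")
 then have "ze (k div 2) : free_coords Q dv S" by (rule bij_betw_apply[OF ze])
 moreover obtain i r m where "ze (k div 2) = (i, r, m)" by (rule prod_cases3)
 ultimately show ?thesis by (intro that[of i r m]) (simp_all add: free_coords_def)
qed

abbreviation "EU == Euclidean_space (2 * weight Q S)"

definition "coord y k = (case ze (k div 2) of (i, r, m) => if even k then Re (y (i, m) $$ (r, 0)) else Im (y (i, m) $$ (r, 0)))"
definition "coords y = (%k. if k < 2 * weight Q S then coord y k else 0)"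
text \<open>Contracts the infinitely many entries to the right of the pivots and keeps the pivot
  columns and the free coordinates. What is left at time \<open>0\<close> is a complex vector space
  of dimension \<open>weight Q S\<close>, with inverse coordinate maps \<open>coords\<close> and
  \<open>point\<close>.\<close>

definition "scaled s y = (\<lambda>p\<in>verts Q \<times> UNIV. mat (dv (fst p)) 1 (%(r, c).
 if snd p : S (fst p) \<or> snd p < e (fst p) r then y p $$ (r, 0) else complex_of_real s * y p $$ (r, 0)))"
definition "point w = (\<lambda>p\<in>verts Q \<times> UNIV. mat (dv (fst p)) 1 (%(r, c).
 if snd p : S (fst p) then if e (fst p) r = snd p then 1 else 0
 else if snd p < e (fst p) r then let z = inv_into {..<weight Q S} ze (fst p, r, snd p) in
  complex_of_real (w (2 * z)) + \<i> * complex_of_real (w (2 * z + 1))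
 else 0))"

lemma continuous_coords: "continuous_map FS EU coords" unfolding coords_def continuous_map_componentwise_Euclidean_space
proof (intro allI impI)
 fix k assume k: "k < 2 * weight Q S"
 then obtain i r m where z: "ze (k div 2) = (i, r, m)" "i : verts Q" "r < dv i" by (rule ze_div)
 have c: "continuous_map FS euclidean (%y. y (i, m) $$ (r, 0))"
  by (rule continuous_map_matD(2)[OF frame_space_coord[OF z(2), of dv m] z(3)]) simp
 have "continuous_map FS euclideanreal (%y. Re (y (i, m) $$ (r, 0)))" "continuous_map FS euclideanreal (%y. Im (y (i, m) $$ (r, 0)))"
  using c by (simp_all add: continuous_map_atin tendsto_Re tendsto_Im)
 then show "continuous_map FS euclideanreal (%y. coord y k)" by (simp add: coord_def z)
qed

lemma continuous_scaled:
 assumes t: "continuous_map Z euclideanreal t" and y: "continuous_map Z FS y" shows "continuous_map Z FS (%z. scaled (t z) (y z))"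
proof (rule continuous_map_frame_space)
 fix i m assume i: "i : verts Q"
 show "continuous_map Z (mat_topology (dv i) 1) (%z. scaled (t z) (y z) (i, m))"
 proof (rule continuous_map_matI)
  fix r c assume rc: "r < dv i" "c < (1::nat)"
  have c: "continuous_map Z euclidean (%z. y z (i, m) $$ (r, 0))"
   using continuous_map_compose[OF y continuous_map_matD(2)[OF frame_space_coord[OF i, of dv m] rc(1), of 0]] by (simp add: o_def)
  have "continuous_map Z euclidean (%z. complex_of_real (t z))" using t by (simp add: continuous_map_atin tendsto_of_real)
  from continuous_map_complex_mult[OF this c] c
  show "continuous_map Z euclidean (%z. scaled (t z) (y z) (i, m) $$ (r, c))" using rc i by (simp add: scaled_def)
 qed (simp add: scaled_def i)
qed (simp add: scaled_def)

lemma continuous_point: "continuous_map EU FS point"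
proof (rule continuous_map_frame_space)
 fix i m assume i: "i : verts Q"
 have w: "continuous_map EU euclidean (%w. complex_of_real (w k))" for k
  using continuous_map_from_subtopology[OF continuous_map_product_coordinates[of k UNIV "%_. euclideanreal"]]
  by (simp add: Euclidean_space_def continuous_map_atin tendsto_of_real)
 show "continuous_map EU (mat_topology (dv i) 1) (%w. point w (i, m))"
 proof (rule continuous_map_matI)
  fix r c assume rc: "r < dv i" "c < (1::nat)"
  have "continuous_map EU euclidean (%w. complex_of_real (w k) + \<i> * complex_of_real (w l))" for k l
   by (intro continuous_map_add continuous_map_complex_mult w) simp
  then show "continuous_map EU euclidean (%w. point w (i, m) $$ (r, c))" using rc i by (simp add: point_def Let_def)
 qed (simp add: point_def i)
qed (simp add: point_def)

lemma minor_unit: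
 assumes i: "i : verts Q" and r: "r < dv i" "j < dv i" shows "e i j : S i" "e i r = e i j \<longleftrightarrow> r = j"
proof -
 note D = schubert_indexD[OF index i]
 show "e i j : S i" using enumerate_finite(2)[OF D(1)] D(2) r by simp
 show "e i r = e i j \<longleftrightarrow> r = j" using bij_betw_imp_inj_on[OF enumerate_finite(1)[OF D(1)]] D(2) r by (auto dest: inj_onD)
qed

lemma point_slice: "point w : slice"
proof -
 have "point w : topspace FS" by (auto simp: topspace_frame_space point_def)
 moreover have "minor dv i (e i) (point w) = 1\<^sub>m (dv i)" if i: "i : verts Q" for i
  by (rule eq_matI) (use minor_unit[OF i] i in "auto simp: minor_def point_def")
 ultimately show ?thesis by (simp add: slice_def)
qed

lemma scaled_slice: "y : slice ==> scaled s y : slice"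
proof -
 assume y: "y : slice"
 have "scaled s y : topspace FS" by (auto simp: topspace_frame_space scaled_def)
 moreover have "minor dv i (e i) (scaled s y) = minor dv i (e i) y" if i: "i : verts Q" for i
  by (rule eq_matI) (use minor_unit[OF i] i in "auto simp: minor_def scaled_def")
 ultimately show ?thesis using y by (simp add: slice_def)
qed

lemma frame_space_eqI:
 assumes "x : topspace FS" "y : topspace FS" "!!i m r. i : verts Q ==> r < dv i ==> x (i, m) $$ (r, 0) = y (i, m) $$ (r, 0)" shows "x = y"
proof (rule PiE_ext[OF assms(1,2)[unfolded topspace_frame_space]])
 fix p :: "'v \<times> nat" assume "p : verts Q \<times> UNIV"
 then obtain i m where p: "p = (i, m)" "i : verts Q" by auto
 show "x p = y p" unfolding p(1)
  by (rule eq_matI) (use frame_space_mem[OF assms(1) p(2), of m] frame_space_mem[OF assms(2) p(2), of m] assms(3)[OF p(2)] in auto)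
qed

lemma scaled_1: "y : slice ==> scaled 1 y = y" using scaled_slice[of y 1] by (intro frame_space_eqI) (auto simp: slice_def scaled_def)

lemma ze_inv:
 assumes "(i, r, m) : free_coords Q dv S"
 obtains z where "inv_into {..<weight Q S} ze (i, r, m) = z" "z < weight Q S" "ze z = (i, r, m)"
 using assms ze bij_betw_inv_into_right[OF ze] bij_betw_apply[OF bij_betw_inv_into[OF ze]] by auto

lemma point_coords: "y : slice ==> point (coords y) = scaled 0 y"
proof (rule frame_space_eqI)
 assume y: "y : slice"
 then show "scaled 0 y : topspace FS" "point (coords y) : topspace FS" using scaled_slice[OF y] point_slice by (auto simp: slice_def)
 fix i m r assume i: "i : verts Q" and r: "r < dv i"
 show "point (coords y) (i, m) $$ (r, 0) = scaled 0 y (i, m) $$ (r, 0)"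
 proof (cases "m : S i")
  case True
  then obtain j where j: "j < dv i" "m = e i j"
   using enumerate_finite(1)[OF schubert_indexD(1)[OF index i]] schubert_indexD(2)[OF index i] by (auto simp: bij_betw_def)
  have "minor dv i (e i) y $$ (r, j) = (1\<^sub>m (dv i)) $$ (r, j)" using y i by (simp add: slice_def)
  then have "y (i, m) $$ (r, 0) = (if r = j then 1 else 0)" using r j by (simp add: minor_def)
  then show ?thesis using i r True minor_unit(2)[OF i r j(1)] j(2) by (simp add: point_def scaled_def)
 next
  case False
  show ?thesis
  proof (cases "m < e i r")
   case True
   then have "(i, r, m) : free_coords Q dv S" using i r False by (simp add: free_coords_def)
   then obtain z where "inv_into {..<weight Q S} ze (i, r, m) = z" "z < weight Q S" "ze z = (i, r, m)" by (rule ze_inv)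
   then show ?thesis using i r False True by (simp add: point_def scaled_def Let_def coords_def coord_def complex_eq[symmetric])
  qed (use False i r in "simp add: point_def scaled_def")
 qed
qed

lemma coords_point: "w : topspace EU ==> coords (point w) = w"
proof
 fix k assume w: "w : topspace EU"
 show "coords (point w) k = w k"
 proof (cases "k < 2 * weight Q S")
  case True
  then obtain i r m where z: "ze (k div 2) = (i, r, m)" "i : verts Q" "r < dv i" "m ~: S i" "m < e i r" by (rule ze_div)
  have k: "k div 2 < weight Q S" by (rule less_mult_imp_div_less) (use True in "simp add: mult.commute")
  have "inv_into {..<weight Q S} ze (i, r, m) = k div 2" using bij_betw_inv_into_left[OF ze, of "k div 2"] k z(1) by simp
  then show ?thesis using True z by (simp add: coords_def coord_def point_def Let_def)
 next
  case False then show ?thesis using w by (simp add: coords_def topspace_Euclidean_space)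
 qed
qed

lemma coords_zero_iff: "coords y = (%_. 0) \<longleftrightarrow> (\<forall>(i, r, m)\<in>free_coords Q dv S. y (i, m) $$ (r, 0) = 0)"
proof
 assume L: "coords y = (%_. 0)"
 show "\<forall>(i, r, m)\<in>free_coords Q dv S. y (i, m) $$ (r, 0) = 0"
 proof clarify
  fix i r m assume "(i, r, m) : free_coords Q dv S"
  then obtain z where z: "z < weight Q S" "ze z = (i, r, m)" by (rule ze_inv)
  have "coords y (2 * z) = 0" "coords y (2 * z + 1) = 0" unfolding L by auto
  then show "y (i, m) $$ (r, 0) = 0" using z by (simp add: coords_def coord_def complex_eq_iff)
 qed
next
 assume R: "\<forall>(i, r, m)\<in>free_coords Q dv S. y (i, m) $$ (r, 0) = 0"
 have "coord y k = 0" if "k < 2 * weight Q S" for k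
 proof -
  from that obtain i r m where "ze (k div 2) = (i, r, m)" "(i, r, m) : free_coords Q dv S" by (rule ze_div)
  then show ?thesis using R by (auto simp: coord_def)
 qed
 then show "coords y = (%_. 0)" by (auto simp: coords_def)
qed

end

section \<open>The open cells in the homotopy quotient\<close>

context schubert_cell
begin

abbreviation "NB T == M.bo ` (milnor_points GG \<times> N T)"

lemma btot_N: "milnor_points GG \<times> N T <= topspace M.btot" using N_X[of T] by auto

lemma NB_iff:
 assumes "p : topspace M.btot" shows "M.bo p : NB T \<longleftrightarrow> snd p : N T"
proof
 assume "M.bo p : NB T"
 then obtain q where q: "q : milnor_points GG \<times> N T" "M.bo q = M.bo p" by auto
 obtain g where g: "g : carrier GG" "p = M.twist q g"
  using M.bo_eqE[OF q(2) subsetD[OF btot_N q(1)] assms] by (auto simp: frame_stack_simps)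
 then show "snd p : N T" using q(1) by (auto simp: M.twist_def intro: act_N group_simps)
next
 assume "snd p : N T"
 moreover have "fst p : milnor_points GG" using assms by (auto simp: mem_Times_iff)
 ultimately show "M.bo p : NB T" by (intro imageI) (simp add: mem_Times_iff)
qed

lemma openin_NB: "openin M.hq (NB T)"
proof -
 have "openin (space (frame_stack Q dv)) (N T)"
  unfolding frame_stack_simps openin_subtopology using openin_pivot_cell[OF finite_verts, of dv T] N_X[of T] by blast
 moreover have "openin (milnor_space GG (grp_top (frame_stack Q dv))) (milnor_points GG)"
  using openin_topspace[of "milnor_space GG (grp_top (frame_stack Q dv))"] by simp
 ultimately have "openin M.btot (milnor_points GG \<times> N T)" by (simp only: openin_prod_Times_iff frame_stack_simps(1) simp_thms)
 then show ?thesis by (rule M.open_map_bo[unfolded open_map_def, rule_format])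
qed

lemma milnor_point: obtains e0 where "e0 : milnor_points GG"
proof
 show "mpt GG (%k. if k = 0 then 1 else 0) (%_. \<one>\<^bsub>GG\<^esub>) : milnor_points GG"
 proof (rule mpt_in_milnor_points)
  show "(%k. if k = (0::nat) then 1 else 0 :: real) sums 1" using sums_single[of 0 "%_. 1 :: real"] by simp
 qed (use M.is_monoid M.one_closed in auto)
qed

context
 fixes F
 assumes F: "F <= schubert_index Q dv" "S ~: F" "!!T. T : F ==> weight Q T <= weight Q S"
   "!!T. T : schubert_index Q dv ==> weight Q T < weight Q S ==> T : F"
begin

definition "B = subtopology M.hq (NB S)"
definition "A = NB S \<inter> \<Union> (NB ` F)"
definition "XP = subtopology M.btot (milnor_points GG \<times> N S)"

lemma topspace_XP: "topspace XP = milnor_points GG \<times> N S" unfolding XP_def topspace_subtopology by (rule inf_absorb2[OF btot_N])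

lemma XPD: "p : topspace XP ==> fst p : milnor_points GG" "p : topspace XP ==> snd p : N S"
 "p : topspace XP ==> p : topspace M.btot" unfolding topspace_XP using subsetD[OF btot_N[of S], of p] by (simp_all only: mem_Times_iff)

lemma XP_quotient: "continuous_map XP B M.bo" "open_map XP B M.bo" "M.bo ` topspace XP = topspace B"
proof -
 show s: "M.bo ` topspace XP = topspace B"
  unfolding topspace_XP B_def topspace_subtopology M.topspace_hq by (rule inf_absorb2[symmetric, OF image_mono[OF btot_N]])
 show "continuous_map XP B M.bo" unfolding B_def continuous_map_in_subtopology topspace_XP unfolding XP_def
  by (intro conjI continuous_map_from_subtopology[OF M.continuous_map_bo] funcsetI imageI)
 show "open_map XP B M.bo" unfolding XP_def B_def
 proof (rule open_map_restriction[OF M.open_map_bo])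
  show "{p : topspace M.btot. M.bo p : NB S} = milnor_points GG \<times> N S"
  proof (intro equalityI subsetI)
   fix p assume "p : {p : topspace M.btot. M.bo p : NB S}"
   then have p: "p : topspace M.btot" "M.bo p : NB S" unfolding mem_Collect_eq by (rule conjunct1, rule conjunct2)
   then show "p : milnor_points GG \<times> N S" using NB_iff[OF p(1)] by (simp add: mem_Times_iff)
  qed (use btot_N[of S] in blast)
 qed
qed

lemma continuous_XP: "continuous_map XP (milnor_space GG (grp_top (frame_stack Q dv))) fst"
 "continuous_map XP (subtopology FS (N S)) snd"
proof -
 show "continuous_map XP (milnor_space GG (grp_top (frame_stack Q dv))) fst"
  unfolding XP_def using continuous_map_from_subtopology[OF continuous_map_fst] by simp
 have "continuous_map XP (space (frame_stack Q dv)) snd" unfolding XP_def by (rule continuous_map_from_subtopology[OF continuous_map_snd])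
 then have "continuous_map XP FS snd" unfolding frame_stack_simps by (rule continuous_map_into_fulltopology)
 then show "continuous_map XP (subtopology FS (N S)) snd" unfolding continuous_map_in_subtopology topspace_XP by auto
qed

lemma XP_twist:
 assumes "p : topspace XP" "p' : topspace XP" "M.bo p = M.bo p'"
 obtains g where "g : carrier GG" "p' = (milnor_act GG (fst p) g, frame_act Q (inv\<^bsub>GG\<^esub> g) (snd p))"
 using M.bo_eqE[OF assms(3) XPD(3)[OF assms(1)] XPD(3)[OF assms(2)]] unfolding M.twist_def frame_stack_simps .

lemma slice_A:
 assumes "y : slice" shows "y : \<Union> (N ` F) \<longleftrightarrow> coords y ~= (%_. 0)"
proof -
 have y: "y : topspace FS" "!!i. i : verts Q ==> minor dv i (e i) y = 1\<^sub>m (dv i)" using assms by (simp_all add: slice_def)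
 show ?thesis using slice_in_lower_cells[OF finite_verts index y F] by (simp add: coords_zero_iff case_prod_unfold)
qed

lemma bo_A: "p : topspace XP ==> M.bo p : A \<longleftrightarrow> coords (nform (snd p)) ~= (%_. 0)"
proof -
 assume p: "p : topspace XP"
 have "M.bo p : A \<longleftrightarrow> snd p : \<Union> (N ` F)" unfolding A_def using NB_iff[OF XPD(3)[OF p]] XPD(2)[OF p] by auto
 also have "... \<longleftrightarrow> nform (snd p) : \<Union> (N ` F)" using nform_N[OF XPD(2)[OF p]] by auto
 finally show ?thesis using slice_A[OF nform_slice[OF XPD(2)[OF p]]] by simp
qed

lemma coords_scaled: "coords (scaled s y) = coords y"
proof
 fix k show "coords (scaled s y) k = coords y k"
 proof (cases "k < 2 * weight Q S")
  case True
  then obtain i r m where "ze (k div 2) = (i, r, m)" "i : verts Q" "r < dv i" "m < e i r" by (rule ze_div)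
  then show ?thesis by (simp add: coords_def coord_def scaled_def)
 qed (simp add: coords_def)
qed

text \<open>Over a pivot cell the Borel construction is the join times the slice. The join
  coordinate is contracted to \<open>e0\<close> while the slice is scaled; this leaves the free
  coordinates unchanged, hence also the part lying in lower cells, which is where they do not all
  vanish.\<close>

lemma relative_homology_B: "Hr p B A \<cong> Hr p EU (topspace EU - {%_. 0})"
proof -
 obtain e0 where e0: "e0 : milnor_points GG" by (rule milnor_point)
 obtain H where H:
  "continuous_map (prod_topology I01 (prod_topology M.EG M.EG)) M.EG H"
  "!!e e'. H (0, e, e') = e" "!!e e'. H (1, e, e') = e'"
  "!!s e e' g. s : {0..1} ==> e : milnor_points (grp (frame_stack Q dv)) ==> e' : milnor_points (grp (frame_stack Q dv)) ==>
    g : carrier (grp (frame_stack Q dv)) ==> H (s, milnor_act (grp (frame_stack Q dv)) e g, milnor_act (grp (frame_stack Q dv)) e' g)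
     = milnor_act (grp (frame_stack Q dv)) (H (s, e, e')) g" by (rule M.milnor_contractionE) blast
 \<comment> \<open>The chosen preimage does not matter, because \<open>nform\<close> is constant on
   orbits.\<close>
 define \<alpha> where "\<alpha> b = coords (nform (snd (inv_into (topspace XP) M.bo b)))" for b
 define \<beta> where "\<beta> w = M.bo (e0, point w)" for w
 \<comment> \<open>\<open>(\<nu> p, nform (snd p))\<close> is the point of the orbit of
   \<open>p\<close> whose frame is in normal form, so \<open>\<nu>\<close> is constant on orbits
   too.\<close>
 define \<nu> where "\<nu> p = milnor_act GG (fst p) (\<mu> (snd p))" for p
 define \<Phi> where "\<Phi> s p = M.bo (H (s, e0, \<nu> p), scaled s (nform (snd p)))" for s p
 have inv: "nform (snd p) = nform (snd p')" "\<nu> p = \<nu> p'" if pp: "p : topspace XP" "p' : topspace XP" "M.bo p = M.bo p'" for p p'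
 proof -
  obtain g where g: "g : carrier GG" "p' = (milnor_act GG (fst p) g, frame_act Q (inv\<^bsub>GG\<^esub> g) (snd p))"
   using pp by (rule XP_twist)
  show "nform (snd p) = nform (snd p')" unfolding g(2) snd_conv by (rule nform_act[symmetric]) (use g XPD[OF pp(1)] group_simps in auto)
  have "\<mu> (frame_act Q (inv\<^bsub>GG\<^esub> g) (snd p)) = inv\<^bsub>GG\<^esub> g \<otimes>\<^bsub>GG\<^esub> \<mu> (snd p)" by (rule act_\<mu>) (use g XPD[OF pp(1)] group_simps in auto)
  then show "\<nu> p = \<nu> p'" unfolding g(2) \<nu>_def fst_conv snd_conv using g(1) \<mu>_carrier[OF XPD(2)[OF pp(1)]] XPD(1)[OF pp(1)]
   by (simp add: M.milnor_act_mult[unfolded frame_stack_simps] group_simps M.r_inv_ex M.m_assoc[unfolded frame_stack_simps, symmetric] M.l_one[unfolded frame_stack_simps])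
 qed
 have \<alpha>: "\<alpha> (M.bo p) = coords (nform (snd p))" if p: "p : topspace XP" for p
 proof -
  have b: "M.bo p : M.bo ` topspace XP" using p by (rule imageI)
  show ?thesis unfolding \<alpha>_def using inv(1)[OF inv_into_into[OF b] p f_inv_into_f[OF b]] by simp
 qed
 have c\<alpha>: "continuous_map B EU \<alpha>"
 proof (rule open_quotient_continuous_map[OF XP_quotient])
  show "!!p. p : topspace XP ==> \<alpha> (M.bo p) = coords (nform (snd p))" by (rule \<alpha>)
  show "continuous_map XP EU (%p. coords (nform (snd p)))"
   using continuous_map_compose[OF continuous_XP(2) continuous_map_compose[OF continuous_nform continuous_coords]] by (simp add: o_def)
 qed
 have pXP: "(e0, point w) : topspace XP" for w unfolding topspace_XP using e0 slice_N[OF point_slice] by simp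
 have c\<beta>: "continuous_map EU B \<beta>"
 proof -
  have X: "continuous_map EU (space (frame_stack Q dv)) point"
   unfolding frame_stack_simps continuous_map_in_subtopology using continuous_point N_X[of S] slice_N[OF point_slice] by auto
  have "continuous_map EU M.btot (%w. (e0, point w))" by (rule continuous_map_pairedI[OF _ X]) (use e0 in simp)
  from continuous_map_compose[OF this M.continuous_map_bo]
  have "continuous_map EU M.hq \<beta>" by (simp add: o_def \<beta>_def[abs_def])
  then show ?thesis unfolding B_def continuous_map_in_subtopology \<beta>_def using pXP unfolding topspace_XP by blast
 qed
 have AX: "A = M.bo ` {p : topspace XP. coords (nform (snd p)) ~= (%_. 0)}"
 proof -
  have "A <= M.bo ` topspace XP" unfolding A_def topspace_XP by auto
  then show ?thesis using bo_A by blast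
 qed
 have \<alpha>A: "\<alpha> : A \<rightarrow> topspace EU - {%_. 0}"
 proof
  fix b assume b: "b : A"
  then obtain p where p: "p : topspace XP" "b = M.bo p" "coords (nform (snd p)) ~= (%_. 0)" unfolding AX by auto
  have "b : topspace B" unfolding p(2) XP_quotient(3)[symmetric] using p(1) by (rule imageI)
  then have "\<alpha> b : topspace EU" using continuous_map_funspace[OF c\<alpha>] by auto
  then show "\<alpha> b : topspace EU - {%_. 0}" using p \<alpha> by simp
 qed
 have pw: "coords (nform (point w)) = w" if "w : topspace EU" for w using coords_point[OF that] slice_nform[OF point_slice] by simp
 have \<beta>A: "\<beta> : topspace EU - {%_. 0} \<rightarrow> A"
  using bo_A[OF pXP] pw by (auto simp: \<beta>_def simp del: topspace_Euclidean_space)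
 have XPi: "(e', y) : topspace XP" if "e' : milnor_points GG" "y : slice" for e' y using that slice_N unfolding topspace_XP by auto
 have \<nu>: "\<nu> p : milnor_points GG" if p: "p : topspace XP" for p
  unfolding \<nu>_def using M.milnor_act_closed[unfolded frame_stack_simps] XPD(1)[OF p] \<mu>_carrier[OF XPD(2)[OF p]] by blast
 have Hc: "H (s, e0, \<nu> p) : milnor_points GG" if "s : {0..1}" "p : topspace XP" for s p
  using continuous_map_funspace[OF H(1)] that(1) \<nu>[OF that(2)] e0 by (auto simp: Pi_iff)
 have \<Phi>X: "(H (s, e0, \<nu> p), scaled s (nform (snd p))) : topspace XP" if "s : {0..1}" "p : topspace XP" for s p
  by (intro XPi Hc that scaled_slice nform_slice XPD)
 have "homotopic_with (%h. h ` M.bo ` {p : topspace XP. coords (nform (snd p)) ~= (%_. 0)} <= A) B B (\<beta> \<circ> \<alpha>) id"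
 proof (rule open_quotient_homotopic_with[OF XP_quotient, where \<Phi> = \<Phi>])
  let ?Z = "prod_topology I01 XP"
  have f: "continuous_map ?Z I01 fst" by (rule continuous_map_fst)
  have N': "continuous_map ?Z (subtopology FS (N S)) (%z. snd (snd z))"
   using continuous_map_compose[OF continuous_map_snd continuous_XP(2)] by (simp add: o_def)
  have E': "continuous_map ?Z M.EG (%z. fst (snd z))" using continuous_map_compose[OF continuous_map_snd continuous_XP(1)]
   by (simp add: o_def)
  have n: "continuous_map ?Z M.EG (%z. \<nu> (snd z))"
   using M.continuous_map_milnor_act[OF E' continuous_map_compose[OF N' continuous_\<mu>]] by (simp add: o_def \<nu>_def)
  have "continuous_map ?Z M.EG (%z. H (fst z, e0, \<nu> (snd z)))"
   using continuous_map_compose[OF continuous_map_pairedI[OF f continuous_map_pairedI[OF _ n]] H(1), of "%_. e0"] e0 by (simp add: o_def)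
  moreover have "continuous_map ?Z FS (%z. scaled (fst z) (nform (snd (snd z))))"
   using continuous_scaled[OF continuous_map_into_fulltopology[OF f] continuous_map_compose[OF N' continuous_nform]] by (simp add: o_def)
  then have "continuous_map ?Z (space (frame_stack Q dv)) (%z. scaled (fst z) (nform (snd (snd z))))"
   unfolding frame_stack_simps continuous_map_in_subtopology
  proof (intro conjI funcsetI)
   fix z assume "z : topspace ?Z"
   then have "snd z : topspace XP" by (simp only: topspace_prod_topology mem_Times_iff)
   then have "scaled (fst z) (nform (snd (snd z))) : N S" by (intro slice_N scaled_slice nform_slice XPD)
   then show "scaled (fst z) (nform (snd (snd z))) : full_rank Q dv" using N_X[of S] by blast
  qed
  ultimately have "continuous_map ?Z M.btot (%z. (H (fst z, e0, \<nu> (snd z)), scaled (fst z) (nform (snd (snd z)))))"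
   by (rule continuous_map_pairedI)
  from continuous_map_compose[OF this M.continuous_map_bo]
  have c: "continuous_map ?Z M.hq (%z. \<Phi> (fst z) (snd z))" by (simp add: o_def \<Phi>_def)
  show "continuous_map ?Z B (%z. \<Phi> (fst z) (snd z))" unfolding B_def continuous_map_in_subtopology
  proof (intro conjI funcsetI c)
   fix z assume "z : topspace ?Z"
   then have "fst z : {0..1}" "snd z : topspace XP" by (simp_all only: topspace_prod_topology mem_Times_iff topspace_euclidean_subtopology)
   from \<Phi>X[OF this] show "\<Phi> (fst z) (snd z) : NB S" unfolding \<Phi>_def topspace_XP by (rule imageI)
  qed
  show "\<Phi> s p = \<Phi> s p'" if "s : {0..1}" "p : topspace XP" "p' : topspace XP" "M.bo p = M.bo p'" for s p p'
   unfolding \<Phi>_def inv[OF that(2-4)] ..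
  show "(\<beta> \<circ> \<alpha>) (M.bo p) = \<Phi> 0 p" if p: "p : topspace XP" for p
   unfolding \<Phi>_def H(2) o_def \<alpha>[OF p] \<beta>_def point_coords[OF nform_slice[OF XPD(2)[OF p]]] ..
  show "id (M.bo p) = \<Phi> 1 p" if p: "p : topspace XP" for p
  proof -
   have "(\<nu> p, nform (snd p)) = M.twist p (\<mu> (snd p))" by (simp add: \<nu>_def nform_def M.twist_def)
   then show ?thesis unfolding \<Phi>_def H(3) scaled_1[OF nform_slice[OF XPD(2)[OF p]]]
    using M.bo_twist[OF XPD(3)[OF p], of "\<mu> (snd p)"] \<mu>_carrier[OF XPD(2)[OF p]] by simp
  qed
  show "\<Phi> s p : A" if "s : {0..1}" "p : {p : topspace XP. coords (nform (snd p)) ~= (%_. 0)}" for s p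
  proof -
   have p: "p : topspace XP" "coords (nform (snd p)) ~= (%_. 0)" using that by auto
   have "nform (scaled s (nform (snd p))) = scaled s (nform (snd p))" by (intro slice_nform scaled_slice nform_slice XPD p)
   then show ?thesis unfolding \<Phi>_def bo_A[OF \<Phi>X[OF that(1) p(1)]] snd_conv using p(2) by (simp add: coords_scaled)
  qed
 qed auto
 then have h1: "homotopic_with (%h. h : A \<rightarrow> A) B B (\<beta> \<circ> \<alpha>) id"
  unfolding AX[symmetric] by (rule homotopic_with_mono) auto
 have h2: "homotopic_with (%h. h : topspace EU - {%_. 0} \<rightarrow> topspace EU - {%_. 0}) EU EU (\<alpha> \<circ> \<beta>) id"
 proof (rule homotopic_with_equal)
  have e: "(\<alpha> \<circ> \<beta>) w = w" if "w : topspace EU" for w using \<alpha>[OF pXP] pw[OF that] by (simp add: \<beta>_def)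
  then show "\<alpha> \<circ> \<beta> : topspace EU - {%_. 0} \<rightarrow> topspace EU - {%_. 0}" by auto
  show "continuous_map EU EU (\<alpha> \<circ> \<beta>)" by (rule continuous_map_compose[OF c\<beta> c\<alpha>])
  show "(\<alpha> \<circ> \<beta>) w = id w" if "w : topspace EU" for w using e[OF that] by simp
 qed auto
 show ?thesis by (rule homotopy_equivalent_space_imp_isomorphic_relative_homology_groups[OF c\<alpha> \<alpha>A c\<beta> \<beta>A h1 h2])
qed

text \<open>Excision of everything outside the new open set: that part is closed and contained in
  the open union of the earlier ones.\<close>

lemma relative_homology_pivot:
 "Hr p (subtopology M.hq (\<Union> (NB ` insert S F))) (\<Union> (NB ` F)) \<cong>
   Hr p EU (topspace EU - {%_. 0})"
proof -
 let ?X = "subtopology M.hq (\<Union> (NB ` insert S F))" and ?T = "\<Union> (NB ` F)"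
 have oT: "openin M.hq ?T" by (rule openin_Union) (use openin_NB in auto)
 have tX: "topspace ?X = \<Union> (NB ` insert S F)"
  unfolding topspace_subtopology using openin_subset[OF oT] openin_subset[OF openin_NB[of S]] by blast
 have opT: "openin ?X ?T" unfolding openin_subtopology by (intro exI[of _ ?T] conjI oT) blast
 have opS: "openin ?X (NB S)" unfolding openin_subtopology by (intro exI[of _ "NB S"] conjI openin_NB) blast
 let ?U = "topspace ?X - NB S"
 have "?X closure_of ?U <= ?X interior_of ?T"
 proof -
  have "closedin ?X ?U" by (rule closedin_diff[OF closedin_topspace opS])
  moreover have "?U <= ?T" unfolding tX by blast
  ultimately show ?thesis unfolding interior_of_openin[OF opT] by (simp only: closure_of_closedin)
 qed
 from homology_excision_axiom[OF this, of "topspace ?X" p]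
 have "Hr p (subtopology ?X (topspace ?X - ?U)) (?T - ?U) \<cong> Hr p (subtopology ?X (topspace ?X)) ?T"
  unfolding is_iso_def using openin_subset[OF opT] by blast
 moreover have "subtopology ?X (topspace ?X - ?U) = B"
  unfolding tX B_def subtopology_subtopology by (rule arg_cong[where f = "subtopology M.hq"]) blast
 moreover have "?T - ?U = A" unfolding tX A_def by blast
 ultimately have "Hr p B A \<cong> Hr p ?X ?T" by (simp only: subtopology_topspace)
 then show ?thesis using relative_homology_B[of p] by (meson group.iso_sym group_relative_homology_group iso_trans)
qed

end

end

theorem dual_rank_frame_stack:
 assumes Q: "finite (verts Q)" shows "dual_rank (homology_group (int p) (homotopy_quotient (frame_stack Q dv)))
  (if even p then card {S : schubert_index Q dv. weight Q S = p div 2} else 0)"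
proof -
 interpret M: stack_presentation "frame_stack Q dv" by (rule stack_presentation_frame_stack)
 have P: "schubert_cell Q dv S" if "S : schubert_index Q dv" for S
  by (intro schubert_cell.intro schubert_cell_axioms.intro M.stack_presentation_axioms Q that)
 let ?NB = "%T. M.bo ` (milnor_points (BG Q dv) \<times> pivot_cell Q dv T)"
 interpret cell_filtration M.hq ?NB "schubert_index Q dv" "weight Q"
 proof
  show "openin M.hq (?NB T)" if "T : schubert_index Q dv" for T by (rule schubert_cell.openin_NB[OF P[OF that]])
  have "topspace M.btot = (\<Union>T\<in>schubert_index Q dv. milnor_points (BG Q dv) \<times> pivot_cell Q dv T)"
   using full_rank_pivot_cells[of Q dv] by auto
  then show "topspace M.hq = \<Union> (?NB ` schubert_index Q dv)" unfolding M.topspace_hq by (simp add: image_UN)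
  show "finite {T : schubert_index Q dv. weight Q T < s}" for s by (rule finite_weight_below[OF Q])
  fix F S p
  assume F: "F <= schubert_index Q dv" "S : schubert_index Q dv" "S ~: F" "!!i. i : F ==> weight Q i <= weight Q S"
   "!!i. i : schubert_index Q dv ==> weight Q i < weight Q S ==> i : F"
  let ?R = "Hr p (subtopology M.hq (\<Union> (?NB ` insert S F))) (\<Union> (?NB ` F))"
  let ?E = "Euclidean_space (2 * weight Q S)"
  have iso: "?R \<cong> Hr p ?E (topspace ?E - {%_. 0})" by (rule schubert_cell.relative_homology_pivot[OF P[OF F(2)] F(1,3,4,5)])
  then show "if p = 2 * int (weight Q S) then ?R \<cong> integer_group else trivial_group ?R"
   using relative_homology_punctured_Euclidean_space[of p "2 * weight Q S"] iso_trans[OF iso, of integer_group]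
    isomorphic_group_triviality[OF iso] by (auto split: if_splits)
 qed
 show ?thesis by (rule dual_rank_homology)
qed

section \<open>Counting cells\<close>

definition gf :: "'x set => ('x => nat) => int fps" where
 "gf A w = Abs_fps (%m. int (card {x : A. w x = m}))"

lemma gf_bij:
 assumes "bij_betw f A B" "!!x. x : A ==> w' (f x) = w x" shows "gf A w = gf B w'"
proof -
 have "bij_betw f {x : A. w x = m} {y : B. w' y = m}" for m
 proof (rule bij_betw_imageI)
  show "inj_on f {x : A. w x = m}" using bij_betw_imp_inj_on[OF assms(1)] by (rule inj_on_subset) auto
  show "f ` {x : A. w x = m} = {y : B. w' y = m}" using bij_betw_imp_surj_on[OF assms(1)] assms(2) by force
 qed
 from bij_betw_same_card[OF this] show ?thesis by (simp add: gf_def)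
qed

lemma gf_Times:
 assumes "!!m. finite {x : A. w x = m}" "!!m. finite {y : B. w' y = m}" shows "gf (A \<times> B) (%(x, y). w x + w' y) = gf A w * gf B w'"
proof (rule fps_ext)
 fix m
 have "{z : A \<times> B. (case z of (x, y) => w x + w' y) = m} = (\<Union>i\<in>{0..m}. {x : A. w x = i} \<times> {y : B. w' y = m - i})" by auto
 then have "card {z : A \<times> B. (case z of (x, y) => w x + w' y) = m} = (\<Sum>i=0..m. card ({x : A. w x = i} \<times> {y : B. w' y = m - i}))"
  by (simp only:) (rule card_UN_disjoint, use assms in auto)
 then show "fps_nth (gf (A \<times> B) (%(x, y). w x + w' y)) m = fps_nth (gf A w * gf B w') m"
  by (simp add: gf_def fps_mult_nth card_cartesian_product)
qed

definition finite_sets :: "nat => nat set set" where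
 "finite_sets n = {S. finite S & card S = n}"

definition grassmann_series :: "nat => int fps" where
 "grassmann_series n = gf (finite_sets n) weight_set"

lemma finite_weight_set_eq: "finite {S : finite_sets n. weight_set S = m}"
 by (rule finite_subset[OF _ finite_weight_set_le[of n m]]) (auto simp: finite_sets_def)

lemma grassmann_series_0: "grassmann_series 0 = 1"
proof (rule fps_ext)
 fix m
 have "{S : finite_sets 0. weight_set S = m} = (if m = 0 then {{}} else {})" by (auto simp: finite_sets_def weight_set_def)
 then show "fps_nth (grassmann_series 0) m = fps_nth 1 m" by (simp add: grassmann_series_def gf_def)
qed

lemma weight_set_shift:
 assumes T: "finite T" shows "weight_set (Suc ` T) = weight_set T + card T" "weight_set (insert 0 (Suc ` T)) = weight_set T"
proof -
 have s: "\<Sum> (Suc ` T) = \<Sum> T + card T" by (simp add: sum.reindex sum_Suc)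
 have "card (Suc ` T) = card T" by (simp add: card_image)
 then show "weight_set (Suc ` T) = weight_set T + card T" using weight_set_sum[of "Suc ` T"] weight_set_sum[OF T] T s by simp
 have "card (insert 0 (Suc ` T)) = Suc (card T)" using T by (simp add: card_image)
 then show "weight_set (insert 0 (Suc ` T)) = weight_set T" using weight_set_sum[of "insert 0 (Suc ` T)"] weight_set_sum[OF T] T s by simp
qed

text \<open>Split by whether \<open>0\<close> is in the set. If so, removing it and shifting down
  keeps the weight and lowers the size; if not, shifting down lowers the weight by
  \<open>Suc n\<close>. Hence the series is the inverse of the product of
  \<open>1 - fps_X ^ k\<close> for \<open>k\<close> from \<open>1\<close> to
  \<open>n\<close>.\<close>

lemma grassmann_series_Suc: "grassmann_series (Suc n) * (1 - fps_X ^ Suc n) = grassmann_series n"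
proof -
 have nth: "fps_nth (grassmann_series (Suc n)) m = fps_nth (grassmann_series n) m +
   (if m < Suc n then 0 else fps_nth (grassmann_series (Suc n)) (m - Suc n))" for m
 proof -
  let ?A = "{T : finite_sets n. weight_set T = m}" and ?B = "{T : finite_sets (Suc n). weight_set T + Suc n = m}"
  have "{S : finite_sets (Suc n). weight_set S = m} = (%T. insert 0 (Suc ` T)) ` ?A \<union> (%T. Suc ` T) ` ?B"
  proof (intro equalityI subsetI)
   fix S assume "S : {S : finite_sets (Suc n). weight_set S = m}"
   then have S: "finite S" "card S = Suc n" "weight_set S = m" by (auto simp: finite_sets_def)
   define T where "T = (%k. k - 1) ` (S - {0})"
   have ST: "Suc ` T = S - {0}" by (force simp: T_def image_image)
   have T: "finite T" using S by (simp add: T_def)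
   have cT: "card T = card (S - {0})" using card_image[of Suc T] ST by simp
   show "S : (%T. insert 0 (Suc ` T)) ` ?A \<union> (%T. Suc ` T) ` ?B"
   proof (cases "0 : S")
    case True
    then have e: "S = insert 0 (Suc ` T)" using ST by auto
    have "T : ?A" using weight_set_shift(2)[OF T] e S T cT True by (auto simp: finite_sets_def)
    then show ?thesis using e by blast
   next
    case False
    then have e: "S = Suc ` T" using ST by auto
    have "T : ?B" using weight_set_shift(1)[OF T] e S T cT False by (auto simp: finite_sets_def)
    then show ?thesis using e by blast
   qed
  qed (auto simp: finite_sets_def weight_set_shift card_image)
  moreover have "finite ?A" by (rule finite_weight_set_eq)
  moreover have "finite ?B" by (rule finite_subset[OF _ finite_weight_set_le[of "Suc n" m]]) (auto simp: finite_sets_def)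
  moreover have "inj_on (%T. insert 0 (Suc ` T)) ?A"
  proof (rule inj_onI)
   fix T T' assume "insert 0 (Suc ` T) = insert 0 (Suc ` T')"
   then have "insert 0 (Suc ` T) - {0} = insert 0 (Suc ` T') - {0}" by (rule arg_cong)
   then have "Suc ` T = Suc ` T'" by (simp add: insert_Diff_if)
   then show "T = T'" by (simp add: inj_image_eq_iff)
  qed
  moreover have "inj_on (%T. Suc ` T) ?B" by (rule inj_onI) (simp add: inj_image_eq_iff)
  moreover have "(%T. insert 0 (Suc ` T)) ` ?A \<inter> (%T. Suc ` T) ` ?B = {}" by auto
  ultimately have "card {S : finite_sets (Suc n). weight_set S = m} = card ?A + card ?B"
   by (simp only: card_Un_disjoint finite_imageI card_image)
  moreover have "?B = (if m < Suc n then {} else {T : finite_sets (Suc n). weight_set T = m - Suc n})" by auto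
  ultimately show ?thesis by (simp add: grassmann_series_def gf_def)
 qed
 have "grassmann_series (Suc n) = grassmann_series n + fps_X ^ Suc n * grassmann_series (Suc n)"
  by (rule fps_ext) (subst nth, simp only: fps_add_nth fps_X_power_mult_nth)
 then show ?thesis by (simp add: algebra_simps)
qed

text \<open>The contribution of the stratum of rank \<open>l\<close> in matrices of size
  \<open>a\<close> by \<open>b\<close>: it is up to homotopy the classifying space of general linear
  groups of sizes \<open>a - l\<close>, \<open>b - l\<close> and \<open>l\<close>.\<close>

definition durfee_term :: "nat => nat => nat => int fps" where
 "durfee_term a b l = (if l <= a & l <= b then
   fps_X ^ ((a - l) * (b - l)) * (grassmann_series (a - l) * grassmann_series (b - l) * grassmann_series l) else 0)"

text \<open>Write \<open>1 - X ^ (a + 1)\<close> as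
  \<open>(1 - X ^ (a + 1 - l)) + X ^ (a + 1 - l) * (1 - X ^ l)\<close>. The first summand lowers the
  size \<open>a + 1 - l\<close> and keeps \<open>l\<close>; the second lowers \<open>l\<close> and
  keeps that size.\<close>

lemma durfee_step:
 "durfee_term (Suc a) b l * (1 - fps_X ^ Suc a) =
   (if l <= a then fps_X ^ (b - l) * durfee_term a b l else 0) +
   (case l of 0 => 0 | Suc m => (1 - fps_X ^ (b - m)) * durfee_term a b m)"
proof (cases "l <= Suc a & l <= b")
 case True
 let ?G = grassmann_series and ?X = "%k. fps_X ^ k :: int fps"
 have split: "(1 - ?X (Suc a)) = (1 - ?X (Suc a - l)) + ?X (Suc a - l) * (1 - ?X l)"
  using True by (simp add: algebra_simps power_add[symmetric])
 have 1: "durfee_term (Suc a) b l * (1 - ?X (Suc a - l)) = (if l <= a then ?X (b - l) * durfee_term a b l else 0)"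
 proof (cases "l <= a")
  case la: True
  then have s: "Suc a - l = Suc (a - l)" by simp
  have "?X ((Suc a - l) * (b - l)) = ?X (b - l) * ?X ((a - l) * (b - l))" by (simp add: s power_add)
  then show ?thesis using la True grassmann_series_Suc[of "a - l"] by (simp add: durfee_term_def s mult_ac)
 next
  case False
  then have "l = Suc a" using True by simp
  then show ?thesis by simp
 qed
 have 2: "durfee_term (Suc a) b l * (?X (Suc a - l) * (1 - ?X l)) = (case l of 0 => 0 | Suc m => (1 - ?X (b - m)) * durfee_term a b m)"
 proof (cases l)
  case (Suc m)
  then have m: "m <= a" "m < b" using True by auto
  then have s: "b - m = Suc (b - Suc m)" by simp
  have e: "?X ((a - m) * (b - m)) = ?X ((a - m) * (b - Suc m)) * ?X (a - m)" by (simp add: s power_add)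
  show ?thesis using m grassmann_series_Suc[of m] grassmann_series_Suc[of "b - Suc m", folded s]
   by (simp add: Suc durfee_term_def e mult_ac del: power_Suc)
 qed simp
 show ?thesis unfolding split distrib_left 1 2 ..
next
 case False
 then show ?thesis by (auto simp: durfee_term_def split: nat.splits)
qed

text \<open>The Durfee rectangle identity; algebraically it expresses that ranks stratify matrices.\<close>

lemma durfee: "(\<Sum>l\<le>a. durfee_term a b l) = grassmann_series a * grassmann_series b"
proof (induction a)
 case 0
 show ?case by (simp add: durfee_term_def grassmann_series_0)
next
 case (Suc a)
 let ?q = "1 - fps_X ^ Suc a :: int fps"
 have "(\<Sum>l\<le>Suc a. durfee_term (Suc a) b l) * ?q = (\<Sum>l\<le>Suc a. if l <= a then fps_X ^ (b - l) * durfee_term a b l else 0) +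
   (\<Sum>l\<le>Suc a. case l of 0 => 0 | Suc m => (1 - fps_X ^ (b - m)) * durfee_term a b m)"
  unfolding sum_distrib_right durfee_step sum.distrib ..
 also have "(\<Sum>l\<le>Suc a. if l <= a then fps_X ^ (b - l) * durfee_term a b l else 0) = (\<Sum>l\<le>a. fps_X ^ (b - l) * durfee_term a b l)"
  by simp
 also have "(\<Sum>l\<le>Suc a. case l of 0 => 0 | Suc m => (1 - fps_X ^ (b - m)) * durfee_term a b m) =
   (\<Sum>m\<le>a. (1 - fps_X ^ (b - m)) * durfee_term a b m)" unfolding sum.atMost_Suc_shift by simp
 \<comment> \<open>After the shift of the index the two coefficients of each term are
   \<open>X ^ (b - l)\<close> and \<open>1 - X ^ (b - l)\<close>.\<close>
 also have "(\<Sum>l\<le>a. fps_X ^ (b - l) * durfee_term a b l) + ... = (\<Sum>l\<le>a. durfee_term a b l)"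
  unfolding sum.distrib[symmetric] by (simp add: algebra_simps)
 also have "... = grassmann_series (Suc a) * grassmann_series b * ?q"
  unfolding Suc.IH by (simp only: grassmann_series_Suc[of a, symmetric] mult_ac)
 finally have "(\<Sum>l\<le>Suc a. durfee_term (Suc a) b l) * ?q = grassmann_series (Suc a) * grassmann_series b * ?q" .
 moreover have "fps_nth ?q 0 ~= fps_nth 0 0" by simp
 then have "?q ~= 0" by metis
 ultimately show ?case using mult_right_cancel by blast
qed

section \<open>Counting cells of a product\<close>

lemma gf_PiE:
 assumes "finite V" shows "gf (\<Pi>\<^sub>E i\<in>V. finite_sets (dv i)) (%S. \<Sum>i\<in>V. weight_set (S i)) = (\<Prod>i\<in>V. grassmann_series (dv i))"
  "finite {S : (\<Pi>\<^sub>E i\<in>V. finite_sets (dv i)). (\<Sum>i\<in>V. weight_set (S i)) = m}" using assms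
proof (induction V arbitrary: m)
 case empty
 { case 1 show ?case by (rule fps_ext) (simp add: gf_def) }
 { case 2 show ?case by simp }
next
 case (insert v V)
 have b: "bij_betw (%(T, S). S(v := T)) (finite_sets (dv v) \<times> (\<Pi>\<^sub>E i\<in>V. finite_sets (dv i))) (\<Pi>\<^sub>E i\<in>insert v V. finite_sets (dv i))"
  unfolding PiE_insert_eq by (rule bij_betw_imageI[OF inj_combinator[OF insert.hyps(2)] refl])
 have w: "(\<Sum>i\<in>insert v V. weight_set ((case x of (T, S) => S(v := T)) i)) = (case x of (T, S) => weight_set T + (\<Sum>i\<in>V. weight_set (S i)))" for x
 proof -
  have "(\<Sum>i\<in>V. weight_set (((snd x)(v := fst x)) i)) = (\<Sum>i\<in>V. weight_set (snd x i))"
   using insert.hyps by (intro sum.cong) auto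
  then show ?thesis using insert.hyps by (simp add: case_prod_unfold)
 qed
 { case 1
  have "gf (\<Pi>\<^sub>E i\<in>insert v V. finite_sets (dv i)) (%S. \<Sum>i\<in>insert v V. weight_set (S i)) =
    gf (finite_sets (dv v) \<times> (\<Pi>\<^sub>E i\<in>V. finite_sets (dv i))) (%(T, S). weight_set T + (\<Sum>i\<in>V. weight_set (S i)))"
   by (rule gf_bij[where w' = "%S. \<Sum>i\<in>insert v V. weight_set (S i)", OF b w, symmetric])
  also have "... = grassmann_series (dv v) * (\<Prod>i\<in>V. grassmann_series (dv i))"
   unfolding gf_Times[OF finite_weight_set_eq insert.IH(2)] insert.IH(1) grassmann_series_def[of "dv v"] ..
  finally show ?case using insert.hyps by simp }
 { case 2
  have "{S : (\<Pi>\<^sub>E i\<in>insert v V. finite_sets (dv i)). (\<Sum>i\<in>insert v V. weight_set (S i)) = m} <=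
   (%(T, S). S(v := T)) ` (\<Union>k\<le>m. {T : finite_sets (dv v). weight_set T = m - k} \<times> {S : (\<Pi>\<^sub>E i\<in>V. finite_sets (dv i)). (\<Sum>i\<in>V. weight_set (S i)) = k})"
  proof
   fix S assume S: "S : {S : (\<Pi>\<^sub>E i\<in>insert v V. finite_sets (dv i)). (\<Sum>i\<in>insert v V. weight_set (S i)) = m}"
   then have "S : (%(T, S). S(v := T)) ` (finite_sets (dv v) \<times> (\<Pi>\<^sub>E i\<in>V. finite_sets (dv i)))"
    unfolding bij_betw_imp_surj_on[OF b] unfolding mem_Collect_eq by (rule conjunct1)
   then obtain T S' where x: "S = S'(v := T)" "T : finite_sets (dv v)" "S' : (\<Pi>\<^sub>E i\<in>V. finite_sets (dv i))" by auto
   have m: "weight_set T + (\<Sum>i\<in>V. weight_set (S' i)) = m" using S w[of "(T, S')"] by (simp only: mem_Collect_eq x(1) prod.case)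
   show "S : (%(T, S). S(v := T)) ` (\<Union>k\<le>m. {T : finite_sets (dv v). weight_set T = m - k} \<times> {S : (\<Pi>\<^sub>E i\<in>V. finite_sets (dv i)). (\<Sum>i\<in>V. weight_set (S i)) = k})"
    by (rule image_eqI[where x = "(T, S')"]) (use x m in auto)
  qed
  then show ?case by (rule finite_subset) (use finite_weight_set_eq insert.IH(2) in auto) }
qed

definition cell_count :: "('v, 'e) pre_digraph => ('v => nat) => nat => nat" where
 "cell_count Q dv m = card {S : schubert_index Q dv. weight Q S = m}"

lemma cell_count_nth: "finite (verts Q) ==> int (cell_count Q dv m) = fps_nth (\<Prod>i\<in>verts Q. grassmann_series (dv i)) m"
 using gf_PiE(1)[of "verts Q" dv, symmetric] by (simp add: gf_def cell_count_def schubert_index_def weight_def finite_sets_def)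

section \<open>Decomposition of the cohomology\<close>

text \<open>Extended by zero to all integers, since the shifts by Euler forms reach negative
  degrees.\<close>

definition betti :: "('v, 'e) pre_digraph => ('v => nat) => int => nat" where
 "betti G dv n = (if 0 <= n & even n then cell_count G dv (nat n div 2) else 0)"

lemma betti_even: "betti G dv (2 * int m - 2 * int k) = (if m < k then 0 else cell_count G dv (m - k))"
proof (cases "m < k")
 case False
 then have "2 * int m - 2 * int k = int (2 * (m - k))" by simp
 then show ?thesis using False unfolding betti_def by (simp only: nat_int) simp
qed (simp add: betti_def)

lemma betti_eq_0: "\<not> (0 <= n & even n) ==> betti G dv (n - 2 * int k) = 0" by (auto simp: betti_def)

lemma (in wf_digraph) stack_cohomology_coordinates:
 assumes "finite (verts G)" shows "\<exists>T. coordinates (stack_cohomology (moduli_stack G dv) n) {..<betti G dv n} T"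
proof (cases "n < 0")
 case True
 then show ?thesis using coordinates_zero_module by (auto simp: stack_cohomology_def cohomology_def betti_def)
next
 case False
 define p where "p = nat n"
 have n: "n = int p" using False by (simp add: p_def)
 have b: "betti G dv n = (if even p then card {S : schubert_index G dv. weight G S = p div 2} else 0)"
  by (simp add: n betti_def cell_count_def)
 have "homology_group (int p) (homotopy_quotient (frame_stack G dv)) \<cong> homology_group (int p) (homotopy_quotient (moduli_stack G dv))"
  using homotopy_equivalent_space_imp_isomorphic_homology_groups[OF moduli_stack_frame_stack] by (simp add: group.iso_sym)
 from dual_rank_is_iso[OF dual_rank_frame_stack[OF assms, of p] this]
 have "dual_rank (homology_group (int p) (homotopy_quotient (moduli_stack G dv))) (betti G dv n)" unfolding b by simp
 from cohomology_coordinates[OF this] show ?thesis unfolding stack_cohomology_def n .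
qed

context unlinking
begin

text \<open>The arrows replacing \<open>a\<close> correspond to the blocks of its matrix, so their
  contributions expand the product of the two split dimensions.\<close>

lemma sum_arrows_from:
 fixes g :: "'v option => int"
 assumes a: "a : arcs Q" shows "(\<Sum>x\<in>arrows_from Q c d a. g (head U x) * g (tail U x)) =
  (if a = c then g None * g None else if a = d then 0 else
   (g (Some (head Q a)) + (if head Q a : {v0, v1} then g None else 0)) * (g (Some (tail Q a)) + (if tail Q a : {v0, v1} then g None else 0)))"
proof -
 have Z: "{tail Q c, head Q c} = {v0, v1}" using cd by auto
 show ?thesis unfolding arrows_from_def Let_def Z using v01(4) by (simp add: algebra_simps)
qed

text \<open>Dropping \<open>d\<close> and reducing \<open>c\<close> to a loop removes twice the
  product of the full dimensions from the arrow sum, up to the loop, which cancels the new vertex.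
  Splitting the squares at the two vertices accounts for all of this except twice the product of the
  remaining dimensions.\<close>

lemma euler_pairing_unlink:
 "euler_pairing U ep ep = euler_pairing Q dv dv + 2 * int (n0 v0 * n0 v1)"
proof -
 let ?dv = "%i. int (n0 i) + int (ex i)"
 let ?h = "%a. ?dv (head Q a) * ?dv (tail Q a)"
 have dv: "int (dv i) = ?dv i" for i unfolding dv_eq by simp
 have arcs: "arcs U = (\<Union>a\<in>arcs Q. arrows_from Q c d a)" by (simp add: unlink_def)
 have ex: "int (ex i) = (if i : {v0, v1} then int l else 0)" for i by (simp add: ex_def)
 have "(\<Sum>x\<in>arcs U. int (ep (head U x)) * int (ep (tail U x))) = (\<Sum>a\<in>arcs Q. \<Sum>x\<in>arrows_from Q c d a. int (ep (head U x)) * int (ep (tail U x)))"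
  unfolding arcs by (rule sum.UNION_disjoint) (auto simp: arrows_from_def Let_def split: if_splits)
 also have "... = (\<Sum>a\<in>arcs Q. ?h a + (if a = c then int l * int l - ?h c else 0) + (if a = d then - ?h d else 0))"
 proof (rule sum.cong[OF refl])
  fix a assume a: "a : arcs Q"
  show "(\<Sum>x\<in>arrows_from Q c d a. int (ep (head U x)) * int (ep (tail U x))) = ?h a + (if a = c then int l * int l - ?h c else 0) + (if a = d then - ?h d else 0)"
   unfolding sum_arrows_from[OF a, of "%i. int (ep i)"] ex[symmetric] using v01(4) by simp
 qed
 also have "... = (\<Sum>a\<in>arcs Q. ?h a) + int l * int l - ?h c - ?h d" using c d by (simp add: sum.distrib)
 finally have A: "(\<Sum>x\<in>arcs U. int (ep (head U x)) * int (ep (tail U x))) = (\<Sum>a\<in>arcs Q. ?h a) + int l * int l - ?h c - ?h d" .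
 have "(\<Sum>i\<in>verts Q. ?dv i * ?dv i) = (\<Sum>i\<in>verts Q. int (n0 i) * int (n0 i)) + (\<Sum>i\<in>verts Q. if i : {v0, v1} then 2 * int (n0 i) * int l + int l * int l else 0)"
  unfolding sum.distrib[symmetric] by (rule sum.cong) (auto simp: ex_def algebra_simps)
 also have "(\<Sum>i\<in>verts Q. if i : {v0, v1} then 2 * int (n0 i) * int l + int l * int l else 0) = (\<Sum>i\<in>{v0, v1}. 2 * int (n0 i) * int l + int l * int l)"
  using v01(2,3) by (intro sum.mono_neutral_cong_right) auto
 finally have V: "(\<Sum>i\<in>verts Q. ?dv i * ?dv i) = (\<Sum>i\<in>verts Q. int (n0 i) * int (n0 i)) + (2 * int (n0 v0) * int l + 2 * int (n0 v1) * int l + 2 * int l * int l)"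
  using v01(1) by simp
 have W: "(\<Sum>i\<in>verts U. int (ep i) * int (ep i)) = int l * int l + (\<Sum>i\<in>verts Q. int (n0 i) * int (n0 i))"
  by (simp add: sum.reindex)
 have cd': "?h c = (int (n0 v0) + int l) * (int (n0 v1) + int l)" "?h d = (int (n0 v0) + int l) * (int (n0 v1) + int l)"
  using cd by (simp_all add: ex_def)
 show ?thesis unfolding euler_pairing_def A W dv V cd' by (simp add: algebra_simps)
qed

end

section \<open>Summation over the lifts of a dimension vector\<close>

locale unlinking_pair = fin_digraph Q for Q :: "('v, 'e) pre_digraph" +
 fixes c d :: 'e and dv :: "'v => nat"
 assumes c: "c : arcs Q" and d: "d : arcs Q" and cd: "tail Q c ~= head Q c"
  "tail Q d = head Q c" "head Q d = tail Q c" and dv: "dv : dim_vectors Q"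
begin

abbreviation "u == tail Q c"
abbreviation "v == head Q c"
abbreviation "lifts == {ep : dim_vectors (unlink Q c d). unlink_dim Q c ep = dv}"

definition lift :: "nat => 'v option => nat" where
 "lift l x = (case x of None => l | Some i => if i : {u, v} then dv i - l else dv i)"

text \<open>A lift is determined by its starred entry \<open>l\<close>; the bound by both vertex
  dimensions keeps the subtraction in \<open>lift\<close> from truncating.\<close>

lemma bij_lift: "bij_betw lift {l. l <= dv u & l <= dv v} lifts"
proof (rule bij_betw_byWitness[where f' = "%ep. ep None"])
 have uv: "u : verts Q" "v : verts Q" using c by auto
 show "lift ` {l. l <= dv u & l <= dv v} <= lifts"
 proof
  fix ep assume "ep : lift ` {l. l <= dv u & l <= dv v}"
  then obtain l where l: "ep = lift l" "l <= dv u" "l <= dv v" by auto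
  have "ep x = 0" if "x ~: verts (unlink Q c d)" for x using that dv uv by (cases x) (auto simp: l lift_def dim_vectors_def unlink_def)
  moreover have "unlink_dim Q c ep = dv" using l by (intro ext) (auto simp: unlink_dim_def lift_def)
  ultimately show "ep : lifts" by (simp add: dim_vectors_def)
 qed
 show "(%ep. ep None) ` lifts <= {l. l <= dv u & l <= dv v}" by (auto simp: unlink_dim_def)
 show "\<forall>ep\<in>lifts. lift (ep None) = ep"
 proof
  fix ep assume "ep : lifts"
  then have e: "unlink_dim Q c ep = dv" by simp
  show "lift (ep None) = ep" by (rule ext) (simp add: lift_def e[symmetric, THEN fun_cong] unlink_dim_def split: option.split)
 qed
qed (simp add: lift_def)

lemma finite_lifts: "finite lifts"
proof -
 have "finite {l. l <= dv u & l <= dv v}" by (rule finite_subset[of _ "{..dv u}"]) auto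
 then show ?thesis using bij_betw_finite[OF bij_lift] by blast
qed

text \<open>Only the factors at the two vertices and at the new one change, so the identity is the
  Durfee rectangle identity times a common product over the other vertices.\<close>

lemma cell_count_unlink:
 "cell_count Q dv m = (\<Sum>ep\<in>lifts. let k = ep (Some u) * ep (Some v) in if m < k then 0 else cell_count (unlink Q c d) ep (m - k))"
proof -
 let ?G = grassmann_series and ?R = "\<Prod>i\<in>verts Q - {u, v}. grassmann_series (dv i)"
 let ?L = "{l. l <= dv u & l <= dv v}" and ?U = "unlink Q c d"
 let ?P = "%ep. \<Prod>i\<in>verts ?U. ?G (ep i)"
 have uv: "u : verts Q" "v : verts Q" using c by auto
 have split: "prod f (verts Q) = f u * f v * prod f (verts Q - {u, v})" for f :: "'v => int fps"
  using prod.subset_diff[of "{u, v}" "verts Q" f] uv cd(1) by (simp add: mult.commute)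
 have U: "verts ?U = insert None (Some ` verts Q)" "finite (verts ?U)" by (simp_all add: unlink_def)
 have P: "?P (lift l) = ?G l * (?G (dv u - l) * ?G (dv v - l) * ?R)" for l
 proof -
  have "?P (lift l) = ?G l * (\<Prod>i\<in>verts Q. ?G (lift l (Some i)))" unfolding U(1) by (simp add: prod.reindex lift_def)
  also have "(\<Prod>i\<in>verts Q. ?G (lift l (Some i))) = ?G (dv u - l) * ?G (dv v - l) * ?R" unfolding split by (simp add: lift_def)
  finally show ?thesis .
 qed
 have "(\<Prod>i\<in>verts Q. ?G (dv i)) = (\<Sum>l\<le>dv u. durfee_term (dv u) (dv v) l) * ?R" unfolding split durfee ..
 also have "(\<Sum>l\<le>dv u. durfee_term (dv u) (dv v) l) = (\<Sum>l\<in>?L. durfee_term (dv u) (dv v) l)"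
  by (rule sum.mono_neutral_right) (auto simp: durfee_term_def)
 also have "... * ?R = (\<Sum>l\<in>?L. fps_X ^ (lift l (Some u) * lift l (Some v)) * ?P (lift l))"
  unfolding sum_distrib_right by (rule sum.cong[OF refl], unfold P) (simp add: durfee_term_def lift_def mult_ac)
 also have "... = (\<Sum>ep\<in>lifts. fps_X ^ (ep (Some u) * ep (Some v)) * ?P ep)" by (rule sum.reindex_bij_betw[OF bij_lift])
 finally have "int (cell_count Q dv m) = fps_nth (\<Sum>ep\<in>lifts. fps_X ^ (ep (Some u) * ep (Some v)) * ?P ep) m"
  unfolding cell_count_nth[OF finite_verts] by simp
 also have "... = int (\<Sum>ep\<in>lifts. let k = ep (Some u) * ep (Some v) in if m < k then 0 else cell_count ?U ep (m - k))"
  unfolding fps_sum_nth fps_X_power_mult_nth Let_def cell_count_nth[OF U(2), symmetric] of_nat_sum by (rule sum.cong) auto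
 finally show ?thesis unfolding of_nat_eq_iff .
qed

text \<open>The Euler forms differ by even numbers. Hence all terms vanish unless the degree is even
  and nonnegative, and there the difference is the exponent in
  \<open>cell_count_unlink\<close>.\<close>

lemma betti_unlink:
 "betti Q dv (n - euler_pairing Q dv dv) = (\<Sum>ep\<in>lifts. betti (unlink Q c d) ep (n - euler_pairing (unlink Q c d) ep ep))"
proof -
 let ?N = "n - euler_pairing Q dv dv"
 have e: "n - euler_pairing (unlink Q c d) ep ep = ?N - 2 * int (ep (Some u) * ep (Some v))" if "ep : lifts" for ep
 proof -
  interpret unlinking Q c d ep by unfold_locales (rule c d cd)+
  show ?thesis using euler_pairing_unlink that cd by (simp add: mult.commute)
 qed
 show ?thesis
 proof (cases "0 <= ?N & even ?N")
  case True
  then obtain m where "?N = 2 * int m" by (metis evenE nonneg_int_cases zero_le_mult_iff zero_less_numeral not_le)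
  then have "betti Q dv ?N = cell_count Q dv m" "!!ep. ep : lifts ==> betti (unlink Q c d) ep (n - euler_pairing (unlink Q c d) ep ep) =
   (let k = ep (Some u) * ep (Some v) in if m < k then 0 else cell_count (unlink Q c d) ep (m - k))"
   using betti_even[of Q dv m 0] by (simp_all add: e betti_even Let_def del: of_nat_mult)
  then show ?thesis unfolding cell_count_unlink by (simp only: cong: sum.cong)
 next
  case False
  have "betti (unlink Q c d) ep (n - euler_pairing (unlink Q c d) ep ep) = 0" if "ep : lifts" for ep
   unfolding e[OF that] by (rule betti_eq_0[OF False])
  then have "(\<Sum>ep\<in>lifts. betti (unlink Q c d) ep (n - euler_pairing (unlink Q c d) ep ep)) = 0" by (rule sum.neutral[OF ballI])
  then show ?thesis using betti_eq_0[OF False, of Q dv 0] by simp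
 qed
qed

text \<open>Both sides have finite coordinates in each degree, indexed by sets of equal size; the
  isomorphism comes from any bijection of these sets and is not canonical.\<close>

theorem cohomology_decomposition:
 "graded_isomorphic
   (shift (stack_cohomology (moduli_stack Q dv)) (- euler_pairing Q dv dv))
   (graded_direct_sum lifts
    (%ep. shift (stack_cohomology (moduli_stack (unlink Q c d) ep)) (- euler_pairing (unlink Q c d) ep ep)))"
 unfolding graded_isomorphic_def
proof
 fix n
 let ?U = "unlink Q c d"
 let ?b = "%ep. betti ?U ep (n - euler_pairing ?U ep ep)"
 \<comment> \<open>The interpretation supplies only the well-formedness of the unlinked quiver,
   which involves no dimension vector.\<close>
 interpret unlinking Q c d undefined by unfold_locales (rule c d cd)+
 have fU: "finite (verts ?U)" by (simp add: unlink_def)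
 obtain T where T: "coordinates (shift (stack_cohomology (moduli_stack Q dv)) (- euler_pairing Q dv dv) n) {..<betti Q dv (n - euler_pairing Q dv dv)} T"
  using stack_cohomology_coordinates[OF finite_verts, of dv "n - euler_pairing Q dv dv"] by (auto simp: shift_def)
 have "\<exists>S. \<forall>ep. coordinates (shift (stack_cohomology (moduli_stack ?U ep)) (- euler_pairing ?U ep ep) n) {..<?b ep} (S ep)"
  using U.stack_cohomology_coordinates[OF fU] by (intro choice) (simp add: shift_def)
 then obtain S where S: "!!ep. coordinates (shift (stack_cohomology (moduli_stack ?U ep)) (- euler_pairing ?U ep ep) n) {..<?b ep} (S ep)" by blast
 have "card (SIGMA ep:lifts. {..<?b ep}) = card {..<betti Q dv (n - euler_pairing Q dv dv)}"
  unfolding card_lessThan betti_unlink by (subst card_SigmaI) (use finite_lifts in auto)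
 from finite_same_card_bij[OF finite_SigmaI[OF finite_lifts finite_lessThan] finite_lessThan this]
 obtain h where "bij_betw h (SIGMA ep:lifts. {..<?b ep}) {..<betti Q dv (n - euler_pairing Q dv dv)}" by blast
 from coordinates_isomorphism[OF T coordinates_direct_sum[OF finite_lifts S] this]
 show "\<exists>T. linear_map class_ring (shift (stack_cohomology (moduli_stack Q dv)) (- euler_pairing Q dv dv) n)
   (graded_direct_sum lifts (%ep. shift (stack_cohomology (moduli_stack ?U ep)) (- euler_pairing ?U ep ep)) n) T &
  bij_betw T (carrier (shift (stack_cohomology (moduli_stack Q dv)) (- euler_pairing Q dv dv) n))
   (carrier (graded_direct_sum lifts (%ep. shift (stack_cohomology (moduli_stack ?U ep)) (- euler_pairing ?U ep ep)) n))"
  unfolding graded_direct_sum_def .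
qed

end

theorem theorem1:
  fixes Q :: "('v, 'e) pre_digraph" and c d :: 'e
  assumes "fin_digraph Q"
    and "c \<in> arcs Q" and "d \<in> arcs Q"
    and "tail Q c \<noteq> head Q c"
    and "tail Q d = head Q c" and "head Q d = tail Q c"
  shows "(\<forall>\<epsilon>\<in>dim_vectors (unlink Q c d). \<exists>\<phi> f.
            stack_homotopy_equivalence
              (moduli_stack (unlink Q c d) \<epsilon>)
              (stratum_stack Q d (unlink_dim Q c \<epsilon>) (\<epsilon> None)) \<phi> f)
       \<and> (\<forall>\<delta>\<in>dim_vectors Q.
            graded_isomorphic
              (shift (stack_cohomology (moduli_stack Q \<delta>)) (- euler_pairing Q \<delta> \<delta>))
              (graded_direct_sum {\<epsilon> \<in> dim_vectors (unlink Q c d). unlink_dim Q c \<epsilon> = \<delta>}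
                 (\<lambda>\<epsilon>. shift (stack_cohomology (moduli_stack (unlink Q c d) \<epsilon>))
                        (- euler_pairing (unlink Q c d) \<epsilon> \<epsilon>))))"
proof (intro conjI ballI)
 fix ep assume "ep : dim_vectors (unlink Q c d)"
 show "\<exists>ph f. stack_homotopy_equivalence (moduli_stack (unlink Q c d) ep) (stratum_stack Q d (unlink_dim Q c ep) (ep None)) ph f"
  using unlinking.stack_homotopy_equivalence_unlinking[OF unlinking.intro[OF assms(1) unlinking_axioms.intro[OF assms(2-)]]] by blast
next
 fix dv assume "dv : dim_vectors Q"
 then show "graded_isomorphic
   (shift (stack_cohomology (moduli_stack Q dv)) (- euler_pairing Q dv dv))
   (graded_direct_sum {ep : dim_vectors (unlink Q c d). unlink_dim Q c ep = dv}
     (%ep. shift (stack_cohomology (moduli_stack (unlink Q c d) ep)) (- euler_pairing (unlink Q c d) ep ep)))"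
  by (intro unlinking_pair.cohomology_decomposition unlinking_pair.intro unlinking_pair_axioms.intro assms)
qed

end
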